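(* Let $\mathcal B$ be a Heyting category, let $(A,\cdot)$ be a partial applicative structure in $\mathcal B$, and let $\phi$ be a combinatory complete filter on $(A,\cdot)$. Then the category of assemblies $\mathsf{Asm}(\mathcal B,(A,\cdot),\phi)$ is a Heyting category.
   Context: All categories considered as base categories are small. A *Heyting category* is a category with finite limits such that: for each object $X$ the poset $\mathsf{Sub}(X)$ of subobjects (isomorphism classes of monomorphisms into $X$) is a Heyting algebra; for each $f:X\to Y$ the inverse image map $f^{-1}:\mathsf{Sub}(Y)\to\mathsf{Sub}(X)$ (pullback) is a homomorphism of Heyting algebras with a left adjoint $\exists_f$ and a right adjoint $\forall_f$; and for each pullback square $f\circ g'=g\circ f'$ the Beck–Chevalley conditions $\exists_{g'}\circ (f')^{-1}=f^{-1}\circ\exists_g$ and $\forall_{g'}\circ (f')^{-1}=f^{-1}\circ\forall_g$ hold. First-order intuitionistic formulas are interpreted in the internal language in the usual way. An object $X$ (or a subobject with domain $X$) is *inhabited* if $X\to 1$ is a regular epimorphism. A *partial morphism* $X\rightharpoonup Y$ is an isomorphism class of spans $(m:Z\to X,\ f:Z\to Y)$ with $m$ monic; its domain $\mathrm{dom}$ is the subobject represented by $m$. A *partial applicative structure* in $\mathcal B$ is an object $A$ with a partial morphism $\cdot:A\times A\rightharpoonup A$. Write $x\cdot y\downarrow$ for $(x,y)\in\mathrm{dom}(\cdot)$. A *filter* on $(A,\cdot)$ is a set $\phi\subseteq\mathsf{Sub}(A)$ such that: every $U\in\phi$ is inhabited; if $U\in\phi$ and $U\subseteq V$ then $V\in\phi$;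 if $U,V\in\phi$ and $U\times V\subseteq\mathrm{dom}(\cdot)$, then the image of $U\times V$ under $\cdot$ is in $\phi$. A partial morphism $f:A^n\rightharpoonup A$ (with $n\ge 1$) is *$\phi$-computable* if there is $R\in\phi$ such that, in the internal language of $\mathcal B$: for all $r\in R$ and $\vec x\in A^{n-1}$, $((r\cdot x_1)\cdots x_{n-1})$ is defined; and for all $r\in R$ and $\vec y\in\mathrm{dom} f$, $((r\cdot y_1)\cdots y_n)$ is defined and equal to $f(\vec y)$. A filter $\phi$ is *combinatory complete* if all projections $A^n\to A$ are $\phi$-computable and, whenever $f,g:A^n\rightharpoonup A$ are $\phi$-computable, so is the pointwise application $(\cdot)\circ(f,g):A^n\rightharpoonup A$, with domain $(f,g)^{-1}(\mathrm{dom}(\cdot))$. *Category of assemblies.* An *$A$-assembly* $X$ is a pair $(|X|,\rho_X)$ with $|X|$ an object of $\mathcal B$ and $\rho_X\in\mathsf{Sub}(A\times|X|)$ such that $\mathcal B\models\forall x\in|X|.\exists a\in A.\ \rho_X(a,x)$. For assemblies $X,Y$, a subobject $R\in\mathsf{Sub}(A)$ *tracks* $f:|X|\to|Y|$ if $\mathcal B\models\forall a,b\in A,\,x\in|X|.\ a\in R\wedge(b,x)\in\rho_X\to a\cdot b\downarrow\wedge\,(a\cdot b,f(x))\in\rho_Y$. The morphism $f$ is *$\phi$-total* if some $R\in\phi$ tracks it. $\mathsf{Asm}(\mathcal B,(A,\cdot),\phi)$ is the category of $A$-assemblies and $\phi$-total morphisms, with composition as in $\mathcal B$. *)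

theory Defs
  imports "HOL-Algebra.Galois_Connection"
begin

section \<open>Categories\<close>

text \<open>Objects and arrows form sets, so all categories are small. \<open>Comp g f\<close> (\<open>g\<close> after \<open>f\<close>) is
  meaningful only if \<open>Cod f = Dom g\<close>.\<close>

record ('o, 'm) cat =
  Obj :: "'o set"
  Mor :: "'m set"
  Dom :: "'m \<Rightarrow> 'o"
  Cod :: "'m \<Rightarrow> 'o"
  Ident :: "'o \<Rightarrow> 'm"
  Comp :: "'m \<Rightarrow> 'm \<Rightarrow> 'm" (infixr \<open>\<odot>\<index>\<close> 70)

definition Hom :: "('o, 'm) cat \<Rightarrow> 'o \<Rightarrow> 'o \<Rightarrow> 'm set"
  where "Hom C X Y = {f \<in> Mor C. Dom C f = X \<and> Cod C f = Y}"

locale category =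
  fixes C :: "('o, 'm) cat" (structure)
  assumes Dom_in_Obj: "f \<in> Mor C \<Longrightarrow> Dom C f \<in> Obj C"
    and Cod_in_Obj: "f \<in> Mor C \<Longrightarrow> Cod C f \<in> Obj C"
    and Ident_in_Hom: "X \<in> Obj C \<Longrightarrow> Ident C X \<in> Hom C X X"
    and Comp_in_Hom: "f \<in> Hom C X Y \<Longrightarrow> g \<in> Hom C Y Z \<Longrightarrow> g \<odot> f \<in> Hom C X Z"
    and Ident_left: "f \<in> Hom C X Y \<Longrightarrow> Ident C Y \<odot> f = f"
    and Ident_right: "f \<in> Hom C X Y \<Longrightarrow> f \<odot> Ident C X = f"
    and Comp_assoc: "f \<in> Hom C W X \<Longrightarrow> g \<in> Hom C X Y \<Longrightarrow> h \<in> Hom C Y Z \<Longrightarrow>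
      (h \<odot> g) \<odot> f = h \<odot> (g \<odot> f)"

locale finite_category = category +
  assumes finite_Obj: "finite (Obj C)"
    and finite_Mor: "finite (Mor C)"

locale cat_functor = J: category J + C: category C
  for J :: "('i, 'j) cat" and C :: "('o, 'm) cat" +
  fixes Fo :: "'i \<Rightarrow> 'o" and Fm :: "'j \<Rightarrow> 'm"
  assumes map_Obj: "i \<in> Obj J \<Longrightarrow> Fo i \<in> Obj C"
    and map_Mor: "u \<in> Hom J i j \<Longrightarrow> Fm u \<in> Hom C (Fo i) (Fo j)"
    and map_Ident: "i \<in> Obj J \<Longrightarrow> Fm (Ident J i) = Ident C (Fo i)"
    and map_Comp: "u \<in> Hom J i j \<Longrightarrow> v \<in> Hom J j k \<Longrightarrow>
      Fm (v \<odot>\<^bsub>J\<^esub> u) = Fm v \<odot>\<^bsub>C\<^esub> Fm u"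

definition is_cone ::
  "('i, 'j) cat \<Rightarrow> ('o, 'm) cat \<Rightarrow> ('i \<Rightarrow> 'o) \<Rightarrow> ('j \<Rightarrow> 'm) \<Rightarrow> 'o \<Rightarrow> ('i \<Rightarrow> 'm) \<Rightarrow> bool"
  where "is_cone J C Fo Fm L l \<longleftrightarrow>
    L \<in> Obj C \<and> (\<forall>i\<in>Obj J. l i \<in> Hom C L (Fo i)) \<and>
    (\<forall>u\<in>Mor J. Fm u \<odot>\<^bsub>C\<^esub> l (Dom J u) = l (Cod J u))"

definition is_limit ::
  "('i, 'j) cat \<Rightarrow> ('o, 'm) cat \<Rightarrow> ('i \<Rightarrow> 'o) \<Rightarrow> ('j \<Rightarrow> 'm) \<Rightarrow> 'o \<Rightarrow> ('i \<Rightarrow> 'm) \<Rightarrow> bool"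
  where "is_limit J C Fo Fm L l \<longleftrightarrow>
    is_cone J C Fo Fm L l \<and>
    (\<forall>M k. is_cone J C Fo Fm M k \<longrightarrow> (\<exists>!h. h \<in> Hom C M L \<and> (\<forall>i\<in>Obj J. l i \<odot>\<^bsub>C\<^esub> h = k i)))"

text \<open>Every finite category is isomorphic to one whose objects and arrows are natural numbers, so
  these index categories suffice.\<close>

definition has_finite_limits :: "('o, 'm) cat \<Rightarrow> bool"
  where "has_finite_limits C \<longleftrightarrow>
    (\<forall>(J :: (nat, nat) cat) Fo Fm. finite_category J \<and> cat_functor J C Fo Fm \<longrightarrow>
      (\<exists>L l. is_limit J C Fo Fm L l))"

definition is_terminal :: "('o, 'm) cat \<Rightarrow> 'o \<Rightarrow> bool"
  where "is_terminal C T \<longleftrightarrow> T \<in> Obj C \<and> (\<forall>X\<in>Obj C. \<exists>!h. h \<in> Hom C X T)"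

definition is_product :: "('o, 'm) cat \<Rightarrow> 'o \<Rightarrow> 'o \<Rightarrow> 'o \<Rightarrow> 'm \<Rightarrow> 'm \<Rightarrow> bool"
  where "is_product C X Y P p q \<longleftrightarrow>
    P \<in> Obj C \<and> p \<in> Hom C P X \<and> q \<in> Hom C P Y \<and>
    (\<forall>Z\<in>Obj C. \<forall>f\<in>Hom C Z X. \<forall>g\<in>Hom C Z Y.
      \<exists>!h. h \<in> Hom C Z P \<and> p \<odot>\<^bsub>C\<^esub> h = f \<and> q \<odot>\<^bsub>C\<^esub> h = g)"

definition is_pullback :: "('o, 'm) cat \<Rightarrow> 'm \<Rightarrow> 'm \<Rightarrow> 'm \<Rightarrow> 'm \<Rightarrow> bool"
  where "is_pullback C f g p q \<longleftrightarrow>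
    f \<in> Mor C \<and> g \<in> Mor C \<and> Cod C f = Cod C g \<and>
    p \<in> Mor C \<and> q \<in> Mor C \<and> Dom C p = Dom C q \<and> Cod C p = Dom C f \<and> Cod C q = Dom C g \<and>
    f \<odot>\<^bsub>C\<^esub> p = g \<odot>\<^bsub>C\<^esub> q \<and>
    (\<forall>Z\<in>Obj C. \<forall>a\<in>Hom C Z (Dom C f). \<forall>b\<in>Hom C Z (Dom C g). f \<odot>\<^bsub>C\<^esub> a = g \<odot>\<^bsub>C\<^esub> b \<longrightarrow>
      (\<exists>!h. h \<in> Hom C Z (Dom C p) \<and> p \<odot>\<^bsub>C\<^esub> h = a \<and> q \<odot>\<^bsub>C\<^esub> h = b))"

definition is_equalizer :: "('o, 'm) cat \<Rightarrow> 'm \<Rightarrow> 'm \<Rightarrow> 'm \<Rightarrow> bool"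
  where "is_equalizer C f g e \<longleftrightarrow>
    f \<in> Mor C \<and> g \<in> Hom C (Dom C f) (Cod C f) \<and> e \<in> Mor C \<and> Cod C e = Dom C f \<and>
    f \<odot>\<^bsub>C\<^esub> e = g \<odot>\<^bsub>C\<^esub> e \<and>
    (\<forall>a\<in>Mor C. Cod C a = Dom C f \<and> f \<odot>\<^bsub>C\<^esub> a = g \<odot>\<^bsub>C\<^esub> a \<longrightarrow>
      (\<exists>!h. h \<in> Hom C (Dom C a) (Dom C e) \<and> e \<odot>\<^bsub>C\<^esub> h = a))"

definition is_coequalizer :: "('o, 'm) cat \<Rightarrow> 'm \<Rightarrow> 'm \<Rightarrow> 'm \<Rightarrow> bool"
  where "is_coequalizer C f g e \<longleftrightarrow>
    f \<in> Mor C \<and> g \<in> Hom C (Dom C f) (Cod C f) \<and> e \<in> Mor C \<and> Dom C e = Cod C f \<and>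
    e \<odot>\<^bsub>C\<^esub> f = e \<odot>\<^bsub>C\<^esub> g \<and>
    (\<forall>a\<in>Mor C. Dom C a = Cod C f \<and> a \<odot>\<^bsub>C\<^esub> f = a \<odot>\<^bsub>C\<^esub> g \<longrightarrow>
      (\<exists>!h. h \<in> Hom C (Cod C e) (Cod C a) \<and> h \<odot>\<^bsub>C\<^esub> e = a))"

definition regular_epi :: "('o, 'm) cat \<Rightarrow> 'm \<Rightarrow> bool"
  where "regular_epi C e \<longleftrightarrow> (\<exists>f g. is_coequalizer C f g e)"

definition mono_arr :: "('o, 'm) cat \<Rightarrow> 'm \<Rightarrow> bool"
  where "mono_arr C m \<longleftrightarrow>
    m \<in> Mor C \<and>
    (\<forall>Z\<in>Obj C. \<forall>a\<in>Hom C Z (Dom C m). \<forall>b\<in>Hom C Z (Dom C m). m \<odot>\<^bsub>C\<^esub> a = m \<odot>\<^bsub>C\<^esub> b \<longrightarrow> a = b)"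

definition iso_arr :: "('o, 'm) cat \<Rightarrow> 'm \<Rightarrow> bool"
  where "iso_arr C i \<longleftrightarrow>
    i \<in> Mor C \<and>
    (\<exists>j\<in>Hom C (Cod C i) (Dom C i).
      j \<odot>\<^bsub>C\<^esub> i = Ident C (Dom C i) \<and> i \<odot>\<^bsub>C\<^esub> j = Ident C (Cod C i))"

text \<open>Chosen terminal object and binary products; they are unique up to isomorphism, so nothing
  below depends essentially on the choice.\<close>

definition terminal_obj :: "('o, 'm) cat \<Rightarrow> 'o"
  where "terminal_obj C = (SOME T. is_terminal C T)"

definition bang :: "('o, 'm) cat \<Rightarrow> 'o \<Rightarrow> 'm"
  where "bang C X = (THE h. h \<in> Hom C X (terminal_obj C))"

definition prod_cone :: "('o, 'm) cat \<Rightarrow> 'o \<Rightarrow> 'o \<Rightarrow> 'o \<times> 'm \<times> 'm"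
  where "prod_cone C X Y = (SOME (P, p, q). is_product C X Y P p q)"

definition prod_obj :: "('o, 'm) cat \<Rightarrow> 'o \<Rightarrow> 'o \<Rightarrow> 'o"
  where "prod_obj C X Y = fst (prod_cone C X Y)"

definition pr1 :: "('o, 'm) cat \<Rightarrow> 'o \<Rightarrow> 'o \<Rightarrow> 'm"
  where "pr1 C X Y = fst (snd (prod_cone C X Y))"

definition pr2 :: "('o, 'm) cat \<Rightarrow> 'o \<Rightarrow> 'o \<Rightarrow> 'm"
  where "pr2 C X Y = snd (snd (prod_cone C X Y))"

definition pairing :: "('o, 'm) cat \<Rightarrow> 'm \<Rightarrow> 'm \<Rightarrow> 'm"
  where "pairing C f g =
    (THE h. h \<in> Hom C (Dom C f) (prod_obj C (Cod C f) (Cod C g)) \<and>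
      pr1 C (Cod C f) (Cod C g) \<odot>\<^bsub>C\<^esub> h = f \<and> pr2 C (Cod C f) (Cod C g) \<odot>\<^bsub>C\<^esub> h = g)"

primrec pow_obj :: "('o, 'm) cat \<Rightarrow> 'o \<Rightarrow> nat \<Rightarrow> 'o" where
  "pow_obj C A 0 = terminal_obj C"
| "pow_obj C A (Suc n) = prod_obj C (pow_obj C A n) A"

text \<open>The projections from \<open>pow_obj C A n\<close> are numbered \<open>0, \<dots>, n - 1\<close>.\<close>

primrec (nonexhaustive) pow_proj :: "('o, 'm) cat \<Rightarrow> 'o \<Rightarrow> nat \<Rightarrow> nat \<Rightarrow> 'm" where
  "pow_proj C A (Suc n) i =
    (if i = n then pr2 C (pow_obj C A n) A
     else pow_proj C A n i \<odot>\<^bsub>C\<^esub> pr1 C (pow_obj C A n) A)"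


section \<open>Subobjects and Heyting categories\<close>

definition sub_class :: "('o, 'm) cat \<Rightarrow> 'm \<Rightarrow> 'm set"
  where "sub_class C m = {m \<odot>\<^bsub>C\<^esub> i | i. iso_arr C i \<and> Cod C i = Dom C m}"

definition factors_through :: "('o, 'm) cat \<Rightarrow> 'm \<Rightarrow> 'm \<Rightarrow> bool"
  where "factors_through C m n \<longleftrightarrow> (\<exists>h\<in>Hom C (Dom C m) (Dom C n). n \<odot>\<^bsub>C\<^esub> h = m)"

definition Sub :: "('o, 'm) cat \<Rightarrow> 'o \<Rightarrow> 'm set gorder"
  where "Sub C X =
    \<lparr>carrier = {sub_class C m | m. mono_arr C m \<and> Cod C m = X},
     eq = (=),
     le = (\<lambda>U V. \<exists>m\<in>U. \<exists>n\<in>V. factors_through C m n)\<rparr>"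

locale heyting_algebra = bounded_lattice L for L (structure) +
  assumes himp_exists: "x \<in> carrier L \<Longrightarrow> y \<in> carrier L \<Longrightarrow>
    \<exists>z. greatest L z {w \<in> carrier L. w \<sqinter> x \<sqsubseteq> y}"

definition himp :: "('a, 'b) gorder_scheme \<Rightarrow> 'a \<Rightarrow> 'a \<Rightarrow> 'a"
  where "himp L x y = (SOME z. greatest L z {w \<in> carrier L. w \<sqinter>\<^bsub>L\<^esub> x \<sqsubseteq>\<^bsub>L\<^esub> y})"

definition heyting_hom :: "('a, 'c) gorder_scheme \<Rightarrow> ('b, 'd) gorder_scheme \<Rightarrow> ('a \<Rightarrow> 'b) \<Rightarrow> bool"
  where "heyting_hom L M h \<longleftrightarrow>
    h \<in> carrier L \<rightarrow> carrier M \<and>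
    h \<top>\<^bsub>L\<^esub> = \<top>\<^bsub>M\<^esub> \<and> h \<bottom>\<^bsub>L\<^esub> = \<bottom>\<^bsub>M\<^esub> \<and>
    (\<forall>x\<in>carrier L. \<forall>y\<in>carrier L.
      h (x \<sqinter>\<^bsub>L\<^esub> y) = h x \<sqinter>\<^bsub>M\<^esub> h y \<and>
      h (x \<squnion>\<^bsub>L\<^esub> y) = h x \<squnion>\<^bsub>M\<^esub> h y \<and>
      h (himp L x y) = himp M (h x) (h y))"

definition inv_im :: "('o, 'm) cat \<Rightarrow> 'm \<Rightarrow> 'm set \<Rightarrow> 'm set"
  where "inv_im C f U = {p. \<exists>m\<in>U. \<exists>q. is_pullback C f m p q}"

definition is_left_adjoint :: "('o, 'm) cat \<Rightarrow> 'm \<Rightarrow> ('m set \<Rightarrow> 'm set) \<Rightarrow> bool"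
  where "is_left_adjoint C f e \<longleftrightarrow>
    galois_connection \<lparr>orderA = Sub C (Dom C f), orderB = Sub C (Cod C f),
      lower = e, upper = inv_im C f\<rparr>"

definition is_right_adjoint :: "('o, 'm) cat \<Rightarrow> 'm \<Rightarrow> ('m set \<Rightarrow> 'm set) \<Rightarrow> bool"
  where "is_right_adjoint C f a \<longleftrightarrow>
    galois_connection \<lparr>orderA = Sub C (Cod C f), orderB = Sub C (Dom C f),
      lower = inv_im C f, upper = a\<rparr>"

text \<open>Adjoints are unique on the carrier, so \<open>SOME\<close> only fixes irrelevant values outside it.\<close>

definition ex_along :: "('o, 'm) cat \<Rightarrow> 'm \<Rightarrow> 'm set \<Rightarrow> 'm set"
  where "ex_along C f = (SOME e. is_left_adjoint C f e)"

definition all_along :: "('o, 'm) cat \<Rightarrow> 'm \<Rightarrow> 'm set \<Rightarrow> 'm set"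
  where "all_along C f = (SOME a. is_right_adjoint C f a)"

locale heyting_category = category +
  assumes finite_limits: "has_finite_limits C"
    and Sub_heyting: "X \<in> Obj C \<Longrightarrow> heyting_algebra (Sub C X)"
    and inv_im_hom: "f \<in> Hom C X Y \<Longrightarrow> heyting_hom (Sub C Y) (Sub C X) (inv_im C f)"
    and left_adjoint: "f \<in> Mor C \<Longrightarrow> \<exists>e. is_left_adjoint C f e"
    and right_adjoint: "f \<in> Mor C \<Longrightarrow> \<exists>a. is_right_adjoint C f a"
    and beck_chevalley_ex: "is_pullback C f g g' f' \<Longrightarrow> U \<in> carrier (Sub C (Dom C g)) \<Longrightarrow>
      ex_along C g' (inv_im C f' U) = inv_im C f (ex_along C g U)"
    and beck_chevalley_all: "is_pullback C f g g' f' \<Longrightarrow> U \<in> carrier (Sub C (Dom C g)) \<Longrightarrow>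
      all_along C g' (inv_im C f' U) = inv_im C f (all_along C g U)"

definition inhabited :: "('o, 'm) cat \<Rightarrow> 'o \<Rightarrow> bool"
  where "inhabited C X \<longleftrightarrow> regular_epi C (bang C X)"

definition inhabited_sub :: "('o, 'm) cat \<Rightarrow> 'm set \<Rightarrow> bool"
  where "inhabited_sub C U \<longleftrightarrow> (\<exists>m\<in>U. inhabited C (Dom C m))"

text \<open>For \<open>U \<in> Sub(X)\<close> and \<open>V \<in> Sub(Y)\<close>, the subobject \<open>U \<times> V\<close> of \<open>X \<times> Y\<close>, represented by
  \<open>m \<times> n\<close> for representatives \<open>m\<close>, \<open>n\<close> and any product \<open>(P, p, q)\<close> of their domains.\<close>

definition sub_prod :: "('o, 'm) cat \<Rightarrow> 'm set \<Rightarrow> 'm set \<Rightarrow> 'm set"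
  where "sub_prod C U V =
    {pairing C (m \<odot>\<^bsub>C\<^esub> p) (n \<odot>\<^bsub>C\<^esub> q) | m n P p q.
      m \<in> U \<and> n \<in> V \<and> is_product C (Dom C m) (Dom C n) P p q}"


section \<open>Partial morphisms\<close>

definition pm_class :: "('o, 'm) cat \<Rightarrow> 'm \<Rightarrow> 'm \<Rightarrow> ('m \<times> 'm) set"
  where "pm_class C m f = {(m \<odot>\<^bsub>C\<^esub> i, f \<odot>\<^bsub>C\<^esub> i) | i. iso_arr C i \<and> Cod C i = Dom C m}"

definition PMor :: "('o, 'm) cat \<Rightarrow> 'o \<Rightarrow> 'o \<Rightarrow> ('m \<times> 'm) set set"
  where "PMor C X Y =
    {pm_class C m f | m f. mono_arr C m \<and> Cod C m = X \<and> f \<in> Hom C (Dom C m) Y}"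

definition pm_dom :: "('m \<times> 'm) set \<Rightarrow> 'm set"
  where "pm_dom F = fst ` F"

definition pm_total :: "('o, 'm) cat \<Rightarrow> 'm \<Rightarrow> ('m \<times> 'm) set"
  where "pm_total C f = pm_class C (Ident C (Dom C f)) f"

text \<open>The following operations collect the results over all representatives and all pullbacks;
  these form exactly one isomorphism class.\<close>

definition pm_comp :: "('o, 'm) cat \<Rightarrow> ('m \<times> 'm) set \<Rightarrow> ('m \<times> 'm) set \<Rightarrow> ('m \<times> 'm) set"
  where "pm_comp C G F =
    {(m \<odot>\<^bsub>C\<^esub> p, g \<odot>\<^bsub>C\<^esub> q) | m f n g p q.
      (m, f) \<in> F \<and> (n, g) \<in> G \<and> is_pullback C f n p q}"

definition pm_pair :: "('o, 'm) cat \<Rightarrow> ('m \<times> 'm) set \<Rightarrow> ('m \<times> 'm) set \<Rightarrow> ('m \<times> 'm) set"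
  where "pm_pair C F G =
    {(m \<odot>\<^bsub>C\<^esub> p, pairing C (f \<odot>\<^bsub>C\<^esub> p) (g \<odot>\<^bsub>C\<^esub> q)) | m f n g p q.
      (m, f) \<in> F \<and> (n, g) \<in> G \<and> is_pullback C m n p q}"

definition pm_inv_im :: "('o, 'm) cat \<Rightarrow> ('m \<times> 'm) set \<Rightarrow> 'm set \<Rightarrow> 'm set"
  where "pm_inv_im C F U =
    {m \<odot>\<^bsub>C\<^esub> p | m f u p q. (m, f) \<in> F \<and> u \<in> U \<and> is_pullback C f u p q}"

definition pm_eq :: "('o, 'm) cat \<Rightarrow> ('m \<times> 'm) set \<Rightarrow> ('m \<times> 'm) set \<Rightarrow> 'm set"
  where "pm_eq C F G =
    {(m \<odot>\<^bsub>C\<^esub> p) \<odot>\<^bsub>C\<^esub> e | m f n g p q e.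
      (m, f) \<in> F \<and> (n, g) \<in> G \<and> is_pullback C m n p q \<and>
      is_equalizer C (f \<odot>\<^bsub>C\<^esub> p) (g \<odot>\<^bsub>C\<^esub> q) e}"

definition pm_image :: "('o, 'm) cat \<Rightarrow> ('m \<times> 'm) set \<Rightarrow> 'm set \<Rightarrow> 'm set"
  where "pm_image C F W = {k. \<exists>(m, f)\<in>F. k \<in> ex_along C f (inv_im C m W)}"


section \<open>Internal language\<close>

text \<open>Variables are de Bruijn indices into a context, i.e. a list of sorts (objects) with the most
  recently bound variable first. Function symbols are partial morphisms, relation symbols are
  subobjects. A term in context \<open>G\<close> denotes a partial morphism out of \<open>ctx_obj C G\<close>, a formula
  denotes a subobject of \<open>ctx_obj C G\<close>. Atomic formulas are strict: they imply that the terms in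
  them are defined.\<close>

datatype 'm tm =
    Var nat
  | Fn "('m \<times> 'm) set" "'m tm"
  | Tup "'m tm" "'m tm"

datatype ('o, 'm) fm =
    In "'m tm" "'m set"
  | Defined "'m tm"
  | Equal "'m tm" "'m tm"
  | Truth
  | Falsity
  | And "('o, 'm) fm" "('o, 'm) fm"
  | Or "('o, 'm) fm" "('o, 'm) fm"
  | Imp "('o, 'm) fm" "('o, 'm) fm"
  | All 'o "('o, 'm) fm"
  | Ex 'o "('o, 'm) fm"

primrec ctx_obj :: "('o, 'm) cat \<Rightarrow> 'o list \<Rightarrow> 'o" where
  "ctx_obj C [] = terminal_obj C"
| "ctx_obj C (X # G) = prod_obj C (ctx_obj C G) X"

primrec (nonexhaustive) ctx_proj :: "('o, 'm) cat \<Rightarrow> 'o list \<Rightarrow> nat \<Rightarrow> 'm" where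
  "ctx_proj C (X # G) i =
    (case i of 0 \<Rightarrow> pr2 C (ctx_obj C G) X
     | Suc j \<Rightarrow> ctx_proj C G j \<odot>\<^bsub>C\<^esub> pr1 C (ctx_obj C G) X)"

primrec tm_sem :: "('o, 'm) cat \<Rightarrow> 'o list \<Rightarrow> 'm tm \<Rightarrow> ('m \<times> 'm) set" where
  "tm_sem C G (Var i) = pm_total C (ctx_proj C G i)"
| "tm_sem C G (Fn F t) = pm_comp C F (tm_sem C G t)"
| "tm_sem C G (Tup t u) = pm_pair C (tm_sem C G t) (tm_sem C G u)"

primrec fm_sem :: "('o, 'm) cat \<Rightarrow> ('o, 'm) fm \<Rightarrow> 'o list \<Rightarrow> 'm set" where
  "fm_sem C (In t U) G = pm_inv_im C (tm_sem C G t) U"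
| "fm_sem C (Defined t) G = pm_dom (tm_sem C G t)"
| "fm_sem C (Equal t u) G = pm_eq C (tm_sem C G t) (tm_sem C G u)"
| "fm_sem C Truth G = \<top>\<^bsub>Sub C (ctx_obj C G)\<^esub>"
| "fm_sem C Falsity G = \<bottom>\<^bsub>Sub C (ctx_obj C G)\<^esub>"
| "fm_sem C (And p q) G = fm_sem C p G \<sqinter>\<^bsub>Sub C (ctx_obj C G)\<^esub> fm_sem C q G"
| "fm_sem C (Or p q) G = fm_sem C p G \<squnion>\<^bsub>Sub C (ctx_obj C G)\<^esub> fm_sem C q G"
| "fm_sem C (Imp p q) G = himp (Sub C (ctx_obj C G)) (fm_sem C p G) (fm_sem C q G)"
| "fm_sem C (All X p) G = all_along C (pr1 C (ctx_obj C G) X) (fm_sem C p (X # G))"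
| "fm_sem C (Ex X p) G = ex_along C (pr1 C (ctx_obj C G) X) (fm_sem C p (X # G))"

definition models :: "('o, 'm) cat \<Rightarrow> ('o, 'm) fm \<Rightarrow> bool"
  where "models C p \<longleftrightarrow> fm_sem C p [] = \<top>\<^bsub>Sub C (terminal_obj C)\<^esub>"


section \<open>Partial applicative structures and filters\<close>

definition partial_applicative_structure :: "('o, 'm) cat \<Rightarrow> 'o \<Rightarrow> ('m \<times> 'm) set \<Rightarrow> bool"
  where "partial_applicative_structure C A app \<longleftrightarrow>
    A \<in> Obj C \<and> app \<in> PMor C (prod_obj C A A) A"

definition applicative_filter :: "('o, 'm) cat \<Rightarrow> 'o \<Rightarrow> ('m \<times> 'm) set \<Rightarrow> 'm set set \<Rightarrow> bool"
  where "applicative_filter C A app \<phi> \<longleftrightarrow>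
    \<phi> \<subseteq> carrier (Sub C A) \<and>
    (\<forall>U\<in>\<phi>. inhabited_sub C U) \<and>
    (\<forall>U\<in>\<phi>. \<forall>V\<in>carrier (Sub C A). U \<sqsubseteq>\<^bsub>Sub C A\<^esub> V \<longrightarrow> V \<in> \<phi>) \<and>
    (\<forall>U\<in>\<phi>. \<forall>V\<in>\<phi>. sub_prod C U V \<sqsubseteq>\<^bsub>Sub C (prod_obj C A A)\<^esub> pm_dom app \<longrightarrow>
      pm_image C app (sub_prod C U V) \<in> \<phi>)"

text \<open>\<open>app_tuple C A app t s n k\<close> is the term \<open>((t \<cdot> s\<^sub>0) \<cdots> s\<^sub>k\<^sub>-\<^sub>1)\<close>, where \<open>s\<close> is a term of sort
  \<open>A\<^sup>n\<close> and \<open>s\<^sub>i\<close> its components.\<close>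

primrec app_tuple ::
  "('o, 'm) cat \<Rightarrow> 'o \<Rightarrow> ('m \<times> 'm) set \<Rightarrow> 'm tm \<Rightarrow> 'm tm \<Rightarrow> nat \<Rightarrow> nat \<Rightarrow> 'm tm" where
  "app_tuple C A app t s n 0 = t"
| "app_tuple C A app t s n (Suc k) =
    Fn app (Tup (app_tuple C A app t s n k) (Fn (pm_total C (pow_proj C A n k)) s))"

definition computable ::
  "('o, 'm) cat \<Rightarrow> 'o \<Rightarrow> ('m \<times> 'm) set \<Rightarrow> 'm set set \<Rightarrow> nat \<Rightarrow> ('m \<times> 'm) set \<Rightarrow> bool"
  where "computable C A app \<phi> n f \<longleftrightarrow>
    (\<exists>R\<in>\<phi>.
      models C (All A (All (pow_obj C A (n - 1))
        (Imp (In (Var 1) R)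
          (Defined (app_tuple C A app (Var 1) (Var 0) (n - 1) (n - 1)))))) \<and>
      models C (All A (All (pow_obj C A n)
        (Imp (And (In (Var 1) R) (In (Var 0) (pm_dom f)))
          (And (Defined (app_tuple C A app (Var 1) (Var 0) n n))
            (Equal (app_tuple C A app (Var 1) (Var 0) n n) (Fn f (Var 0))))))))"

definition combinatory_complete ::
  "('o, 'm) cat \<Rightarrow> 'o \<Rightarrow> ('m \<times> 'm) set \<Rightarrow> 'm set set \<Rightarrow> bool"
  where "combinatory_complete C A app \<phi> \<longleftrightarrow>
    (\<forall>n\<ge>1. \<forall>i<n. computable C A app \<phi> n (pm_total C (pow_proj C A n i))) \<and>
    (\<forall>n\<ge>1. \<forall>f\<in>PMor C (pow_obj C A n) A. \<forall>g\<in>PMor C (pow_obj C A n) A.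
      computable C A app \<phi> n f \<and> computable C A app \<phi> n g \<longrightarrow>
      computable C A app \<phi> n (pm_comp C app (pm_pair C f g)))"


section \<open>Assemblies\<close>

text \<open>An assembly \<open>(X, \<rho>)\<close> with \<open>X\<close> an object and \<open>\<rho>\<close> a subobject of \<open>A \<times> X\<close>.\<close>

type_synonym ('o, 'm) assembly = "'o \<times> 'm set"

definition is_assembly :: "('o, 'm) cat \<Rightarrow> 'o \<Rightarrow> ('o, 'm) assembly \<Rightarrow> bool"
  where "is_assembly C A = (\<lambda>(X, \<rho>).
    X \<in> Obj C \<and> \<rho> \<in> carrier (Sub C (prod_obj C A X)) \<and>
    models C (All X (Ex A (In (Tup (Var 0) (Var 1)) \<rho>))))"

definition tracks ::
  "('o, 'm) cat \<Rightarrow> 'o \<Rightarrow> ('m \<times> 'm) set \<Rightarrow> ('o, 'm) assembly \<Rightarrow> ('o, 'm) assembly \<Rightarrow>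
    'm set \<Rightarrow> 'm \<Rightarrow> bool"
  where "tracks C A app = (\<lambda>(X, \<rho>) (Y, \<sigma>) R f.
    models C (All A (All A (All X
      (Imp (And (In (Var 2) R) (In (Tup (Var 1) (Var 0)) \<rho>))
        (And (Defined (Fn app (Tup (Var 2) (Var 1))))
          (In (Tup (Fn app (Tup (Var 2) (Var 1))) (Fn (pm_total C f) (Var 0))) \<sigma>)))))))"

text \<open>Arrows of assemblies carry their source and target, as an arrow of the base category may be a
  morphism between many pairs of assemblies.\<close>

definition Asm ::
  "('o, 'm) cat \<Rightarrow> 'o \<Rightarrow> ('m \<times> 'm) set \<Rightarrow> 'm set set \<Rightarrow>
    (('o, 'm) assembly, ('o, 'm) assembly \<times> 'm \<times> ('o, 'm) assembly) cat"
  where "Asm C A app \<phi> =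
    \<lparr>Obj = {X. is_assembly C A X},
     Mor = {(X, f, Y). is_assembly C A X \<and> is_assembly C A Y \<and> f \<in> Hom C (fst X) (fst Y) \<and>
              (\<exists>R\<in>\<phi>. tracks C A app X Y R f)},
     Dom = (\<lambda>(X, f, Y). X),
     Cod = (\<lambda>(X, f, Y). Y),
     Ident = (\<lambda>X. (X, Ident C (fst X), X)),
     Comp = (\<lambda>(Y, g, Z) (X, f, Y'). (X, g \<odot>\<^bsub>C\<^esub> f, Z))\<rparr>"

end

theory Submission
  imports Defs
begin

text \<open>Subobjects are handled through generalized elements: a subobject of \<open>X\<close> is a predicate on arrows
  into \<open>X\<close>, and the Beck-Chevalley conditions turn the internal language of the base category into
  Kripke-Joyal forcing, where "there is" means "there is after passing to a cover". Combinatory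
  completeness then gives trackers for polynomial operations with parameters in the filter.
  A subobject of an assembly \<open>X\<close> is determined, up to realizable equivalence, by a predicate
  \<open>\<alpha> \<subseteq> A \<times> |X|\<close>, and inclusion becomes realizable entailment \<open>\<rho>\<^sub>X \<and> \<alpha> \<turnstile> \<beta>\<close>. So it is enough that
  realizability predicates are closed under pairing, realizable implication, tagged disjunction, image
  \<open>\<exists>\<^sub>f\<close>, and \<open>\<forall>\<^sub>f\<close> guarded by \<open>\<rho>\<^sub>X\<close> (so that a realizer is applied only where \<open>|X|\<close> has a point).\<close>

section \<open>Subobjects by generalized elements\<close>

text \<open>The main obstacle is that nothing can be chosen globally: a member of the filter has
  elements only after a cover, and so does the set of realizers of a point of an assembly. Trackers
  are therefore sets of realizers, elements of them are picked locally, and each conclusion has to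
  descend along the cover. It does so because an application has at most one value and because every
  predicate in play is represented by a subobject. A second obstacle is that the filter is closed
  under application only when all products of elements are defined. This is why the clause of
  computability about \<open>n - 1\<close> arguments matters: it allows a combinator to be applied
  to parameters from the filter while one argument is still missing. In the order of subobjects of
  an assembly the realizability relation of the assembly stands as an additional hypothesis, and
  much of the final computation consists in moving or absorbing it. The description of subobjects,
  pullbacks and adjunctions uses finite limits only, so that it applies to the base and, once their
  limits are known, to assemblies as well.\<close>

definition sub_mem :: "('o, 'm) cat \<Rightarrow> 'm set \<Rightarrow> 'm \<Rightarrow> bool"
  where "sub_mem C U x \<longleftrightarrow> (\<exists>m\<in>U. factors_through C x m)"

text \<open>The representatives of the subobject whose generalized elements are those satisfying \<open>Q\<close>; the
  empty set if there is no such subobject.\<close>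

definition sub_of :: "('o, 'm) cat \<Rightarrow> 'o \<Rightarrow> ('m \<Rightarrow> bool) \<Rightarrow> 'm set"
  where "sub_of C X Q = {m. mono_arr C m \<and> Cod C m = X \<and>
    (\<forall>x\<in>Mor C. Cod C x = X \<longrightarrow> (factors_through C x m \<longleftrightarrow> Q x))}"

text \<open>Logical operations are later defined on predicates of generalized elements; this
  condition is what turns such a predicate into a member of \<open>Sub\<close>.\<close>

definition representable :: "('o, 'm) cat \<Rightarrow> 'o \<Rightarrow> ('m \<Rightarrow> bool) \<Rightarrow> bool"
  where "representable C X Q \<longleftrightarrow> sub_of C X Q \<noteq> {}"

lemma Sub_simps [simp]: "eq (Sub C X) = (=)"
  by (simp add: Sub_def)

context category
begin

lemma Mor_Comp [simp]: "f \<in> Mor C \<Longrightarrow> g \<in> Mor C \<Longrightarrow> Dom C g = Cod C f \<Longrightarrow> g \<odot> f \<in> Mor C"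
  and Dom_Comp [simp]: "f \<in> Mor C \<Longrightarrow> g \<in> Mor C \<Longrightarrow> Dom C g = Cod C f \<Longrightarrow> Dom C (g \<odot> f) = Dom C f"
  and Cod_Comp [simp]: "f \<in> Mor C \<Longrightarrow> g \<in> Mor C \<Longrightarrow> Dom C g = Cod C f \<Longrightarrow> Cod C (g \<odot> f) = Cod C g"
  using Comp_in_Hom[of f "Dom C f" "Cod C f" g "Cod C g"] by (auto simp: Hom_def)

lemma Comp_assoc' [simp]:
  "f \<in> Mor C \<Longrightarrow> g \<in> Mor C \<Longrightarrow> h \<in> Mor C \<Longrightarrow> Dom C g = Cod C f \<Longrightarrow> Dom C h = Cod C g \<Longrightarrow>
    (h \<odot> g) \<odot> f = h \<odot> (g \<odot> f)"
  using Comp_assoc[of f "Dom C f" "Cod C f" g "Cod C g" h "Cod C h"] by (auto simp: Hom_def)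

lemma Mor_Ident [simp]: "X \<in> Obj C \<Longrightarrow> Ident C X \<in> Mor C"
  and Dom_Ident [simp]: "X \<in> Obj C \<Longrightarrow> Dom C (Ident C X) = X"
  and Cod_Ident [simp]: "X \<in> Obj C \<Longrightarrow> Cod C (Ident C X) = X"
  using Ident_in_Hom by (auto simp: Hom_def)

lemma Ident_left' [simp]: "f \<in> Mor C \<Longrightarrow> Cod C f = Y \<Longrightarrow> Ident C Y \<odot> f = f"
  and Ident_right' [simp]: "f \<in> Mor C \<Longrightarrow> Dom C f = X \<Longrightarrow> f \<odot> Ident C X = f"
  using Ident_left Ident_right by (auto simp: Hom_def)

lemmas Obj_simps [simp] = Dom_in_Obj Cod_in_Obj

lemma monoD: "mono_arr C m \<Longrightarrow> m \<in> Mor C"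
  by (simp add: mono_arr_def)

lemma mono_cancel:
  "mono_arr C m \<Longrightarrow> a \<in> Mor C \<Longrightarrow> b \<in> Mor C \<Longrightarrow> Cod C a = Dom C m \<Longrightarrow> Cod C b = Dom C m \<Longrightarrow>
    Dom C a = Dom C b \<Longrightarrow> m \<odot> a = m \<odot> b \<Longrightarrow> a = b"
  unfolding mono_arr_def Hom_def by (auto dest: Dom_in_Obj)

lemma monoI:
  "m \<in> Mor C \<Longrightarrow> (\<And>a b. a \<in> Mor C \<Longrightarrow> b \<in> Mor C \<Longrightarrow> Cod C a = Dom C m \<Longrightarrow> Cod C b = Dom C m \<Longrightarrow>
    Dom C a = Dom C b \<Longrightarrow> m \<odot> a = m \<odot> b \<Longrightarrow> a = b) \<Longrightarrow> mono_arr C m"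
  unfolding mono_arr_def Hom_def by auto

lemma isoE:
  assumes "iso_arr C i"
  obtains j where "i \<in> Mor C" "j \<in> Mor C" "Dom C j = Cod C i" "Cod C j = Dom C i"
    "j \<odot> i = Ident C (Dom C i)" "i \<odot> j = Ident C (Cod C i)"
  using assms by (auto simp: iso_arr_def Hom_def)

lemma iso_Ident: "X \<in> Obj C \<Longrightarrow> iso_arr C (Ident C X)"
  unfolding iso_arr_def Hom_def by (auto intro!: bexI[of _ "Ident C X"])

lemma mono_comp:
  assumes "mono_arr C m" "mono_arr C n" "Cod C n = Dom C m"
  shows "mono_arr C (m \<odot> n)"
proof (rule monoI)
  have [simp]: "m \<in> Mor C" "n \<in> Mor C" using assms by (auto dest: monoD)
  show "m \<odot> n \<in> Mor C" using assms by simp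
  fix a b assume ab [simp]: "a \<in> Mor C" "b \<in> Mor C" "Cod C a = Dom C (m \<odot> n)"
    "Cod C b = Dom C (m \<odot> n)" "Dom C a = Dom C b" and e: "(m \<odot> n) \<odot> a = (m \<odot> n) \<odot> b"
  have "n \<odot> a = n \<odot> b"
    using mono_cancel[OF assms(1), of "n \<odot> a" "n \<odot> b"] e ab assms by simp
  then show "a = b" using mono_cancel[OF assms(2), of a b] ab assms by simp
qed

lemma iso_mono:
  assumes "iso_arr C i" shows "mono_arr C i"
proof -
  obtain j where j: "i \<in> Mor C" "j \<in> Mor C" "Dom C j = Cod C i" "Cod C j = Dom C i"
    "j \<odot> i = Ident C (Dom C i)" "i \<odot> j = Ident C (Cod C i)" using isoE[OF assms] .
  show ?thesis
  proof (rule monoI)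
    fix a b assume ab: "a \<in> Mor C" "b \<in> Mor C" "Cod C a = Dom C i"
    "Cod C b = Dom C i" "Dom C a = Dom C b" and e: "i \<odot> a = i \<odot> b"
    have "j \<odot> (i \<odot> a) = j \<odot> (i \<odot> b)" using e by simp
    then show "a = b" using Comp_assoc'[of a i j] Comp_assoc'[of b i j] ab j by simp
  qed (fact j)
qed

lemma factorsI:
  "h \<in> Mor C \<Longrightarrow> Dom C h = Dom C x \<Longrightarrow> Cod C h = Dom C m \<Longrightarrow> m \<odot> h = x \<Longrightarrow> factors_through C x m"
  by (auto simp: factors_through_def Hom_def)

lemma factorsE:
  assumes "factors_through C x m"
  obtains h where "h \<in> Mor C" "Dom C h = Dom C x" "Cod C h = Dom C m" "m \<odot> h = x"
  using assms by (auto simp: factors_through_def Hom_def)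

lemma factors_refl [simp]: "m \<in> Mor C \<Longrightarrow> factors_through C m m"
  by (rule factorsI[of "Ident C (Dom C m)"]) auto

lemma factors_trans:
  assumes "n \<in> Mor C" "factors_through C x m" "factors_through C m n"
  shows "factors_through C x n"
proof -
  obtain h where h: "h \<in> Mor C" "Dom C h = Dom C x" "Cod C h = Dom C m" "m \<odot> h = x"
    using factorsE[OF assms(2)] .
  obtain k where k: "k \<in> Mor C" "Dom C k = Dom C m" "Cod C k = Dom C n" "n \<odot> k = m"
    using factorsE[OF assms(3)] .
  show ?thesis using h k assms by (intro factorsI[of "k \<odot> h"]) (auto simp flip: Comp_assoc')
qed

lemma factors_precomp:
  assumes "factors_through C x m" "m \<in> Mor C" "x \<in> Mor C" "s \<in> Mor C" "Cod C s = Dom C x"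
  shows "factors_through C (x \<odot> s) m"
proof -
  obtain h where h: "h \<in> Mor C" "Dom C h = Dom C x" "Cod C h = Dom C m" "m \<odot> h = x"
    using factorsE[OF assms(1)] .
  show ?thesis using h assms by (intro factorsI[of "h \<odot> s"]) (auto simp flip: Comp_assoc')
qed

lemma mutual_factors_iso:
  assumes "mono_arr C m" "mono_arr C n" "h \<in> Mor C" "Dom C h = Dom C n" "Cod C h = Dom C m"
    "m \<odot> h = n" "factors_through C m n"
  shows "iso_arr C h"
proof -
  have [simp]: "m \<in> Mor C" "n \<in> Mor C" using assms by (auto dest: monoD)
  obtain k where k: "k \<in> Mor C" "Dom C k = Dom C m" "Cod C k = Dom C n" "n \<odot> k = m"
    using factorsE[OF assms(7)] .
  have "m \<odot> (h \<odot> k) = m \<odot> Ident C (Dom C m)"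
    using k assms by (simp flip: Comp_assoc')
  then have "h \<odot> k = Ident C (Dom C m)"
    using mono_cancel[OF assms(1), of "h \<odot> k" "Ident C (Dom C m)"] k assms by simp
  moreover have "n \<odot> (k \<odot> h) = n \<odot> Ident C (Dom C n)"
    using k assms by (simp flip: Comp_assoc')
  then have "k \<odot> h = Ident C (Dom C n)"
    using mono_cancel[OF assms(2), of "k \<odot> h" "Ident C (Dom C n)"] k assms by simp
  ultimately show ?thesis
    using k assms by (auto simp: iso_arr_def Hom_def intro!: bexI[of _ k])
qed

text \<open>The comparison arrow between two monos that factor through each other is invertible, so
  isomorphism classes can be handled through factorizations alone.\<close>

lemma sub_class_iff:
  assumes "mono_arr C m"
  shows "n \<in> sub_class C m \<longleftrightarrow>
    mono_arr C n \<and> Cod C n = Cod C m \<and> factors_through C n m \<and> factors_through C m n"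
proof
  have [simp]: "m \<in> Mor C" using assms by (auto dest: monoD)
  assume "n \<in> sub_class C m"
  then obtain i where i: "n = m \<odot> i" "iso_arr C i" "Cod C i = Dom C m"
    by (auto simp: sub_class_def)
  then obtain j where j: "i \<in> Mor C" "j \<in> Mor C" "Dom C j = Cod C i" "Cod C j = Dom C i"
    "j \<odot> i = Ident C (Dom C i)" "i \<odot> j = Ident C (Cod C i)" using isoE by blast
  have "factors_through C n m" using i j by (intro factorsI[of i]) auto
  moreover have "factors_through C m n" using i j by (intro factorsI[of j]) auto
  ultimately show "mono_arr C n \<and> Cod C n = Cod C m \<and> factors_through C n m \<and> factors_through C m n"
    using i j assms mono_comp[OF assms iso_mono[OF i(2)]] by auto
next
  have [simp]: "m \<in> Mor C" using assms by (auto dest: monoD)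
  assume n: "mono_arr C n \<and> Cod C n = Cod C m \<and> factors_through C n m \<and> factors_through C m n"
  then have [simp]: "n \<in> Mor C" by (auto dest: monoD)
  obtain h where h: "h \<in> Mor C" "Dom C h = Dom C n" "Cod C h = Dom C m" "m \<odot> h = n"
    using n factorsE by blast
  have "iso_arr C h" using mutual_factors_iso[OF assms, of n h] n h by auto
  then show "n \<in> sub_class C m" using h by (auto simp: sub_class_def)
qed

lemma sub_class_self: "mono_arr C m \<Longrightarrow> m \<in> sub_class C m"
  by (simp add: sub_class_iff monoD)

lemma Sub_carrierE:
  assumes "U \<in> carrier (Sub C X)"
  obtains m where "mono_arr C m" "m \<in> Mor C" "Cod C m = X" "U = sub_class C m" "m \<in> U"
  using assms sub_class_self by (auto simp: Sub_def dest: monoD)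

text \<open>Members of one class factor through each other, so the existential in
  \<open>sub_mem\<close> may be tested on any representative.\<close>

lemma Sub_member:
  assumes "U \<in> carrier (Sub C X)" "m \<in> U"
  shows "mono_arr C m" "m \<in> Mor C" "Cod C m = X" "sub_mem C U x \<longleftrightarrow> factors_through C x m"
proof -
  obtain n where n: "mono_arr C n" "n \<in> Mor C" "Cod C n = X" "U = sub_class C n"
    using Sub_carrierE[OF assms(1)] .
  have mn: "mono_arr C m \<and> Cod C m = X \<and> factors_through C m n \<and> factors_through C n m"
    using assms n by (simp add: sub_class_iff)
  then show "mono_arr C m" "Cod C m = X" and m: "m \<in> Mor C" by (auto dest: monoD)
  show "sub_mem C U x \<longleftrightarrow> factors_through C x m"
    unfolding sub_mem_def
    using assms(2) factors_trans[OF m] mn n by (metis sub_class_iff)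
qed

lemma Sub_Obj: "U \<in> carrier (Sub C X) \<Longrightarrow> X \<in> Obj C"
  by (metis Sub_carrierE Cod_in_Obj)

text \<open>A Yoneda argument: two monos with the same generalized elements are evaluated at each
  other and so factor through each other.\<close>

lemma sub_of_eq_class:
  assumes "m \<in> sub_of C X Q" shows "sub_of C X Q = sub_class C m"
proof -
  have m: "mono_arr C m" "Cod C m = X" "m \<in> Mor C"
    "\<And>x. x \<in> Mor C \<Longrightarrow> Cod C x = X \<Longrightarrow> factors_through C x m \<longleftrightarrow> Q x"
    using assms by (auto simp: sub_of_def dest: monoD)
  show ?thesis
  proof (intro subset_antisym subsetI)
    fix n assume "n \<in> sub_of C X Q"
    then have n: "mono_arr C n" "Cod C n = X" "n \<in> Mor C"
      "\<And>x. x \<in> Mor C \<Longrightarrow> Cod C x = X \<Longrightarrow> factors_through C x n \<longleftrightarrow> Q x"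
      by (auto simp: sub_of_def dest: monoD)
    have "factors_through C n m" "factors_through C m n"
      using n(2,3) m(2,3) m(4)[of n] m(4)[of m] n(4)[of n] n(4)[of m] by simp_all
    then show "n \<in> sub_class C m" using m n by (simp add: sub_class_iff)
  next
    fix n assume "n \<in> sub_class C m"
    then have n: "mono_arr C n" "Cod C n = X" "n \<in> Mor C" "factors_through C n m" "factors_through C m n"
      using m by (auto simp: sub_class_iff dest: monoD)
    show "n \<in> sub_of C X Q"
      using n(1,2) m(4) factors_trans[OF m(3) _ n(4)] factors_trans[OF n(3) _ n(5)]
      by (auto simp: sub_of_def)
  qed
qed

lemma representableD:
  assumes "representable C X Q"
  shows sub_of_carrier: "sub_of C X Q \<in> carrier (Sub C X)"
    and mem_sub_of: "x \<in> Mor C \<Longrightarrow> Cod C x = X \<Longrightarrow> sub_mem C (sub_of C X Q) x \<longleftrightarrow> Q x"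
proof -
  obtain m where m: "m \<in> sub_of C X Q" using assms by (auto simp: representable_def)
  then have m': "mono_arr C m" "Cod C m = X" by (auto simp: sub_of_def)
  show c: "sub_of C X Q \<in> carrier (Sub C X)"
    unfolding Sub_def using sub_of_eq_class[OF m] m' by auto
  assume "x \<in> Mor C" "Cod C x = X"
  with Sub_member(4)[OF c m] m show "sub_mem C (sub_of C X Q) x \<longleftrightarrow> Q x"
    by (auto simp: sub_of_def)
qed

lemma representableE:
  assumes "representable C X Q"
  obtains m where "mono_arr C m" "m \<in> Mor C" "Cod C m = X"
    "\<And>x. x \<in> Mor C \<Longrightarrow> Cod C x = X \<Longrightarrow> factors_through C x m \<longleftrightarrow> Q x"
  using assms monoD by (auto simp: representable_def sub_of_def)

lemma representableI:
  assumes "mono_arr C m" "Cod C m = X"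
    "\<And>x. x \<in> Mor C \<Longrightarrow> Cod C x = X \<Longrightarrow> factors_through C x m \<longleftrightarrow> Q x"
  shows "representable C X Q"
  using assms by (auto simp: representable_def sub_of_def)

lemma representable_Sub:
  assumes "U \<in> carrier (Sub C X)" "\<And>x. x \<in> Mor C \<Longrightarrow> Cod C x = X \<Longrightarrow> sub_mem C U x \<longleftrightarrow> Q x"
  shows "representable C X Q"
proof -
  obtain m where m: "mono_arr C m" "Cod C m = X" "m \<in> U" using Sub_carrierE[OF assms(1)] by metis
  show ?thesis
    using Sub_member(4)[OF assms(1) m(3)] m assms(2) by (intro representableI[of m]) blast+
qed

lemma mem_comp:
  assumes "U \<in> carrier (Sub C X)" "sub_mem C U x" "x \<in> Mor C" "s \<in> Mor C" "Cod C s = Dom C x"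
  shows "sub_mem C U (x \<odot> s)"
  using assms factors_precomp unfolding sub_mem_def by (meson Sub_member(2))

lemma representable_comp:
  assumes "representable C X Q" "Q x" "x \<in> Mor C" "Cod C x = X" "s \<in> Mor C" "Cod C s = Dom C x"
  shows "Q (x \<odot> s)"
  using mem_comp[OF sub_of_carrier[OF assms(1)], of x s] mem_sub_of[OF assms(1)] assms by auto

text \<open>A representing mono is itself the generic element of its subobject, so inclusion at all
  elements is decided there.\<close>

lemma Sub_le_iff:
  assumes "U \<in> carrier (Sub C X)" "V \<in> carrier (Sub C X)"
  shows "U \<sqsubseteq>\<^bsub>Sub C X\<^esub> V \<longleftrightarrow> (\<forall>x\<in>Mor C. Cod C x = X \<longrightarrow> sub_mem C U x \<longrightarrow> sub_mem C V x)"
proof -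
  obtain m where m: "mono_arr C m" "m \<in> Mor C" "Cod C m = X" "m \<in> U" using Sub_carrierE[OF assms(1)] by metis
  obtain n where n: "mono_arr C n" "n \<in> Mor C" "Cod C n = X" "n \<in> V" using Sub_carrierE[OF assms(2)] by metis
  have "U \<sqsubseteq>\<^bsub>Sub C X\<^esub> V \<longleftrightarrow> factors_through C m n"
  proof
    assume "U \<sqsubseteq>\<^bsub>Sub C X\<^esub> V"
    then obtain m' n' where mn: "m' \<in> U" "n' \<in> V" "factors_through C m' n'" by (auto simp: Sub_def)
    have "sub_mem C U m" using m by (simp add: Sub_member(4)[OF assms(1) m(4)])
    then have "factors_through C m m'" using Sub_member(4)[OF assms(1) mn(1)] by blast
    then have "factors_through C m n'" using factors_trans Sub_member(2)[OF assms(2) mn(2)] mn(3) by blast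
    then have "sub_mem C V m" using mn(2) by (auto simp: sub_mem_def)
    then show "factors_through C m n" using Sub_member(4)[OF assms(2) n(4)] by blast
  next
    assume "factors_through C m n"
    then show "U \<sqsubseteq>\<^bsub>Sub C X\<^esub> V" using m n by (auto simp: Sub_def)
  qed
  also have "\<dots> \<longleftrightarrow> (\<forall>x\<in>Mor C. Cod C x = X \<longrightarrow> sub_mem C U x \<longrightarrow> sub_mem C V x)"
    unfolding Sub_member(4)[OF assms(1) m(4)] Sub_member(4)[OF assms(2) n(4)]
    using factors_trans[OF n(2)] factors_refl m by blast
  finally show ?thesis .
qed

lemma Sub_eqI:
  assumes "U \<in> carrier (Sub C X)" "V \<in> carrier (Sub C X)"
    "\<And>x. x \<in> Mor C \<Longrightarrow> Cod C x = X \<Longrightarrow> sub_mem C U x \<longleftrightarrow> sub_mem C V x"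
  shows "U = V"
proof -
  obtain m where m: "mono_arr C m" "m \<in> Mor C" "Cod C m = X" "m \<in> U" "U = sub_class C m"
    using Sub_carrierE[OF assms(1)] by metis
  obtain n where n: "mono_arr C n" "n \<in> Mor C" "Cod C n = X" "n \<in> V" "V = sub_class C n"
    using Sub_carrierE[OF assms(2)] by metis
  have "\<And>x. x \<in> Mor C \<Longrightarrow> Cod C x = X \<Longrightarrow> factors_through C x m \<longleftrightarrow> factors_through C x n"
    using assms(3) Sub_member(4)[OF assms(1) m(4)] Sub_member(4)[OF assms(2) n(4)] by blast
  then have "m \<in> sub_of C X (\<lambda>x. factors_through C x n)" "n \<in> sub_of C X (\<lambda>x. factors_through C x n)"
    using m n by (auto simp: sub_of_def)
  from sub_of_eq_class[OF this(1)] sub_of_eq_class[OF this(2)] show ?thesis using m n by simp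
qed

lemma Sub_eq_sub_of:
  assumes "U \<in> carrier (Sub C X)" "\<And>x. x \<in> Mor C \<Longrightarrow> Cod C x = X \<Longrightarrow> sub_mem C U x \<longleftrightarrow> Q x"
  shows "U = sub_of C X Q"
proof (rule Sub_eqI[OF assms(1)])
  have r: "representable C X Q" using representable_Sub assms by blast
  show "sub_of C X Q \<in> carrier (Sub C X)" using r by (rule sub_of_carrier)
  show "sub_mem C U x \<longleftrightarrow> sub_mem C (sub_of C X Q) x" if "x \<in> Mor C" "Cod C x = X" for x
    using assms(2) mem_sub_of[OF r] that by simp
qed

lemma Sub_partial_order: "partial_order (Sub C X)"
proof (unfold_locales, goal_cases)
  case (5 x y)
  have "x = y" using 5(1,2) by (intro Sub_eqI[OF 5(3,4)]) (auto simp: Sub_le_iff 5(3,4))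
  then show ?case by simp
qed (simp_all add: Sub_le_iff)

text \<open>Operations such as \<open>inv_im\<close>, \<open>pm_inv_im\<close> or
  \<open>sub_prod\<close> collect the results of all choices of representatives and limits. Once
  each result represents \<open>Q\<close>, closure under isomorphisms makes the collection a full
  class.\<close>

lemma set_eq_sub_of:
  assumes "S \<subseteq> sub_of C X Q" "S \<noteq> {}"
    "\<And>m i. m \<in> S \<Longrightarrow> iso_arr C i \<Longrightarrow> Cod C i = Dom C m \<Longrightarrow> m \<odot> i \<in> S"
  shows "S = sub_of C X Q" "representable C X Q"
proof -
  obtain m where m: "m \<in> S" using assms by auto
  then have "sub_of C X Q = sub_class C m" using assms(1) by (intro sub_of_eq_class) auto
  also have "\<dots> \<subseteq> S" using assms(3)[OF m] by (auto simp: sub_class_def)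
  finally show "S = sub_of C X Q" using assms by auto
  show "representable C X Q" using m assms(1) by (auto simp: representable_def)
qed

lemma set_carrier_Sub:
  assumes "S \<subseteq> sub_of C X Q" "S \<noteq> {}"
    "\<And>m i. m \<in> S \<Longrightarrow> iso_arr C i \<Longrightarrow> Cod C i = Dom C m \<Longrightarrow> m \<odot> i \<in> S"
  shows "S \<in> carrier (Sub C X)" "x \<in> Mor C \<Longrightarrow> Cod C x = X \<Longrightarrow> sub_mem C S x \<longleftrightarrow> Q x"
  using sub_of_carrier mem_sub_of set_eq_sub_of[OF assms] by metis+

lemma representable_True: "X \<in> Obj C \<Longrightarrow> representable C X (\<lambda>_. True)"
  by (rule representableI[of "Ident C X"]) (simp_all add: iso_mono iso_Ident factorsI)

end

subsection \<open>Finite limits\<close>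

text \<open>Index categories without composable pairs of non-identity arrows; identities are numbered
  like their objects.\<close>

definition bipartite_cat :: "nat set \<Rightarrow> nat set \<Rightarrow> (nat \<Rightarrow> nat) \<Rightarrow> (nat \<Rightarrow> nat) \<Rightarrow> (nat, nat) cat"
  where "bipartite_cat V E d c = \<lparr>Obj = V, Mor = V \<union> E, Dom = (\<lambda>u. if u \<in> V then u else d u),
    Cod = (\<lambda>u. if u \<in> V then u else c u), Ident = (\<lambda>i. i), Comp = (\<lambda>g f. if g \<in> V then f else g)\<rparr>"

locale finite_limit_category = category +
  assumes finite_limits': "has_finite_limits C"
begin

definition bipartite_cone where
  "bipartite_cone V E d c Fo Fm L l \<longleftrightarrow>
    L \<in> Obj C \<and> (\<forall>i\<in>V. l i \<in> Hom C L (Fo i)) \<and> (\<forall>e\<in>E. Fm e \<odot> l (d e) = l (c e))"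

text \<open>Limits over a graph whose arrows never compose. The condition
  \<open>c e \<noteq> d e'\<close> leaves only composites with identities, so an assignment of
  arrows with the right ends extends to a functor, and cones need to be checked on \<open>E\<close>
  only.\<close>

lemma bipartite_limit:
  fixes V E :: "nat set" and Fo :: "nat \<Rightarrow> 'a" and Fm :: "nat \<Rightarrow> 'b"
  assumes "finite V" "finite E" "V \<inter> E = {}"
    and dc: "\<And>e. e \<in> E \<Longrightarrow> d e \<in> V" "\<And>e. e \<in> E \<Longrightarrow> c e \<in> V" "\<And>e e'. e \<in> E \<Longrightarrow> e' \<in> E \<Longrightarrow> c e \<noteq> d e'"
    and Fo: "\<And>i. i \<in> V \<Longrightarrow> Fo i \<in> Obj C"
    and Fm: "\<And>e. e \<in> E \<Longrightarrow> Fm e \<in> Hom C (Fo (d e)) (Fo (c e))"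
  obtains L l where "bipartite_cone V E d c Fo Fm L l"
    "\<And>M k. bipartite_cone V E d c Fo Fm M k \<Longrightarrow> \<exists>!h. h \<in> Hom C M L \<and> (\<forall>i\<in>V. l i \<odot> h = k i)"
proof -
  let ?J = "bipartite_cat V E d c"
  have VE: "x \<in> E \<Longrightarrow> x \<notin> V" for x using assms(3) by auto
  have J: "category ?J"
    using dc VE
    by unfold_locales (auto simp: bipartite_cat_def Hom_def split: if_splits, metis)
  then have fin: "finite_category ?J"
    by (simp add: finite_category_def finite_category_axioms_def assms(1,2) bipartite_cat_def)
  \<comment> \<open>Identities carry the numbers of their objects, so membership in \<open>V\<close>
    decides where an index arrow is an identity.\<close>
  let ?Fm = "\<lambda>u. if u \<in> V then Ident C (Fo u) else Fm u"
  have funct: "cat_functor ?J C Fo ?Fm"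
    unfolding cat_functor_def cat_functor_axioms_def
  proof (intro conjI allI impI J category_axioms, goal_cases)
    case (1 i) then show ?case using Fo by (auto simp: bipartite_cat_def)
  next
    case (2 u i j) then show ?case using Fo Fm VE
      by (auto simp: bipartite_cat_def Ident_in_Hom Hom_def)
  next
    case (3 i) then show ?case by (auto simp: bipartite_cat_def)
  next
    case (4 u i j v k)
    have "\<And>u. u \<in> V \<union> E \<Longrightarrow> ?Fm u \<in> Mor C \<and> Dom C (?Fm u) = Fo (Dom ?J u) \<and> Cod C (?Fm u) = Fo (Cod ?J u)"
      using Fm Fo by (auto simp: Hom_def bipartite_cat_def)
    from this[of u] this[of v] 4 show ?case using VE dc(3)[of u v]
      by (auto simp: bipartite_cat_def Hom_def)
  qed
  obtain L l where "is_limit ?J C Fo ?Fm L l"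
    using finite_limits' fin funct unfolding has_finite_limits_def by blast
  moreover have "is_cone ?J C Fo ?Fm M k \<longleftrightarrow> bipartite_cone V E d c Fo Fm M k" for M k
    unfolding is_cone_def bipartite_cone_def using VE
    by (auto simp: bipartite_cat_def Hom_def)
  ultimately show thesis
    by (intro that[of L l]) (auto simp: is_limit_def bipartite_cat_def)
qed

lemma terminal_exists: "\<exists>T. is_terminal C T"
proof (rule bipartite_limit[of "{}" "{}" id id undefined undefined])
  fix L l assume "bipartite_cone {} {} id id undefined undefined L l"
    "\<And>M k. bipartite_cone {} {} id id undefined undefined M k \<Longrightarrow>
      \<exists>!h. h \<in> Hom C M L \<and> (\<forall>i\<in>{}. l i \<odot> h = k i)"
  then have "is_terminal C L" by (simp add: is_terminal_def bipartite_cone_def)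
  then show "\<exists>T. is_terminal C T" by blast
qed simp_all

lemma product_exists:
  assumes "X \<in> Obj C" "Y \<in> Obj C" shows "\<exists>P p q. is_product C X Y P p q"
proof -
  define Fo where "Fo = (\<lambda>i::nat. if i = 0 then X else Y)"
  obtain L l where L: "bipartite_cone {0,1} {} id id Fo undefined L l"
    and U: "\<And>M k. bipartite_cone {0,1} {} id id Fo undefined M k \<Longrightarrow>
       \<exists>!h. h \<in> Hom C M L \<and> (\<forall>i\<in>{0,1}. l i \<odot> h = k i)"
    by (rule bipartite_limit[of "{0,1}" "{}" id id Fo undefined]) (auto simp: Fo_def assms)
  note L = L[unfolded bipartite_cone_def] and U = U[unfolded bipartite_cone_def]
  have "is_product C X Y L (l 0) (l 1)"
    unfolding is_product_def
  proof (intro conjI ballI)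
    fix Z f g assume "Z \<in> Obj C" "f \<in> Hom C Z X" "g \<in> Hom C Z Y"
    then show "\<exists>!h. h \<in> Hom C Z L \<and> l 0 \<odot> h = f \<and> l 1 \<odot> h = g"
      using U[of Z "\<lambda>i. if i = 0 then f else g"] by (simp add: Fo_def)
  qed (use L in \<open>auto simp: Fo_def\<close>)
  then show ?thesis by blast
qed

text \<open>The index graph has the arrows 2 and 3 from 0 to 1. The leg at 1 is the composite of the
  leg at 0 with \<open>f\<close>, which is why it drops out of the universal property.\<close>

lemma equalizer_exists:
  assumes fg: "f \<in> Mor C" "g \<in> Mor C" "Dom C f = Dom C g" "Cod C f = Cod C g"
  shows "\<exists>e. is_equalizer C f g e"
proof -
  define Fo where "Fo = (\<lambda>i::nat. if i = 0 then Dom C f else Cod C f)"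
  define Fm where "Fm = (\<lambda>i::nat. if i = 2 then f else g)"
  have prems: "\<And>i. i \<in> {0, 1} \<Longrightarrow> Fo i \<in> Obj C"
    "\<And>e. e \<in> {2, 3} \<Longrightarrow> Fm e \<in> Hom C (Fo 0) (Fo 1)"
    using fg by (auto simp: Fo_def Fm_def Hom_def)
  obtain L l where L: "bipartite_cone {0,1} {2,3} (\<lambda>_. 0) (\<lambda>_. 1) Fo Fm L l"
    and U: "\<And>M k. bipartite_cone {0,1} {2,3} (\<lambda>_. 0) (\<lambda>_. 1) Fo Fm M k \<Longrightarrow>
       \<exists>!h. h \<in> Hom C M L \<and> (\<forall>i\<in>{0,1}. l i \<odot> h = k i)"
    by (rule bipartite_limit[of "{0,1}" "{2,3}" "\<lambda>_. 0" "\<lambda>_. 1" Fo Fm, OF _ _ _ _ _ _ prems])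
      (simp, simp, simp, simp, simp, simp, assumption, assumption, blast)
  have l: "l 0 \<in> Mor C" "Dom C (l 0) = L" "Cod C (l 0) = Dom C f" "f \<odot> l 0 = l 1" "g \<odot> l 0 = l 1"
    using L by (simp_all add: bipartite_cone_def Fo_def Fm_def Hom_def)
  have ex: "\<exists>!h. h \<in> Hom C (Dom C a) L \<and> l 0 \<odot> h = a"
    if a: "a \<in> Mor C" "Cod C a = Dom C f" "f \<odot> a = g \<odot> a" for a
  proof -
    have "bipartite_cone {0,1} {2,3} (\<lambda>_. 0) (\<lambda>_. 1) Fo Fm (Dom C a) (\<lambda>i. if i = 0 then a else f \<odot> a)"
      using a(1,2) a(3)[symmetric] fg by (simp add: bipartite_cone_def Fo_def Fm_def Hom_def)
    from U[OF this] have "\<exists>!h. h \<in> Hom C (Dom C a) L \<and> l 0 \<odot> h = a \<and> l 1 \<odot> h = f \<odot> a" by simp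
    moreover have "l 1 \<odot> h = f \<odot> a" if "h \<in> Hom C (Dom C a) L" "l 0 \<odot> h = a" for h
      unfolding l(4)[symmetric] using that l(1,2,3) fg by (simp add: Hom_def)
    ultimately show ?thesis by blast
  qed
  have "is_equalizer C f g (l 0)"
    unfolding is_equalizer_def using ex l fg by (simp add: Hom_def)
  then show ?thesis by blast
qed

text \<open>The index graph has the arrows 3 from 0 to 2 and 4 from 1 to 2; the leg at 2 is again
  determined, here by the leg at 0.\<close>

lemma pullback_exists:
  assumes fg: "f \<in> Mor C" "g \<in> Mor C" "Cod C f = Cod C g"
  shows "\<exists>p q. is_pullback C f g p q"
proof -
  define Fo where "Fo = (\<lambda>i::nat. if i = 0 then Dom C f else if i = 1 then Dom C g else Cod C f)"
  define Fm where "Fm = (\<lambda>i::nat. if i = 3 then f else g)"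
  define d :: "nat \<Rightarrow> nat" where "d = (\<lambda>i. if i = 3 then 0 else 1)"
  have prems: "\<And>e. e \<in> {3, 4} \<Longrightarrow> d e \<in> {0, 1, 2}"
    "\<And>e. e \<in> {3, 4} \<Longrightarrow> (2::nat) \<in> {0, 1, 2}"
    "\<And>e e'. e \<in> {3, 4} \<Longrightarrow> e' \<in> {3, 4} \<Longrightarrow> 2 \<noteq> d e'"
    "\<And>i. i \<in> {0, 1, 2} \<Longrightarrow> Fo i \<in> Obj C"
    "\<And>e. e \<in> {3, 4} \<Longrightarrow> Fm e \<in> Hom C (Fo (d e)) (Fo 2)"
    using fg by (auto simp: Fo_def Fm_def Hom_def d_def)
  obtain L l where L: "bipartite_cone {0,1,2} {3,4} d (\<lambda>_. 2) Fo Fm L l"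
    and U: "\<And>M k. bipartite_cone {0,1,2} {3,4} d (\<lambda>_. 2) Fo Fm M k \<Longrightarrow>
       \<exists>!h. h \<in> Hom C M L \<and> (\<forall>i\<in>{0,1,2}. l i \<odot> h = k i)"
    by (rule bipartite_limit[of "{0,1,2}" "{3,4}" d "\<lambda>_. 2" Fo Fm, OF _ _ _ prems])
      (simp, simp, simp, assumption, assumption, assumption, assumption, assumption, assumption, blast)
  have l: "l 0 \<in> Mor C" "Dom C (l 0) = L" "Cod C (l 0) = Dom C f"
      "l 1 \<in> Mor C" "Dom C (l 1) = L" "Cod C (l 1) = Dom C g" "f \<odot> l 0 = l 2" "g \<odot> l 1 = l 2"
    using L by (simp_all add: bipartite_cone_def Fo_def Fm_def Hom_def d_def)
  have ex: "\<exists>!h. h \<in> Hom C Z L \<and> l 0 \<odot> h = a \<and> l 1 \<odot> h = b"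
    if a: "Z \<in> Obj C" "a \<in> Hom C Z (Dom C f)" "b \<in> Hom C Z (Dom C g)" "f \<odot> a = g \<odot> b" for Z a b
  proof -
    let ?k = "\<lambda>i::nat. if i = 0 then a else if i = 1 then b else f \<odot> a"
    have "bipartite_cone {0,1,2} {3,4} d (\<lambda>_. 2) Fo Fm Z ?k"
      using a(1-3) a(4)[symmetric] fg by (simp add: bipartite_cone_def Fo_def Fm_def Hom_def d_def)
    from U[OF this] have "\<exists>!h. h \<in> Hom C Z L \<and> l 0 \<odot> h = a \<and> l 1 \<odot> h = b \<and> l 2 \<odot> h = f \<odot> a" by simp
    moreover have "l 2 \<odot> h = f \<odot> a" if "h \<in> Hom C Z L" "l 0 \<odot> h = a" for h
      unfolding l(7)[symmetric] using that l(1,2,3) fg by (simp add: Hom_def)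
    ultimately show ?thesis by blast
  qed
  have "is_pullback C f g (l 0) (l 1)"
    unfolding is_pullback_def using l fg by (intro conjI ballI impI) (simp_all add: ex[unfolded One_nat_def])
  then show ?thesis by blast
qed

subsection \<open>Products\<close>

lemma terminal_obj: "is_terminal C (terminal_obj C)"
  unfolding terminal_obj_def using someI_ex[OF terminal_exists] .

lemma terminal_Obj [simp]: "terminal_obj C \<in> Obj C"
  using terminal_obj by (simp add: is_terminal_def)

lemma bang: "X \<in> Obj C \<Longrightarrow> bang C X \<in> Hom C X (terminal_obj C)"
  unfolding bang_def by (rule theI') (use terminal_obj in \<open>simp add: is_terminal_def\<close>)

lemma bang_simps [simp]:
  "X \<in> Obj C \<Longrightarrow> bang C X \<in> Mor C" "X \<in> Obj C \<Longrightarrow> Dom C (bang C X) = X"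
  "X \<in> Obj C \<Longrightarrow> Cod C (bang C X) = terminal_obj C"
  using bang[of X] by (auto simp: Hom_def)

lemma prod_cone:
  assumes "X \<in> Obj C" "Y \<in> Obj C"
  shows "is_product C X Y (prod_obj C X Y) (pr1 C X Y) (pr2 C X Y)"
proof -
  have "\<exists>c. (\<lambda>(P, p, q). is_product C X Y P p q) c" using product_exists[OF assms] by auto
  from someI_ex[OF this] show ?thesis
    by (simp add: prod_cone_def prod_obj_def pr1_def pr2_def split: prod.splits)
qed

lemma prod_simps [simp]:
  assumes "X \<in> Obj C" "Y \<in> Obj C"
  shows "prod_obj C X Y \<in> Obj C"
    "pr1 C X Y \<in> Mor C" "Dom C (pr1 C X Y) = prod_obj C X Y" "Cod C (pr1 C X Y) = X"
    "pr2 C X Y \<in> Mor C" "Dom C (pr2 C X Y) = prod_obj C X Y" "Cod C (pr2 C X Y) = Y"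
  using prod_cone[OF assms] by (auto simp: is_product_def Hom_def)

lemma pairing_ex1:
  assumes "f \<in> Mor C" "g \<in> Mor C" "Dom C f = Dom C g"
  shows "\<exists>!h. h \<in> Hom C (Dom C f) (prod_obj C (Cod C f) (Cod C g)) \<and>
      pr1 C (Cod C f) (Cod C g) \<odot> h = f \<and> pr2 C (Cod C f) (Cod C g) \<odot> h = g"
proof -
  have "Cod C f \<in> Obj C" "Cod C g \<in> Obj C" using assms by auto
  from prod_cone[OF this] show ?thesis using assms Dom_in_Obj[OF assms(1)]
    unfolding is_product_def by (auto simp: Hom_def)
qed

lemma pairing_all:
  assumes "f \<in> Mor C" "g \<in> Mor C" "Dom C f = Dom C g"
  shows "pairing C f g \<in> Mor C" "Dom C (pairing C f g) = Dom C g"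
      "Cod C (pairing C f g) = prod_obj C (Cod C f) (Cod C g)"
      "pr1 C (Cod C f) (Cod C g) \<odot> pairing C f g = f"
      "pr2 C (Cod C f) (Cod C g) \<odot> pairing C f g = g"
  using theI'[OF pairing_ex1[OF assms], folded pairing_def] assms by (auto simp: Hom_def)

lemma pairing_simps [simp]:
  assumes "f \<in> Mor C" "g \<in> Mor C" "Dom C f = Dom C g"
  shows "pairing C f g \<in> Mor C" "Dom C (pairing C f g) = Dom C g"
      "Cod C (pairing C f g) = prod_obj C (Cod C f) (Cod C g)"
      "Cod C f = X \<Longrightarrow> Cod C g = Y \<Longrightarrow> pr1 C X Y \<odot> pairing C f g = f"
      "Cod C f = X \<Longrightarrow> Cod C g = Y \<Longrightarrow> pr2 C X Y \<odot> pairing C f g = g"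
  using pairing_all[OF assms] by auto

lemma pairing_eqI:
  assumes "X \<in> Obj C" "Y \<in> Obj C" "h \<in> Mor C" "h' \<in> Mor C" "Dom C h = Dom C h'"
    "Cod C h = prod_obj C X Y" "Cod C h' = prod_obj C X Y"
    "pr1 C X Y \<odot> h = pr1 C X Y \<odot> h'" "pr2 C X Y \<odot> h = pr2 C X Y \<odot> h'"
  shows "h = h'"
  using pairing_ex1[of "pr1 C X Y \<odot> h" "pr2 C X Y \<odot> h"] assms by (auto simp: Hom_def)

lemma pairing_comp [simp]:
  assumes "f \<in> Mor C" "g \<in> Mor C" "Dom C f = Dom C g" "h \<in> Mor C" "Cod C h = Dom C g"
  shows "pairing C f g \<odot> h = pairing C (f \<odot> h) (g \<odot> h)"
proof (rule pairing_eqI[of "Cod C f" "Cod C g"])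
  have "pr1 C (Cod C f) (Cod C g) \<odot> (pairing C f g \<odot> h) = (pr1 C (Cod C f) (Cod C g) \<odot> pairing C f g) \<odot> h"
    using assms by (intro Comp_assoc'[symmetric]) auto
  then show "pr1 C (Cod C f) (Cod C g) \<odot> (pairing C f g \<odot> h) = pr1 C (Cod C f) (Cod C g) \<odot> pairing C (f \<odot> h) (g \<odot> h)"
    using assms by simp
  have "pr2 C (Cod C f) (Cod C g) \<odot> (pairing C f g \<odot> h) = (pr2 C (Cod C f) (Cod C g) \<odot> pairing C f g) \<odot> h"
    using assms by (intro Comp_assoc'[symmetric]) auto
  then show "pr2 C (Cod C f) (Cod C g) \<odot> (pairing C f g \<odot> h) = pr2 C (Cod C f) (Cod C g) \<odot> pairing C (f \<odot> h) (g \<odot> h)"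
    using assms by simp
qed (use assms in simp_all)

lemma pairing_eta:
  assumes "X \<in> Obj C" "Y \<in> Obj C" "h \<in> Mor C" "Cod C h = prod_obj C X Y"
  shows "pairing C (pr1 C X Y \<odot> h) (pr2 C X Y \<odot> h) = h"
  by (rule pairing_eqI[of X Y]) (use assms in simp_all)

lemma pairing_inj:
  assumes "f \<in> Mor C" "g \<in> Mor C" "Dom C f = Dom C g" "f' \<in> Mor C" "g' \<in> Mor C" "Dom C f' = Dom C g'"
    "Cod C f = Cod C f'" "Cod C g = Cod C g'"
  shows "pairing C f g = pairing C f' g' \<longleftrightarrow> f = f' \<and> g = g'"
proof
  assume e: "pairing C f g = pairing C f' g'"
  have "pr1 C (Cod C f) (Cod C g) \<odot> pairing C f g = f" "pr2 C (Cod C f) (Cod C g) \<odot> pairing C f g = g"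
    using assms by simp_all
  moreover have "pr1 C (Cod C f) (Cod C g) \<odot> pairing C f' g' = f'" "pr2 C (Cod C f) (Cod C g) \<odot> pairing C f' g' = g'"
    using assms by simp_all
  ultimately show "f = f' \<and> g = g'" using e by simp
qed simp

subsection \<open>Pullbacks and inverse images\<close>

lemma pullbackD:
  assumes "is_pullback C f g p q"
  shows "f \<in> Mor C" "g \<in> Mor C" "Cod C g = Cod C f" "p \<in> Mor C" "q \<in> Mor C" "Dom C q = Dom C p"
    "Cod C p = Dom C f" "Cod C q = Dom C g" "f \<odot> p = g \<odot> q"
  using assms unfolding is_pullback_def by auto

lemma pullback_eq:
  assumes "is_pullback C f g p q" "h \<in> Mor C" "Cod C h = Dom C p"
  shows "f \<odot> (p \<odot> h) = g \<odot> (q \<odot> h)"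
  using pullbackD[OF assms(1)] assms(2,3) Comp_assoc'[of h p f] Comp_assoc'[of h q g] by simp

lemma pullback_ex1:
  assumes "is_pullback C f g p q" "Z \<in> Obj C" "a \<in> Hom C Z (Dom C f)" "b \<in> Hom C Z (Dom C g)" "f \<odot> a = g \<odot> b"
  shows "\<exists>!h. h \<in> Hom C Z (Dom C p) \<and> p \<odot> h = a \<and> q \<odot> h = b"
  using assms(1) unfolding is_pullback_def by (elim conjE) (use assms in simp)

lemma pullback_lift:
  assumes "is_pullback C f g p q" "a \<in> Mor C" "b \<in> Mor C" "Dom C a = Dom C b"
    "Cod C a = Dom C f" "Cod C b = Dom C g" "f \<odot> a = g \<odot> b"
  obtains h where "h \<in> Mor C" "Dom C h = Dom C b" "Cod C h = Dom C p" "p \<odot> h = a" "q \<odot> h = b"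
proof -
  have "\<exists>!h. h \<in> Hom C (Dom C b) (Dom C p) \<and> p \<odot> h = a \<and> q \<odot> h = b"
    by (rule pullback_ex1[OF assms(1)]) (use assms in \<open>simp_all add: Hom_def\<close>)
  then show thesis using that by (auto simp: Hom_def)
qed

lemma pullback_unique:
  assumes "is_pullback C f g p q" "h \<in> Mor C" "h' \<in> Mor C" "Dom C h = Dom C h'"
    "Cod C h = Dom C p" "Cod C h' = Dom C p" "p \<odot> h = p \<odot> h'" "q \<odot> h = q \<odot> h'"
  shows "h = h'"
proof -
  note pb = pullbackD[OF assms(1)]
  have "f \<odot> (p \<odot> h) = g \<odot> (q \<odot> h)"
    using pb assms Comp_assoc'[of h p f] Comp_assoc'[of h q g] by simp
  moreover have "p \<odot> h \<in> Hom C (Dom C h) (Dom C f)" "q \<odot> h \<in> Hom C (Dom C h) (Dom C g)"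
    using pb assms by (auto simp: Hom_def)
  ultimately have "\<exists>!k. k \<in> Hom C (Dom C h) (Dom C p) \<and> p \<odot> k = p \<odot> h \<and> q \<odot> k = q \<odot> h"
    by (intro pullback_ex1[OF assms(1)]) (use assms in simp_all)
  moreover have "h \<in> Hom C (Dom C h) (Dom C p)" "h' \<in> Hom C (Dom C h) (Dom C p)"
    using assms by (auto simp: Hom_def)
  ultimately show ?thesis using assms by metis
qed

lemma pullbackI:
  assumes "f \<in> Mor C" "g \<in> Mor C" "Cod C f = Cod C g" "p \<in> Mor C" "q \<in> Mor C" "Dom C p = Dom C q"
    "Cod C p = Dom C f" "Cod C q = Dom C g" "f \<odot> p = g \<odot> q"
    and ex: "\<And>a b. a \<in> Mor C \<Longrightarrow> b \<in> Mor C \<Longrightarrow> Dom C a = Dom C b \<Longrightarrow> Cod C a = Dom C f \<Longrightarrow> Cod C b = Dom C g \<Longrightarrow>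
      f \<odot> a = g \<odot> b \<Longrightarrow> \<exists>h. h \<in> Mor C \<and> Dom C h = Dom C b \<and> Cod C h = Dom C p \<and> p \<odot> h = a \<and> q \<odot> h = b"
    and un: "\<And>h h'. h \<in> Mor C \<Longrightarrow> h' \<in> Mor C \<Longrightarrow> Dom C h = Dom C h' \<Longrightarrow> Cod C h = Dom C p \<Longrightarrow> Cod C h' = Dom C p \<Longrightarrow>
      p \<odot> h = p \<odot> h' \<Longrightarrow> q \<odot> h = q \<odot> h' \<Longrightarrow> h = h'"
  shows "is_pullback C f g p q"
  unfolding is_pullback_def
proof (intro conjI ballI impI)
  fix Z a b assume ab: "a \<in> Hom C Z (Dom C f)" "b \<in> Hom C Z (Dom C g)" "f \<odot> a = g \<odot> b"
  show "\<exists>!h. h \<in> Hom C Z (Dom C p) \<and> p \<odot> h = a \<and> q \<odot> h = b"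
  proof (rule ex_ex1I)
    show "\<exists>h. h \<in> Hom C Z (Dom C p) \<and> p \<odot> h = a \<and> q \<odot> h = b" using ex[of a b] ab by (auto simp: Hom_def)
    fix h h' assume "h \<in> Hom C Z (Dom C p) \<and> p \<odot> h = a \<and> q \<odot> h = b"
      "h' \<in> Hom C Z (Dom C p) \<and> p \<odot> h' = a \<and> q \<odot> h' = b"
    then show "h = h'" using un[of h h'] by (auto simp: Hom_def)
  qed
qed (use assms in auto)

lemma pullback_swap:
  assumes pb: "is_pullback C f g p q" shows "is_pullback C g f q p"
proof (rule pullbackI)
  note pbD = pullbackD[OF pb]
  fix a b assume ab: "a \<in> Mor C" "b \<in> Mor C" "Dom C a = Dom C b" "Cod C a = Dom C g" "Cod C b = Dom C f" "g \<odot> a = f \<odot> b"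
  obtain h where "h \<in> Mor C" "Dom C h = Dom C a" "Cod C h = Dom C p" "p \<odot> h = b" "q \<odot> h = a"
    using pullback_lift[OF pb ab(2,1) ab(3)[symmetric] ab(5,4) ab(6)[symmetric]] .
  then show "\<exists>h. h \<in> Mor C \<and> Dom C h = Dom C b \<and> Cod C h = Dom C q \<and> q \<odot> h = a \<and> p \<odot> h = b"
    using ab pbD by (intro exI[of _ h]) simp
next
  note pbD = pullbackD[OF pb]
  fix h h' assume "h \<in> Mor C" "h' \<in> Mor C" "Dom C h = Dom C h'" "Cod C h = Dom C q" "Cod C h' = Dom C q"
    "q \<odot> h = q \<odot> h'" "p \<odot> h = p \<odot> h'"
  then show "h = h'" using pullback_unique[OF pb, of h h'] pbD by simp
qed (use pullbackD[OF pb] in simp_all)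

text \<open>Supplies closure under isomorphisms for the sets that \<open>inv_im\<close> and the
  operations on partial morphisms collect over all pullbacks.\<close>

lemma pullback_iso:
  assumes pb: "is_pullback C f g p q" and i: "iso_arr C i" "Cod C i = Dom C p"
  shows "is_pullback C f g (p \<odot> i) (q \<odot> i)"
proof -
  note pbD = pullbackD[OF pb]
  obtain j where j: "i \<in> Mor C" "j \<in> Mor C" "Dom C j = Cod C i" "Cod C j = Dom C i"
    "j \<odot> i = Ident C (Dom C i)" "i \<odot> j = Ident C (Cod C i)" using isoE i by blast
  show ?thesis
  proof (rule pullbackI)
    show "f \<odot> p \<odot> i = g \<odot> q \<odot> i" using pbD j i(2) Comp_assoc'[of i p f] Comp_assoc'[of i q g] by simp
    fix a b assume ab: "a \<in> Mor C" "b \<in> Mor C" "Dom C a = Dom C b" "Cod C a = Dom C f" "Cod C b = Dom C g"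
      "f \<odot> a = g \<odot> b"
    obtain h where h: "h \<in> Mor C" "Dom C h = Dom C b" "Cod C h = Dom C p" "p \<odot> h = a" "q \<odot> h = b"
      using pullback_lift[OF pb ab] .
    have "i \<odot> j \<odot> h = h" using h j i(2) Comp_assoc'[of h j i] by simp
    then show "\<exists>h. h \<in> Mor C \<and> Dom C h = Dom C b \<and> Cod C h = Dom C (p \<odot> i) \<and> (p \<odot> i) \<odot> h = a \<and> (q \<odot> i) \<odot> h = b"
      using h j i(2) pbD by (intro exI[of _ "j \<odot> h"]) simp
  next
    fix h h' assume h: "h \<in> Mor C" "h' \<in> Mor C" "Dom C h = Dom C h'" "Cod C h = Dom C (p \<odot> i)"
      "Cod C h' = Dom C (p \<odot> i)" "(p \<odot> i) \<odot> h = (p \<odot> i) \<odot> h'" "(q \<odot> i) \<odot> h = (q \<odot> i) \<odot> h'"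
    have "i \<odot> h = i \<odot> h'"
      by (rule pullback_unique[OF pb]) (use h j i(2) pbD in simp_all)
    then show "h = h'" using mono_cancel[OF iso_mono[OF i(1)], of h h'] h j i(2) pbD by simp
  qed (use pbD j i(2) in simp_all)
qed

lemma pullback_mono:
  assumes pb: "is_pullback C f m p q" and m: "mono_arr C m"
  shows "mono_arr C p"
proof (rule monoI)
  note pbD = pullbackD[OF pb]
  show "p \<in> Mor C" by fact
  fix a b assume ab: "a \<in> Mor C" "b \<in> Mor C" "Cod C a = Dom C p" "Cod C b = Dom C p" "Dom C a = Dom C b" "p \<odot> a = p \<odot> b"
  have "m \<odot> (q \<odot> a) = f \<odot> (p \<odot> a)" using ab pbD Comp_assoc'[of a p f] Comp_assoc'[of a q m] by simp
  also have "\<dots> = m \<odot> (q \<odot> b)" using ab pbD Comp_assoc'[of b p f] Comp_assoc'[of b q m] by simp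
  finally have "q \<odot> a = q \<odot> b" using mono_cancel[OF m, of "q \<odot> a" "q \<odot> b"] ab pbD by simp
  then show "a = b" using pullback_unique[OF pb, of a b] ab by simp
qed

text \<open>Along a monic \<open>m\<close> the second leg is determined by the first, so the
  universal property reduces to a statement about factorizations.\<close>

lemma pullback_factors:
  assumes pb: "is_pullback C f m p q" and m: "mono_arr C m" and x: "x \<in> Mor C" "Cod C x = Dom C f"
  shows "factors_through C x p \<longleftrightarrow> factors_through C (f \<odot> x) m"
proof
  note pbD = pullbackD[OF pb]
  {
    assume "factors_through C x p"
    then obtain h where h: "h \<in> Mor C" "Dom C h = Dom C x" "Cod C h = Dom C p" "p \<odot> h = x"
      using factorsE by blast
    have "m \<odot> (q \<odot> h) = f \<odot> (p \<odot> h)" using h pbD Comp_assoc'[of h p f] Comp_assoc'[of h q m] by simp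
    then show "factors_through C (f \<odot> x) m"
      using h pbD x by (intro factorsI[of "q \<odot> h"]) auto
  }
  assume "factors_through C (f \<odot> x) m"
  then obtain k where k: "k \<in> Mor C" "Dom C k = Dom C (f \<odot> x)" "Cod C k = Dom C m" "m \<odot> k = f \<odot> x"
    using factorsE by blast
  then obtain h where "h \<in> Mor C" "Dom C h = Dom C k" "Cod C h = Dom C p" "p \<odot> h = x" "q \<odot> h = k"
    using pullback_lift[OF pb, of x k] x pbD by auto
  then show "factors_through C x p" using k x pbD by (intro factorsI[of h]) auto
qed

lemma inv_im:
  assumes f: "f \<in> Mor C" "Dom C f = X" "Cod C f = Y" and U: "U \<in> carrier (Sub C Y)"
  shows inv_im_carrier: "inv_im C f U \<in> carrier (Sub C X)"
    and mem_inv_im: "\<And>x. x \<in> Mor C \<Longrightarrow> Cod C x = X \<Longrightarrow> sub_mem C (inv_im C f U) x \<longleftrightarrow> sub_mem C U (f \<odot> x)"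
proof -
  have sub: "inv_im C f U \<subseteq> sub_of C X (\<lambda>x. sub_mem C U (f \<odot> x))"
  proof
    fix p assume "p \<in> inv_im C f U"
    then obtain m q where m: "m \<in> U" and pb: "is_pullback C f m p q" by (auto simp: inv_im_def)
    have mono: "mono_arr C m" using Sub_member(1)[OF U m] .
    show "p \<in> sub_of C X (\<lambda>x. sub_mem C U (f \<odot> x))"
      using pullback_mono[OF pb mono] pullbackD[OF pb] pullback_factors[OF pb mono]
        Sub_member(4)[OF U m] f by (auto simp: sub_of_def)
  qed
  obtain m where m: "mono_arr C m" "m \<in> Mor C" "Cod C m = Y" "m \<in> U" using Sub_carrierE[OF U] by blast
  then obtain p q where "is_pullback C f m p q" using pullback_exists[of f m] f by auto
  then have ne: "inv_im C f U \<noteq> {}" using m by (auto simp: inv_im_def)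
  have iso: "p \<odot> i \<in> inv_im C f U" if "p \<in> inv_im C f U" "iso_arr C i" "Cod C i = Dom C p" for p i
    using that(1) pullback_iso[OF _ that(2,3)] unfolding inv_im_def by blast
  show "inv_im C f U \<in> carrier (Sub C X)"
    by (rule set_carrier_Sub(1)[OF sub ne iso])
  show "\<And>x. x \<in> Mor C \<Longrightarrow> Cod C x = X \<Longrightarrow> sub_mem C (inv_im C f U) x \<longleftrightarrow> sub_mem C U (f \<odot> x)"
    by (rule set_carrier_Sub(2)[OF sub ne iso])
qed

lemma inv_im_sub_of:
  assumes f: "f \<in> Mor C" "Dom C f = X" "Cod C f = Y" and Q: "representable C Y Q"
  shows "inv_im C f (sub_of C Y Q) = sub_of C X (\<lambda>x. Q (f \<odot> x))"
    and representable_inv_im: "representable C X (\<lambda>x. Q (f \<odot> x))"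
proof -
  note c = inv_im_carrier[OF f sub_of_carrier[OF Q]]
  have m: "\<And>x. x \<in> Mor C \<Longrightarrow> Cod C x = X \<Longrightarrow> sub_mem C (inv_im C f (sub_of C Y Q)) x \<longleftrightarrow> Q (f \<odot> x)"
    using mem_inv_im[OF f sub_of_carrier[OF Q]] mem_sub_of[OF Q] f by simp
  show "inv_im C f (sub_of C Y Q) = sub_of C X (\<lambda>x. Q (f \<odot> x))" by (rule Sub_eq_sub_of[OF c m])
  show "representable C X (\<lambda>x. Q (f \<odot> x))" by (rule representable_Sub[OF c m])
qed

subsection \<open>Partial morphisms by generalized elements\<close>

text \<open>Partial morphisms are treated through their graphs on generalized elements:
  \<open>x\<close> is in the domain when it lifts along \<open>m\<close>, and for monic
  \<open>m\<close> the lift, hence the value \<open>v\<close>, is unique.\<close>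

definition span_val :: "'b \<Rightarrow> 'b \<Rightarrow> 'b \<Rightarrow> 'b \<Rightarrow> bool"
  where "span_val m f x v \<longleftrightarrow> (\<exists>h\<in>Mor C. Dom C h = Dom C x \<and> Cod C h = Dom C m \<and> m \<odot> h = x \<and> f \<odot> h = v)"

definition pm_val :: "('b \<times> 'b) set \<Rightarrow> 'b \<Rightarrow> 'b \<Rightarrow> bool"
  where "pm_val F x v \<longleftrightarrow> (\<exists>(m, f)\<in>F. span_val m f x v)"

definition pm_of :: "'a \<Rightarrow> 'a \<Rightarrow> ('b \<Rightarrow> 'b \<Rightarrow> bool) \<Rightarrow> ('b \<times> 'b) set"
  where "pm_of X Y Q = {(m, f). mono_arr C m \<and> Cod C m = X \<and> f \<in> Hom C (Dom C m) Y \<and>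
    (\<forall>x\<in>Mor C. Cod C x = X \<longrightarrow> (\<forall>v. span_val m f x v \<longleftrightarrow> Q x v))}"

lemma span_valI: "h \<in> Mor C \<Longrightarrow> Dom C h = Dom C x \<Longrightarrow> Cod C h = Dom C m \<Longrightarrow> m \<odot> h = x \<Longrightarrow> f \<odot> h = v \<Longrightarrow>
    span_val m f x v"
  by (auto simp: span_val_def)

lemma span_valE:
  assumes "span_val m f x v"
  obtains h where "h \<in> Mor C" "Dom C h = Dom C x" "Cod C h = Dom C m" "m \<odot> h = x" "f \<odot> h = v"
  using assms by (auto simp: span_val_def)

text \<open>The Yoneda argument for graphs: each span is evaluated at its own first leg, where its
  value is its second leg, and this pair is then lifted along the other span.\<close>

lemma pm_of_eq_class:
  assumes "(m, f) \<in> pm_of X Y Q" shows "pm_of X Y Q = pm_class C m f"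
proof -
  have m: "mono_arr C m" "Cod C m = X" "m \<in> Mor C" "f \<in> Mor C" "Dom C f = Dom C m" "Cod C f = Y"
    and Q: "\<And>x v. x \<in> Mor C \<Longrightarrow> Cod C x = X \<Longrightarrow> span_val m f x v \<longleftrightarrow> Q x v"
    using assms by (auto simp: pm_of_def Hom_def dest: monoD)
  show ?thesis
  proof (intro subset_antisym subrelI)
    fix n g assume "(n, g) \<in> pm_of X Y Q"
    then have n: "mono_arr C n" "Cod C n = X" "n \<in> Mor C" "g \<in> Mor C" "Dom C g = Dom C n" "Cod C g = Y"
      and Q': "\<And>x v. x \<in> Mor C \<Longrightarrow> Cod C x = X \<Longrightarrow> span_val n g x v \<longleftrightarrow> Q x v"
      by (auto simp: pm_of_def Hom_def dest: monoD)
    have "span_val n g n g" using n by (intro span_valI[of "Ident C (Dom C n)"]) auto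
    then have "span_val m f n g" using Q Q' n by simp
    then obtain h where h: "h \<in> Mor C" "Dom C h = Dom C n" "Cod C h = Dom C m" "m \<odot> h = n" "f \<odot> h = g"
      using span_valE by blast
    have "span_val m f m f" using m by (intro span_valI[of "Ident C (Dom C m)"]) auto
    then have "span_val n g m f" using Q Q' m by simp
    then have "factors_through C m n" using span_valE factorsI by metis
    then have "iso_arr C h" using mutual_factors_iso[OF m(1) n(1) h(1-4)] by blast
    then show "(n, g) \<in> pm_class C m f" using h by (auto simp: pm_class_def)
  next
    fix n g assume "(n, g) \<in> pm_class C m f"
    then obtain i where i: "n = m \<odot> i" "g = f \<odot> i" "iso_arr C i" "Cod C i = Dom C m"
      by (auto simp: pm_class_def)
    then obtain j where j: "i \<in> Mor C" "j \<in> Mor C" "Dom C j = Cod C i" "Cod C j = Dom C i"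
      "j \<odot> i = Ident C (Dom C i)" "i \<odot> j = Ident C (Cod C i)" using isoE by blast
    have mono: "mono_arr C n" using i mono_comp[OF m(1) iso_mono] by simp
    have "span_val n g x v \<longleftrightarrow> span_val m f x v" for x v
    proof
      assume "span_val n g x v"
      then obtain h where h: "h \<in> Mor C" "Dom C h = Dom C x" "Cod C h = Dom C n" "n \<odot> h = x" "g \<odot> h = v"
        using span_valE by blast
      show "span_val m f x v" using h i j m by (intro span_valI[of "i \<odot> h"]) auto
    next
      assume "span_val m f x v"
      then obtain h where h: "h \<in> Mor C" "Dom C h = Dom C x" "Cod C h = Dom C m" "m \<odot> h = x" "f \<odot> h = v"
        using span_valE by blast
      have "i \<odot> j \<odot> h = h" using h j i(4) Comp_assoc'[of h j i] by simp
      then show "span_val n g x v" using h i j m by (intro span_valI[of "j \<odot> h"]) auto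
    qed
    then show "(n, g) \<in> pm_of X Y Q" using Q mono i j m by (simp add: pm_of_def Hom_def)
  qed
qed

lemma PMor_eq:
  assumes "F \<in> PMor C X Y"
  shows PMor_nonempty: "\<exists>m f. (m, f) \<in> F" and PMor_eq_pm_of: "(n, g) \<in> F \<Longrightarrow> F = pm_of X Y (span_val n g)"
proof -
  obtain m f where m: "F = pm_class C m f" "mono_arr C m" "Cod C m = X" "f \<in> Hom C (Dom C m) Y"
    using assms by (auto simp: PMor_def)
  have mf: "(m, f) \<in> pm_of X Y (span_val m f)" using m by (simp add: pm_of_def)
  then have F: "F = pm_of X Y (span_val m f)" using pm_of_eq_class[OF mf] m by simp
  then show "\<exists>m f. (m, f) \<in> F" using mf by blast
  assume "(n, g) \<in> F"
  then have "(n, g) \<in> pm_of X Y (span_val m f)" using F by simp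
  then have "(m, f) \<in> pm_of X Y (span_val n g)"
    using m(2-4) by (simp add: pm_of_def)
  then have "pm_of X Y (span_val n g) = pm_class C m f" by (rule pm_of_eq_class)
  then show "F = pm_of X Y (span_val n g)" using m by simp
qed

lemma PMor_member:
  assumes F: "F \<in> PMor C X Y" "(m, f) \<in> F"
  shows "mono_arr C m" "m \<in> Mor C" "Cod C m = X" "f \<in> Mor C" "Dom C f = Dom C m" "Cod C f = Y"
    "x \<in> Mor C \<Longrightarrow> Cod C x = X \<Longrightarrow> pm_val F x v \<longleftrightarrow> span_val m f x v"
proof -
  have mf: "(m, f) \<in> pm_of X Y (span_val m f)" using PMor_eq_pm_of[OF F] F(2) by simp
  then show "mono_arr C m" "Cod C m = X" "f \<in> Mor C" "Dom C f = Dom C m" "Cod C f = Y"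
    by (simp_all add: pm_of_def Hom_def)
  then show "m \<in> Mor C" by (simp add: monoD)
  assume x: "x \<in> Mor C" "Cod C x = X"
  have "span_val n g x v \<longleftrightarrow> span_val m f x v" if "(n, g) \<in> F" for n g
  proof -
    have "(n, g) \<in> pm_of X Y (span_val m f)" using that PMor_eq_pm_of[OF F] by simp
    then show ?thesis using x by (simp add: pm_of_def)
  qed
  then show "pm_val F x v \<longleftrightarrow> span_val m f x v" using F(2) unfolding pm_val_def by blast
qed

lemma PMor_E:
  assumes "F \<in> PMor C X Y"
  obtains m f where "(m, f) \<in> F" "mono_arr C m" "m \<in> Mor C" "Cod C m = X" "f \<in> Mor C" "Dom C f = Dom C m" "Cod C f = Y"
    "\<And>x v. x \<in> Mor C \<Longrightarrow> Cod C x = X \<Longrightarrow> pm_val F x v \<longleftrightarrow> span_val m f x v"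
proof -
  obtain m f where mf: "(m, f) \<in> F" using PMor_nonempty[OF assms] by blast
  show thesis by (rule that[OF mf PMor_member[OF assms mf]])
qed

lemma pm_val_typed:
  assumes "F \<in> PMor C X Y" "x \<in> Mor C" "Cod C x = X" "pm_val F x v"
  shows "v \<in> Mor C" "Dom C v = Dom C x" "Cod C v = Y"
proof -
  obtain m f where m: "(m, f) \<in> F" "f \<in> Mor C" "Dom C f = Dom C m" "Cod C f = Y" "span_val m f x v"
    using PMor_E[OF assms(1)] assms by metis
  then obtain h where h: "h \<in> Mor C" "Dom C h = Dom C x" "Cod C h = Dom C m" "m \<odot> h = x" "f \<odot> h = v"
    using span_valE by blast
  then show "v \<in> Mor C" "Dom C v = Dom C x" "Cod C v = Y" using m by auto
qed

lemma pm_val_fun: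
  assumes "F \<in> PMor C X Y" "x \<in> Mor C" "Cod C x = X" "pm_val F x v" "pm_val F x w"
  shows "v = w"
proof -
  obtain m f where m: "(m, f) \<in> F" "mono_arr C m" "span_val m f x v" "span_val m f x w"
    using PMor_E[OF assms(1)] assms by metis
  then obtain h k where h: "h \<in> Mor C" "Dom C h = Dom C x" "Cod C h = Dom C m" "m \<odot> h = x" "f \<odot> h = v"
    and k: "k \<in> Mor C" "Dom C k = Dom C x" "Cod C k = Dom C m" "m \<odot> k = x" "f \<odot> k = w"
    using span_valE by metis
  then show ?thesis using mono_cancel[OF m(2), of h k] by simp
qed

lemma pm_val_comp:
  assumes "F \<in> PMor C X Y" "x \<in> Mor C" "Cod C x = X" "pm_val F x v" "s \<in> Mor C" "Cod C s = Dom C x"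
  shows "pm_val F (x \<odot> s) (v \<odot> s)"
proof -
  obtain m f where m: "(m, f) \<in> F" "m \<in> Mor C" "f \<in> Mor C" "Dom C f = Dom C m" "Cod C f = Y" "span_val m f x v"
    using PMor_E[OF assms(1)] assms by metis
  then obtain h where h: "h \<in> Mor C" "Dom C h = Dom C x" "Cod C h = Dom C m" "m \<odot> h = x" "f \<odot> h = v"
    using span_valE by blast
  then have "span_val m f (x \<odot> s) (v \<odot> s)"
    using m assms Comp_assoc'[of s h m] Comp_assoc'[of s h f] by (intro span_valI[of "h \<odot> s"]) auto
  then show ?thesis using m by (auto simp: pm_val_def)
qed

text \<open>The analogue of \<open>set_carrier_Sub\<close> for operations that collect
  spans.\<close>

lemma set_PMor:
  assumes "S \<subseteq> pm_of X Y Q" "S \<noteq> {}"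
    "\<And>m f i. (m, f) \<in> S \<Longrightarrow> iso_arr C i \<Longrightarrow> Cod C i = Dom C m \<Longrightarrow> (m \<odot> i, f \<odot> i) \<in> S"
  shows "S \<in> PMor C X Y" "\<And>x v. x \<in> Mor C \<Longrightarrow> Cod C x = X \<Longrightarrow> pm_val S x v \<longleftrightarrow> Q x v"
proof -
  obtain m f where m: "(m, f) \<in> S" using assms(2) by auto
  then have mp: "(m, f) \<in> pm_of X Y Q" using assms(1) by blast
  have "pm_class C m f \<subseteq> S" using assms(3)[OF m] by (auto simp: pm_class_def)
  then have S: "S = pm_class C m f" using assms(1) pm_of_eq_class[OF mp] by blast
  then show P: "S \<in> PMor C X Y" using mp by (auto simp: PMor_def pm_of_def)
  fix x v assume "x \<in> Mor C" "Cod C x = X"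
  then show "pm_val S x v \<longleftrightarrow> Q x v" using PMor_member(7)[OF P m] mp by (simp add: pm_of_def)
qed

lemma pm_total:
  assumes f: "f \<in> Mor C" "Dom C f = X" "Cod C f = Y"
  shows pm_total_PMor: "pm_total C f \<in> PMor C X Y"
    and pm_val_total: "\<And>x v. x \<in> Mor C \<Longrightarrow> Cod C x = X \<Longrightarrow> pm_val (pm_total C f) x v \<longleftrightarrow> v = f \<odot> x"
proof -
  have X: "X \<in> Obj C" using f by auto
  show P: "pm_total C f \<in> PMor C X Y"
    unfolding PMor_def pm_total_def using f X iso_mono[OF iso_Ident[OF X]]
    by (intro CollectI exI[of _ "Ident C X"] exI[of _ f]) (simp add: Hom_def)
  have "(Ident C X \<odot> Ident C X, f \<odot> Ident C X) \<in> pm_total C f"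
    unfolding pm_total_def pm_class_def f(2) using iso_Ident[OF X] X
    by (intro CollectI exI[of _ "Ident C X"]) simp
  then have "(Ident C X, f) \<in> pm_total C f" using f X by simp
  note V = PMor_member(7)[OF P this]
  fix x v assume x: "x \<in> Mor C" "Cod C x = X"
  have "span_val (Ident C X) f x v \<longleftrightarrow> v = f \<odot> x"
    using x X by (auto elim!: span_valE intro!: span_valI[of x])
  then show "pm_val (pm_total C f) x v \<longleftrightarrow> v = f \<odot> x" using V x by simp
qed

text \<open>An element of the pullback of \<open>f\<close> and \<open>n\<close> is a lift of
  \<open>x\<close> along \<open>m\<close> together with a lift of its value along \<open>n\<close>;
  these are the two witnesses in the composite relation.\<close>

lemma pm_comp:
  assumes F: "F \<in> PMor C X Y" and G: "G \<in> PMor C Y Z"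
  shows pm_comp_PMor: "pm_comp C G F \<in> PMor C X Z"
    and pm_val_comp_iff: "\<And>x v. x \<in> Mor C \<Longrightarrow> Cod C x = X \<Longrightarrow>
      pm_val (pm_comp C G F) x v \<longleftrightarrow> (\<exists>u. pm_val F x u \<and> pm_val G u v)"
proof -
  let ?Q = "\<lambda>x v. \<exists>u. pm_val F x u \<and> pm_val G u v"
  have sub: "pm_comp C G F \<subseteq> pm_of X Z ?Q"
  proof (intro subrelI)
    fix k l assume "(k, l) \<in> pm_comp C G F"
    then obtain m f n g p q where kl: "k = m \<odot> p" "l = g \<odot> q" "(m, f) \<in> F" "(n, g) \<in> G" and pb: "is_pullback C f n p q"
      by (auto simp: pm_comp_def)
    note m = PMor_member[OF F kl(3)] and n = PMor_member[OF G kl(4)] and pbD = pullbackD(1-8)[OF pb]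
    have mono: "mono_arr C k" using mono_comp[OF m(1) pullback_mono[OF pb n(1)]] pbD m kl by simp
    have "span_val k l x v \<longleftrightarrow> ?Q x v" if x: "x \<in> Mor C" "Cod C x = X" for x v
    proof
      assume "span_val k l x v"
      then obtain h where h: "h \<in> Mor C" "Dom C h = Dom C x" "Cod C h = Dom C k" "k \<odot> h = x" "l \<odot> h = v"
        using span_valE by blast
      have e: "f \<odot> (p \<odot> h) = n \<odot> (q \<odot> h)"
        using pullback_eq[OF pb, of h] h pbD m kl by simp
      have "span_val m f x (f \<odot> (p \<odot> h))" using h pbD m kl by (intro span_valI[of "p \<odot> h"]) auto
      moreover have "span_val n g (f \<odot> (p \<odot> h)) v"
        using e h pbD m n kl by (intro span_valI[of "q \<odot> h"]) auto
      ultimately show "?Q x v" using m(7)[OF x] n(7)[of "f \<odot> (p \<odot> h)"] h pbD m kl by auto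
    next
      assume "?Q x v"
      then obtain u where u: "pm_val F x u" "pm_val G u v" by blast
      note ut = pm_val_typed[OF F x u(1)]
      obtain a where a: "a \<in> Mor C" "Dom C a = Dom C x" "Cod C a = Dom C m" "m \<odot> a = x" "f \<odot> a = u"
        using span_valE m(7)[OF x] u by metis
      obtain b where b: "b \<in> Mor C" "Dom C b = Dom C u" "Cod C b = Dom C n" "n \<odot> b = u" "g \<odot> b = v"
        using span_valE n(7)[OF ut(1,3)] u by metis
      obtain h where h: "h \<in> Mor C" "Dom C h = Dom C b" "Cod C h = Dom C p" "p \<odot> h = a" "q \<odot> h = b"
        using pullback_lift[OF pb a(1) b(1)] a b pbD ut m by auto
      show "span_val k l x v" using h a b m n kl pbD ut by (intro span_valI[of h]) auto
    qed
    then show "(k, l) \<in> pm_of X Z ?Q" using mono kl m n pbD by (simp add: pm_of_def Hom_def)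
  qed
  obtain m f where m: "(m, f) \<in> F" "f \<in> Mor C" "Cod C f = Y" using PMor_E[OF F] by metis
  obtain n g where n: "(n, g) \<in> G" "n \<in> Mor C" "Cod C n = Y" using PMor_E[OF G] by metis
  obtain p q where "is_pullback C f n p q" using pullback_exists[of f n] m n by auto
  then have ne: "pm_comp C G F \<noteq> {}" using m n unfolding pm_comp_def by blast
  have iso: "(k \<odot> i, l \<odot> i) \<in> pm_comp C G F"
    if kS: "(k, l) \<in> pm_comp C G F" and i: "iso_arr C i" "Cod C i = Dom C k" for k l i
  proof -
    obtain m f n g p q where kl: "k = m \<odot> p" "l = g \<odot> q" "(m, f) \<in> F" "(n, g) \<in> G" and pb: "is_pullback C f n p q"
      using kS by (auto simp: pm_comp_def)
    note m = PMor_member[OF F kl(3)] and n = PMor_member[OF G kl(4)] and pbD = pullbackD(1-8)[OF pb]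
    have im: "i \<in> Mor C" "Cod C i = Dom C p" using i pbD m kl by (auto simp: iso_arr_def)
    have "is_pullback C f n (p \<odot> i) (q \<odot> i)" using pullback_iso[OF pb i(1) im(2)] .
    moreover have "k \<odot> i = m \<odot> (p \<odot> i)" "l \<odot> i = g \<odot> (q \<odot> i)" using kl im pbD m n by auto
    ultimately show ?thesis using kl unfolding pm_comp_def by blast
  qed
  show "pm_comp C G F \<in> PMor C X Z" by (rule set_PMor(1)[OF sub ne iso])
  show "\<And>x v. x \<in> Mor C \<Longrightarrow> Cod C x = X \<Longrightarrow> pm_val (pm_comp C G F) x v \<longleftrightarrow> ?Q x v"
    by (rule set_PMor(2)[OF sub ne iso])
qed

text \<open>Here the pullback is that of the two domains, so one lift of \<open>x\<close> into it
  stands for a lift along each of them.\<close>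

lemma pm_pair:
  assumes F: "F \<in> PMor C X Y" and G: "G \<in> PMor C X Z"
  shows pm_pair_PMor: "pm_pair C F G \<in> PMor C X (prod_obj C Y Z)"
    and pm_val_pair_iff: "\<And>x v. x \<in> Mor C \<Longrightarrow> Cod C x = X \<Longrightarrow>
      pm_val (pm_pair C F G) x v \<longleftrightarrow> (\<exists>u w. pm_val F x u \<and> pm_val G x w \<and> v = pairing C u w)"
proof -
  let ?Q = "\<lambda>x v. \<exists>u w. pm_val F x u \<and> pm_val G x w \<and> v = pairing C u w"
  have sub: "pm_pair C F G \<subseteq> pm_of X (prod_obj C Y Z) ?Q"
  proof (intro subrelI)
    fix k l assume "(k, l) \<in> pm_pair C F G"
    then obtain m f n g p q where kl: "k = m \<odot> p" "l = pairing C (f \<odot> p) (g \<odot> q)" "(m, f) \<in> F" "(n, g) \<in> G"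
      and pb: "is_pullback C m n p q"
      by (auto simp: pm_pair_def)
    note m = PMor_member[OF F kl(3)] and n = PMor_member[OF G kl(4)] and pbD = pullbackD(1-8)[OF pb]
    have mono: "mono_arr C k" using mono_comp[OF m(1) pullback_mono[OF pb n(1)]] pbD m kl by simp
    have "span_val k l x v \<longleftrightarrow> ?Q x v" if x: "x \<in> Mor C" "Cod C x = X" for x v
    proof
      assume "span_val k l x v"
      then obtain h where h: "h \<in> Mor C" "Dom C h = Dom C x" "Cod C h = Dom C k" "k \<odot> h = x" "l \<odot> h = v"
        using span_valE by blast
      have e: "m \<odot> (p \<odot> h) = n \<odot> (q \<odot> h)"
        using pullback_eq[OF pb, of h] h pbD m kl by simp
      have "span_val m f x (f \<odot> (p \<odot> h))" using h pbD m kl by (intro span_valI[of "p \<odot> h"]) auto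
      moreover have "span_val n g x (g \<odot> (q \<odot> h))"
        using e h pbD m n kl by (intro span_valI[of "q \<odot> h"]) auto
      moreover have "v = pairing C (f \<odot> (p \<odot> h)) (g \<odot> (q \<odot> h))" using h pbD m n kl by auto
      ultimately show "?Q x v" using m(7)[OF x] n(7)[OF x] by blast
    next
      assume "?Q x v"
      then obtain u w where u: "pm_val F x u" "pm_val G x w" "v = pairing C u w" by blast
      obtain a where a: "a \<in> Mor C" "Dom C a = Dom C x" "Cod C a = Dom C m" "m \<odot> a = x" "f \<odot> a = u"
        using span_valE m(7)[OF x] u by metis
      obtain b where b: "b \<in> Mor C" "Dom C b = Dom C x" "Cod C b = Dom C n" "n \<odot> b = x" "g \<odot> b = w"
        using span_valE n(7)[OF x] u by metis
      obtain h where h: "h \<in> Mor C" "Dom C h = Dom C b" "Cod C h = Dom C p" "p \<odot> h = a" "q \<odot> h = b"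
        using pullback_lift[OF pb a(1) b(1)] a b pbD m by auto
      show "span_val k l x v" using h a b m n kl pbD u by (intro span_valI[of h]) auto
    qed
    then show "(k, l) \<in> pm_of X (prod_obj C Y Z) ?Q" using mono kl m n pbD by (simp add: pm_of_def Hom_def)
  qed
  obtain m f where m: "(m, f) \<in> F" "m \<in> Mor C" "Cod C m = X" using PMor_E[OF F] by metis
  obtain n g where n: "(n, g) \<in> G" "n \<in> Mor C" "Cod C n = X" using PMor_E[OF G] by metis
  obtain p q where "is_pullback C m n p q" using pullback_exists[of m n] m n by auto
  then have ne: "pm_pair C F G \<noteq> {}" using m n unfolding pm_pair_def by blast
  have iso: "(k \<odot> i, l \<odot> i) \<in> pm_pair C F G"
    if kS: "(k, l) \<in> pm_pair C F G" and i: "iso_arr C i" "Cod C i = Dom C k" for k l i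
  proof -
    obtain m f n g p q where kl: "k = m \<odot> p" "l = pairing C (f \<odot> p) (g \<odot> q)" "(m, f) \<in> F" "(n, g) \<in> G"
      and pb: "is_pullback C m n p q"
      using kS by (auto simp: pm_pair_def)
    note m = PMor_member[OF F kl(3)] and n = PMor_member[OF G kl(4)] and pbD = pullbackD(1-8)[OF pb]
    have im: "i \<in> Mor C" "Cod C i = Dom C p" using i pbD m kl by (auto simp: iso_arr_def)
    have "is_pullback C m n (p \<odot> i) (q \<odot> i)" using pullback_iso[OF pb i(1) im(2)] .
    moreover have "k \<odot> i = m \<odot> (p \<odot> i)" "l \<odot> i = pairing C (f \<odot> (p \<odot> i)) (g \<odot> (q \<odot> i))"
      using kl im pbD m n by auto
    ultimately show ?thesis using kl unfolding pm_pair_def by blast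
  qed
  show "pm_pair C F G \<in> PMor C X (prod_obj C Y Z)" by (rule set_PMor(1)[OF sub ne iso])
  show "\<And>x v. x \<in> Mor C \<Longrightarrow> Cod C x = X \<Longrightarrow> pm_val (pm_pair C F G) x v \<longleftrightarrow> ?Q x v"
    by (rule set_PMor(2)[OF sub ne iso])
qed

lemma pm_inv_im:
  assumes F: "F \<in> PMor C X Y" and U: "U \<in> carrier (Sub C Y)"
  shows pm_inv_im_carrier: "pm_inv_im C F U \<in> carrier (Sub C X)"
    and mem_pm_inv_im: "\<And>x. x \<in> Mor C \<Longrightarrow> Cod C x = X \<Longrightarrow>
      sub_mem C (pm_inv_im C F U) x \<longleftrightarrow> (\<exists>v. pm_val F x v \<and> sub_mem C U v)"
proof -
  let ?Q = "\<lambda>x. \<exists>v. pm_val F x v \<and> sub_mem C U v"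
  have sub: "pm_inv_im C F U \<subseteq> sub_of C X ?Q"
  proof
    fix k assume "k \<in> pm_inv_im C F U"
    then obtain m f n p q where k: "k = m \<odot> p" "(m, f) \<in> F" "n \<in> U" and pb: "is_pullback C f n p q"
      by (auto simp: pm_inv_im_def)
    note m = PMor_member[OF F k(2)] and n = Sub_member[OF U k(3)] and pbD = pullbackD(1-8)[OF pb]
    have mono: "mono_arr C k" using mono_comp[OF m(1) pullback_mono[OF pb n(1)]] pbD m k by simp
    have "factors_through C x k \<longleftrightarrow> ?Q x" if x: "x \<in> Mor C" "Cod C x = X" for x
    proof
      assume "factors_through C x k"
      then obtain h where h: "h \<in> Mor C" "Dom C h = Dom C x" "Cod C h = Dom C k" "k \<odot> h = x"
        using factorsE by blast
      have "span_val m f x (f \<odot> (p \<odot> h))" using h pbD m k by (intro span_valI[of "p \<odot> h"]) auto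
      moreover have "factors_through C (p \<odot> h) p" using h pbD m k by (intro factorsI[of h]) auto
      then have "factors_through C (f \<odot> (p \<odot> h)) n"
        using pullback_factors[OF pb n(1), of "p \<odot> h"] h pbD m k by simp
      ultimately show "?Q x" using m(7)[OF x] n(4) by blast
    next
      assume "?Q x"
      then obtain v where v: "pm_val F x v" "sub_mem C U v" by blast
      obtain a where a: "a \<in> Mor C" "Dom C a = Dom C x" "Cod C a = Dom C m" "m \<odot> a = x" "f \<odot> a = v"
        using span_valE m(7)[OF x] v by metis
      have "factors_through C a p" using pullback_factors[OF pb n(1), of a] a v n(4) m by simp
      then obtain h where h: "h \<in> Mor C" "Dom C h = Dom C a" "Cod C h = Dom C p" "p \<odot> h = a"
        using factorsE by blast
      then show "factors_through C x k" using a pbD m k by (intro factorsI[of h]) auto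
    qed
    then show "k \<in> sub_of C X ?Q" using mono k m pbD by (simp add: sub_of_def)
  qed
  obtain m f where m: "(m, f) \<in> F" "f \<in> Mor C" "Cod C f = Y" using PMor_E[OF F] by metis
  obtain n where n: "n \<in> U" "n \<in> Mor C" "Cod C n = Y" using Sub_carrierE[OF U] by metis
  obtain p q where "is_pullback C f n p q" using pullback_exists[of f n] m n by auto
  then have ne: "pm_inv_im C F U \<noteq> {}" using m n unfolding pm_inv_im_def by blast
  have iso: "k \<odot> i \<in> pm_inv_im C F U"
    if kS: "k \<in> pm_inv_im C F U" and i: "iso_arr C i" "Cod C i = Dom C k" for k i
  proof -
    obtain m f n p q where k: "k = m \<odot> p" "(m, f) \<in> F" "n \<in> U" and pb: "is_pullback C f n p q"
      using kS by (auto simp: pm_inv_im_def)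
    note m = PMor_member[OF F k(2)] and pbD = pullbackD(1-8)[OF pb]
    have im: "i \<in> Mor C" "Cod C i = Dom C p" using i pbD m k by (auto simp: iso_arr_def)
    have "is_pullback C f n (p \<odot> i) (q \<odot> i)" using pullback_iso[OF pb i(1) im(2)] .
    moreover have "k \<odot> i = m \<odot> (p \<odot> i)" using k im pbD m by auto
    ultimately show ?thesis using k unfolding pm_inv_im_def by blast
  qed
  show "pm_inv_im C F U \<in> carrier (Sub C X)" by (rule set_carrier_Sub(1)[OF sub ne iso])
  show "\<And>x. x \<in> Mor C \<Longrightarrow> Cod C x = X \<Longrightarrow> sub_mem C (pm_inv_im C F U) x \<longleftrightarrow> ?Q x"
    by (rule set_carrier_Sub(2)[OF sub ne iso])
qed

lemma pm_dom:
  assumes F: "F \<in> PMor C X Y"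
  shows pm_dom_carrier: "pm_dom F \<in> carrier (Sub C X)"
    and mem_pm_dom: "\<And>x. x \<in> Mor C \<Longrightarrow> Cod C x = X \<Longrightarrow>
      sub_mem C (pm_dom F) x \<longleftrightarrow> (\<exists>v. pm_val F x v)"
proof -
  let ?Q = "\<lambda>x. \<exists>v. pm_val F x v"
  have sub: "pm_dom F \<subseteq> sub_of C X ?Q"
  proof
    fix m assume "m \<in> pm_dom F"
    then obtain f where f: "(m, f) \<in> F" by (auto simp: pm_dom_def)
    note m = PMor_member[OF F f]
    have "factors_through C x m \<longleftrightarrow> ?Q x" if x: "x \<in> Mor C" "Cod C x = X" for x
      unfolding m(7)[OF x] factors_through_def span_val_def Hom_def by auto
    then show "m \<in> sub_of C X ?Q" using m(1,3) by (simp add: sub_of_def)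
  qed
  have ne: "pm_dom F \<noteq> {}" using PMor_E[OF F] unfolding pm_dom_def by blast
  have iso: "m \<odot> i \<in> pm_dom F"
    if kS: "m \<in> pm_dom F" and i: "iso_arr C i" "Cod C i = Dom C m" for m i
  proof -
    obtain f where f: "(m, f) \<in> F" using kS by (auto simp: pm_dom_def)
    have "F = pm_class C m f" using PMor_eq_pm_of[OF F f] pm_of_eq_class f by metis
    then have "(m \<odot> i, f \<odot> i) \<in> F" using i by (auto simp: pm_class_def)
    then show ?thesis unfolding pm_dom_def by force
  qed
  show "pm_dom F \<in> carrier (Sub C X)" by (rule set_carrier_Sub(1)[OF sub ne iso])
  show "\<And>x. x \<in> Mor C \<Longrightarrow> Cod C x = X \<Longrightarrow> sub_mem C (pm_dom F) x \<longleftrightarrow> ?Q x"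
    by (rule set_carrier_Sub(2)[OF sub ne iso])
qed

lemma equalizerD:
  assumes "is_equalizer C f g e"
  shows "e \<in> Mor C" "Cod C e = Dom C f" "f \<odot> e = g \<odot> e"
    "\<And>a. a \<in> Mor C \<Longrightarrow> Cod C a = Dom C f \<Longrightarrow> f \<odot> a = g \<odot> a \<Longrightarrow>
      \<exists>!h. h \<in> Hom C (Dom C a) (Dom C e) \<and> e \<odot> h = a"
  using assms unfolding is_equalizer_def by auto

lemma equalizer_eq:
  assumes "is_equalizer C f g e" "f \<in> Mor C" "g \<in> Mor C" "Dom C g = Dom C f" "h \<in> Mor C" "Cod C h = Dom C e"
  shows "f \<odot> (e \<odot> h) = g \<odot> (e \<odot> h)"
  using equalizerD(1-3)[OF assms(1)] assms(2-) Comp_assoc'[of h e f] Comp_assoc'[of h e g] by simp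

lemma equalizer_mono:
  assumes e: "is_equalizer C f g e" and fg: "f \<in> Mor C" "g \<in> Mor C" "Dom C g = Dom C f"
  shows "mono_arr C e"
proof (rule monoI)
  note eD = equalizerD(1,2)[OF e]
  show "e \<in> Mor C" by fact
  fix a b assume ab: "a \<in> Mor C" "b \<in> Mor C" "Cod C a = Dom C e" "Cod C b = Dom C e" "Dom C a = Dom C b" "e \<odot> a = e \<odot> b"
  have "\<exists>!h. h \<in> Hom C (Dom C (e \<odot> a)) (Dom C e) \<and> e \<odot> h = e \<odot> a"
    by (rule equalizerD(4)[OF e _ _ equalizer_eq[OF e fg ab(1,3)]]) (use ab eD in simp_all)
  moreover have "a \<in> Hom C (Dom C (e \<odot> a)) (Dom C e)" "b \<in> Hom C (Dom C (e \<odot> a)) (Dom C e)"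
    using ab eD by (simp_all add: Hom_def)
  ultimately show "a = b" using ab(6) by metis
qed

lemma equalizer_iso:
  assumes e: "is_equalizer C f g e" and fg: "f \<in> Mor C" "g \<in> Mor C" "Dom C g = Dom C f"
    and i: "iso_arr C i" "Cod C i = Dom C e"
  shows "is_equalizer C f g (e \<odot> i)"
proof -
  note eD = equalizerD(1,2)[OF e] and mono = mono_comp[OF equalizer_mono[OF e fg] iso_mono[OF i(1)] i(2)]
  obtain j where j: "i \<in> Mor C" "j \<in> Mor C" "Dom C j = Cod C i" "Cod C j = Dom C i"
    "j \<odot> i = Ident C (Dom C i)" "i \<odot> j = Ident C (Cod C i)" using isoE i by blast
  have "\<exists>!h. h \<in> Hom C (Dom C a) (Dom C (e \<odot> i)) \<and> (e \<odot> i) \<odot> h = a"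
    if a: "a \<in> Mor C" "Cod C a = Dom C f" "f \<odot> a = g \<odot> a" for a
  proof (rule ex_ex1I)
    obtain h where h: "h \<in> Mor C" "Dom C h = Dom C a" "Cod C h = Dom C e" "e \<odot> h = a"
      using ex1_implies_ex[OF equalizerD(4)[OF e a]] by (auto simp: Hom_def)
    have "i \<odot> j \<odot> h = h" using h j i(2) Comp_assoc'[of h j i] by simp
    then show "\<exists>h. h \<in> Hom C (Dom C a) (Dom C (e \<odot> i)) \<and> (e \<odot> i) \<odot> h = a"
      using h i(2) j eD by (intro exI[of _ "j \<odot> h"]) (simp add: Hom_def)
    fix h h' assume "h \<in> Hom C (Dom C a) (Dom C (e \<odot> i)) \<and> (e \<odot> i) \<odot> h = a"
      "h' \<in> Hom C (Dom C a) (Dom C (e \<odot> i)) \<and> (e \<odot> i) \<odot> h' = a"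
    then show "h = h'" using mono_cancel[OF mono, of h h'] by (simp add: Hom_def)
  qed
  moreover have "g \<in> Hom C (Dom C f) (Cod C f)" using e by (simp add: is_equalizer_def)
  ultimately show ?thesis
    using fg eD j i(2) equalizer_eq[OF e fg j(1) i(2)] by (simp add: is_equalizer_def)
qed

text \<open>An element of the equalizer is a point of the common domain at which both values agree;
  this is the strict reading of equality.\<close>

lemma pm_eq:
  assumes F: "F \<in> PMor C X Y" and G: "G \<in> PMor C X Y"
  shows pm_eq_carrier: "pm_eq C F G \<in> carrier (Sub C X)"
    and mem_pm_eq: "\<And>x. x \<in> Mor C \<Longrightarrow> Cod C x = X \<Longrightarrow>
      sub_mem C (pm_eq C F G) x \<longleftrightarrow> (\<exists>v. pm_val F x v \<and> pm_val G x v)"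
proof -
  let ?Q = "\<lambda>x. \<exists>v. pm_val F x v \<and> pm_val G x v"
  have sub: "pm_eq C F G \<subseteq> sub_of C X ?Q"
  proof
    fix k assume "k \<in> pm_eq C F G"
    then obtain m f n g p q e where k: "k = (m \<odot> p) \<odot> e" "(m, f) \<in> F" "(n, g) \<in> G"
      and pb: "is_pullback C m n p q" and e: "is_equalizer C (f \<odot> p) (g \<odot> q) e"
      by (auto simp: pm_eq_def)
    note m = PMor_member[OF F k(2)] and n = PMor_member[OF G k(3)] and pbD = pullbackD(1-8)[OF pb]
      and eD = equalizerD(1,2)[OF e]
    have fg: "f \<odot> p \<in> Mor C" "g \<odot> q \<in> Mor C" "Dom C (g \<odot> q) = Dom C (f \<odot> p)" using m n pbD by simp_all
    have e2: "Cod C e = Dom C p" using eD m pbD by simp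
    have mono: "mono_arr C k"
      unfolding k(1) using mono_comp[OF mono_comp[OF m(1) pullback_mono[OF pb n(1)]] equalizer_mono[OF e fg]] pbD m eD by simp
    have "factors_through C x k \<longleftrightarrow> ?Q x" if x: "x \<in> Mor C" "Cod C x = X" for x
    proof
      assume "factors_through C x k"
      then obtain h where h: "h \<in> Mor C" "Dom C h = Dom C x" "Cod C h = Dom C k" "k \<odot> h = x"
        using factorsE by blast
      have hk: "Cod C h = Dom C e" "m \<odot> (p \<odot> (e \<odot> h)) = x" using h k(1) m pbD eD by auto
      have "span_val m f x (f \<odot> (p \<odot> (e \<odot> h)))"
        using h hk pbD m eD by (intro span_valI[of "p \<odot> (e \<odot> h)"]) auto
      moreover have "f \<odot> (p \<odot> (e \<odot> h)) = g \<odot> (q \<odot> (e \<odot> h))"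
        using equalizer_eq[OF e fg h(1) hk(1)] h(1) hk(1) m n pbD eD by simp
      moreover have "span_val n g x (g \<odot> (q \<odot> (e \<odot> h)))"
        using pullback_eq[OF pb, of "e \<odot> h"] h hk pbD n m eD by (intro span_valI[of "q \<odot> (e \<odot> h)"]) auto
      ultimately show "?Q x" using m(7)[OF x] n(7)[OF x] by auto
    next
      assume "?Q x"
      then obtain v where v: "pm_val F x v" "pm_val G x v" by blast
      obtain a where a: "a \<in> Mor C" "Dom C a = Dom C x" "Cod C a = Dom C m" "m \<odot> a = x" "f \<odot> a = v"
        using span_valE m(7)[OF x] v by metis
      obtain b where b: "b \<in> Mor C" "Dom C b = Dom C x" "Cod C b = Dom C n" "n \<odot> b = x" "g \<odot> b = v"
        using span_valE n(7)[OF x] v by metis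
      obtain h where h: "h \<in> Mor C" "Dom C h = Dom C b" "Cod C h = Dom C p" "p \<odot> h = a" "q \<odot> h = b"
        using pullback_lift[OF pb a(1) b(1)] a b by auto
      have "(f \<odot> p) \<odot> h = (g \<odot> q) \<odot> h" using h a b m n pbD by simp
      then obtain l where l: "l \<in> Mor C" "Dom C l = Dom C h" "Cod C l = Dom C e" "e \<odot> l = h"
        using ex1_implies_ex[OF equalizerD(4)[OF e h(1)]] h m pbD by (auto simp: Hom_def)
      show "factors_through C x k" unfolding k(1)
        using l h a b m pbD eD by (intro factorsI[of l]) auto
    qed
    then show "k \<in> sub_of C X ?Q" using mono k(1) m(2,3) pbD eD e2 by (simp add: sub_of_def)
  qed
  obtain m f where m: "(m, f) \<in> F" "m \<in> Mor C" "Cod C m = X" "f \<in> Mor C" "Dom C f = Dom C m" "Cod C f = Y"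
    using PMor_E[OF F] by metis
  obtain n g where n: "(n, g) \<in> G" "n \<in> Mor C" "Cod C n = X" "g \<in> Mor C" "Dom C g = Dom C n" "Cod C g = Y"
    using PMor_E[OF G] by metis
  obtain p q where pq: "is_pullback C m n p q" using pullback_exists[of m n] m n by auto
  obtain e where "is_equalizer C (f \<odot> p) (g \<odot> q) e"
    using equalizer_exists[of "f \<odot> p" "g \<odot> q"] m n pullbackD(1-8)[OF pq] by auto
  then have ne: "pm_eq C F G \<noteq> {}" using m(1) n(1) pq unfolding pm_eq_def by blast
  have iso: "k \<odot> i \<in> pm_eq C F G"
    if kS: "k \<in> pm_eq C F G" and i: "iso_arr C i" "Cod C i = Dom C k" for k i
  proof -
    obtain m f n g p q e where k: "k = (m \<odot> p) \<odot> e" "(m, f) \<in> F" "(n, g) \<in> G"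
      and pb: "is_pullback C m n p q" and e: "is_equalizer C (f \<odot> p) (g \<odot> q) e"
      using kS by (auto simp: pm_eq_def)
    note m = PMor_member[OF F k(2)] and n = PMor_member[OF G k(3)] and pbD = pullbackD(1-8)[OF pb]
      and eD = equalizerD(1,2)[OF e]
    have fg: "f \<odot> p \<in> Mor C" "g \<odot> q \<in> Mor C" "Dom C (g \<odot> q) = Dom C (f \<odot> p)" using m n pbD by simp_all
    have e2: "Cod C e = Dom C p" using eD m pbD by simp
    have im: "i \<in> Mor C" "Cod C i = Dom C e" using i e2 pbD m k eD by (auto simp: iso_arr_def)
    have "is_equalizer C (f \<odot> p) (g \<odot> q) (e \<odot> i)" using equalizer_iso[OF e fg i(1) im(2)] .
    moreover have "k \<odot> i = (m \<odot> p) \<odot> (e \<odot> i)" using k(1) im e2 eD pbD m by simp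
    ultimately show ?thesis using k(2,3) pb unfolding pm_eq_def by blast
  qed
  show "pm_eq C F G \<in> carrier (Sub C X)" by (rule set_carrier_Sub(1)[OF sub ne iso])
  show "\<And>x. x \<in> Mor C \<Longrightarrow> Cod C x = X \<Longrightarrow> sub_mem C (pm_eq C F G) x \<longleftrightarrow> ?Q x"
    by (rule set_carrier_Sub(2)[OF sub ne iso])
qed

lemma productD:
  assumes "is_product C X Y P p q"
  shows "p \<in> Mor C" "q \<in> Mor C" "Dom C p = P" "Dom C q = P" "Cod C p = X" "Cod C q = Y" "P \<in> Obj C"
  using assms by (auto simp: is_product_def Hom_def)

lemma product_ex1:
  assumes "is_product C X Y P p q" "f \<in> Hom C Z X" "g \<in> Hom C Z Y"
  shows "\<exists>!h. h \<in> Hom C Z P \<and> p \<odot> h = f \<and> q \<odot> h = g"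
proof -
  have "Z \<in> Obj C" using assms(2) by (auto simp: Hom_def)
  then show ?thesis using assms unfolding is_product_def by simp
qed

lemma product_unique:
  assumes P: "is_product C X Y P p q" and "h \<in> Mor C" "h' \<in> Mor C" "Dom C h = Dom C h'" "Cod C h = P" "Cod C h' = P"
    "p \<odot> h = p \<odot> h'" "q \<odot> h = q \<odot> h'"
  shows "h = h'"
proof -
  note PD = productD[OF P]
  have "\<exists>!k. k \<in> Hom C (Dom C h) P \<and> p \<odot> k = p \<odot> h \<and> q \<odot> k = q \<odot> h"
    by (rule product_ex1[OF P]) (use assms PD in \<open>simp_all add: Hom_def\<close>)
  moreover have "h \<in> Hom C (Dom C h) P" "h' \<in> Hom C (Dom C h) P" using assms by (auto simp: Hom_def)
  ultimately show ?thesis using assms(7,8) by metis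
qed

lemma product_iso:
  assumes P: "is_product C X Y P p q" and i: "iso_arr C i" "Cod C i = P"
  shows "is_product C X Y (Dom C i) (p \<odot> i) (q \<odot> i)"
proof -
  note PD = productD[OF P]
  obtain j where j: "i \<in> Mor C" "j \<in> Mor C" "Dom C j = Cod C i" "Cod C j = Dom C i"
    "j \<odot> i = Ident C (Dom C i)" "i \<odot> j = Ident C (Cod C i)" using isoE i by blast
  have "\<exists>!h. h \<in> Hom C Z (Dom C i) \<and> (p \<odot> i) \<odot> h = f \<and> (q \<odot> i) \<odot> h = g"
    if fg: "f \<in> Hom C Z X" "g \<in> Hom C Z Y" for Z f g
  proof (rule ex_ex1I)
    obtain h where h: "h \<in> Mor C" "Dom C h = Z" "Cod C h = P" "p \<odot> h = f" "q \<odot> h = g"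
      using ex1_implies_ex[OF product_ex1[OF P fg]] by (auto simp: Hom_def)
    have "i \<odot> j \<odot> h = h" using h j i(2) Comp_assoc'[of h j i] by simp
    then show "\<exists>h. h \<in> Hom C Z (Dom C i) \<and> (p \<odot> i) \<odot> h = f \<and> (q \<odot> i) \<odot> h = g"
      using h i(2) j PD by (intro exI[of _ "j \<odot> h"]) (simp add: Hom_def)
    fix h h' assume h: "h \<in> Hom C Z (Dom C i) \<and> (p \<odot> i) \<odot> h = f \<and> (q \<odot> i) \<odot> h = g"
      and h': "h' \<in> Hom C Z (Dom C i) \<and> (p \<odot> i) \<odot> h' = f \<and> (q \<odot> i) \<odot> h' = g"
    have t: "h \<in> Mor C" "Dom C h = Z" "Cod C h = Dom C i" "h' \<in> Mor C" "Dom C h' = Z" "Cod C h' = Dom C i"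
      using h h' by (auto simp: Hom_def)
    have "p \<odot> (i \<odot> h) = f" "p \<odot> (i \<odot> h') = f" "q \<odot> (i \<odot> h) = g" "q \<odot> (i \<odot> h') = g"
      using h h' t j i(2) PD by (auto simp: Hom_def)
    then have "p \<odot> (i \<odot> h) = p \<odot> (i \<odot> h')" "q \<odot> (i \<odot> h) = q \<odot> (i \<odot> h')" by simp_all
    from product_unique[OF P _ _ _ _ _ this] have "i \<odot> h = i \<odot> h'" using t j(1) i(2) by simp
    then show "h = h'" using mono_cancel[OF iso_mono[OF i(1)], of h h'] t by simp
  qed
  then show ?thesis using PD j i(2) by (simp add: is_product_def) (simp add: Hom_def)
qed

lemma sub_prod:
  assumes U: "U \<in> carrier (Sub C X)" and V: "V \<in> carrier (Sub C Y)"
  shows sub_prod_carrier: "sub_prod C U V \<in> carrier (Sub C (prod_obj C X Y))"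
    and mem_sub_prod: "\<And>x. x \<in> Mor C \<Longrightarrow> Cod C x = prod_obj C X Y \<Longrightarrow>
      sub_mem C (sub_prod C U V) x \<longleftrightarrow> sub_mem C U (pr1 C X Y \<odot> x) \<and> sub_mem C V (pr2 C X Y \<odot> x)"
proof -
  have XY: "X \<in> Obj C" "Y \<in> Obj C" using Sub_Obj U V by auto
  let ?Q = "\<lambda>x. sub_mem C U (pr1 C X Y \<odot> x) \<and> sub_mem C V (pr2 C X Y \<odot> x)"
  have sub: "sub_prod C U V \<subseteq> sub_of C (prod_obj C X Y) ?Q"
  proof
    fix k assume "k \<in> sub_prod C U V"
    then obtain m n P p q where k: "k = pairing C (m \<odot> p) (n \<odot> q)" "m \<in> U" "n \<in> V"
      and P: "is_product C (Dom C m) (Dom C n) P p q"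
      by (auto simp: sub_prod_def)
    note m = Sub_member[OF U k(2)] and n = Sub_member[OF V k(3)] and PD = productD[OF P]
    have kt: "k \<in> Mor C" "Dom C k = P" "Cod C k = prod_obj C X Y" using k(1) m n PD by simp_all
    have prk: "pr1 C X Y \<odot> (k \<odot> h) = m \<odot> (p \<odot> h)" "pr2 C X Y \<odot> (k \<odot> h) = n \<odot> (q \<odot> h)"
      if "h \<in> Mor C" "Cod C h = P" for h
      using k(1) m n PD that by simp_all
    have mono: "mono_arr C k"
    proof (rule monoI[OF kt(1)])
      fix a b assume ab: "a \<in> Mor C" "b \<in> Mor C" "Cod C a = Dom C k" "Cod C b = Dom C k" "Dom C a = Dom C b" "k \<odot> a = k \<odot> b"
      have "m \<odot> (p \<odot> a) = m \<odot> (p \<odot> b)" "n \<odot> (q \<odot> a) = n \<odot> (q \<odot> b)"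
        using prk[of a] prk[of b] ab kt by simp_all
      then have "p \<odot> a = p \<odot> b" "q \<odot> a = q \<odot> b"
        using mono_cancel[OF m(1), of "p \<odot> a" "p \<odot> b"] mono_cancel[OF n(1), of "q \<odot> a" "q \<odot> b"] ab PD kt by simp_all
      then show "a = b" using product_unique[OF P, of a b] ab kt by simp
    qed
    have "factors_through C x k \<longleftrightarrow> ?Q x" if x: "x \<in> Mor C" "Cod C x = prod_obj C X Y" for x
    proof
      assume "factors_through C x k"
      then obtain h where h: "h \<in> Mor C" "Dom C h = Dom C x" "Cod C h = Dom C k" "k \<odot> h = x"
        using factorsE by blast
      have hP: "Cod C h = P" using h(3) kt(2) by simp
      have e: "m \<odot> (p \<odot> h) = pr1 C X Y \<odot> x" "n \<odot> (q \<odot> h) = pr2 C X Y \<odot> x"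
        using prk[OF h(1) hP] h(4) by simp_all
      have "factors_through C (pr1 C X Y \<odot> x) m" "factors_through C (pr2 C X Y \<odot> x) n"
        by (rule factorsI[OF _ _ _ e(1)] factorsI[OF _ _ _ e(2)]; use h(1,2) hP x XY PD in simp)+
      then show "?Q x" using m(4) n(4) by blast
    next
      assume "?Q x"
      then have "factors_through C (pr1 C X Y \<odot> x) m" "factors_through C (pr2 C X Y \<odot> x) n" using m(4) n(4) by auto
      moreover have "Dom C (pr1 C X Y \<odot> x) = Dom C x" "Dom C (pr2 C X Y \<odot> x) = Dom C x" using x XY by simp_all
      ultimately obtain a b where a: "a \<in> Mor C" "Dom C a = Dom C x" "Cod C a = Dom C m" "m \<odot> a = pr1 C X Y \<odot> x"
        and b: "b \<in> Mor C" "Dom C b = Dom C x" "Cod C b = Dom C n" "n \<odot> b = pr2 C X Y \<odot> x"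
        by (metis factorsE)
      obtain h where h: "h \<in> Mor C" "Dom C h = Dom C x" "Cod C h = P" "p \<odot> h = a" "q \<odot> h = b"
        using ex1_implies_ex[OF product_ex1[OF P, of a "Dom C x" b]] a b by (auto simp: Hom_def)
      have "k \<odot> h = x"
        by (rule pairing_eqI[of X Y]) (use XY h kt x prk[of h] a b in simp_all)
      then show "factors_through C x k" using h kt by (intro factorsI[of h]) auto
    qed
    then show "k \<in> sub_of C (prod_obj C X Y) ?Q" using mono kt by (simp add: sub_of_def)
  qed
  obtain m where m: "m \<in> U" "m \<in> Mor C" using Sub_carrierE[OF U] by metis
  obtain n where n: "n \<in> V" "n \<in> Mor C" using Sub_carrierE[OF V] by metis
  obtain P p q where "is_product C (Dom C m) (Dom C n) P p q" using product_exists[of "Dom C m" "Dom C n"] m n by auto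
  then have ne: "sub_prod C U V \<noteq> {}" using m(1) n(1) unfolding sub_prod_def by blast
  have iso: "k \<odot> i \<in> sub_prod C U V"
    if kS: "k \<in> sub_prod C U V" and i: "iso_arr C i" "Cod C i = Dom C k" for k i
  proof -
    obtain m n P p q where k: "k = pairing C (m \<odot> p) (n \<odot> q)" "m \<in> U" "n \<in> V"
      and P: "is_product C (Dom C m) (Dom C n) P p q"
      using kS unfolding sub_prod_def by blast
    note m = Sub_member[OF U k(2)] and n = Sub_member[OF V k(3)] and PD = productD[OF P]
    have im: "i \<in> Mor C" "Cod C i = P" using i k(1) PD m n by (auto simp: iso_arr_def)
    have "k \<odot> i = pairing C (m \<odot> (p \<odot> i)) (n \<odot> (q \<odot> i))"
      unfolding k(1) using im PD m(2,3) n(2,3) by simp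
    then show ?thesis using k(2,3) product_iso[OF P i(1) im(2)] unfolding sub_prod_def by blast
  qed
  show "sub_prod C U V \<in> carrier (Sub C (prod_obj C X Y))" by (rule set_carrier_Sub(1)[OF sub ne iso])
  show "\<And>x. x \<in> Mor C \<Longrightarrow> Cod C x = prod_obj C X Y \<Longrightarrow> sub_mem C (sub_prod C U V) x \<longleftrightarrow> ?Q x"
    by (rule set_carrier_Sub(2)[OF sub ne iso])
qed

end

section \<open>Kripke-Joyal semantics\<close>

context lattice
begin

lemma le_meet_iff:
  "x \<in> carrier L \<Longrightarrow> y \<in> carrier L \<Longrightarrow> w \<in> carrier L \<Longrightarrow> w \<sqsubseteq> x \<sqinter> y \<longleftrightarrow> w \<sqsubseteq> x \<and> w \<sqsubseteq> y"
  by (meson le_trans meet_closed meet_le meet_left meet_right)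

lemma join_le_iff:
  "x \<in> carrier L \<Longrightarrow> y \<in> carrier L \<Longrightarrow> w \<in> carrier L \<Longrightarrow> x \<squnion> y \<sqsubseteq> w \<longleftrightarrow> x \<sqsubseteq> w \<and> y \<sqsubseteq> w"
  by (meson le_trans join_closed join_le join_left join_right)

end

context heyting_algebra
begin

lemma himp_greatest: "x \<in> carrier L \<Longrightarrow> y \<in> carrier L \<Longrightarrow> greatest L (himp L x y) {w \<in> carrier L. w \<sqinter> x \<sqsubseteq> y}"
  unfolding himp_def using someI_ex[OF himp_exists] .

lemma himp_closed: "x \<in> carrier L \<Longrightarrow> y \<in> carrier L \<Longrightarrow> himp L x y \<in> carrier L"
  using himp_greatest by (simp add: greatest_def)

lemma le_himp_iff:
  assumes "x \<in> carrier L" "y \<in> carrier L" "w \<in> carrier L"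
  shows "w \<sqsubseteq> himp L x y \<longleftrightarrow> w \<sqinter> x \<sqsubseteq> y"
proof
  have g: "himp L x y \<in> carrier L" "himp L x y \<sqinter> x \<sqsubseteq> y"
    and m: "w \<sqinter> x \<sqsubseteq> y \<Longrightarrow> w \<sqsubseteq> himp L x y"
    using himp_greatest[OF assms(1,2)] assms(3) by (auto simp: greatest_def)
  show "w \<sqinter> x \<sqsubseteq> y \<Longrightarrow> w \<sqsubseteq> himp L x y" by (rule m)
  assume w: "w \<sqsubseteq> himp L x y"
  have "w \<sqinter> x \<sqsubseteq> himp L x y \<sqinter> x"
    using w g(1) assms by (meson le_trans meet_closed meet_le meet_left meet_right)
  then show "w \<sqinter> x \<sqsubseteq> y" using g assms by (meson le_trans meet_closed)
qed

lemma himp_eqI: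
  assumes "x \<in> carrier L" "y \<in> carrier L" "z \<in> carrier L"
    "\<And>w. w \<in> carrier L \<Longrightarrow> w \<sqsubseteq> z \<longleftrightarrow> w \<sqinter> x \<sqsubseteq> y"
  shows "z = himp L x y"
  using assms le_himp_iff[OF assms(1,2)] himp_closed[OF assms(1,2)] by (meson le_antisym le_refl)

end

context finite_limit_category
begin

text \<open>Covers are the extremal epimorphisms.\<close>

definition cover :: "'b \<Rightarrow> bool"
  where "cover w \<longleftrightarrow> w \<in> Mor C \<and>
    (\<forall>U\<in>carrier (Sub C (Cod C w)). sub_mem C U w \<longrightarrow> sub_mem C U (Ident C (Cod C w)))"

lemma cover_Mor: "cover w \<Longrightarrow> w \<in> Mor C"
  by (simp add: cover_def)

lemma cover_Ident: "X \<in> Obj C \<Longrightarrow> cover (Ident C X)"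
  by (simp add: cover_def)

text \<open>The inverse image of \<open>U\<close> along \<open>x\<close> contains the cover, hence
  is everything. This is the local character of membership on which descent along covers
  relies.\<close>

lemma cover_mem:
  assumes w: "cover w" and U: "U \<in> carrier (Sub C X)" and x: "x \<in> Mor C" "Cod C x = X" "Cod C w = Dom C x"
    and m: "sub_mem C U (x \<odot> w)"
  shows "sub_mem C U x"
proof -
  have wM: "w \<in> Mor C" using w by (rule cover_Mor)
  note inv = inv_im_carrier[OF x(1) refl x(2) U] and minv = mem_inv_im[OF x(1) refl x(2) U]
  have "sub_mem C (inv_im C x U) w" using minv[OF wM x(3)] m by simp
  then have "sub_mem C (inv_im C x U) (Ident C (Dom C x))" using w inv x by (simp add: cover_def)
  then show ?thesis using minv[of "Ident C (Dom C x)"] x by simp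
qed

lemma cover_representable:
  assumes "cover w" "representable C X Q" "x \<in> Mor C" "Cod C x = X" "Cod C w = Dom C x" "Q (x \<odot> w)"
  shows "Q x"
proof -
  have wM: "w \<in> Mor C" using assms(1) by (rule cover_Mor)
  have "sub_mem C (sub_of C X Q) (x \<odot> w)" using mem_sub_of[OF assms(2), of "x \<odot> w"] assms wM by simp
  then have "sub_mem C (sub_of C X Q) x"
    using cover_mem[OF assms(1) sub_of_carrier[OF assms(2)] assms(3-5)] by simp
  then show ?thesis using mem_sub_of[OF assms(2-4)] by simp
qed

lemma cover_comp:
  assumes v: "cover v" and w: "cover w" and c: "Cod C v = Dom C w"
  shows "cover (w \<odot> v)"
proof -
  have M: "v \<in> Mor C" "w \<in> Mor C" using v w by (auto dest: cover_Mor)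
  show ?thesis unfolding cover_def
  proof (intro conjI ballI impI)
    show "w \<odot> v \<in> Mor C" using M c by simp
    fix U assume U: "U \<in> carrier (Sub C (Cod C (w \<odot> v)))" "sub_mem C U (w \<odot> v)"
    then have "U \<in> carrier (Sub C (Cod C w))" using M c by simp
    then show "sub_mem C U (Ident C (Cod C (w \<odot> v)))"
      using cover_mem[OF v _ M(2) refl c U(2)] w M c by (simp add: cover_def)
  qed
qed

lemma ex1_eqD: "\<exists>!x. P x \<Longrightarrow> P x \<Longrightarrow> P y \<Longrightarrow> x = y"
  by blast

text \<open>If \<open>e = n \<odot> h\<close> with \<open>n\<close> monic, then \<open>h\<close>
  coequalizes the same pair, so it factors as \<open>k \<odot> e\<close>, and
  \<open>n \<odot> k\<close> is the identity by uniqueness.\<close>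

lemma regular_epi_cover:
  assumes "regular_epi C e" shows "cover e"
proof -
  obtain f g where e: "is_coequalizer C f g e" using assms by (auto simp: regular_epi_def)
  from e[unfolded is_coequalizer_def] have t0: "f \<in> Mor C" "g \<in> Hom C (Dom C f) (Cod C f)" "e \<in> Mor C" "Dom C e = Cod C f"
    and eq: "e \<odot> f = e \<odot> g"
    and U0: "\<forall>a\<in>Mor C. Dom C a = Cod C f \<and> a \<odot> f = a \<odot> g \<longrightarrow>
      (\<exists>!h. h \<in> Hom C (Cod C e) (Cod C a) \<and> h \<odot> e = a)"
    by - (elim conjE, assumption)+
  then have t: "f \<in> Mor C" "g \<in> Mor C" "Dom C g = Dom C f" "Cod C g = Cod C f" "e \<in> Mor C" "Dom C e = Cod C f"
    by (simp_all add: Hom_def)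
  have U: "\<exists>!h. h \<in> Hom C (Cod C e) (Cod C a) \<and> h \<odot> e = a"
    if "a \<in> Mor C" "Dom C a = Cod C f" "a \<odot> f = a \<odot> g" for a
    by (rule bspec[OF U0 that(1), THEN mp]) (use that in simp)
  show ?thesis unfolding cover_def
  proof (intro conjI ballI impI t(5))
    fix V assume V: "V \<in> carrier (Sub C (Cod C e))" "sub_mem C V e"
    obtain n where n: "mono_arr C n" "n \<in> Mor C" "Cod C n = Cod C e" "n \<in> V" using Sub_carrierE[OF V(1)] by metis
    obtain h where h: "h \<in> Mor C" "Dom C h = Dom C e" "Cod C h = Dom C n" "n \<odot> h = e"
      using Sub_member(4)[OF V(1) n(4)] V(2) factorsE by blast
    have "n \<odot> (h \<odot> f) = n \<odot> (h \<odot> g)"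
      using eq h t n Comp_assoc'[of f h n] Comp_assoc'[of g h n] by simp
    then have hf: "h \<odot> f = h \<odot> g" using mono_cancel[OF n(1), of "h \<odot> f" "h \<odot> g"] h t by simp
    have "Dom C h = Cod C f" using h t by simp
    from ex1_implies_ex[OF U[OF h(1) this hf]]
    obtain k where k: "k \<in> Mor C" "Dom C k = Cod C e" "Cod C k = Dom C n" "k \<odot> e = h"
      using h by (auto simp: Hom_def)
    have "(n \<odot> k) \<odot> e = e" using k h t n by simp
    then have "n \<odot> k = Ident C (Cod C e)"
      using ex1_eqD[OF U[OF t(5,6) eq], of "n \<odot> k" "Ident C (Cod C e)"] k(1-3) n(2,3) t(5) by (simp add: Hom_def)
    then have "factors_through C (Ident C (Cod C e)) n"
      using k t by (intro factorsI[of k]) auto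
    then show "sub_mem C V (Ident C (Cod C e))" using Sub_member(4)[OF V(1) n(4)] by blast
  qed
qed

lemma left_adjointD:
  assumes e: "is_left_adjoint C f e" and f: "Dom C f = X" "Cod C f = Y" and U: "U \<in> carrier (Sub C X)"
  shows "e U \<in> carrier (Sub C Y)" "V \<in> carrier (Sub C Y) \<Longrightarrow> e U \<sqsubseteq>\<^bsub>Sub C Y\<^esub> V \<longleftrightarrow> U \<sqsubseteq>\<^bsub>Sub C X\<^esub> inv_im C f V"
proof -
  interpret galois_connection "\<lparr>orderA = Sub C X, orderB = Sub C Y, lower = e, upper = inv_im C f\<rparr>"
    using e unfolding is_left_adjoint_def f .
  show "e U \<in> carrier (Sub C Y)" using lower_closed[of U] U by simp
  show "V \<in> carrier (Sub C Y) \<Longrightarrow> e U \<sqsubseteq>\<^bsub>Sub C Y\<^esub> V \<longleftrightarrow> U \<sqsubseteq>\<^bsub>Sub C X\<^esub> inv_im C f V"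
    using galois_property[of U V] U by simp
qed

lemma right_adjointD:
  assumes a: "is_right_adjoint C f a" and f: "Dom C f = X" "Cod C f = Y" and U: "U \<in> carrier (Sub C X)"
  shows "a U \<in> carrier (Sub C Y)" "V \<in> carrier (Sub C Y) \<Longrightarrow> V \<sqsubseteq>\<^bsub>Sub C Y\<^esub> a U \<longleftrightarrow> inv_im C f V \<sqsubseteq>\<^bsub>Sub C X\<^esub> U"
proof -
  interpret galois_connection "\<lparr>orderA = Sub C Y, orderB = Sub C X, lower = inv_im C f, upper = a\<rparr>"
    using a unfolding is_right_adjoint_def f .
  show "a U \<in> carrier (Sub C Y)" using upper_closed[of U] U by simp
  show "V \<in> carrier (Sub C Y) \<Longrightarrow> V \<sqsubseteq>\<^bsub>Sub C Y\<^esub> a U \<longleftrightarrow> inv_im C f V \<sqsubseteq>\<^bsub>Sub C X\<^esub> U"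
    using galois_property[of V U] U by simp
qed

end

sublocale heyting_category \<subseteq> finite_limit_category
  by unfold_locales (rule finite_limits)

context heyting_category
begin

section \<open>Connectives and quantifiers at generalized elements\<close>

lemma adjoint_ex:
  assumes f: "f \<in> Mor C" "Dom C f = X" "Cod C f = Y" and U: "U \<in> carrier (Sub C X)"
  shows ex_along_carrier: "ex_along C f U \<in> carrier (Sub C Y)"
    and ex_along_le: "V \<in> carrier (Sub C Y) \<Longrightarrow>
      ex_along C f U \<sqsubseteq>\<^bsub>Sub C Y\<^esub> V \<longleftrightarrow> U \<sqsubseteq>\<^bsub>Sub C X\<^esub> inv_im C f V"
proof -
  have e: "is_left_adjoint C f (ex_along C f)"
    unfolding ex_along_def using someI_ex[OF left_adjoint[OF f(1)]] .
  show "ex_along C f U \<in> carrier (Sub C Y)" by (rule left_adjointD(1)[OF e f(2,3) U])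
  show "V \<in> carrier (Sub C Y) \<Longrightarrow> ex_along C f U \<sqsubseteq>\<^bsub>Sub C Y\<^esub> V \<longleftrightarrow> U \<sqsubseteq>\<^bsub>Sub C X\<^esub> inv_im C f V"
    by (rule left_adjointD(2)[OF e f(2,3) U])
qed

lemma adjoint_all:
  assumes f: "f \<in> Mor C" "Dom C f = X" "Cod C f = Y" and U: "U \<in> carrier (Sub C X)"
  shows all_along_carrier: "all_along C f U \<in> carrier (Sub C Y)"
    and le_all_along: "V \<in> carrier (Sub C Y) \<Longrightarrow>
      V \<sqsubseteq>\<^bsub>Sub C Y\<^esub> all_along C f U \<longleftrightarrow> inv_im C f V \<sqsubseteq>\<^bsub>Sub C X\<^esub> U"
proof -
  have a: "is_right_adjoint C f (all_along C f)"
    unfolding all_along_def using someI_ex[OF right_adjoint[OF f(1)]] .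
  show "all_along C f U \<in> carrier (Sub C Y)" by (rule right_adjointD(1)[OF a f(2,3) U])
  show "V \<in> carrier (Sub C Y) \<Longrightarrow> V \<sqsubseteq>\<^bsub>Sub C Y\<^esub> all_along C f U \<longleftrightarrow> inv_im C f V \<sqsubseteq>\<^bsub>Sub C X\<^esub> U"
    by (rule right_adjointD(2)[OF a f(2,3) U])
qed

lemma top_carrier: "X \<in> Obj C \<Longrightarrow> \<top>\<^bsub>Sub C X\<^esub> \<in> carrier (Sub C X)"
proof -
  assume "X \<in> Obj C"
  then interpret heyting_algebra "Sub C X" by (rule Sub_heyting)
  show ?thesis by simp
qed

lemma mem_top:
  assumes "x \<in> Mor C" "Cod C x = X" shows "sub_mem C (\<top>\<^bsub>Sub C X\<^esub>) x"
proof -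
  have X: "X \<in> Obj C" using assms by auto
  interpret heyting_algebra "Sub C X" using X by (rule Sub_heyting)
  note r = representable_True[OF X]
  have "sub_of C X (\<lambda>_. True) \<sqsubseteq>\<^bsub>Sub C X\<^esub> \<top>\<^bsub>Sub C X\<^esub>" using top_higher[OF sub_of_carrier[OF r]] .
  then show ?thesis
    using Sub_le_iff[OF sub_of_carrier[OF r] top_carrier[OF X]] mem_sub_of[OF r] assms by simp
qed

lemma top_iff:
  assumes U: "U \<in> carrier (Sub C X)"
  shows "U = \<top>\<^bsub>Sub C X\<^esub> \<longleftrightarrow> (\<forall>x\<in>Mor C. Cod C x = X \<longrightarrow> sub_mem C U x)"
    "U = \<top>\<^bsub>Sub C X\<^esub> \<longleftrightarrow> sub_mem C U (Ident C X)"
proof -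
  have X: "X \<in> Obj C" using U by (rule Sub_Obj)
  show 1: "U = \<top>\<^bsub>Sub C X\<^esub> \<longleftrightarrow> (\<forall>x\<in>Mor C. Cod C x = X \<longrightarrow> sub_mem C U x)"
  proof
    assume "\<forall>x\<in>Mor C. Cod C x = X \<longrightarrow> sub_mem C U x"
    then show "U = \<top>\<^bsub>Sub C X\<^esub>" using mem_top by (intro Sub_eqI[OF U top_carrier[OF X]]) simp
  qed (simp add: mem_top)
  have "sub_mem C U x" if "sub_mem C U (Ident C X)" "x \<in> Mor C" "Cod C x = X" for x
    using mem_comp[OF U that(1), of x] that X by simp
  then show "U = \<top>\<^bsub>Sub C X\<^esub> \<longleftrightarrow> sub_mem C U (Ident C X)" unfolding 1 using X by auto
qed

text \<open>Membership is a statement about the top of \<open>Sub C Z\<close>, so a connective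
  preserved by inverse images can be evaluated after pulling it back along the element.\<close>

lemma mem_iff_top_le:
  assumes U: "U \<in> carrier (Sub C X)" and x: "x \<in> Mor C" "Cod C x = X" "Dom C x = Z"
  shows "sub_mem C U x \<longleftrightarrow> \<top>\<^bsub>Sub C Z\<^esub> \<sqsubseteq>\<^bsub>Sub C Z\<^esub> inv_im C x U"
proof -
  have Z: "Z \<in> Obj C" using x by auto
  note c = inv_im_carrier[OF x(1,3,2) U] and m = mem_inv_im[OF x(1,3,2) U]
  have "\<top>\<^bsub>Sub C Z\<^esub> \<sqsubseteq>\<^bsub>Sub C Z\<^esub> inv_im C x U \<longleftrightarrow> (\<forall>t\<in>Mor C. Cod C t = Z \<longrightarrow> sub_mem C (inv_im C x U) t)"
    using Sub_le_iff[OF top_carrier[OF Z] c] mem_top by simp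
  also have "\<dots> \<longleftrightarrow> sub_mem C (inv_im C x U) (Ident C Z)" using top_iff[OF c] by simp
  also have "\<dots> \<longleftrightarrow> sub_mem C U x" using m[of "Ident C Z"] Z x by simp
  finally show ?thesis by simp
qed

lemma mem_meet:
  assumes U: "U \<in> carrier (Sub C X)" and V: "V \<in> carrier (Sub C X)" and x: "x \<in> Mor C" "Cod C x = X"
  shows "sub_mem C (U \<sqinter>\<^bsub>Sub C X\<^esub> V) x \<longleftrightarrow> sub_mem C U x \<and> sub_mem C V x"
proof -
  have X: "X \<in> Obj C" "Dom C x \<in> Obj C" using x by auto
  interpret X: heyting_algebra "Sub C X" using X(1) by (rule Sub_heyting)
  interpret Z: heyting_algebra "Sub C (Dom C x)" using X(2) by (rule Sub_heyting)
  have "x \<in> Hom C (Dom C x) X" using x by (simp add: Hom_def)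
  from inv_im_hom[OF this] have e: "inv_im C x (U \<sqinter>\<^bsub>Sub C X\<^esub> V) = inv_im C x U \<sqinter>\<^bsub>Sub C (Dom C x)\<^esub> inv_im C x V"
    using U V by (simp add: heyting_hom_def)
  note c = inv_im_carrier[OF x(1) refl x(2)]
  show ?thesis
    unfolding mem_iff_top_le[OF U x refl] mem_iff_top_le[OF V x refl] mem_iff_top_le[OF X.meet_closed[OF U V] x refl] e
    using Z.le_meet_iff[OF c[OF U] c[OF V] Z.top_closed] .
qed

text \<open>Once the implication is pulled back along \<open>x\<close>, the top lies below it
  exactly if the inverse image of \<open>U\<close> lies below that of \<open>V\<close>; the stages
  \<open>s\<close> are the elements at which this inclusion is read.\<close>

lemma mem_himp:
  assumes U: "U \<in> carrier (Sub C X)" and V: "V \<in> carrier (Sub C X)" and x: "x \<in> Mor C" "Cod C x = X"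
  shows "sub_mem C (himp (Sub C X) U V) x \<longleftrightarrow>
    (\<forall>s\<in>Mor C. Cod C s = Dom C x \<longrightarrow> sub_mem C U (x \<odot> s) \<longrightarrow> sub_mem C V (x \<odot> s))"
proof -
  have X: "X \<in> Obj C" "Dom C x \<in> Obj C" using x by auto
  interpret X: heyting_algebra "Sub C X" using X(1) by (rule Sub_heyting)
  interpret Z: heyting_algebra "Sub C (Dom C x)" using X(2) by (rule Sub_heyting)
  have "x \<in> Hom C (Dom C x) X" using x by (simp add: Hom_def)
  from inv_im_hom[OF this] have e: "inv_im C x (himp (Sub C X) U V) = himp (Sub C (Dom C x)) (inv_im C x U) (inv_im C x V)"
    using U V by (simp add: heyting_hom_def)
  note c = inv_im_carrier[OF x(1) refl x(2)] and m = mem_inv_im[OF x(1) refl x(2)]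
  have t: "\<top>\<^bsub>Sub C (Dom C x)\<^esub> \<sqinter>\<^bsub>Sub C (Dom C x)\<^esub> inv_im C x U = inv_im C x U"
    using Z.le_meet_iff[OF Z.top_closed c[OF U] c[OF U]] Z.top_higher[OF c[OF U]] Z.meet_right[OF Z.top_closed c[OF U]]
    by (meson Z.le_antisym Z.le_refl Z.meet_closed Z.top_closed c[OF U])
  show ?thesis
    unfolding mem_iff_top_le[OF X.himp_closed[OF U V] x refl] e
      Z.le_himp_iff[OF c[OF U] c[OF V] Z.top_closed] t Sub_le_iff[OF c[OF U] c[OF V]]
    using m[OF U] m[OF V] by simp
qed

text \<open>A join has no simple description by elements, so it is used through elimination into a
  representable goal: after pulling back to \<open>Z\<close> the goal bounds both parts, hence their
  join, which is top.\<close>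

lemma join_elim:
  assumes U: "U \<in> carrier (Sub C X)" and V: "V \<in> carrier (Sub C X)" and x: "x \<in> Mor C" "Cod C x = X" "Dom C x = Z"
    and j: "sub_mem C (U \<squnion>\<^bsub>Sub C X\<^esub> V) x" and Q: "representable C Z Q"
    and 1: "\<And>s. s \<in> Mor C \<Longrightarrow> Cod C s = Z \<Longrightarrow> sub_mem C U (x \<odot> s) \<Longrightarrow> Q s"
    and 2: "\<And>s. s \<in> Mor C \<Longrightarrow> Cod C s = Z \<Longrightarrow> sub_mem C V (x \<odot> s) \<Longrightarrow> Q s"
  shows "Q (Ident C Z)"
proof -
  have X: "X \<in> Obj C" "Z \<in> Obj C" using x by auto
  interpret X: heyting_algebra "Sub C X" using X(1) by (rule Sub_heyting)
  interpret Z: heyting_algebra "Sub C Z" using X(2) by (rule Sub_heyting)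
  have "x \<in> Hom C Z X" using x by (simp add: Hom_def)
  from inv_im_hom[OF this] have e: "inv_im C x (U \<squnion>\<^bsub>Sub C X\<^esub> V) = inv_im C x U \<squnion>\<^bsub>Sub C Z\<^esub> inv_im C x V"
    using U V by (simp add: heyting_hom_def)
  note c = inv_im_carrier[OF x(1,3,2)] and m = mem_inv_im[OF x(1,3,2)]
  note q = sub_of_carrier[OF Q]
  have l: "inv_im C x U \<sqsubseteq>\<^bsub>Sub C Z\<^esub> sub_of C Z Q" "inv_im C x V \<sqsubseteq>\<^bsub>Sub C Z\<^esub> sub_of C Z Q"
    unfolding Sub_le_iff[OF c[OF U] q] Sub_le_iff[OF c[OF V] q]
    using 1 2 m[OF U] m[OF V] mem_sub_of[OF Q] by auto
  have "\<top>\<^bsub>Sub C Z\<^esub> \<sqsubseteq>\<^bsub>Sub C Z\<^esub> inv_im C x U \<squnion>\<^bsub>Sub C Z\<^esub> inv_im C x V"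
    using j unfolding mem_iff_top_le[OF X.join_closed[OF U V] x] e .
  moreover have "inv_im C x U \<squnion>\<^bsub>Sub C Z\<^esub> inv_im C x V \<sqsubseteq>\<^bsub>Sub C Z\<^esub> sub_of C Z Q"
    using l Z.join_le_iff[OF c[OF U] c[OF V] q] by simp
  ultimately have "\<top>\<^bsub>Sub C Z\<^esub> \<sqsubseteq>\<^bsub>Sub C Z\<^esub> sub_of C Z Q"
    by (rule Z.le_trans) (simp_all add: c U V q)
  then show ?thesis
    unfolding Sub_le_iff[OF Z.top_closed q] using mem_top[of "Ident C Z" Z] mem_sub_of[OF Q, of "Ident C Z"] X by simp
qed

lemma bottom_elim:
  assumes x: "x \<in> Mor C" "Cod C x = X" "Dom C x = Z"
    and j: "sub_mem C (\<bottom>\<^bsub>Sub C X\<^esub>) x" and Q: "representable C Z Q"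
  shows "Q (Ident C Z)"
proof -
  have X: "X \<in> Obj C" "Z \<in> Obj C" using x by auto
  interpret X: heyting_algebra "Sub C X" using X(1) by (rule Sub_heyting)
  interpret Z: heyting_algebra "Sub C Z" using X(2) by (rule Sub_heyting)
  have "x \<in> Hom C Z X" using x by (simp add: Hom_def)
  from inv_im_hom[OF this] have e: "inv_im C x (\<bottom>\<^bsub>Sub C X\<^esub>) = \<bottom>\<^bsub>Sub C Z\<^esub>"
    by (simp add: heyting_hom_def)
  note q = sub_of_carrier[OF Q]
  have "\<top>\<^bsub>Sub C Z\<^esub> \<sqsubseteq>\<^bsub>Sub C Z\<^esub> \<bottom>\<^bsub>Sub C Z\<^esub>"
    using j unfolding mem_iff_top_le[OF X.bottom_closed x] e .
  then have "\<top>\<^bsub>Sub C Z\<^esub> \<sqsubseteq>\<^bsub>Sub C Z\<^esub> sub_of C Z Q"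
    using Z.bottom_lower[OF q] by (rule Z.le_trans) (simp_all add: q)
  then show ?thesis
    unfolding Sub_le_iff[OF Z.top_closed q] using mem_top[of "Ident C Z" Z] mem_sub_of[OF Q, of "Ident C Z"] X by simp
qed

text \<open>Beck-Chevalley replaces \<open>g\<close> by its pullback \<open>p\<close> along
  \<open>y\<close>, where the adjunction is applied to the top. The elements of the pullback are the
  pairs \<open>(s, u)\<close> with \<open>g \<odot> u = y \<odot> s\<close>.\<close>

lemma mem_all_along:
  assumes g: "g \<in> Mor C" "Dom C g = X" "Cod C g = Y" and U: "U \<in> carrier (Sub C X)" and y: "y \<in> Mor C" "Cod C y = Y"
  shows "sub_mem C (all_along C g U) y \<longleftrightarrow>
    (\<forall>s\<in>Mor C. \<forall>u\<in>Mor C. Cod C s = Dom C y \<longrightarrow> Dom C u = Dom C s \<longrightarrow> Cod C u = X \<longrightarrow> g \<odot> u = y \<odot> s \<longrightarrow> sub_mem C U u)"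
proof -
  have Z: "Dom C y \<in> Obj C" using y by auto
  obtain p q where pb: "is_pullback C y g p q" using pullback_exists[of y g] y g by auto
  note pbD = pullbackD(1-8)[OF pb]
  note ac = all_along_carrier[OF g U]
  have q: "q \<in> Mor C" "Dom C q = Dom C p" "Cod C q = X" using pbD g by simp_all
  have p: "p \<in> Mor C" "Dom C p = Dom C p" "Cod C p = Dom C y" using pbD by simp_all
  have U': "U \<in> carrier (Sub C (Dom C g))" using U g by simp
  note qc = inv_im_carrier[OF q U]
  have "sub_mem C (all_along C g U) y \<longleftrightarrow> \<top>\<^bsub>Sub C (Dom C y)\<^esub> \<sqsubseteq>\<^bsub>Sub C (Dom C y)\<^esub> all_along C p (inv_im C q U)"
    unfolding mem_iff_top_le[OF ac y refl] beck_chevalley_all[OF pb U'] ..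
  also have "\<dots> \<longleftrightarrow> inv_im C p (\<top>\<^bsub>Sub C (Dom C y)\<^esub>) \<sqsubseteq>\<^bsub>Sub C (Dom C p)\<^esub> inv_im C q U"
    by (rule le_all_along[OF p qc top_carrier[OF Z]])
  also have "\<dots> \<longleftrightarrow> (\<forall>t\<in>Mor C. Cod C t = Dom C p \<longrightarrow> sub_mem C U (q \<odot> t))"
    unfolding Sub_le_iff[OF inv_im_carrier[OF p top_carrier[OF Z]] qc]
    using mem_inv_im[OF p top_carrier[OF Z]] mem_inv_im[OF q U] mem_top p by simp
  also have "\<dots> \<longleftrightarrow> (\<forall>s\<in>Mor C. \<forall>u\<in>Mor C. Cod C s = Dom C y \<longrightarrow> Dom C u = Dom C s \<longrightarrow> Cod C u = X \<longrightarrow> g \<odot> u = y \<odot> s \<longrightarrow> sub_mem C U u)"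
  proof (intro iffI ballI impI)
    fix s u assume a: "\<forall>t\<in>Mor C. Cod C t = Dom C p \<longrightarrow> sub_mem C U (q \<odot> t)"
      and su: "s \<in> Mor C" "u \<in> Mor C" "Cod C s = Dom C y" "Dom C u = Dom C s" "Cod C u = X" "g \<odot> u = y \<odot> s"
    obtain t where "t \<in> Mor C" "Cod C t = Dom C p" "q \<odot> t = u"
      using pullback_lift[OF pb su(1,2) su(4)[symmetric] su(3) _ su(6)[symmetric]] su(5) g by metis
    then show "sub_mem C U u" using a by metis
  next
    fix t assume a: "\<forall>s\<in>Mor C. \<forall>u\<in>Mor C. Cod C s = Dom C y \<longrightarrow> Dom C u = Dom C s \<longrightarrow> Cod C u = X \<longrightarrow> g \<odot> u = y \<odot> s \<longrightarrow> sub_mem C U u"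
      and t: "t \<in> Mor C" "Cod C t = Dom C p"
    show "sub_mem C U (q \<odot> t)"
      using bspec[OF bspec[OF a, of "p \<odot> t"], of "q \<odot> t"] pullback_eq[OF pb t] t p q by simp
  qed
  finally show ?thesis .
qed

text \<open>Beck-Chevalley reduces membership to the image along the pullback \<open>p\<close> being
  top. A mono \<open>n\<close> representing the inverse image of \<open>U\<close> then makes
  \<open>p \<odot> n\<close> a cover, and this composite serves as the witness.\<close>

lemma mem_ex_along:
  assumes g: "g \<in> Mor C" "Dom C g = X" "Cod C g = Y" and U: "U \<in> carrier (Sub C X)" and y: "y \<in> Mor C" "Cod C y = Y"
  shows "sub_mem C (ex_along C g U) y \<longleftrightarrow>
    (\<exists>w u. cover w \<and> Cod C w = Dom C y \<and> u \<in> Mor C \<and> Dom C u = Dom C w \<and> Cod C u = X \<and> g \<odot> u = y \<odot> w \<and> sub_mem C U u)"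
    (is "_ \<longleftrightarrow> ?R")
proof
  note ec = ex_along_carrier[OF g U]
  assume m: "sub_mem C (ex_along C g U) y"
  have Z: "Dom C y \<in> Obj C" using y by auto
  obtain p q where pb: "is_pullback C y g p q" using pullback_exists[of y g] y g by auto
  note pbD = pullbackD(1-8)[OF pb]
  have q: "q \<in> Mor C" "Dom C q = Dom C p" "Cod C q = X" using pbD g by simp_all
  have p: "p \<in> Mor C" "Dom C p = Dom C p" "Cod C p = Dom C y" using pbD by simp_all
  have U': "U \<in> carrier (Sub C (Dom C g))" using U g by simp
  note qc = inv_im_carrier[OF q U]
  have tle: "\<top>\<^bsub>Sub C (Dom C y)\<^esub> \<sqsubseteq>\<^bsub>Sub C (Dom C y)\<^esub> ex_along C p (inv_im C q U)"
    using m unfolding mem_iff_top_le[OF ec y refl] beck_chevalley_ex[OF pb U'] .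
  obtain n where n: "mono_arr C n" "n \<in> Mor C" "Cod C n = Dom C p" "n \<in> inv_im C q U" using Sub_carrierE[OF qc] by metis
  note mn = Sub_member(4)[OF qc n(4)]
  \<comment> \<open>A subobject containing \<open>p \<odot> n\<close> has an inverse image along
    \<open>p\<close> that contains the inverse image of \<open>U\<close>; by adjunction it contains
    the image of the latter, which is top.\<close>
  have "cover (p \<odot> n)" unfolding cover_def
  proof (intro conjI ballI impI)
    show "p \<odot> n \<in> Mor C" using p n by simp
    fix V assume V: "V \<in> carrier (Sub C (Cod C (p \<odot> n)))" "sub_mem C V (p \<odot> n)"
    then have V': "V \<in> carrier (Sub C (Dom C y))" using p n by simp
    have "sub_mem C V (p \<odot> x)" if x: "x \<in> Mor C" "Cod C x = Dom C p" "sub_mem C (inv_im C q U) x" for x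
    proof -
      obtain h where h: "h \<in> Mor C" "Dom C h = Dom C x" "Cod C h = Dom C n" "n \<odot> h = x"
        using x(3) mn factorsE by blast
      then have "sub_mem C V ((p \<odot> n) \<odot> h)" using mem_comp[OF V' V(2), of h] p n by simp
      then show ?thesis using h p n by simp
    qed
    then have "inv_im C q U \<sqsubseteq>\<^bsub>Sub C (Dom C p)\<^esub> inv_im C p V"
      unfolding Sub_le_iff[OF qc inv_im_carrier[OF p V']] using mem_inv_im[OF p V'] by simp
    then have "ex_along C p (inv_im C q U) \<sqsubseteq>\<^bsub>Sub C (Dom C y)\<^esub> V" using ex_along_le[OF p qc V'] by simp
    then have "sub_mem C V (Ident C (Dom C y))"
      using tle mem_top[of "Ident C (Dom C y)" "Dom C y"] Z
      unfolding Sub_le_iff[OF ex_along_carrier[OF p qc] V'] Sub_le_iff[OF top_carrier[OF Z] ex_along_carrier[OF p qc]] by simp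
    then show "sub_mem C V (Ident C (Cod C (p \<odot> n)))" using p n by simp
  qed
  moreover have "sub_mem C U (q \<odot> n)" using mem_inv_im[OF q U n(2,3)] mn n by simp
  ultimately show ?R using pullback_eq[OF pb n(2,3)] p q n
    by (intro exI[of _ "p \<odot> n"] exI[of _ "q \<odot> n"]) simp
next
  note ec = ex_along_carrier[OF g U]
  assume ?R
  then obtain w u where w: "cover w" "Cod C w = Dom C y" "u \<in> Mor C" "Dom C u = Dom C w" "Cod C u = X" "g \<odot> u = y \<odot> w" "sub_mem C U u"
    by blast
  interpret Y: partial_order "Sub C Y" by (rule Sub_partial_order)
  \<comment> \<open>The unit of the adjunction puts \<open>g \<odot> u\<close> into the image, and
    the cover \<open>w\<close> is then removed by locality.\<close>
  have "U \<sqsubseteq>\<^bsub>Sub C X\<^esub> inv_im C g (ex_along C g U)" using ex_along_le[OF g U ec] Y.le_refl[OF ec] by simp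
  then have "sub_mem C (ex_along C g U) (g \<odot> u)"
    unfolding Sub_le_iff[OF U inv_im_carrier[OF g ec]] using mem_inv_im[OF g ec w(3,5)] w(3,5,7) by blast
  then show "sub_mem C (ex_along C g U) y" using cover_mem[OF w(1) ec y w(2)] w(6) by simp
qed

lemma representable_conj:
  assumes P: "representable C X P" and Q: "representable C X Q"
  shows "representable C X (\<lambda>x. P x \<and> Q x)"
proof -
  note p = sub_of_carrier[OF P] and q = sub_of_carrier[OF Q]
  interpret heyting_algebra "Sub C X" using Sub_Obj[OF p] by (rule Sub_heyting)
  show ?thesis
    by (rule representable_Sub[OF meet_closed[OF p q]]) (simp add: mem_meet[OF p q] mem_sub_of[OF P] mem_sub_of[OF Q])
qed

lemma representable_imp:
  assumes P: "representable C X P" and Q: "representable C X Q"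
  shows "representable C X (\<lambda>x. \<forall>s\<in>Mor C. Cod C s = Dom C x \<longrightarrow> P (x \<odot> s) \<longrightarrow> Q (x \<odot> s))"
proof -
  note p = sub_of_carrier[OF P] and q = sub_of_carrier[OF Q]
  interpret heyting_algebra "Sub C X" using Sub_Obj[OF p] by (rule Sub_heyting)
  show ?thesis
    by (rule representable_Sub[OF himp_closed[OF p q]])
      (simp add: mem_himp[OF p q] mem_sub_of[OF P] mem_sub_of[OF Q])
qed

lemma representable_all:
  assumes g: "g \<in> Mor C" "Dom C g = X" "Cod C g = Y" and Q: "representable C X Q"
  shows "representable C Y (\<lambda>y. \<forall>s\<in>Mor C. \<forall>u\<in>Mor C. Cod C s = Dom C y \<longrightarrow> Dom C u = Dom C s \<longrightarrow>
    Cod C u = X \<longrightarrow> g \<odot> u = y \<odot> s \<longrightarrow> Q u)"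
  by (rule representable_Sub[OF all_along_carrier[OF g sub_of_carrier[OF Q]]])
    (simp add: mem_all_along[OF g sub_of_carrier[OF Q]] mem_sub_of[OF Q] cong: imp_cong)

lemma representable_ex:
  assumes g: "g \<in> Mor C" "Dom C g = X" "Cod C g = Y" and Q: "representable C X Q"
  shows "representable C Y (\<lambda>y. \<exists>w u. cover w \<and> Cod C w = Dom C y \<and> u \<in> Mor C \<and> Dom C u = Dom C w \<and>
    Cod C u = X \<and> g \<odot> u = y \<odot> w \<and> Q u)"
  by (rule representable_Sub[OF ex_along_carrier[OF g sub_of_carrier[OF Q]]])
    (simp add: mem_ex_along[OF g sub_of_carrier[OF Q]] mem_sub_of[OF Q] cong: conj_cong)

end

section \<open>Decoding the internal language\<close>

context heyting_category
begin

text \<open>Truth at all generalized elements of the context, which lets the outer quantifiers be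
  stripped one by one.\<close>

definition valid :: "'a list \<Rightarrow> ('a, 'b) fm \<Rightarrow> bool"
  where "valid G p \<longleftrightarrow> (\<forall>g\<in>Mor C. Cod C g = ctx_obj C G \<longrightarrow> sub_mem C (fm_sem C p G) g)"

lemma models_iff_valid:
  "fm_sem C p [] \<in> carrier (Sub C (terminal_obj C)) \<Longrightarrow> models C p \<longleftrightarrow> valid [] p"
  by (simp add: models_def valid_def top_iff(1))

lemma fm_All_carrier:
  assumes "X \<in> Obj C" "ctx_obj C G \<in> Obj C" "fm_sem C p (X # G) \<in> carrier (Sub C (ctx_obj C (X # G)))"
  shows "fm_sem C (All X p) G \<in> carrier (Sub C (ctx_obj C G))"
  using assms all_along_carrier[of "pr1 C (ctx_obj C G) X" "prod_obj C (ctx_obj C G) X" "ctx_obj C G"] by simp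

text \<open>An element of the extended context lies over its own projection, so the universal clause
  can be read at the identity stage.\<close>

lemma valid_All:
  assumes X: "X \<in> Obj C" and G: "ctx_obj C G \<in> Obj C"
    and p: "fm_sem C p (X # G) \<in> carrier (Sub C (ctx_obj C (X # G)))"
  shows "valid G (All X p) \<longleftrightarrow> valid (X # G) p"
proof -
  let ?pr = "pr1 C (ctx_obj C G) X"
  have g: "?pr \<in> Mor C" "Dom C ?pr = prod_obj C (ctx_obj C G) X" "Cod C ?pr = ctx_obj C G" using X G by simp_all
  have p': "fm_sem C p (X # G) \<in> carrier (Sub C (prod_obj C (ctx_obj C G) X))" using p by simp
  note m = mem_all_along[OF g p']
  show ?thesis
  proof
    assume v: "valid G (All X p)"
    show "valid (X # G) p" unfolding valid_def
    proof (intro ballI impI)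
      fix u assume u: "u \<in> Mor C" "Cod C u = ctx_obj C (X # G)"
      then have y: "?pr \<odot> u \<in> Mor C" "Cod C (?pr \<odot> u) = ctx_obj C G" "Dom C (?pr \<odot> u) = Dom C u" using g by simp_all
      have "sub_mem C (all_along C ?pr (fm_sem C p (X # G))) (?pr \<odot> u)" using v y by (simp add: valid_def)
      from this[unfolded m[OF y(1,2)], rule_format, of "Ident C (Dom C u)" u]
      show "sub_mem C (fm_sem C p (X # G)) u" using u y by simp
    qed
  next
    assume v: "valid (X # G) p"
    show "valid G (All X p)" unfolding valid_def
    proof (intro ballI impI)
      fix y assume y: "y \<in> Mor C" "Cod C y = ctx_obj C G"
      show "sub_mem C (fm_sem C (All X p) G) y"
        using v by (simp add: m[OF y] valid_def)
    qed
  qed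
qed

lemma valid_Imp:
  assumes G: "ctx_obj C G \<in> Obj C"
    and p: "fm_sem C p G \<in> carrier (Sub C (ctx_obj C G))" and q: "fm_sem C q G \<in> carrier (Sub C (ctx_obj C G))"
  shows "fm_sem C (Imp p q) G \<in> carrier (Sub C (ctx_obj C G))"
    "valid G (Imp p q) \<longleftrightarrow>
      (\<forall>g\<in>Mor C. Cod C g = ctx_obj C G \<longrightarrow> sub_mem C (fm_sem C p G) g \<longrightarrow> sub_mem C (fm_sem C q G) g)"
proof -
  interpret heyting_algebra "Sub C (ctx_obj C G)" using G by (rule Sub_heyting)
  show "fm_sem C (Imp p q) G \<in> carrier (Sub C (ctx_obj C G))" using himp_closed[OF p q] by simp
  show "valid G (Imp p q) \<longleftrightarrow>
      (\<forall>g\<in>Mor C. Cod C g = ctx_obj C G \<longrightarrow> sub_mem C (fm_sem C p G) g \<longrightarrow> sub_mem C (fm_sem C q G) g)" (is "_ \<longleftrightarrow> ?R")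
  proof
    assume v: "valid G (Imp p q)"
    show ?R
    proof (intro ballI impI)
      fix g assume g: "g \<in> Mor C" "Cod C g = ctx_obj C G" and m: "sub_mem C (fm_sem C p G) g"
      have "sub_mem C (himp (Sub C (ctx_obj C G)) (fm_sem C p G) (fm_sem C q G)) g" using v g by (simp add: valid_def)
      from this[unfolded mem_himp[OF p q g], rule_format, of "Ident C (Dom C g)"]
      show "sub_mem C (fm_sem C q G) g" using g m by simp
    qed
  next
    assume ?R then show "valid G (Imp p q)" by (simp add: valid_def mem_himp[OF p q])
  qed
qed

lemma fm_And:
  assumes G: "ctx_obj C G \<in> Obj C"
    and p: "fm_sem C p G \<in> carrier (Sub C (ctx_obj C G))" and q: "fm_sem C q G \<in> carrier (Sub C (ctx_obj C G))"
  shows fm_And_carrier: "fm_sem C (And p q) G \<in> carrier (Sub C (ctx_obj C G))"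
    and mem_And: "g \<in> Mor C \<Longrightarrow> Cod C g = ctx_obj C G \<Longrightarrow>
      sub_mem C (fm_sem C (And p q) G) g \<longleftrightarrow> sub_mem C (fm_sem C p G) g \<and> sub_mem C (fm_sem C q G) g"
proof -
  interpret heyting_algebra "Sub C (ctx_obj C G)" using G by (rule Sub_heyting)
  show "fm_sem C (And p q) G \<in> carrier (Sub C (ctx_obj C G))" using meet_closed[OF p q] by simp
  show "g \<in> Mor C \<Longrightarrow> Cod C g = ctx_obj C G \<Longrightarrow>
      sub_mem C (fm_sem C (And p q) G) g \<longleftrightarrow> sub_mem C (fm_sem C p G) g \<and> sub_mem C (fm_sem C q G) g"
    using mem_meet[OF p q] by simp
qed

text \<open>Existential quantification is local, hence the cover \<open>w\<close>: a point of an
  assembly has a realizer only after its domain is refined.\<close>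

lemma models_assembly:
  assumes A: "A \<in> Obj C" and X: "X \<in> Obj C" and \<rho>: "\<rho> \<in> carrier (Sub C (prod_obj C A X))"
  shows "models C (All X (Ex A (In (Tup (Var 0) (Var 1)) \<rho>))) \<longleftrightarrow>
    (\<forall>x\<in>Mor C. Cod C x = X \<longrightarrow> (\<exists>w a. cover w \<and> Cod C w = Dom C x \<and> a \<in> Hom C (Dom C w) A \<and> sub_mem C \<rho> (pairing C a (x \<odot> w))))"
    (is "_ \<longleftrightarrow> ?R")
proof -
  let ?G = "[A, X]" and ?in = "In (Tup (Var 0) (Var 1)) \<rho>"
  have O: "ctx_obj C [] \<in> Obj C" "ctx_obj C [X] \<in> Obj C" "ctx_obj C ?G \<in> Obj C" using A X by simp_all
  have p0: "ctx_proj C ?G 0 \<in> Mor C" "Dom C (ctx_proj C ?G 0) = ctx_obj C ?G" "Cod C (ctx_proj C ?G 0) = A"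
    and p1: "ctx_proj C ?G 1 \<in> Mor C" "Dom C (ctx_proj C ?G 1) = ctx_obj C ?G" "Cod C (ctx_proj C ?G 1) = X"
    using A X by simp_all
  have t: "tm_sem C ?G (Tup (Var 0) (Var 1)) \<in> PMor C (ctx_obj C ?G) (prod_obj C A X)"
    using pm_pair_PMor[OF pm_total_PMor[OF p0] pm_total_PMor[OF p1]] by simp
  have tv: "pm_val (tm_sem C ?G (Tup (Var 0) (Var 1))) g v \<longleftrightarrow> v = pairing C (ctx_proj C ?G 0 \<odot> g) (ctx_proj C ?G 1 \<odot> g)"
    if "g \<in> Mor C" "Cod C g = ctx_obj C ?G" for g v
    using pm_val_pair_iff[OF pm_total_PMor[OF p0] pm_total_PMor[OF p1] that]
      pm_val_total[OF p0 that] pm_val_total[OF p1 that] by simp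
  have c1: "fm_sem C ?in ?G \<in> carrier (Sub C (ctx_obj C ?G))" using pm_inv_im_carrier[OF t \<rho>] by simp
  have m1: "sub_mem C (fm_sem C ?in ?G) g \<longleftrightarrow> sub_mem C \<rho> (pairing C (ctx_proj C ?G 0 \<odot> g) (ctx_proj C ?G 1 \<odot> g))"
    if "g \<in> Mor C" "Cod C g = ctx_obj C ?G" for g
    using mem_pm_inv_im[OF t \<rho> that] tv[OF that] by simp
  let ?pr = "pr1 C (ctx_obj C [X]) A"
  have pr: "?pr \<in> Mor C" "Dom C ?pr = ctx_obj C ?G" "Cod C ?pr = ctx_obj C [X]" using A X by simp_all
  have c2: "fm_sem C (Ex A ?in) [X] \<in> carrier (Sub C (ctx_obj C [X]))"
    using ex_along_carrier[OF pr c1] by simp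
  have c3: "fm_sem C (All X (Ex A ?in)) [] \<in> carrier (Sub C (terminal_obj C))"
    using fm_All_carrier[OF X O(1) c2] by simp
  have "models C (All X (Ex A ?in)) \<longleftrightarrow> valid [X] (Ex A ?in)"
    using models_iff_valid[OF c3] valid_All[OF X O(1) c2] by simp
  also have "\<dots> \<longleftrightarrow> ?R"
  proof
    assume v: "valid [X] (Ex A ?in)"
    show ?R
    proof (intro ballI impI)
      fix x assume x: "x \<in> Mor C" "Cod C x = X"
      \<comment> \<open>A context begins with the terminal object, so an environment starts with
        \<open>bang\<close>.\<close>
      let ?y = "pairing C (bang C (Dom C x)) x"
      have y: "?y \<in> Mor C" "Cod C ?y = ctx_obj C [X]" "Dom C ?y = Dom C x" using x by simp_all
      have "sub_mem C (ex_along C ?pr (fm_sem C ?in ?G)) ?y" using v y by (simp add: valid_def)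
      then obtain w u where w: "cover w" "Cod C w = Dom C x" and u: "u \<in> Mor C" "Dom C u = Dom C w" "Cod C u = ctx_obj C ?G"
        and e: "?pr \<odot> u = ?y \<odot> w" and m: "sub_mem C (fm_sem C ?in ?G) u"
        using mem_ex_along[OF pr c1 y(1,2)] y(3) by metis
      have wM: "w \<in> Mor C" using w(1) by (rule cover_Mor)
      have u': "Cod C u = prod_obj C (prod_obj C (terminal_obj C) X) A" using u by simp
      have "ctx_proj C ?G 1 \<odot> u = pr2 C (terminal_obj C) X \<odot> (?pr \<odot> u)" using A X u(1) u' by simp
      also have "\<dots> = x \<odot> w" unfolding e using x w(2) wM by simp
      finally have "sub_mem C \<rho> (pairing C (ctx_proj C ?G 0 \<odot> u) (x \<odot> w))" using m m1[OF u(1,3)] by simp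
      moreover have "ctx_proj C ?G 0 \<odot> u \<in> Hom C (Dom C w) A" using p0 u by (simp add: Hom_def)
      ultimately show "\<exists>w a. cover w \<and> Cod C w = Dom C x \<and> a \<in> Hom C (Dom C w) A \<and> sub_mem C \<rho> (pairing C a (x \<odot> w))"
        using w by blast
    qed
  next
    assume R: ?R
    show "valid [X] (Ex A ?in)" unfolding valid_def
    proof (intro ballI impI)
      fix y assume y: "y \<in> Mor C" "Cod C y = ctx_obj C [X]"
      let ?x = "pr2 C (terminal_obj C) X \<odot> y"
      have x: "?x \<in> Mor C" "Cod C ?x = X" "Dom C ?x = Dom C y" using y X by simp_all
      obtain w a where w: "cover w" "Cod C w = Dom C y" and a: "a \<in> Mor C" "Dom C a = Dom C w" "Cod C a = A"
        and m: "sub_mem C \<rho> (pairing C a (?x \<odot> w))" using R x unfolding Hom_def by force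
      have wM: "w \<in> Mor C" using w(1) by (rule cover_Mor)
      let ?u = "pairing C (y \<odot> w) a"
      have u: "?u \<in> Mor C" "Dom C ?u = Dom C w" "Cod C ?u = ctx_obj C ?G" "?pr \<odot> ?u = y \<odot> w"
        using y w(2) wM a X by simp_all
      have yw: "y \<odot> w \<in> Mor C" "Dom C (y \<odot> w) = Dom C w" "Cod C (y \<odot> w) = prod_obj C (terminal_obj C) X" using y w(2) wM by simp_all
      have "ctx_proj C ?G 0 \<odot> ?u = a" "ctx_proj C ?G 1 \<odot> ?u = ?x \<odot> w"
        using yw a X A wM w(2) y by simp_all
      then have "sub_mem C (fm_sem C ?in ?G) ?u" using m m1[OF u(1,3)] by simp
      then show "sub_mem C (fm_sem C (Ex A ?in) [X]) y"
        using mem_ex_along[OF pr c1 y] w u by auto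
    qed
  qed
  finally show ?thesis .
qed

text \<open>Atomic formulas are strict, so the last conjunct already yields the value of the
  application and absorbs \<open>Defined\<close>. No cover appears, because a partial morphism has a
  value outright wherever its domain contains the element.\<close>

lemma models_tracks:
  assumes A: "A \<in> Obj C" and X: "X \<in> Obj C" and \<rho>: "\<rho> \<in> carrier (Sub C (prod_obj C A X))"
    and \<sigma>: "\<sigma> \<in> carrier (Sub C (prod_obj C A Y))" and R: "R \<in> carrier (Sub C A)"
    and app: "app \<in> PMor C (prod_obj C A A) A" and f: "f \<in> Mor C" "Dom C f = X" "Cod C f = Y"
  shows "tracks C A app (X, \<rho>) (Y, \<sigma>) R f \<longleftrightarrow>
    (\<forall>Z. \<forall>r\<in>Hom C Z A. \<forall>b\<in>Hom C Z A. \<forall>x\<in>Hom C Z X. sub_mem C R r \<longrightarrow> sub_mem C \<rho> (pairing C b x) \<longrightarrow>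
      (\<exists>c. pm_val app (pairing C r b) c \<and> sub_mem C \<sigma> (pairing C c (f \<odot> x))))"
    (is "_ \<longleftrightarrow> ?R")
proof -
  let ?G = "[X, A, A]"
  have O: "ctx_obj C [] \<in> Obj C" "ctx_obj C [A] \<in> Obj C" "ctx_obj C [A, A] \<in> Obj C" "ctx_obj C ?G \<in> Obj C" using A X by simp_all
  have p0: "ctx_proj C ?G 0 \<in> Mor C" "Dom C (ctx_proj C ?G 0) = ctx_obj C ?G" "Cod C (ctx_proj C ?G 0) = X"
    and p1: "ctx_proj C ?G 1 \<in> Mor C" "Dom C (ctx_proj C ?G 1) = ctx_obj C ?G" "Cod C (ctx_proj C ?G 1) = A"
    and p2: "ctx_proj C ?G 2 \<in> Mor C" "Dom C (ctx_proj C ?G 2) = ctx_obj C ?G" "Cod C (ctx_proj C ?G 2) = A"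
    using A X by (simp_all add: numeral_2_eq_2)
  note v0 = pm_total_PMor[OF p0] and v1 = pm_total_PMor[OF p1] and v2 = pm_total_PMor[OF p2]
  note w0 = pm_val_total[OF p0] and w1 = pm_val_total[OF p1] and w2 = pm_val_total[OF p2]
  note t10 = pm_pair_PMor[OF v1 v0] and t21 = pm_pair_PMor[OF v2 v1]
  note ta = pm_comp_PMor[OF t21 app]
  note tf = pm_comp_PMor[OF v0 pm_total_PMor[OF f]]
  note tt = pm_pair_PMor[OF ta tf]
  let ?R' = "In (Var 2) R" and ?r = "In (Tup (Var 1) (Var 0)) \<rho>"
  let ?ap = "Fn app (Tup (Var 2) (Var 1))"
  let ?s = "In (Tup ?ap (Fn (pm_total C f) (Var 0))) \<sigma>"
  have c: "fm_sem C ?R' ?G \<in> carrier (Sub C (ctx_obj C ?G))" "fm_sem C ?r ?G \<in> carrier (Sub C (ctx_obj C ?G))"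
     "fm_sem C (Defined ?ap) ?G \<in> carrier (Sub C (ctx_obj C ?G))" "fm_sem C ?s ?G \<in> carrier (Sub C (ctx_obj C ?G))"
    unfolding fm_sem.simps tm_sem.simps
    by (rule pm_inv_im_carrier[OF v2 R] pm_inv_im_carrier[OF t10 \<rho>] pm_dom_carrier[OF ta] pm_inv_im_carrier[OF tt \<sigma>])+
  have mR: "sub_mem C (fm_sem C ?R' ?G) g \<longleftrightarrow> sub_mem C R (ctx_proj C ?G 2 \<odot> g)" (is ?m1)
    and mr: "sub_mem C (fm_sem C ?r ?G) g \<longleftrightarrow> sub_mem C \<rho> (pairing C (ctx_proj C ?G 1 \<odot> g) (ctx_proj C ?G 0 \<odot> g))" (is ?m2)
    and md: "sub_mem C (fm_sem C (Defined ?ap) ?G) g \<longleftrightarrow> (\<exists>c. pm_val app (pairing C (ctx_proj C ?G 2 \<odot> g) (ctx_proj C ?G 1 \<odot> g)) c)" (is ?m3)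
    and ms: "sub_mem C (fm_sem C ?s ?G) g \<longleftrightarrow> (\<exists>c. pm_val app (pairing C (ctx_proj C ?G 2 \<odot> g) (ctx_proj C ?G 1 \<odot> g)) c \<and>
        sub_mem C \<sigma> (pairing C c (f \<odot> ctx_proj C ?G 0 \<odot> g)))" (is ?m4)
    if g: "g \<in> Mor C" "Cod C g = ctx_obj C ?G" for g
  proof -
    show ?m1 using mem_pm_inv_im[OF v2 R g] w2[OF g] by simp
    show ?m2 using mem_pm_inv_im[OF t10 \<rho> g] pm_val_pair_iff[OF v1 v0 g] w0[OF g] w1[OF g] by simp
    show ?m3 using mem_pm_dom[OF ta g] pm_val_comp_iff[OF t21 app g] pm_val_pair_iff[OF v2 v1 g] w2[OF g] w1[OF g] by simp
    have xm: "ctx_proj C ?G 0 \<odot> g \<in> Mor C" "Cod C (ctx_proj C ?G 0 \<odot> g) = X" using p0 g by simp_all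
    have af: "pm_val (pm_comp C (pm_total C f) (pm_total C (ctx_proj C ?G 0))) g u \<longleftrightarrow> u = f \<odot> ctx_proj C ?G 0 \<odot> g" for u
      using pm_val_comp_iff[OF v0 pm_total_PMor[OF f] g] w0[OF g] pm_val_total[OF f xm] by simp
    have aa: "pm_val (pm_comp C app (pm_pair C (pm_total C (ctx_proj C ?G 2)) (pm_total C (ctx_proj C ?G 1)))) g u \<longleftrightarrow>
        pm_val app (pairing C (ctx_proj C ?G 2 \<odot> g) (ctx_proj C ?G 1 \<odot> g)) u" for u
      using pm_val_comp_iff[OF t21 app g] pm_val_pair_iff[OF v2 v1 g] w2[OF g] w1[OF g] by simp
    show ?m4 unfolding fm_sem.simps tm_sem.simps mem_pm_inv_im[OF tt \<sigma> g] pm_val_pair_iff[OF ta tf g] af aa by blast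
  qed
  note cA = fm_And_carrier[OF O(4) c(1,2)] and cB = fm_And_carrier[OF O(4) c(3,4)]
  note cI = valid_Imp(1)[OF O(4) cA cB]
  note c1 = fm_All_carrier[OF X O(3) cI]
  note c2 = fm_All_carrier[OF A O(2) c1]
  note c3 = fm_All_carrier[OF A O(1) c2]
  have "tracks C A app (X, \<rho>) (Y, \<sigma>) R f \<longleftrightarrow> valid ?G (Imp (And ?R' ?r) (And (Defined ?ap) ?s))"
    unfolding tracks_def prod.case
    using models_iff_valid[OF c3[unfolded ctx_obj.simps(1)]] valid_All[OF A O(1) c2] valid_All[OF A O(2) c1] valid_All[OF X O(3) cI] by simp
  also have "\<dots> \<longleftrightarrow> (\<forall>g\<in>Mor C. Cod C g = ctx_obj C ?G \<longrightarrow>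
      sub_mem C R (ctx_proj C ?G 2 \<odot> g) \<longrightarrow> sub_mem C \<rho> (pairing C (ctx_proj C ?G 1 \<odot> g) (ctx_proj C ?G 0 \<odot> g)) \<longrightarrow>
      (\<exists>c. pm_val app (pairing C (ctx_proj C ?G 2 \<odot> g) (ctx_proj C ?G 1 \<odot> g)) c \<and>
        sub_mem C \<sigma> (pairing C c (f \<odot> ctx_proj C ?G 0 \<odot> g))))" (is "_ \<longleftrightarrow> ?R2")
    unfolding valid_Imp(2)[OF O(4) cA cB]
    using mem_And[OF O(4) c(1,2)] mem_And[OF O(4) c(3,4)] mR mr md ms by auto
  also have "\<dots> \<longleftrightarrow> ?R"
  proof
    assume R2: ?R2
    show ?R
    proof (intro allI ballI impI)
      fix Z r b x assume "r \<in> Hom C Z A" "b \<in> Hom C Z A" "x \<in> Hom C Z X" and m: "sub_mem C R r" "sub_mem C \<rho> (pairing C b x)"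
      then have t: "r \<in> Mor C" "Dom C r = Z" "Cod C r = A" "b \<in> Mor C" "Dom C b = Z" "Cod C b = A" "x \<in> Mor C" "Dom C x = Z" "Cod C x = X" "Z \<in> Obj C"
        by (auto simp: Hom_def)
      let ?g = "pairing C (pairing C (pairing C (bang C Z) r) b) x"
      have g: "?g \<in> Mor C" "Cod C ?g = ctx_obj C ?G" using t by simp_all
      have "ctx_proj C ?G 0 \<odot> ?g = x" "ctx_proj C ?G 1 \<odot> ?g = b" "ctx_proj C ?G 2 \<odot> ?g = r"
        using t A X by (simp_all add: numeral_2_eq_2)
      with R2[rule_format, OF g] m
      show "\<exists>c. pm_val app (pairing C r b) c \<and> sub_mem C \<sigma> (pairing C c (f \<odot> x))" by simp
    qed
  next
    assume R: ?R
    show ?R2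
    proof (intro ballI impI)
      fix g assume g: "g \<in> Mor C" "Cod C g = ctx_obj C ?G"
      show "sub_mem C R (ctx_proj C ?G 2 \<odot> g) \<Longrightarrow> sub_mem C \<rho> (pairing C (ctx_proj C ?G 1 \<odot> g) (ctx_proj C ?G 0 \<odot> g)) \<Longrightarrow>
        (\<exists>c. pm_val app (pairing C (ctx_proj C ?G 2 \<odot> g) (ctx_proj C ?G 1 \<odot> g)) c \<and>
          sub_mem C \<sigma> (pairing C c (f \<odot> ctx_proj C ?G 0 \<odot> g)))"
        by (rule R[rule_format, of _ "Dom C g"])
          (use g p0 p1 p2 in \<open>simp_all add: Hom_def del: ctx_proj.simps ctx_obj.simps\<close>)
    qed
  qed
  finally show ?thesis .
qed

end

section \<open>Realizers\<close>

text \<open>Applicative polynomials without constants. Parameters from the filter are variables as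
  well; they receive the smallest indices and are instantiated later.\<close>

datatype pterm = PVar nat | PApp pterm pterm

primrec pvars :: "pterm \<Rightarrow> nat set" where
  "pvars (PVar i) = {i}"
| "pvars (PApp s t) = pvars s \<union> pvars t"

context finite_limit_category
begin

lemma HomD:
  assumes "f \<in> Hom C X Y" shows "f \<in> Mor C" "Dom C f = X" "Cod C f = Y"
  using assms by (auto simp: Hom_def)

lemma Hom_Obj: "f \<in> Hom C X Y \<Longrightarrow> X \<in> Obj C" "f \<in> Hom C X Y \<Longrightarrow> Y \<in> Obj C"
  by (auto simp: Hom_def)

lemma pairing_Hom: "f \<in> Hom C Z X \<Longrightarrow> g \<in> Hom C Z Y \<Longrightarrow> pairing C f g \<in> Hom C Z (prod_obj C X Y)"
  by (simp add: Hom_def)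

lemma Comp_Hom: "f \<in> Hom C X Y \<Longrightarrow> s \<in> Mor C \<Longrightarrow> Cod C s = X \<Longrightarrow> f \<odot> s \<in> Hom C (Dom C s) Y"
  by (simp add: Hom_def)

text \<open>Environments are total sequences, so that one sequence serves every arity; only the
  first \<open>n\<close> entries are read.\<close>

primrec tup :: "'a \<Rightarrow> (nat \<Rightarrow> 'b) \<Rightarrow> nat \<Rightarrow> 'b" where
  "tup Z e 0 = bang C Z"
| "tup Z e (Suc n) = pairing C (tup Z e n) (e n)"

lemma pow_simps:
  assumes "A \<in> Obj C"
  shows pow_Obj: "pow_obj C A n \<in> Obj C"
    and pow_proj_Hom: "i < n \<Longrightarrow> pow_proj C A n i \<in> Hom C (pow_obj C A n) A"
proof -
  have 1: "pow_obj C A n \<in> Obj C" for n by (induction n) (simp_all add: assms)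
  then show "pow_obj C A n \<in> Obj C" .
  show "i < n \<Longrightarrow> pow_proj C A n i \<in> Hom C (pow_obj C A n) A"
    by (induction n) (auto simp: Hom_def less_Suc_eq 1 assms)
qed

lemma tup:
  assumes A: "A \<in> Obj C" and Z: "Z \<in> Obj C"
  shows tup_Hom: "(\<And>i. i < n \<Longrightarrow> e i \<in> Hom C Z A) \<Longrightarrow> tup Z e n \<in> Hom C Z (pow_obj C A n)"
    and pow_proj_tup: "(\<And>i. i < n \<Longrightarrow> e i \<in> Hom C Z A) \<Longrightarrow> i < n \<Longrightarrow> pow_proj C A n i \<odot> tup Z e n = e i"
proof -
  have 1: "(\<And>i. i < n \<Longrightarrow> e i \<in> Hom C Z A) \<Longrightarrow> tup Z e n \<in> Hom C Z (pow_obj C A n)" for n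
    by (induction n) (simp_all add: Hom_def Z)
  then show "(\<And>i. i < n \<Longrightarrow> e i \<in> Hom C Z A) \<Longrightarrow> tup Z e n \<in> Hom C Z (pow_obj C A n)" .
  show "(\<And>i. i < n \<Longrightarrow> e i \<in> Hom C Z A) \<Longrightarrow> i < n \<Longrightarrow> pow_proj C A n i \<odot> tup Z e n = e i"
  proof (induction n)
    case (Suc n)
    have t: "tup Z e n \<in> Mor C" "Dom C (tup Z e n) = Z" "Cod C (tup Z e n) = pow_obj C A n"
      using HomD[OF 1[of n]] Suc.prems(1) by simp_all
    have en: "e n \<in> Mor C" "Dom C (e n) = Z" "Cod C (e n) = A" using HomD[OF Suc.prems(1)[of n]] by simp_all
    show ?case
    proof (cases "i = n")
      case True then show ?thesis using t en by simp
    next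
      case False
      then have i: "i < n" using Suc.prems(2) by simp
      note p = HomD[OF pow_proj_Hom[OF A i]]
      have "pow_proj C A n i \<odot> tup Z e n = e i" using Suc.IH Suc.prems(1) i by simp
      then show ?thesis using False t en p pow_Obj[OF A] A by simp
    qed
  qed simp
qed

end

section \<open>Application of generalized elements\<close>

locale partial_applicative = heyting_category +
  fixes A and app
  assumes pas: "partial_applicative_structure C A app"
begin

lemma A_Obj [simp]: "A \<in> Obj C"
  using pas by (simp add: partial_applicative_structure_def)

lemma app_PMor: "app \<in> PMor C (prod_obj C A A) A"
  using pas by (simp add: partial_applicative_structure_def)

text \<open>A relation rather than a function, since application is partial; uniqueness of the value
  is \<open>ap_fun\<close>.\<close>

definition ap :: "'b \<Rightarrow> 'b \<Rightarrow> 'b \<Rightarrow> bool"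
  where "ap a b c \<longleftrightarrow> pm_val app (pairing C a b) c"

primrec apps :: "'b \<Rightarrow> (nat \<Rightarrow> 'b) \<Rightarrow> nat \<Rightarrow> 'b \<Rightarrow> bool" where
  "apps r e 0 v \<longleftrightarrow> v = r"
| "apps r e (Suc k) v \<longleftrightarrow> (\<exists>u. apps r e k u \<and> ap u (e k) v)"

primrec evl :: "pterm \<Rightarrow> (nat \<Rightarrow> 'b) \<Rightarrow> 'b \<Rightarrow> bool" where
  "evl (PVar i) e v \<longleftrightarrow> v = e i"
| "evl (PApp s t) e v \<longleftrightarrow> (\<exists>a b. evl s e a \<and> evl t e b \<and> ap a b v)"

lemma ap_Hom: "a \<in> Hom C Z A \<Longrightarrow> b \<in> Hom C Z A \<Longrightarrow> ap a b c \<Longrightarrow> c \<in> Hom C Z A"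
  using pm_val_typed[OF app_PMor, of "pairing C a b" c] by (simp add: ap_def Hom_def)

lemma ap_fun: "a \<in> Hom C Z A \<Longrightarrow> b \<in> Hom C Z A \<Longrightarrow> ap a b c \<Longrightarrow> ap a b d \<Longrightarrow> c = d"
  using pm_val_fun[OF app_PMor, of "pairing C a b" c d] by (simp add: ap_def Hom_def)

lemma ap_comp:
  "a \<in> Hom C Z A \<Longrightarrow> b \<in> Hom C Z A \<Longrightarrow> ap a b c \<Longrightarrow> s \<in> Mor C \<Longrightarrow> Cod C s = Z \<Longrightarrow> ap (a \<odot> s) (b \<odot> s) (c \<odot> s)"
  using pm_val_comp[OF app_PMor, of "pairing C a b" c s] by (simp add: ap_def Hom_def)

lemma apps_Hom: "r \<in> Hom C Z A \<Longrightarrow> (\<And>i. i < k \<Longrightarrow> e i \<in> Hom C Z A) \<Longrightarrow> apps r e k v \<Longrightarrow> v \<in> Hom C Z A"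
  by (induction k arbitrary: v) (auto intro: ap_Hom)

lemma apps_fun:
  "r \<in> Hom C Z A \<Longrightarrow> (\<And>i. i < k \<Longrightarrow> e i \<in> Hom C Z A) \<Longrightarrow> apps r e k v \<Longrightarrow> apps r e k v' \<Longrightarrow> v = v'"
proof (induction k arbitrary: v v')
  case (Suc k)
  obtain u u' where u: "apps r e k u" "ap u (e k) v" "apps r e k u'" "ap u' (e k) v'" using Suc.prems by auto
  have "u = u'" by (rule Suc.IH) (use Suc.prems u in auto)
  moreover have "u \<in> Hom C Z A" by (rule apps_Hom[of r Z k e]) (use Suc.prems u in auto)
  ultimately show ?case using ap_fun[of u Z "e k"] u Suc.prems by auto
qed simp

lemma apps_comp:
  "r \<in> Hom C Z A \<Longrightarrow> (\<And>i. i < k \<Longrightarrow> e i \<in> Hom C Z A) \<Longrightarrow> apps r e k v \<Longrightarrow> s \<in> Mor C \<Longrightarrow> Cod C s = Z \<Longrightarrow>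
    apps (r \<odot> s) (\<lambda>i. e i \<odot> s) k (v \<odot> s)"
proof (induction k arbitrary: v)
  case (Suc k)
  obtain u where u: "apps r e k u" "ap u (e k) v" using Suc.prems by auto
  have "u \<in> Hom C Z A" by (rule apps_Hom[of r Z k e]) (use Suc.prems u in auto)
  moreover have "apps (r \<odot> s) (\<lambda>i. e i \<odot> s) k (u \<odot> s)" by (rule Suc.IH) (use Suc.prems u in auto)
  ultimately show ?case using ap_comp[OF _ _ u(2) Suc.prems(4,5)] Suc.prems(2)[of k] by auto
qed simp

lemma apps_cong: "(\<And>i. i < k \<Longrightarrow> e i = e' i) \<Longrightarrow> apps r e k v \<longleftrightarrow> apps r e' k v"
  by (induction k arbitrary: v) auto

text \<open>Separates the parameters supplied from the filter from the remaining arguments.\<close>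

lemma apps_add: "apps r e (k + m) v \<longleftrightarrow> (\<exists>x. apps r e k x \<and> apps x (\<lambda>j. e (k + j)) m v)"
  by (induction m arbitrary: v) auto

lemma app_tuple_sem:
  assumes Y: "Y = pow_obj C A m" and k: "k \<le> m"
  shows "tm_sem C [Y, A] (app_tuple C A app (Var 1) (Var 0) m k) \<in> PMor C (ctx_obj C [Y, A]) A"
    "g \<in> Mor C \<Longrightarrow> Cod C g = ctx_obj C [Y, A] \<Longrightarrow>
      pm_val (tm_sem C [Y, A] (app_tuple C A app (Var 1) (Var 0) m k)) g v \<longleftrightarrow>
      apps (ctx_proj C [Y, A] 1 \<odot> g) (\<lambda>i. pow_proj C A m i \<odot> ctx_proj C [Y, A] 0 \<odot> g) k v"
proof -
  let ?G = "[Y, A]"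
  have YO: "Y \<in> Obj C" using Y pow_Obj by simp
  have p0: "ctx_proj C ?G 0 \<in> Mor C" "Dom C (ctx_proj C ?G 0) = ctx_obj C ?G" "Cod C (ctx_proj C ?G 0) = Y"
    and p1: "ctx_proj C ?G 1 \<in> Mor C" "Dom C (ctx_proj C ?G 1) = ctx_obj C ?G" "Cod C (ctx_proj C ?G 1) = A"
    using YO by simp_all
  note v0 = pm_total_PMor[OF p0] and v1 = pm_total_PMor[OF p1]
  have "tm_sem C ?G (app_tuple C A app (Var 1) (Var 0) m k) \<in> PMor C (ctx_obj C ?G) A \<and>
    (\<forall>g v. g \<in> Mor C \<longrightarrow> Cod C g = ctx_obj C ?G \<longrightarrow>
      (pm_val (tm_sem C ?G (app_tuple C A app (Var 1) (Var 0) m k)) g v \<longleftrightarrow>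
      apps (ctx_proj C ?G 1 \<odot> g) (\<lambda>i. pow_proj C A m i \<odot> ctx_proj C ?G 0 \<odot> g) k v))"
    using k
  proof (induction k)
    case 0
    then show ?case using v1 pm_val_total[OF p1] by simp
  next
    case (Suc k)
    let ?t = "tm_sem C ?G (app_tuple C A app (Var 1) (Var 0) m k)"
    have t: "?t \<in> PMor C (ctx_obj C ?G) A"
      and tv: "\<And>g v. g \<in> Mor C \<Longrightarrow> Cod C g = ctx_obj C ?G \<Longrightarrow> pm_val ?t g v \<longleftrightarrow>
        apps (ctx_proj C ?G 1 \<odot> g) (\<lambda>i. pow_proj C A m i \<odot> ctx_proj C ?G 0 \<odot> g) k v"
      using Suc by auto
    have pp: "pow_proj C A m k \<in> Mor C" "Dom C (pow_proj C A m k) = Y" "Cod C (pow_proj C A m k) = A"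
      using HomD[OF pow_proj_Hom[OF A_Obj, of k m]] Suc.prems Y by simp_all
    note s = pm_comp_PMor[OF v0 pm_total_PMor[OF pp]]
    have sv: "pm_val (pm_comp C (pm_total C (pow_proj C A m k)) (pm_total C (ctx_proj C ?G 0))) g u \<longleftrightarrow>
        u = pow_proj C A m k \<odot> ctx_proj C ?G 0 \<odot> g" if g: "g \<in> Mor C" "Cod C g = ctx_obj C ?G" for g u
    proof -
      have xm: "ctx_proj C ?G 0 \<odot> g \<in> Mor C" "Cod C (ctx_proj C ?G 0 \<odot> g) = Y" using p0 g by simp_all
      show ?thesis
        using pm_val_comp_iff[OF v0 pm_total_PMor[OF pp] g] pm_val_total[OF p0 g] pm_val_total[OF pp xm] by simp
    qed
    note q = pm_pair_PMor[OF t s]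
    show ?case
      unfolding app_tuple.simps tm_sem.simps
      using pm_comp_PMor[OF q app_PMor] pm_val_comp_iff[OF q app_PMor] pm_val_pair_iff[OF t s] tv sv
      by (auto simp: ap_def)
  qed
  then show "tm_sem C [Y, A] (app_tuple C A app (Var 1) (Var 0) m k) \<in> PMor C (ctx_obj C [Y, A]) A"
    "g \<in> Mor C \<Longrightarrow> Cod C g = ctx_obj C [Y, A] \<Longrightarrow>
      pm_val (tm_sem C [Y, A] (app_tuple C A app (Var 1) (Var 0) m k)) g v \<longleftrightarrow>
      apps (ctx_proj C [Y, A] 1 \<odot> g) (\<lambda>i. pow_proj C A m i \<odot> ctx_proj C [Y, A] 0 \<odot> g) k v"
    by simp_all
qed

text \<open>Both formulas are read at the environment formed by \<open>r\<close> and the tuple of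
  \<open>e\<close>. The first keeps applications to fewer than \<open>n\<close> arguments defined
  even where \<open>f\<close> itself has no value.\<close>

lemma computableD:
  assumes comp: "computable C A app \<phi> n f" and f: "f \<in> PMor C (pow_obj C A n) A" and \<phi>: "\<phi> \<subseteq> carrier (Sub C A)"
  shows "\<exists>R\<in>\<phi>. \<forall>Z. \<forall>r\<in>Hom C Z A. \<forall>e. (\<forall>i<n. e i \<in> Hom C Z A) \<longrightarrow> sub_mem C R r \<longrightarrow>
    (\<exists>v. apps r e (n - 1) v) \<and> (\<forall>v. pm_val f (tup Z e n) v \<longrightarrow> apps r e n v)"
proof -
  let ?t = "\<lambda>m. app_tuple C A app (Var 1) (Var 0) m m"
  obtain R where R: "R \<in> \<phi>"
    and m1: "models C (All A (All (pow_obj C A (n - 1)) (Imp (In (Var 1) R) (Defined (?t (n - 1))))))"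
    and m2: "models C (All A (All (pow_obj C A n) (Imp (And (In (Var 1) R) (In (Var 0) (pm_dom f)))
          (And (Defined (?t n)) (Equal (?t n) (Fn f (Var 0)))))))"
    using comp unfolding computable_def by blast
  have RS: "R \<in> carrier (Sub C A)" using R \<phi> by blast
  let ?G = "\<lambda>m. [pow_obj C A m, A]"
  have PO: "pow_obj C A m \<in> Obj C" for m using pow_Obj by simp
  have O: "ctx_obj C [] \<in> Obj C" "ctx_obj C [A] \<in> Obj C" and OG: "\<And>m. ctx_obj C (?G m) \<in> Obj C" using PO by simp_all
  have p0: "ctx_proj C (?G m) 0 \<in> Mor C" "Dom C (ctx_proj C (?G m) 0) = ctx_obj C (?G m)" "Cod C (ctx_proj C (?G m) 0) = pow_obj C A m"
    and p1: "ctx_proj C (?G m) 1 \<in> Mor C" "Dom C (ctx_proj C (?G m) 1) = ctx_obj C (?G m)" "Cod C (ctx_proj C (?G m) 1) = A" for m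
    using PO[of m] by simp_all
  note v0 = pm_total_PMor[OF p0] and v1 = pm_total_PMor[OF p1]
  note w0 = pm_val_total[OF p0] and w1 = pm_val_total[OF p1]
  note ts = app_tuple_sem(1)[OF refl order_refl] and tv = app_tuple_sem(2)[OF refl order_refl]
  have cR: "fm_sem C (In (Var 1) R) (?G m) \<in> carrier (Sub C (ctx_obj C (?G m)))" for m
    using pm_inv_im_carrier[OF v1 RS] by simp
  have mR: "sub_mem C (fm_sem C (In (Var 1) R) (?G m)) g \<longleftrightarrow> sub_mem C R (ctx_proj C (?G m) 1 \<odot> g)"
    if g: "g \<in> Mor C" "Cod C g = ctx_obj C (?G m)" for g m
    using mem_pm_inv_im[OF v1 RS g] w1[OF g] by simp
  have cD: "fm_sem C (Defined (?t m)) (?G m) \<in> carrier (Sub C (ctx_obj C (?G m)))" for m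
    using pm_dom_carrier[OF ts] by simp
  have mD: "sub_mem C (fm_sem C (Defined (?t m)) (?G m)) g \<longleftrightarrow>
     (\<exists>v. apps (ctx_proj C (?G m) 1 \<odot> g) (\<lambda>i. pow_proj C A m i \<odot> ctx_proj C (?G m) 0 \<odot> g) m v)"
    if g: "g \<in> Mor C" "Cod C g = ctx_obj C (?G m)" for g m
    unfolding fm_sem.simps using mem_pm_dom[OF ts g] tv[OF g] by simp
  have cd: "fm_sem C (In (Var 0) (pm_dom f)) (?G n) \<in> carrier (Sub C (ctx_obj C (?G n)))"
    using pm_inv_im_carrier[OF v0 pm_dom_carrier[OF f]] by simp
  have md: "sub_mem C (fm_sem C (In (Var 0) (pm_dom f)) (?G n)) g \<longleftrightarrow> (\<exists>v. pm_val f (ctx_proj C (?G n) 0 \<odot> g) v)"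
    if g: "g \<in> Mor C" "Cod C g = ctx_obj C (?G n)" for g
    using mem_pm_inv_im[OF v0 pm_dom_carrier[OF f] g] w0[OF g] mem_pm_dom[OF f, of "ctx_proj C (?G n) 0 \<odot> g"] p0[of n] g
    by (simp del: ctx_proj.simps ctx_obj.simps)
  note fs = pm_comp_PMor[OF v0 f]
  have cE: "fm_sem C (Equal (?t n) (Fn f (Var 0))) (?G n) \<in> carrier (Sub C (ctx_obj C (?G n)))"
    unfolding fm_sem.simps tm_sem.simps(1,2) by (rule pm_eq_carrier[OF ts fs])
  have mE: "sub_mem C (fm_sem C (Equal (?t n) (Fn f (Var 0))) (?G n)) g \<longleftrightarrow>
     (\<exists>v. apps (ctx_proj C (?G n) 1 \<odot> g) (\<lambda>i. pow_proj C A n i \<odot> ctx_proj C (?G n) 0 \<odot> g) n v \<and> pm_val f (ctx_proj C (?G n) 0 \<odot> g) v)"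
    if g: "g \<in> Mor C" "Cod C g = ctx_obj C (?G n)" for g
    unfolding fm_sem.simps tm_sem.simps(1,2) mem_pm_eq[OF ts fs g] tv[OF g] pm_val_comp_iff[OF v0 f g] w0[OF g] by blast
  have env: "pairing C (pairing C (bang C Z) r) (tup Z e m) \<in> Mor C"
     "Cod C (pairing C (pairing C (bang C Z) r) (tup Z e m)) = ctx_obj C (?G m)"
     "ctx_proj C (?G m) 0 \<odot> pairing C (pairing C (bang C Z) r) (tup Z e m) = tup Z e m"
     "ctx_proj C (?G m) 1 \<odot> pairing C (pairing C (bang C Z) r) (tup Z e m) = r"
     "\<And>v k. k \<le> m \<Longrightarrow> apps r (\<lambda>i. pow_proj C A m i \<odot> tup Z e m) k v \<longleftrightarrow> apps r e k v"
    if r: "r \<in> Hom C Z A" and e0: "\<forall>i<m. e i \<in> Hom C Z A" for Z r e m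
  proof -
    have e: "\<And>i. i < m \<Longrightarrow> e i \<in> Hom C Z A" using e0 by simp
    have Z: "Z \<in> Obj C" using r by (rule Hom_Obj)
    note th = HomD[OF tup_Hom[OF A_Obj Z, of m e, OF e]] and rh = HomD[OF r]
    show "pairing C (pairing C (bang C Z) r) (tup Z e m) \<in> Mor C"
      "Cod C (pairing C (pairing C (bang C Z) r) (tup Z e m)) = ctx_obj C (?G m)"
      "ctx_proj C (?G m) 0 \<odot> pairing C (pairing C (bang C Z) r) (tup Z e m) = tup Z e m"
      "ctx_proj C (?G m) 1 \<odot> pairing C (pairing C (bang C Z) r) (tup Z e m) = r"
      using th rh Z PO[of m] by simp_all
    show "apps r (\<lambda>i. pow_proj C A m i \<odot> tup Z e m) k v \<longleftrightarrow> apps r e k v" if "k \<le> m" for v k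
      by (rule apps_cong) (use pow_proj_tup[OF A_Obj Z, of m e, OF e] that in auto)
  qed
  note cI1 = valid_Imp(1)[OF OG[of "n - 1"] cR cD]
  note c11 = fm_All_carrier[OF PO O(2) cI1]
  note c12 = fm_All_carrier[OF A_Obj O(1) c11]
  have V1: "valid (?G (n - 1)) (Imp (In (Var 1) R) (Defined (?t (n - 1))))"
    using m1 models_iff_valid[OF c12[unfolded ctx_obj.simps(1)]] valid_All[OF A_Obj O(1) c11] valid_All[OF PO O(2) cI1] by simp
  note cA = fm_And_carrier[OF OG cR cd] and cB = fm_And_carrier[OF OG cD cE]
  note cI2 = valid_Imp(1)[OF OG cA cB]
  note c21 = fm_All_carrier[OF PO O(2) cI2]
  note c22 = fm_All_carrier[OF A_Obj O(1) c21]
  have V2: "valid (?G n) (Imp (And (In (Var 1) R) (In (Var 0) (pm_dom f)))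
          (And (Defined (?t n)) (Equal (?t n) (Fn f (Var 0)))))"
    using m2 models_iff_valid[OF c22[unfolded ctx_obj.simps(1)]] valid_All[OF A_Obj O(1) c21] valid_All[OF PO O(2) cI2] by simp
  show ?thesis
  proof (intro bexI[OF _ R] allI ballI impI conjI)
    fix Z r e assume r: "r \<in> Hom C Z A" and e: "\<forall>i<n. e i \<in> Hom C Z A" and m: "sub_mem C R r"
    have e': "\<forall>i<n - 1. e i \<in> Hom C Z A" using e by simp
    note E = env[of r Z "n - 1" e, OF r e']
    show "\<exists>v. apps r e (n - 1) v"
      using V1[unfolded valid_Imp(2)[OF OG cR cD], rule_format, OF E(1,2)] m
      unfolding mR[OF E(1,2)] mD[OF E(1,2)] E(3,4) E(5)[OF order_refl] by blast
    fix v assume v: "pm_val f (tup Z e n) v"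
    have e'': "\<And>i. i < n \<Longrightarrow> e i \<in> Hom C Z A" using e by simp
    note E = env[of r Z n e, OF r e]
    have "\<exists>v. apps r e n v \<and> pm_val f (tup Z e n) v"
      using V2[unfolded valid_Imp(2)[OF OG cA cB], rule_format, OF E(1,2)] m v
      unfolding mem_And[OF OG cR cd E(1,2)] mem_And[OF OG cD cE E(1,2)] mR[OF E(1,2)] mE[OF E(1,2)] md[OF E(1,2)]
        E(3,4) E(5)[OF order_refl] by blast
    then obtain v' where v': "apps r e n v'" "pm_val f (tup Z e n) v'" by blast
    \<comment> \<open>The formula asserts that some common value exists; single-valuedness of
      \<open>f\<close> identifies it with the given one.\<close>
    have "v' = v" using pm_val_fun[OF f _ _ v'(2) v] HomD[OF tup_Hom[OF A_Obj Hom_Obj(1)[OF r] e'']] by simp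
    then show "apps r e n v" using v' by simp
  qed
qed

end

section \<open>Elements of the filter and abstraction with parameters\<close>

locale pca_filter = partial_applicative +
  fixes \<phi>
  assumes filt: "applicative_filter C A app \<phi>"
    and complete: "combinatory_complete C A app \<phi>"
begin

lemma filter_Sub: "R \<in> \<phi> \<Longrightarrow> R \<in> carrier (Sub C A)"
  using filt by (auto simp: applicative_filter_def)

text \<open>The image of \<open>Dom C m\<close> in the terminal object contains the cover
  \<open>bang\<close>, hence everything. Its reading at the unique arrow from \<open>Z\<close> gives
  a cover of \<open>Z\<close> with an element of \<open>m\<close>, which takes the place of pulling
  the cover back to \<open>Z\<close>.\<close>

lemma filter_inhabited:
  assumes R: "R \<in> \<phi>" and Z: "Z \<in> Obj C"
  shows "\<exists>w r. cover w \<and> Cod C w = Z \<and> r \<in> Hom C (Dom C w) A \<and> sub_mem C R r"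
proof -
  note RS = filter_Sub[OF R]
  obtain m where m: "m \<in> R" "regular_epi C (bang C (Dom C m))"
    using filt R by (auto simp: applicative_filter_def inhabited_sub_def inhabited_def)
  note mm = Sub_member[OF RS m(1)]
  let ?D = "Dom C m"
  have D: "?D \<in> Obj C" using mm by simp
  note b = bang_simps[OF D]
  note T = top_carrier[OF D]
  let ?E = "ex_along C (bang C ?D) (\<top>\<^bsub>Sub C ?D\<^esub>)"
  note E = ex_along_carrier[OF b T] and mE = mem_ex_along[OF b T]
  have "sub_mem C ?E (bang C ?D)"
    unfolding mE[OF b(1,3)] using cover_Ident[OF D] D mem_top[of "Ident C ?D"]
    by (intro exI[of _ "Ident C ?D"]) simp
  then have I: "sub_mem C ?E (Ident C (terminal_obj C))"
    using regular_epi_cover[OF m(2)] E b by (simp add: cover_def)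
  have "sub_mem C ?E (bang C Z)" using mem_comp[OF E I, of "bang C Z"] Z by simp
  then obtain w u where "cover w" "Cod C w = Z" "u \<in> Mor C" "Dom C u = Dom C w" "Cod C u = ?D"
    using mE[of "bang C Z"] Z by auto
  moreover from this have "sub_mem C R (m \<odot> u)" using mm(2,4) factorsI[of u "m \<odot> u" m] by simp
  ultimately show ?thesis using mm by (intro exI[of _ w] exI[of _ "m \<odot> u"]) (simp add: Hom_def)
qed

text \<open>Induction on the polynomial, together with the partial morphism it denotes: variables
  are projections and applications are pointwise applications, which are the two closure conditions
  of combinatory completeness.\<close>

lemma combinatory:
  assumes t: "pvars t \<subseteq> {..<n}" and n: "n \<ge> 1"
  shows "\<exists>R\<in>\<phi>. \<forall>Z. \<forall>r\<in>Hom C Z A. \<forall>e. (\<forall>i<n. e i \<in> Hom C Z A) \<longrightarrow> sub_mem C R r \<longrightarrow>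
    (\<exists>v. apps r e (n - 1) v) \<and> (\<forall>v. evl t e v \<longrightarrow> apps r e n v)"
proof -
  have "\<exists>f\<in>PMor C (pow_obj C A n) A. computable C A app \<phi> n f \<and>
    (\<forall>Z e v. Z \<in> Obj C \<longrightarrow> (\<forall>i<n. e i \<in> Hom C Z A) \<longrightarrow> (pm_val f (tup Z e n) v \<longleftrightarrow> evl t e v))"
    using t
  proof (induction t)
    case (PVar i)
    then have i: "i < n" by simp
    note p = HomD[OF pow_proj_Hom[OF A_Obj i]]
    have "computable C A app \<phi> n (pm_total C (pow_proj C A n i))"
      using complete n i by (simp add: combinatory_complete_def)
    moreover have "pm_val (pm_total C (pow_proj C A n i)) (tup Z e n) v \<longleftrightarrow> evl (PVar i) e v"
      if Z: "Z \<in> Obj C" and e: "\<forall>i<n. e i \<in> Hom C Z A" for Z e v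
      using pm_val_total[OF p HomD(1,3)[OF tup_Hom[OF A_Obj Z, of n e]]] e pow_proj_tup[OF A_Obj Z, of n e i] i by simp
    ultimately show ?case using pm_total_PMor[OF p] by blast
  next
    case (PApp s t)
    obtain f where f: "f \<in> PMor C (pow_obj C A n) A" "computable C A app \<phi> n f"
      and fv: "\<And>Z e v. Z \<in> Obj C \<Longrightarrow> \<forall>i<n. e i \<in> Hom C Z A \<Longrightarrow> pm_val f (tup Z e n) v \<longleftrightarrow> evl s e v"
      using PApp.IH(1) PApp.prems by auto
    obtain g where g: "g \<in> PMor C (pow_obj C A n) A" "computable C A app \<phi> n g"
      and gv: "\<And>Z e v. Z \<in> Obj C \<Longrightarrow> \<forall>i<n. e i \<in> Hom C Z A \<Longrightarrow> pm_val g (tup Z e n) v \<longleftrightarrow> evl t e v"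
      using PApp.IH(2) PApp.prems by auto
    note q = pm_pair_PMor[OF f(1) g(1)]
    have "computable C A app \<phi> n (pm_comp C app (pm_pair C f g))"
      using complete n f g by (simp add: combinatory_complete_def)
    moreover have "pm_val (pm_comp C app (pm_pair C f g)) (tup Z e n) v \<longleftrightarrow> evl (PApp s t) e v"
      if Z: "Z \<in> Obj C" and e: "\<forall>i<n. e i \<in> Hom C Z A" for Z e v
    proof -
      have th: "tup Z e n \<in> Mor C" "Cod C (tup Z e n) = pow_obj C A n"
        using HomD(1,3)[OF tup_Hom[OF A_Obj Z, of n e]] e by simp_all
      show ?thesis
        unfolding pm_val_comp_iff[OF q app_PMor th] pm_val_pair_iff[OF f(1) g(1) th] fv[OF Z e] gv[OF Z e] evl.simps ap_def
        by blast
    qed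
    ultimately show ?case using pm_comp_PMor[OF q app_PMor] by blast
  qed
  then obtain f where f: "f \<in> PMor C (pow_obj C A n) A" "computable C A app \<phi> n f"
    and fv: "\<And>Z e v. Z \<in> Obj C \<Longrightarrow> \<forall>i<n. e i \<in> Hom C Z A \<Longrightarrow> pm_val f (tup Z e n) v \<longleftrightarrow> evl t e v" by blast
  obtain R where R: "R \<in> \<phi>" "\<And>Z r e. r \<in> Hom C Z A \<Longrightarrow> \<forall>i<n. e i \<in> Hom C Z A \<Longrightarrow> sub_mem C R r \<Longrightarrow>
    (\<exists>v. apps r e (n - 1) v) \<and> (\<forall>v. pm_val f (tup Z e n) v \<longrightarrow> apps r e n v)"
    using computableD[OF f(2,1)] filter_Sub by blast
  show ?thesis using R(2) fv Hom_Obj(1) by (intro bexI[OF _ R(1)]) blast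
qed

text \<open>The domain of application is a subobject, so definedness is local.\<close>

lemma ap_local:
  assumes "cover w" "Cod C w = Z" "a \<in> Hom C Z A" "b \<in> Hom C Z A" "ap (a \<odot> w) (b \<odot> w) c"
  shows "\<exists>c. ap a b c"
proof -
  have wM: "w \<in> Mor C" using assms(1) by (rule cover_Mor)
  have ab: "pairing C a b \<in> Mor C" "Cod C (pairing C a b) = prod_obj C A A" "Dom C (pairing C a b) = Z"
    "pairing C a b \<odot> w = pairing C (a \<odot> w) (b \<odot> w)"
    using assms wM by (simp_all add: Hom_def)
  have "sub_mem C (pm_dom app) (pairing C a b \<odot> w)"
    using mem_pm_dom[OF app_PMor, of "pairing C a b \<odot> w"] assms(5) ab wM assms(2) HomD[OF assms(3)] HomD[OF assms(4)]
    by (auto simp: ap_def)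
  then have "sub_mem C (pm_dom app) (pairing C a b)"
    using cover_mem[OF assms(1) pm_dom_carrier[OF app_PMor] ab(1,2)] ab assms(2) by simp
  then show ?thesis using mem_pm_dom[OF app_PMor ab(1,2)] by (simp add: ap_def)
qed

text \<open>The closure condition of the filter in terms of elements. Hypothesis \<open>d\<close>
  amounts to the inclusion of \<open>sub_prod C T S\<close> in the domain; the image is an
  existential, so its elements are products only locally.\<close>

lemma filter_image:
  assumes T: "T \<in> \<phi>" and S: "S \<in> \<phi>"
    and d: "\<And>Z t s. t \<in> Hom C Z A \<Longrightarrow> s \<in> Hom C Z A \<Longrightarrow> sub_mem C T t \<Longrightarrow> sub_mem C S s \<Longrightarrow> \<exists>v. ap t s v"
  shows "\<exists>T'\<in>\<phi>. \<forall>Z. \<forall>u\<in>Hom C Z A. sub_mem C T' u \<longrightarrow> (\<exists>w t s. cover w \<and> Cod C w = Z \<and>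
    t \<in> Hom C (Dom C w) A \<and> s \<in> Hom C (Dom C w) A \<and> sub_mem C T t \<and> sub_mem C S s \<and> ap t s (u \<odot> w))"
proof -
  note TS = filter_Sub[OF T] and SS = filter_Sub[OF S]
  let ?W = "sub_prod C T S"
  note W = sub_prod_carrier[OF TS SS] and mW = mem_sub_prod[OF TS SS]
  have "\<exists>v. pm_val app x v" if x: "x \<in> Mor C" "Cod C x = prod_obj C A A" "sub_mem C ?W x" for x
  proof -
    have "\<exists>v. ap (pr1 C A A \<odot> x) (pr2 C A A \<odot> x) v"
      by (rule d[of _ "Dom C x"]) (use mW[OF x(1,2)] x in \<open>simp_all add: Hom_def\<close>)
    then show ?thesis using pairing_eta[OF A_Obj A_Obj x(1,2)] by (simp add: ap_def)
  qed
  then have "?W \<sqsubseteq>\<^bsub>Sub C (prod_obj C A A)\<^esub> pm_dom app"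
    unfolding Sub_le_iff[OF W pm_dom_carrier[OF app_PMor]] using mem_pm_dom[OF app_PMor] by simp
  then have I: "pm_image C app ?W \<in> \<phi>" using filt T S by (simp add: applicative_filter_def)
  show ?thesis
  proof (intro bexI[OF _ I] allI ballI impI)
    fix Z u assume u: "u \<in> Hom C Z A" and mu: "sub_mem C (pm_image C app ?W) u"
    note uH = HomD[OF u]
    obtain k m f where k: "factors_through C u k" "(m, f) \<in> app" "k \<in> ex_along C f (inv_im C m ?W)"
      using mu by (auto simp: sub_mem_def pm_image_def)
    note M = PMor_member[OF app_PMor k(2)]
    note iW = inv_im_carrier[OF M(2) refl M(3) W]
    have me: "sub_mem C (ex_along C f (inv_im C m ?W)) u" using k by (auto simp: sub_mem_def)
    obtain w h where w: "cover w" "Cod C w = Z" and h: "h \<in> Mor C" "Dom C h = Dom C w" "Cod C h = Dom C m"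
      "f \<odot> h = u \<odot> w" "sub_mem C (inv_im C m ?W) h"
      using mem_ex_along[OF M(4-6) iW uH(1,3)] me uH(2) by auto
    have "sub_mem C ?W (m \<odot> h)" using mem_inv_im[OF M(2) refl M(3) W h(1,3)] h(5) by simp
    then have mm: "sub_mem C T (pr1 C A A \<odot> m \<odot> h)" "sub_mem C S (pr2 C A A \<odot> m \<odot> h)"
      using mW[of "m \<odot> h"] M h by simp_all
    have x: "m \<odot> h \<in> Mor C" "Cod C (m \<odot> h) = prod_obj C A A" "Dom C (m \<odot> h) = Dom C w" using M h by simp_all
    have "span_val m f (m \<odot> h) (u \<odot> w)" using h M by (intro span_valI[of h]) simp_all
    then have "pm_val app (m \<odot> h) (u \<odot> w)" using M(7)[OF x(1,2)] by simp
    then have "ap (pr1 C A A \<odot> m \<odot> h) (pr2 C A A \<odot> m \<odot> h) (u \<odot> w)"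
      using pairing_eta[OF A_Obj A_Obj x(1,2)] by (simp add: ap_def)
    moreover have "pr1 C A A \<odot> m \<odot> h \<in> Hom C (Dom C w) A" "pr2 C A A \<odot> m \<odot> h \<in> Hom C (Dom C w) A"
      using x by (simp_all add: Hom_def)
    ultimately show "\<exists>w t s. cover w \<and> Cod C w = Z \<and> t \<in> Hom C (Dom C w) A \<and> s \<in> Hom C (Dom C w) A \<and>
        sub_mem C T t \<and> sub_mem C S s \<and> ap t s (u \<odot> w)"
      using w mm by blast
  qed
qed

text \<open>Iterates \<open>filter_image\<close> over the arguments. At each step all products must
  be defined before the filter may be closed under them, which is why \<open>acts\<close> speaks of
  arbitrary arguments from \<open>A\<close>.\<close>

lemma filter_apps:
  assumes T: "T \<in> \<phi>" and Rs: "\<And>i. i < k \<Longrightarrow> Rs i \<in> \<phi>"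
    and acts: "\<And>Z r e. r \<in> Hom C Z A \<Longrightarrow> \<forall>i<k. e i \<in> Hom C Z A \<Longrightarrow> sub_mem C T r \<Longrightarrow> \<exists>v. apps r e k v"
  shows "\<exists>T'\<in>\<phi>. \<forall>Z. \<forall>u\<in>Hom C Z A. sub_mem C T' u \<longrightarrow> (\<exists>w r e. cover w \<and> Cod C w = Z \<and>
    r \<in> Hom C (Dom C w) A \<and> sub_mem C T r \<and>
    (\<forall>i<k. e i \<in> Hom C (Dom C w) A \<and> sub_mem C (Rs i) (e i)) \<and> apps r e k (u \<odot> w))"
  using Rs acts
proof (induction k)
  case 0
  show ?case
  proof (intro bexI[OF _ T] allI ballI impI)
    fix Z u assume u: "u \<in> Hom C Z A" "sub_mem C T u"
    then show "\<exists>w r e. cover w \<and> Cod C w = Z \<and> r \<in> Hom C (Dom C w) A \<and> sub_mem C T r \<and>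
      (\<forall>i<0. e i \<in> Hom C (Dom C w) A \<and> sub_mem C (Rs i) (e i)) \<and> apps r e 0 (u \<odot> w)"
      using cover_Ident[OF Hom_Obj(1)[OF u(1)]] Hom_Obj(1)[OF u(1)] HomD[OF u(1)]
      by (intro exI[of _ "Ident C Z"] exI[of _ u]) simp
  qed
next
  case (Suc k)
  have "\<exists>T'\<in>\<phi>. \<forall>Z. \<forall>u\<in>Hom C Z A. sub_mem C T' u \<longrightarrow> (\<exists>w r e. cover w \<and> Cod C w = Z \<and>
    r \<in> Hom C (Dom C w) A \<and> sub_mem C T r \<and>
    (\<forall>i<k. e i \<in> Hom C (Dom C w) A \<and> sub_mem C (Rs i) (e i)) \<and> apps r e k (u \<odot> w))"
  proof (rule Suc.IH)
    show "Rs i \<in> \<phi>" if "i < k" for i using Suc.prems(1) that by simp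
    fix Z r e assume r: "r \<in> Hom C Z A" "\<forall>i<k. e i \<in> Hom C Z A" "sub_mem C T r"
    \<comment> \<open>Some element of \<open>A\<close> is wanted as the last argument at stage
      \<open>Z\<close>; \<open>r\<close> is at hand.\<close>
    have "\<exists>v. apps r (e(k := r)) (Suc k) v" by (rule Suc.prems(2)) (use r in \<open>auto simp: less_Suc_eq\<close>)
    then obtain v where "apps r (e(k := r)) k v" unfolding apps.simps by blast
    then show "\<exists>v. apps r e k v" using apps_cong[of k "e(k := r)" e] by auto
  qed
  then obtain T1 where T1: "T1 \<in> \<phi>" and T1e: "\<And>Z u. u \<in> Hom C Z A \<Longrightarrow> sub_mem C T1 u \<Longrightarrow> (\<exists>w r e. cover w \<and> Cod C w = Z \<and>
    r \<in> Hom C (Dom C w) A \<and> sub_mem C T r \<and>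
    (\<forall>i<k. e i \<in> Hom C (Dom C w) A \<and> sub_mem C (Rs i) (e i)) \<and> apps r e k (u \<odot> w))" by blast
  have Rk: "Rs k \<in> \<phi>" using Suc.prems(1) by simp
  have d: "\<exists>v. ap t s v" if t: "t \<in> Hom C Z A" "sub_mem C T1 t" and s: "s \<in> Hom C Z A" "sub_mem C (Rs k) s" for Z t s
  proof -
    obtain w r e where w: "cover w" "Cod C w = Z" "r \<in> Hom C (Dom C w) A" "sub_mem C T r"
      "\<forall>i<k. e i \<in> Hom C (Dom C w) A \<and> sub_mem C (Rs i) (e i)" "apps r e k (t \<odot> w)"
      using T1e[OF t] by blast
    have wM: "w \<in> Mor C" using w(1) by (rule cover_Mor)
    let ?e = "e(k := s \<odot> w)"
    have eH: "\<forall>i<Suc k. ?e i \<in> Hom C (Dom C w) A" using w(5) Comp_Hom[OF s(1) wM w(2)] by (simp add: less_Suc_eq)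
    obtain v u where u: "apps r ?e k u" "ap u (s \<odot> w) v" 
      using Suc.prems(2)[OF w(3) eH w(4)] unfolding apps.simps fun_upd_same by blast
    have "apps r ?e k (t \<odot> w)" using apps_cong[of k e ?e] w(6) by auto
    moreover have "?e i \<in> Hom C (Dom C w) A" if "i < k" for i using w(5) that by simp
    \<comment> \<open>The element \<open>t\<close> of \<open>T1\<close> is known as an iterated
      application only after \<open>w\<close>; the product is therefore shown to be defined there,
      and definedness descends.\<close>
    ultimately have "u = t \<odot> w" using apps_fun[OF w(3), of k ?e] u(1) by blast
    then show ?thesis using ap_local[OF w(1,2) t(1) s(1)] u(2) by simp
  qed
  obtain T' where T': "T' \<in> \<phi>" "\<And>Z u. u \<in> Hom C Z A \<Longrightarrow> sub_mem C T' u \<Longrightarrow> (\<exists>w t s. cover w \<and> Cod C w = Z \<and>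
    t \<in> Hom C (Dom C w) A \<and> s \<in> Hom C (Dom C w) A \<and> sub_mem C T1 t \<and> sub_mem C (Rs k) s \<and> ap t s (u \<odot> w))"
    using filter_image[OF T1 Rk] d by blast
  show ?case
  proof (intro bexI[OF _ T'(1)] allI ballI impI)
    fix Z u assume u: "u \<in> Hom C Z A" "sub_mem C T' u"
    obtain w t s where w: "cover w" "Cod C w = Z" and t: "t \<in> Hom C (Dom C w) A" "sub_mem C T1 t"
      and s: "s \<in> Hom C (Dom C w) A" "sub_mem C (Rs k) s" and a: "ap t s (u \<odot> w)"
      using T'(2)[OF u] by blast
    obtain w' r e where w': "cover w'" "Cod C w' = Dom C w" "r \<in> Hom C (Dom C w') A" "sub_mem C T r"
      "\<forall>i<k. e i \<in> Hom C (Dom C w') A \<and> sub_mem C (Rs i) (e i)" "apps r e k (t \<odot> w')"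
      using T1e[OF t] by blast
    have wM: "w \<in> Mor C" "w' \<in> Mor C" using w(1) w'(1) by (auto dest: cover_Mor)
    let ?e = "e(k := s \<odot> w')"
    have 1: "apps r ?e k (t \<odot> w')" using apps_cong[of k e ?e] w'(6) by auto
    have "ap (t \<odot> w') (s \<odot> w') ((u \<odot> w) \<odot> w')" using ap_comp[OF t(1) s(1) a wM(2) w'(2)] .
    then have "ap (t \<odot> w') (s \<odot> w') (u \<odot> w \<odot> w')" using wM w w'(2) HomD[OF u(1)] by simp
    then have 2: "apps r ?e (Suc k) (u \<odot> w \<odot> w')" using 1 unfolding apps.simps fun_upd_same by blast
    have ms: "sub_mem C (Rs k) (s \<odot> w')"
      using mem_comp[OF filter_Sub[OF Rk] s(2)] HomD[OF s(1)] wM w'(2) by simp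
    have eH: "\<forall>i<Suc k. ?e i \<in> Hom C (Dom C w') A \<and> sub_mem C (Rs i) (?e i)"
      using w'(5) ms Comp_Hom[OF s(1) wM(2) w'(2)] by (simp add: less_Suc_eq)
    have ww: "Dom C (w \<odot> w') = Dom C w'" "Cod C (w \<odot> w') = Z" using wM w w'(2) by simp_all
    show "\<exists>w r e. cover w \<and> Cod C w = Z \<and> r \<in> Hom C (Dom C w) A \<and> sub_mem C T r \<and>
      (\<forall>i<Suc k. e i \<in> Hom C (Dom C w) A \<and> sub_mem C (Rs i) (e i)) \<and> apps r e (Suc k) (u \<odot> w)"
      by (intro exI[of _ "w \<odot> w'"] exI[of _ r] exI[of _ ?e]) (use cover_comp[OF w'(1) w(1) w'(2)] ww w' eH 2 in simp)
  qed
qed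

text \<open>Abstraction with parameters: the combinator of a polynomial in \<open>k + n\<close>
  variables is applied to \<open>k\<close> filter sets. Since \<open>n \<ge> 1\<close>, at least one
  argument stays open, so these applications are always defined and the result is again in the
  filter. The realizer acts at every stage \<open>s\<close> over the cover.\<close>

lemma realizer:
  assumes Rs: "\<And>i. i < k \<Longrightarrow> Rs i \<in> \<phi>" and t: "pvars t \<subseteq> {..<k + n}" and n: "n \<ge> 1"
  shows "\<exists>T\<in>\<phi>. \<forall>Z. \<forall>u\<in>Hom C Z A. sub_mem C T u \<longrightarrow> (\<exists>w e. cover w \<and> Cod C w = Z \<and>
    (\<forall>i<k. e i \<in> Hom C (Dom C w) A \<and> sub_mem C (Rs i) (e i)) \<and>
    (\<forall>s d. s \<in> Mor C \<longrightarrow> Cod C s = Dom C w \<longrightarrow> (\<forall>j<n. d j \<in> Hom C (Dom C s) A) \<longrightarrow>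
      (\<exists>v. apps (u \<odot> w \<odot> s) d (n - 1) v) \<and>
      (\<forall>v. evl t (\<lambda>i. if i < k then e i \<odot> s else d (i - k)) v \<longrightarrow> apps (u \<odot> w \<odot> s) d n v)))"
proof -
  obtain T where T: "T \<in> \<phi>" "\<And>Z r e. r \<in> Hom C Z A \<Longrightarrow> (\<forall>i<k + n. e i \<in> Hom C Z A) \<Longrightarrow> sub_mem C T r \<Longrightarrow>
    (\<exists>v. apps r e (k + n - 1) v) \<and> (\<forall>v. evl t e v \<longrightarrow> apps r e (k + n) v)"
    using combinatory[OF t] n by auto
  have kn: "k + n - 1 = k + (n - 1)" using n by simp
  have acts: "\<exists>v. apps r e k v" if r: "r \<in> Hom C Z A" "\<forall>i<k. e i \<in> Hom C Z A" "sub_mem C T r" for Z r e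
  proof -
    \<comment> \<open>The arguments beyond the parameters are filled with \<open>r\<close>; only
      definedness of the first \<open>k\<close> applications is extracted.\<close>
    let ?e = "\<lambda>i. if i < k then e i else r"
    have "\<exists>v. apps r ?e (k + n - 1) v" using T(2)[OF r(1) _ r(3), of ?e] r by simp
    then obtain v where "apps r ?e k v" unfolding kn apps_add by blast
    then show ?thesis using apps_cong[of k ?e e] by auto
  qed
  obtain T' where T': "T' \<in> \<phi>" "\<And>Z u. u \<in> Hom C Z A \<Longrightarrow> sub_mem C T' u \<Longrightarrow> (\<exists>w r e. cover w \<and> Cod C w = Z \<and>
    r \<in> Hom C (Dom C w) A \<and> sub_mem C T r \<and>
    (\<forall>i<k. e i \<in> Hom C (Dom C w) A \<and> sub_mem C (Rs i) (e i)) \<and> apps r e k (u \<odot> w))"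
  proof -
    have "\<exists>T'\<in>\<phi>. \<forall>Z. \<forall>u\<in>Hom C Z A. sub_mem C T' u \<longrightarrow> (\<exists>w r e. cover w \<and> Cod C w = Z \<and>
      r \<in> Hom C (Dom C w) A \<and> sub_mem C T r \<and>
      (\<forall>i<k. e i \<in> Hom C (Dom C w) A \<and> sub_mem C (Rs i) (e i)) \<and> apps r e k (u \<odot> w))"
      by (rule filter_apps[OF T(1)]) (simp_all add: Rs acts)
    then show thesis using that by blast
  qed
  show ?thesis
  proof (intro bexI[OF _ T'(1)] allI ballI impI)
    fix Z u assume u: "u \<in> Hom C Z A" "sub_mem C T' u"
    obtain w r e where w: "cover w" "Cod C w = Z" "r \<in> Hom C (Dom C w) A" "sub_mem C T r"
      "\<forall>i<k. e i \<in> Hom C (Dom C w) A \<and> sub_mem C (Rs i) (e i)" "apps r e k (u \<odot> w)"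
      using T'(2)[OF u] by blast
    have wM: "w \<in> Mor C" using w(1) by (rule cover_Mor)
    have "(\<exists>v. apps (u \<odot> w \<odot> s) d (n - 1) v) \<and>
      (\<forall>v. evl t (\<lambda>i. if i < k then e i \<odot> s else d (i - k)) v \<longrightarrow> apps (u \<odot> w \<odot> s) d n v)"
      if s: "s \<in> Mor C" "Cod C s = Dom C w" and d: "\<forall>j<n. d j \<in> Hom C (Dom C s) A" for s d
    proof -
      let ?e = "\<lambda>i. if i < k then e i \<odot> s else d (i - k)"
      have rs: "r \<odot> s \<in> Hom C (Dom C s) A" "sub_mem C T (r \<odot> s)"
        using Comp_Hom[OF w(3) s] mem_comp[OF filter_Sub[OF T(1)] w(4)] HomD[OF w(3)] s by simp_all
      have eH: "\<forall>i<k + n. ?e i \<in> Hom C (Dom C s) A" using Comp_Hom[OF _ s] w(5) d by simp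
      have "apps (r \<odot> s) (\<lambda>i. e i \<odot> s) k ((u \<odot> w) \<odot> s)" using apps_comp[OF w(3) _ w(6) s] w(5) by simp
      then have "apps (r \<odot> s) (\<lambda>i. e i \<odot> s) k (u \<odot> w \<odot> s)" using HomD[OF u(1)] w(2) wM s by simp
      then have a: "apps (r \<odot> s) ?e k (u \<odot> w \<odot> s)" using apps_cong[of k ?e "\<lambda>i. e i \<odot> s"] by simp
      \<comment> \<open>The restriction of \<open>u\<close> is the only value of the first
        \<open>k\<close> applications, so a splitting by \<open>apps_add\<close> has to pass through
        it.\<close>
      have un: "x = u \<odot> w \<odot> s" if "apps (r \<odot> s) ?e k x" for x
        by (rule apps_fun[OF rs(1) _ that a]) (use w(5) Comp_Hom[OF _ s] in simp)
      have sh: "(\<lambda>j. ?e (k + j)) = d" by auto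
      have "\<exists>v. apps (r \<odot> s) ?e (k + (n - 1)) v" using T(2)[OF rs(1) eH rs(2)] kn by simp
      then have 1: "\<exists>v. apps (u \<odot> w \<odot> s) d (n - 1) v" unfolding apps_add sh using un by blast
      have "apps (u \<odot> w \<odot> s) d n v" if "evl t ?e v" for v
      proof -
        have "apps (r \<odot> s) ?e (k + n) v" using T(2)[OF rs(1) eH rs(2)] that by blast
        then show ?thesis unfolding apps_add sh using un by blast
      qed
      with 1 show ?thesis by blast
    qed
    then show "\<exists>w e. cover w \<and> Cod C w = Z \<and>
      (\<forall>i<k. e i \<in> Hom C (Dom C w) A \<and> sub_mem C (Rs i) (e i)) \<and>
      (\<forall>s d. s \<in> Mor C \<longrightarrow> Cod C s = Dom C w \<longrightarrow> (\<forall>j<n. d j \<in> Hom C (Dom C s) A) \<longrightarrow>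
        (\<exists>v. apps (u \<odot> w \<odot> s) d (n - 1) v) \<and>
        (\<forall>v. evl t (\<lambda>i. if i < k then e i \<odot> s else d (i - k)) v \<longrightarrow> apps (u \<odot> w \<odot> s) d n v))"
      using w by (intro exI[of _ w] exI[of _ e]) blast
  qed
qed

end

section \<open>Realizability predicates\<close>

lemma (in category) representable_cong:
  assumes "\<And>x. x \<in> Mor C \<Longrightarrow> Cod C x = X \<Longrightarrow> Q x \<longleftrightarrow> Q' x" "representable C X Q"
  shows "representable C X Q'"
  by (rule representableE[OF assms(2)]) (rule representableI, use assms(1) in auto)

context partial_applicative
begin

text \<open>Only values at pairs of arrows with a common domain count; elsewhere \<alpha> is
  arbitrary. Hence predicates are compared by equivalences on typed arguments, as in
  \<open>ent_cong\<close>, and not as functions.\<close>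

definition pred :: "'a \<Rightarrow> ('b \<Rightarrow> 'b \<Rightarrow> bool) \<Rightarrow> bool"
  where "pred X \<alpha> \<longleftrightarrow> X \<in> Obj C \<and> representable C (prod_obj C A X) (\<lambda>p. \<alpha> (pr1 C A X \<odot> p) (pr2 C A X \<odot> p))"

lemma pred_Obj: "pred X \<alpha> \<Longrightarrow> X \<in> Obj C"
  by (simp add: pred_def)

text \<open>For fixed arguments the stages at which \<alpha> holds form a subobject of
  \<open>Z\<close>; stability under change of stage and locality are read off from it.\<close>

lemma pred_representable:
  assumes p: "pred X \<alpha>" and a: "a \<in> Hom C Z A" and x: "x \<in> Hom C Z X"
  shows "representable C Z (\<lambda>s. \<alpha> (a \<odot> s) (x \<odot> s))"
proof -
  have X: "X \<in> Obj C" using p by (rule pred_Obj)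
  note aH = HomD[OF a] and xH = HomD[OF x]
  note pH = HomD[OF pairing_Hom[OF a x]]
  have "representable C (prod_obj C A X) (\<lambda>p. \<alpha> (pr1 C A X \<odot> p) (pr2 C A X \<odot> p))" using p by (simp add: pred_def)
  from representable_inv_im[OF pH this] show ?thesis
    by (rule representable_cong[rotated]) (use X aH xH in simp)
qed

lemma pred_comp:
  assumes "pred X \<alpha>" "a \<in> Hom C Z A" "x \<in> Hom C Z X" "\<alpha> a x" "s \<in> Mor C" "Cod C s = Z"
  shows "\<alpha> (a \<odot> s) (x \<odot> s)"
proof -
  note r = pred_representable[OF assms(1-3)] and Z = Hom_Obj(1)[OF assms(2)]
  from representable_comp[OF r, of "Ident C Z" s] show ?thesis
    using assms Z HomD[OF assms(2)] HomD[OF assms(3)] by simp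
qed

lemma pred_local:
  assumes "pred X \<alpha>" "a \<in> Hom C Z A" "x \<in> Hom C Z X" "cover w" "Cod C w = Z" "\<alpha> (a \<odot> w) (x \<odot> w)"
  shows "\<alpha> a x"
proof -
  note r = pred_representable[OF assms(1-3)] and Z = Hom_Obj(1)[OF assms(2)]
  from cover_representable[OF assms(4) r, of "Ident C Z"] show ?thesis
    using assms Z cover_Mor[OF assms(4)] HomD[OF assms(2)] HomD[OF assms(3)] by simp
qed

lemma predI:
  assumes "X \<in> Obj C" "representable C (prod_obj C A X) Q"
    "\<And>p. p \<in> Mor C \<Longrightarrow> Cod C p = prod_obj C A X \<Longrightarrow> Q p \<longleftrightarrow> \<alpha> (pr1 C A X \<odot> p) (pr2 C A X \<odot> p)"
  shows "pred X \<alpha>"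
  unfolding pred_def using assms(1) representable_cong[OF assms(3,2)] by simp

lemma pred_True: "X \<in> Obj C \<Longrightarrow> pred X (\<lambda>a x. True)"
  by (rule predI[OF _ representable_True]) simp_all

lemma pred_Sub:
  assumes X: "X \<in> Obj C" and U: "U \<in> carrier (Sub C (prod_obj C A X))"
  shows "pred X (\<lambda>a x. sub_mem C U (pairing C a x))"
  by (rule predI[OF X representable_Sub[OF U refl]]) (simp add: pairing_eta X)

lemma pred_SubE:
  assumes p: "pred X \<alpha>"
  obtains U where "U \<in> carrier (Sub C (prod_obj C A X))"
    "\<And>Z a x. a \<in> Hom C Z A \<Longrightarrow> x \<in> Hom C Z X \<Longrightarrow> sub_mem C U (pairing C a x) \<longleftrightarrow> \<alpha> a x"
proof -
  let ?Q = "\<lambda>p. \<alpha> (pr1 C A X \<odot> p) (pr2 C A X \<odot> p)"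
  have r: "representable C (prod_obj C A X) ?Q" using p by (simp add: pred_def)
  show thesis
  proof (rule that[OF sub_of_carrier[OF r]])
    fix Z a x assume a: "a \<in> Hom C Z A" and x: "x \<in> Hom C Z X"
    note pH = HomD[OF pairing_Hom[OF a x]]
    show "sub_mem C (sub_of C (prod_obj C A X) ?Q) (pairing C a x) \<longleftrightarrow> \<alpha> a x"
      using mem_sub_of[OF r pH(1,3)] HomD[OF a] HomD[OF x] by simp
  qed
qed

lemma pred_fst:
  assumes X: "X \<in> Obj C" and K: "K \<in> carrier (Sub C A)" shows "pred X (\<lambda>a x. sub_mem C K a)"
proof (rule predI[OF X])
  show "representable C (prod_obj C A X) (\<lambda>p. sub_mem C K (pr1 C A X \<odot> p))"
    by (rule representable_inv_im[OF _ _ _ representable_Sub[OF K refl]]) (simp_all add: X)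
qed simp

lemma pred_conj: "pred X \<alpha> \<Longrightarrow> pred X \<beta> \<Longrightarrow> pred X (\<lambda>a x. \<alpha> a x \<and> \<beta> a x)"
  unfolding pred_def using representable_conj by blast

lemma lift_pr:
  assumes f: "f \<in> Hom C X Y"
  shows "pairing C (pr1 C A X) (f \<odot> pr2 C A X) \<in> Mor C"
    "Dom C (pairing C (pr1 C A X) (f \<odot> pr2 C A X)) = prod_obj C A X"
    "Cod C (pairing C (pr1 C A X) (f \<odot> pr2 C A X)) = prod_obj C A Y"
  using HomD[OF f] Hom_Obj[OF f] by simp_all

lemma pred_reindex:
  assumes p: "pred Y \<alpha>" and f: "f \<in> Hom C X Y" shows "pred X (\<lambda>a x. \<alpha> a (f \<odot> x))"
proof (rule predI)
  show X: "X \<in> Obj C" using f by (rule Hom_Obj)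
  have Y: "Y \<in> Obj C" using f by (rule Hom_Obj)
  have "representable C (prod_obj C A Y) (\<lambda>p. \<alpha> (pr1 C A Y \<odot> p) (pr2 C A Y \<odot> p))" using p by (simp add: pred_def)
  from representable_inv_im[OF lift_pr[OF f] this]
  show "representable C (prod_obj C A X) (\<lambda>p. \<alpha> (pr1 C A Y \<odot> pairing C (pr1 C A X) (f \<odot> pr2 C A X) \<odot> p)
      (pr2 C A Y \<odot> pairing C (pr1 C A X) (f \<odot> pr2 C A X) \<odot> p))" .
  fix p assume "p \<in> Mor C" "Cod C p = prod_obj C A X"
  then show "\<alpha> (pr1 C A Y \<odot> pairing C (pr1 C A X) (f \<odot> pr2 C A X) \<odot> p)
      (pr2 C A Y \<odot> pairing C (pr1 C A X) (f \<odot> pr2 C A X) \<odot> p) \<longleftrightarrow> \<alpha> (pr1 C A X \<odot> p) (f \<odot> pr2 C A X \<odot> p)"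
    using HomD[OF f] X Y by simp
qed

text \<open>The value \<open>c\<close> is unique, so the condition is an inverse image along a
  partial morphism, and the existential introduces no cover.\<close>

lemma representable_ap:
  assumes t: "t \<in> Hom C Z A" and a: "a \<in> Hom C Z A" and x: "x \<in> Hom C Z X" and g: "pred X \<gamma>"
  shows "representable C Z (\<lambda>z. \<exists>c. ap (t \<odot> z) (a \<odot> z) c \<and> \<gamma> c (x \<odot> z))"
proof -
  obtain U where U: "U \<in> carrier (Sub C (prod_obj C A X))"
    and mU: "\<And>Z a x. a \<in> Hom C Z A \<Longrightarrow> x \<in> Hom C Z X \<Longrightarrow> sub_mem C U (pairing C a x) \<longleftrightarrow> \<gamma> a x"
    using pred_SubE[OF g] by blast
  note ta = HomD[OF pairing_Hom[OF t a]] and xH = HomD[OF x]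
  note P = pm_comp_PMor[OF pm_total_PMor[OF ta] app_PMor] and PX = pm_total_PMor[OF xH]
  note Q = pm_pair_PMor[OF P PX]
  show ?thesis
  proof (rule representable_Sub[OF pm_inv_im_carrier[OF Q U]])
    fix z assume z: "z \<in> Mor C" "Cod C z = Z"
    have e: "pairing C t a \<odot> z = pairing C (t \<odot> z) (a \<odot> z)" using HomD[OF t] HomD[OF a] z by simp
    note th = Comp_Hom[OF t z] and ah = Comp_Hom[OF a z] and xh = Comp_Hom[OF x z]
    show "sub_mem C (pm_inv_im C (pm_pair C (pm_comp C app (pm_total C (pairing C t a))) (pm_total C x)) U) z \<longleftrightarrow>
      (\<exists>c. ap (t \<odot> z) (a \<odot> z) c \<and> \<gamma> c (x \<odot> z))"
      unfolding mem_pm_inv_im[OF Q U z] pm_val_pair_iff[OF P PX z] pm_val_comp_iff[OF pm_total_PMor[OF ta] app_PMor z]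
        pm_val_total[OF ta z] pm_val_total[OF xH z] e
      using mU[OF ap_Hom[OF th ah] xh] by (auto simp: ap_def)
  qed
qed

text \<open>The formula "for every realizer \<open>b\<close> of \<alpha>, the application of
  \<open>a\<close> to \<open>b\<close> is defined and realizes \<beta>", forced at \<open>a\<close>
  and \<open>x\<close>; the quantification over stages makes it stable under restriction.\<close>

definition rimp where
  "rimp \<alpha> \<beta> a x \<longleftrightarrow> (\<forall>s b. s \<in> Mor C \<longrightarrow> Cod C s = Dom C x \<longrightarrow> b \<in> Hom C (Dom C s) A \<longrightarrow> \<alpha> b (x \<odot> s) \<longrightarrow>
    (\<exists>c. ap (a \<odot> s) b c \<and> \<beta> c (x \<odot> s)))"

lemma rimpI:
  "(\<And>s b. s \<in> Mor C \<Longrightarrow> Cod C s = Dom C x \<Longrightarrow> b \<in> Hom C (Dom C s) A \<Longrightarrow> \<alpha> b (x \<odot> s) \<Longrightarrow>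
    \<exists>c. ap (a \<odot> s) b c \<and> \<beta> c (x \<odot> s)) \<Longrightarrow> rimp \<alpha> \<beta> a x"
  by (simp add: rimp_def)

lemma rimpD:
  "rimp \<alpha> \<beta> a x \<Longrightarrow> s \<in> Mor C \<Longrightarrow> Cod C s = Dom C x \<Longrightarrow> b \<in> Hom C (Dom C s) A \<Longrightarrow> \<alpha> b (x \<odot> s) \<Longrightarrow>
    \<exists>c. ap (a \<odot> s) b c \<and> \<beta> c (x \<odot> s)"
  by (simp add: rimp_def)

lemma rimpD0:
  assumes "rimp \<alpha> \<beta> a x" "a \<in> Hom C Z A" "x \<in> Hom C Z X" "b \<in> Hom C Z A" "\<alpha> b x"
  shows "\<exists>c. ap a b c \<and> \<beta> c x"
  using rimpD[OF assms(1), of "Ident C Z" b] assms Hom_Obj(1)[OF assms(2)] HomD[OF assms(2)] HomD[OF assms(3)] by simp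

text \<open>A universal quantifier over an added last component \<open>b\<close>, applied to an
  implication. Each of the two brings its own change of stage, and the composite of both is the
  single \<open>s\<close> of \<open>rimp\<close>.\<close>

lemma pred_rimp:
  assumes a: "pred X \<alpha>" and b: "pred X \<beta>" shows "pred X (rimp \<alpha> \<beta>)"
proof -
  have X: "X \<in> Obj C" using a by (rule pred_Obj)
  let ?AX = "prod_obj C A X" let ?W = "prod_obj C ?AX A"
  let ?p = "pr1 C ?AX A" and ?b = "pr2 C ?AX A"
  let ?a = "pr1 C A X \<odot> ?p" and ?x = "pr2 C A X \<odot> ?p"
  have pT: "?p \<in> Mor C" "Dom C ?p = ?W" "Cod C ?p = ?AX" using X by simp_all
  have bH: "?b \<in> Hom C ?W A" and aH: "?a \<in> Hom C ?W A" and xH: "?x \<in> Hom C ?W X" using X by (simp_all add: Hom_def)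
  note r1 = pred_representable[OF a bH xH] and r2 = representable_ap[OF aH bH xH b]
  note r3 = representable_all[OF pT representable_imp[OF r1 r2]]
  show ?thesis
  proof (rule predI[OF X r3])
    fix p assume p: "p \<in> Mor C" "Cod C p = ?AX"
    show "(\<forall>s\<in>Mor C. \<forall>u\<in>Mor C. Cod C s = Dom C p \<longrightarrow> Dom C u = Dom C s \<longrightarrow> Cod C u = ?W \<longrightarrow> ?p \<odot> u = p \<odot> s \<longrightarrow>
        (\<forall>s\<in>Mor C. Cod C s = Dom C u \<longrightarrow> \<alpha> (?b \<odot> u \<odot> s) (?x \<odot> u \<odot> s) \<longrightarrow>
          (\<exists>c. ap (?a \<odot> u \<odot> s) (?b \<odot> u \<odot> s) c \<and> \<beta> c (?x \<odot> u \<odot> s)))) \<longleftrightarrow>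
      rimp \<alpha> \<beta> (pr1 C A X \<odot> p) (pr2 C A X \<odot> p)" (is "?L \<longleftrightarrow> _")
    proof
      assume L: ?L
      show "rimp \<alpha> \<beta> (pr1 C A X \<odot> p) (pr2 C A X \<odot> p)"
      proof (rule rimpI)
        fix s b assume s: "s \<in> Mor C" "Cod C s = Dom C (pr2 C A X \<odot> p)" and bb: "b \<in> Hom C (Dom C s) A"
          and al: "\<alpha> b ((pr2 C A X \<odot> p) \<odot> s)"
        have s2: "Cod C s = Dom C p" using s(2) p X by simp
        let ?u = "pairing C (p \<odot> s) b" let ?i = "Ident C (Dom C s)"
        note bT = HomD[OF bb]
        have u: "?u \<in> Mor C" "Dom C ?u = Dom C s" "Cod C ?u = ?W" "?p \<odot> ?u = p \<odot> s" "?b \<odot> ?u = b"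
          using p s s2 bT X by simp_all
        have e: "?b \<odot> ?u \<odot> ?i = b" "?a \<odot> ?u \<odot> ?i = (pr1 C A X \<odot> p) \<odot> s" "?x \<odot> ?u \<odot> ?i = (pr2 C A X \<odot> p) \<odot> s"
          using u p s s2 bT X by simp_all
        have i: "?i \<in> Mor C" "Cod C ?i = Dom C ?u" using s u by simp_all
        from L[rule_format, OF s(1) u(1) s2 u(2,3,4) i] al
        show "\<exists>c. ap ((pr1 C A X \<odot> p) \<odot> s) b c \<and> \<beta> c ((pr2 C A X \<odot> p) \<odot> s)" unfolding e by simp
      qed
    next
      assume R: "rimp \<alpha> \<beta> (pr1 C A X \<odot> p) (pr2 C A X \<odot> p)"
      show ?L
      proof (intro ballI impI)
        fix s u t assume s: "s \<in> Mor C" "u \<in> Mor C" "Cod C s = Dom C p" "Dom C u = Dom C s" "Cod C u = ?W" "?p \<odot> u = p \<odot> s"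
          and t: "t \<in> Mor C" "Cod C t = Dom C u" and al: "\<alpha> (?b \<odot> u \<odot> t) (?x \<odot> u \<odot> t)"
        have st: "s \<odot> t \<in> Mor C" "Dom C (s \<odot> t) = Dom C t" "Cod C (s \<odot> t) = Dom C (pr2 C A X \<odot> p)"
          using s t p X by simp_all
        have put: "?p \<odot> u \<odot> t = p \<odot> s \<odot> t"
          using Comp_assoc'[of t u ?p] Comp_assoc'[of t s p] s t p X by simp
        have e: "?x \<odot> u \<odot> t = (pr2 C A X \<odot> p) \<odot> s \<odot> t" "?a \<odot> u \<odot> t = (pr1 C A X \<odot> p) \<odot> s \<odot> t"
          using put s(1-5) t p X by simp_all
        have bb: "?b \<odot> u \<odot> t \<in> Hom C (Dom C (s \<odot> t)) A" using s t X st by (simp add: Hom_def)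
        from rimpD[OF R st(1,3) bb] al
        show "\<exists>c. ap (?a \<odot> u \<odot> t) (?b \<odot> u \<odot> t) c \<and> \<beta> c (?x \<odot> u \<odot> t)" unfolding e by simp
      qed
    qed
  qed
qed

text \<open>Existential quantification along \<open>f\<close> in the base, fibrewise over
  \<open>A\<close>: the realizer passes unchanged and the witness \<open>x\<close> carries no code
  of its own.\<close>

definition rex where
  "rex f X \<alpha> a y \<longleftrightarrow> (\<exists>w x. cover w \<and> Cod C w = Dom C y \<and> x \<in> Hom C (Dom C w) X \<and> f \<odot> x = y \<odot> w \<and> \<alpha> (a \<odot> w) x)"

text \<open>Uniform universal quantification: \<open>a\<close> has to serve all \<open>x\<close>
  over \<open>y\<close> without access to realizers of \<open>x\<close>. Such access is added by a
  \<open>rimp\<close> placed inside the argument.\<close>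

definition rall where
  "rall f X \<alpha> a y \<longleftrightarrow> (\<forall>s x. s \<in> Mor C \<longrightarrow> Cod C s = Dom C y \<longrightarrow> x \<in> Hom C (Dom C s) X \<longrightarrow> f \<odot> x = y \<odot> s \<longrightarrow> \<alpha> (a \<odot> s) x)"

lemma lift_eq:
  assumes f: "f \<in> Hom C X Y" and u: "u \<in> Mor C" "Cod C u = prod_obj C A X" and p: "p \<in> Mor C" "Cod C p = prod_obj C A Y"
    and s: "s \<in> Mor C" "Cod C s = Dom C p" "Dom C u = Dom C s"
  shows "pairing C (pr1 C A X) (f \<odot> pr2 C A X) \<odot> u = p \<odot> s \<longleftrightarrow>
    pr1 C A X \<odot> u = (pr1 C A Y \<odot> p) \<odot> s \<and> f \<odot> pr2 C A X \<odot> u = (pr2 C A Y \<odot> p) \<odot> s"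
proof -
  note XY = Hom_Obj[OF f] and fT = HomD[OF f]
  have "p \<odot> s = pairing C ((pr1 C A Y \<odot> p) \<odot> s) ((pr2 C A Y \<odot> p) \<odot> s)"
    using pairing_eta[of A Y "p \<odot> s"] p s XY by simp
  then show ?thesis using pairing_inj[of "pr1 C A X \<odot> u" "f \<odot> pr2 C A X \<odot> u" "(pr1 C A Y \<odot> p) \<odot> s" "(pr2 C A Y \<odot> p) \<odot> s"]
      fT XY u p s by simp
qed

lemma pred_rex:
  assumes a: "pred X \<alpha>" and f: "f \<in> Hom C X Y" shows "pred Y (rex f X \<alpha>)"
proof -
  note XY = Hom_Obj[OF f] and fT = HomD[OF f]
  have r: "representable C (prod_obj C A X) (\<lambda>p. \<alpha> (pr1 C A X \<odot> p) (pr2 C A X \<odot> p))" using a by (simp add: pred_def)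
  show ?thesis
  proof (rule predI[OF XY(2) representable_ex[OF lift_pr[OF f] r]])
    fix p assume p: "p \<in> Mor C" "Cod C p = prod_obj C A Y"
    let ?g = "pairing C (pr1 C A X) (f \<odot> pr2 C A X)"
    have D: "Dom C (pr2 C A Y \<odot> p) = Dom C p" using p XY by simp
    show "(\<exists>w u. cover w \<and> Cod C w = Dom C p \<and> u \<in> Mor C \<and> Dom C u = Dom C w \<and> Cod C u = prod_obj C A X \<and>
         ?g \<odot> u = p \<odot> w \<and> \<alpha> (pr1 C A X \<odot> u) (pr2 C A X \<odot> u)) \<longleftrightarrow> rex f X \<alpha> (pr1 C A Y \<odot> p) (pr2 C A Y \<odot> p)" (is "?L \<longleftrightarrow> ?R")
    proof
      assume ?L
      then obtain w u where w: "cover w" "Cod C w = Dom C p" and u: "u \<in> Mor C" "Dom C u = Dom C w" "Cod C u = prod_obj C A X"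
        and e: "?g \<odot> u = p \<odot> w" and al: "\<alpha> (pr1 C A X \<odot> u) (pr2 C A X \<odot> u)" by blast
      have "pr2 C A X \<odot> u \<in> Hom C (Dom C w) X" using u XY by (simp add: Hom_def)
      then show ?R unfolding rex_def D using e[unfolded lift_eq[OF f u(1,3) p cover_Mor[OF w(1)] w(2) u(2)]] w al
        by (intro exI[of _ w] exI[of _ "pr2 C A X \<odot> u"]) simp
    next
      assume ?R
      then obtain w x where w: "cover w" "Cod C w = Dom C p" and x: "x \<in> Hom C (Dom C w) X"
        and e: "f \<odot> x = (pr2 C A Y \<odot> p) \<odot> w" and al: "\<alpha> ((pr1 C A Y \<odot> p) \<odot> w) x" unfolding rex_def D by blast
      note wM = cover_Mor[OF w(1)] and xT = HomD[OF x]
      let ?u = "pairing C ((pr1 C A Y \<odot> p) \<odot> w) x"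
      have aT: "(pr1 C A Y \<odot> p) \<odot> w \<in> Mor C" "Dom C ((pr1 C A Y \<odot> p) \<odot> w) = Dom C w" "Cod C ((pr1 C A Y \<odot> p) \<odot> w) = A"
        using p w(2) wM XY by simp_all
      have u: "?u \<in> Mor C" "Dom C ?u = Dom C w" "Cod C ?u = prod_obj C A X"
        and pu: "pr1 C A X \<odot> ?u = (pr1 C A Y \<odot> p) \<odot> w" "pr2 C A X \<odot> ?u = x"
        using aT xT by (simp_all del: Comp_assoc')
      have "?g \<odot> ?u = p \<odot> w" unfolding lift_eq[OF f u(1,3) p wM w(2) u(2)] pu using e by simp
      then show ?L using w u al pu by (intro exI[of _ w] exI[of _ ?u]) (simp del: Comp_assoc')
    qed
  qed
qed

lemma pred_rall:
  assumes a: "pred X \<alpha>" and f: "f \<in> Hom C X Y" shows "pred Y (rall f X \<alpha>)"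
proof -
  note XY = Hom_Obj[OF f] and fT = HomD[OF f]
  have r: "representable C (prod_obj C A X) (\<lambda>p. \<alpha> (pr1 C A X \<odot> p) (pr2 C A X \<odot> p))" using a by (simp add: pred_def)
  show ?thesis
  proof (rule predI[OF XY(2) representable_all[OF lift_pr[OF f] r]])
    fix p assume p: "p \<in> Mor C" "Cod C p = prod_obj C A Y"
    let ?g = "pairing C (pr1 C A X) (f \<odot> pr2 C A X)"
    have D: "Dom C (pr2 C A Y \<odot> p) = Dom C p" using p XY by simp
    show "(\<forall>s\<in>Mor C. \<forall>u\<in>Mor C. Cod C s = Dom C p \<longrightarrow> Dom C u = Dom C s \<longrightarrow> Cod C u = prod_obj C A X \<longrightarrow>
         ?g \<odot> u = p \<odot> s \<longrightarrow> \<alpha> (pr1 C A X \<odot> u) (pr2 C A X \<odot> u)) \<longleftrightarrow> rall f X \<alpha> (pr1 C A Y \<odot> p) (pr2 C A Y \<odot> p)" (is "?L \<longleftrightarrow> ?R")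
    proof
      assume R: ?R
      show ?L
      proof (intro ballI impI)
        fix s u assume s: "s \<in> Mor C" and u: "u \<in> Mor C" and t: "Cod C s = Dom C p" "Dom C u = Dom C s" "Cod C u = prod_obj C A X"
          and e: "?g \<odot> u = p \<odot> s"
        have "pr2 C A X \<odot> u \<in> Hom C (Dom C s) X" using u t XY by (simp add: Hom_def)
        then show "\<alpha> (pr1 C A X \<odot> u) (pr2 C A X \<odot> u)"
          using R s t(1) e[unfolded lift_eq[OF f u t(3) p s t(1,2)]] unfolding rall_def D by metis
      qed
    next
      assume L: ?L
      show ?R unfolding rall_def D
      proof (intro allI impI)
        fix s x assume s: "s \<in> Mor C" "Cod C s = Dom C p" and x: "x \<in> Hom C (Dom C s) X"
          and e: "f \<odot> x = (pr2 C A Y \<odot> p) \<odot> s"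
        note xT = HomD[OF x]
        let ?u = "pairing C ((pr1 C A Y \<odot> p) \<odot> s) x"
        have aT: "(pr1 C A Y \<odot> p) \<odot> s \<in> Mor C" "Dom C ((pr1 C A Y \<odot> p) \<odot> s) = Dom C s" "Cod C ((pr1 C A Y \<odot> p) \<odot> s) = A"
          using p s XY by simp_all
        have u: "?u \<in> Mor C" "Dom C ?u = Dom C s" "Cod C ?u = prod_obj C A X"
          and pu: "pr1 C A X \<odot> ?u = (pr1 C A Y \<odot> p) \<odot> s" "pr2 C A X \<odot> ?u = x"
          using aT xT by (simp_all del: Comp_assoc')
        have "?g \<odot> ?u = p \<odot> s" unfolding lift_eq[OF f u(1,3) p s u(2)] pu using e by simp
        from L[rule_format, OF s(1) u(1) s(2) u(2,3) this]
        show "\<alpha> ((pr1 C A Y \<odot> p) \<odot> s) x" unfolding pu .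
      qed
    qed
  qed
qed

end

section \<open>Realizable entailment\<close>

context pca_filter
begin

text \<open>The condition decoded in \<open>models_tracks\<close>, for arbitrary predicates on one
  object; tracking \<open>f\<close> is the case where the right side is reindexed along
  \<open>f\<close>.\<close>

definition tracker where
  "tracker R X \<alpha> \<beta> \<longleftrightarrow> (\<forall>Z. \<forall>r\<in>Hom C Z A. \<forall>b\<in>Hom C Z A. \<forall>x\<in>Hom C Z X. sub_mem C R r \<longrightarrow> \<alpha> b x \<longrightarrow>
    (\<exists>c. ap r b c \<and> \<beta> c x))"

definition ent where
  "ent X \<alpha> \<beta> \<longleftrightarrow> (\<exists>R\<in>\<phi>. tracker R X \<alpha> \<beta>)"

lemma trackerD:
  "tracker R X \<alpha> \<beta> \<Longrightarrow> r \<in> Hom C Z A \<Longrightarrow> b \<in> Hom C Z A \<Longrightarrow> x \<in> Hom C Z X \<Longrightarrow> sub_mem C R r \<Longrightarrow> \<alpha> b x \<Longrightarrow>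
    \<exists>c. ap r b c \<and> \<beta> c x"
  by (simp add: tracker_def)

lemma mem_Comp_filter: "R \<in> \<phi> \<Longrightarrow> sub_mem C R r \<Longrightarrow> r \<in> Hom C Z A \<Longrightarrow> s \<in> Mor C \<Longrightarrow> Cod C s = Z \<Longrightarrow> sub_mem C R (r \<odot> s)"
  using mem_comp[OF filter_Sub, of R r s] HomD[of r Z A] by simp

text \<open>This removes the covers over which elements of filter sets live: the application
  descends, its value restricts to \<open>c\<close> by uniqueness, and \<beta> descends by
  locality.\<close>

lemma ap_pred_local:
  assumes w: "cover w" "Cod C w = Z" and r: "r \<in> Hom C Z A" and b: "b \<in> Hom C Z A" and x: "x \<in> Hom C Z X"
    and p: "pred X \<beta>" and c: "ap (r \<odot> w) (b \<odot> w) c" "\<beta> c (x \<odot> w)"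
  shows "\<exists>c. ap r b c \<and> \<beta> c x"
proof -
  note wM = cover_Mor[OF w(1)]
  obtain d where d: "ap r b d" using ap_local[OF w r b c(1)] by blast
  have "ap (r \<odot> w) (b \<odot> w) (d \<odot> w)" using ap_comp[OF r b d wM w(2)] .
  then have "d \<odot> w = c" using ap_fun[OF Comp_Hom[OF r wM w(2)] Comp_Hom[OF b wM w(2)]] c(1) by blast
  then have "\<beta> d x" using pred_local[OF p ap_Hom[OF r b d] x w] c(2) by simp
  then show ?thesis using d by blast
qed

text \<open>Entailments are proved by writing down a polynomial: variables below \<open>k\<close>
  are parameters from the filter and variable \<open>k\<close> is the given realizer. The parameters
  exist only locally; \<open>ap_pred_local\<close> discharges the cover.\<close>

lemma entI1:
  assumes Rs: "\<And>i. i < k \<Longrightarrow> Rs i \<in> \<phi>" and t: "pvars t \<subseteq> {..<k + 1}" and \<alpha>: "pred X \<alpha>" and \<beta>: "pred X \<beta>"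
    and H: "\<And>Z e b x. \<forall>i<k. e i \<in> Hom C Z A \<and> sub_mem C (Rs i) (e i) \<Longrightarrow> b \<in> Hom C Z A \<Longrightarrow> x \<in> Hom C Z X \<Longrightarrow> \<alpha> b x \<Longrightarrow>
      \<exists>v. evl t (\<lambda>i. if i < k then e i else b) v \<and> \<beta> v x"
  shows "ent X \<alpha> \<beta>"
proof -
  obtain T where T: "T \<in> \<phi>" "\<And>Z u. u \<in> Hom C Z A \<Longrightarrow> sub_mem C T u \<Longrightarrow> (\<exists>w e. cover w \<and> Cod C w = Z \<and>
    (\<forall>i<k. e i \<in> Hom C (Dom C w) A \<and> sub_mem C (Rs i) (e i)) \<and>
    (\<forall>s d. s \<in> Mor C \<longrightarrow> Cod C s = Dom C w \<longrightarrow> (\<forall>j<1. d j \<in> Hom C (Dom C s) A) \<longrightarrow>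
      (\<exists>v. apps (u \<odot> w \<odot> s) d (1 - 1) v) \<and>
      (\<forall>v. evl t (\<lambda>i. if i < k then e i \<odot> s else d (i - k)) v \<longrightarrow> apps (u \<odot> w \<odot> s) d 1 v)))"
    using realizer[of k Rs t 1, OF Rs t] by auto
  show ?thesis unfolding ent_def tracker_def
  proof (intro bexI[OF _ T(1)] allI ballI impI)
    fix Z u b x assume u: "u \<in> Hom C Z A" and b: "b \<in> Hom C Z A" and x: "x \<in> Hom C Z X" and mu: "sub_mem C T u" and ab: "\<alpha> b x"
    obtain w e where w: "cover w" "Cod C w = Z" and e: "\<forall>i<k. e i \<in> Hom C (Dom C w) A \<and> sub_mem C (Rs i) (e i)"
      and act: "\<And>s d v. s \<in> Mor C \<Longrightarrow> Cod C s = Dom C w \<Longrightarrow> (\<forall>j<1. d j \<in> Hom C (Dom C s) A) \<Longrightarrow>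
        evl t (\<lambda>i. if i < k then e i \<odot> s else d (i - k)) v \<Longrightarrow> apps (u \<odot> w \<odot> s) d 1 v"
      using T(2)[OF u mu] by blast
    note wM = cover_Mor[OF w(1)]
    note uw = Comp_Hom[OF u wM w(2)] and bw = Comp_Hom[OF b wM w(2)] and xw = Comp_Hom[OF x wM w(2)]
    obtain v where v: "evl t (\<lambda>i. if i < k then e i else b \<odot> w) v" "\<beta> v (x \<odot> w)"
      using H[OF e bw xw pred_comp[OF \<alpha> b x ab wM w(2)]] by blast
    let ?i = "Ident C (Dom C w)"
    have i: "?i \<in> Mor C" "Cod C ?i = Dom C w" "Dom C ?i = Dom C w" using wM by simp_all
    have "(\<lambda>i. if i < k then e i \<odot> ?i else b \<odot> w) = (\<lambda>i. if i < k then e i else b \<odot> w)"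
      using e HomD(1,2) by fastforce
    then have "apps (u \<odot> w \<odot> ?i) (\<lambda>_. b \<odot> w) 1 v"
      using act[OF i(1,2), of "\<lambda>_. b \<odot> w" v] v(1) bw i by simp
    then have "ap (u \<odot> w) (b \<odot> w) v" using wM by simp
    then show "\<exists>c. ap u b c \<and> \<beta> c x" using ap_pred_local[OF w u b x \<beta>] v(2) by blast
  qed
qed

text \<open>For conclusions whose realizers are themselves functions. The value \<open>y\<close> of
  the realizer at \<open>c\<close> exists because one argument is still missing, even if the
  polynomial is nowhere defined; it is known only through its action at later stages.\<close>

lemma entI2:
  assumes Rs: "\<And>i. i < k \<Longrightarrow> Rs i \<in> \<phi>" and t: "pvars t \<subseteq> {..<k + 2}" and \<alpha>: "pred X \<alpha>" and \<beta>: "pred X \<beta>"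
    and H: "\<And>Z e c x y. \<forall>i<k. e i \<in> Hom C Z A \<and> sub_mem C (Rs i) (e i) \<Longrightarrow> c \<in> Hom C Z A \<Longrightarrow> y \<in> Hom C Z A \<Longrightarrow>
      x \<in> Hom C Z X \<Longrightarrow> \<alpha> c x \<Longrightarrow>
      (\<And>s b v. s \<in> Mor C \<Longrightarrow> Cod C s = Z \<Longrightarrow> b \<in> Hom C (Dom C s) A \<Longrightarrow>
        evl t (\<lambda>i. if i < k then e i \<odot> s else if i = k then c \<odot> s else b) v \<Longrightarrow> ap (y \<odot> s) b v) \<Longrightarrow> \<beta> y x"
  shows "ent X \<alpha> \<beta>"
proof -
  obtain T where T: "T \<in> \<phi>" "\<And>Z u. u \<in> Hom C Z A \<Longrightarrow> sub_mem C T u \<Longrightarrow> (\<exists>w e. cover w \<and> Cod C w = Z \<and>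
    (\<forall>i<k. e i \<in> Hom C (Dom C w) A \<and> sub_mem C (Rs i) (e i)) \<and>
    (\<forall>s d. s \<in> Mor C \<longrightarrow> Cod C s = Dom C w \<longrightarrow> (\<forall>j<2. d j \<in> Hom C (Dom C s) A) \<longrightarrow>
      (\<exists>v. apps (u \<odot> w \<odot> s) d (2 - 1) v) \<and>
      (\<forall>v. evl t (\<lambda>i. if i < k then e i \<odot> s else d (i - k)) v \<longrightarrow> apps (u \<odot> w \<odot> s) d 2 v)))"
    using realizer[of k Rs t 2, OF Rs t] by auto
  show ?thesis unfolding ent_def tracker_def
  proof (intro bexI[OF _ T(1)] allI ballI impI)
    fix Z u b x assume u: "u \<in> Hom C Z A" and b: "b \<in> Hom C Z A" and x: "x \<in> Hom C Z X" and mu: "sub_mem C T u" and ab: "\<alpha> b x"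
    obtain w e where w: "cover w" "Cod C w = Z" and e: "\<forall>i<k. e i \<in> Hom C (Dom C w) A \<and> sub_mem C (Rs i) (e i)"
      and act1: "\<And>s d. s \<in> Mor C \<Longrightarrow> Cod C s = Dom C w \<Longrightarrow> (\<forall>j<2. d j \<in> Hom C (Dom C s) A) \<Longrightarrow>
        \<exists>v. apps (u \<odot> w \<odot> s) d (2 - 1) v"
      and act: "\<And>s d v. s \<in> Mor C \<Longrightarrow> Cod C s = Dom C w \<Longrightarrow> (\<forall>j<2. d j \<in> Hom C (Dom C s) A) \<Longrightarrow>
        evl t (\<lambda>i. if i < k then e i \<odot> s else d (i - k)) v \<Longrightarrow> apps (u \<odot> w \<odot> s) d 2 v"
      using T(2)[OF u mu] by blast
    note wM = cover_Mor[OF w(1)]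
    note uw = Comp_Hom[OF u wM w(2)] and bw = Comp_Hom[OF b wM w(2)] and xw = Comp_Hom[OF x wM w(2)]
    let ?i = "Ident C (Dom C w)"
    have i: "?i \<in> Mor C" "Cod C ?i = Dom C w" "Dom C ?i = Dom C w" using wM by simp_all
    \<comment> \<open>The clause for \<open>2 - 1\<close> arguments gives the partial application
      without any evaluation of \<open>t\<close>.\<close>
    obtain y where y: "ap (u \<odot> w) (b \<odot> w) y"
      using act1[OF i(1,2), of "\<lambda>_. b \<odot> w"] bw i HomD[OF u] wM w(2) by auto
    note yH = ap_Hom[OF uw bw y]
    have "\<beta> y (x \<odot> w)"
    proof (rule H[OF e bw yH xw pred_comp[OF \<alpha> b x ab wM w(2)]])
      fix s b' v assume s: "s \<in> Mor C" "Cod C s = Dom C w" and b': "b' \<in> Hom C (Dom C s) A"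
        and ev: "evl t (\<lambda>i. if i < k then e i \<odot> s else if i = k then (b \<odot> w) \<odot> s else b') v"
      let ?d = "\<lambda>j. if j = 0 then (b \<odot> w) \<odot> s else b'"
      have d: "\<forall>j<2. ?d j \<in> Hom C (Dom C s) A" using Comp_Hom[OF bw s] b' by simp
      have "(\<lambda>i. if i < k then e i \<odot> s else ?d (i - k)) = (\<lambda>i. if i < k then e i \<odot> s else if i = k then (b \<odot> w) \<odot> s else b')"
        by auto
      then have "apps (u \<odot> w \<odot> s) ?d 2 v" using act[OF s d] ev by simp
      then obtain z where z: "ap (u \<odot> w \<odot> s) ((b \<odot> w) \<odot> s) z" "ap z b' v" by (auto simp: numeral_2_eq_2 simp del: Comp_assoc')
      have us: "u \<odot> w \<odot> s = (u \<odot> w) \<odot> s" using HomD[OF u] wM w(2) s by simp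
      have "z = y \<odot> s" using ap_fun[OF Comp_Hom[OF uw s] Comp_Hom[OF bw s] _ ap_comp[OF uw bw y s]] z(1) us by simp
      then show "ap (y \<odot> s) b' v" using z(2) by simp
    qed
    then show "\<exists>c. ap u b c \<and> \<beta> c x" using ap_pred_local[OF w u b x \<beta> y] by blast
  qed
qed

lemma ent_mono:
  assumes "pred X \<alpha>" "pred X \<beta>" "\<And>Z b x. b \<in> Hom C Z A \<Longrightarrow> x \<in> Hom C Z X \<Longrightarrow> \<alpha> b x \<Longrightarrow> \<beta> b x"
  shows "ent X \<alpha> \<beta>"
  by (rule entI1[of 0 _ "PVar 0"]) (use assms in auto)

lemma ent_refl: "pred X \<alpha> \<Longrightarrow> ent X \<alpha> \<alpha>"
  by (rule ent_mono)

lemma ent_trans: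
  assumes "ent X \<alpha> \<beta>" "ent X \<beta> \<gamma>" and p: "pred X \<alpha>" "pred X \<gamma>"
  shows "ent X \<alpha> \<gamma>"
proof -
  obtain R S where R: "R \<in> \<phi>" "tracker R X \<alpha> \<beta>" and S: "S \<in> \<phi>" "tracker S X \<beta> \<gamma>" using assms by (auto simp: ent_def)
  let ?Rs = "\<lambda>i::nat. if i = 0 then R else S"
  show ?thesis
  proof (rule entI1[of 2 ?Rs "PApp (PVar 1) (PApp (PVar 0) (PVar 2))", OF _ _ p])
    fix Z e b x assume e: "\<forall>i<2. e i \<in> Hom C Z A \<and> sub_mem C (?Rs i) (e i)" and b: "b \<in> Hom C Z A" and x: "x \<in> Hom C Z X" and a: "\<alpha> b x"
    have e0: "e 0 \<in> Hom C Z A" "sub_mem C R (e 0)" and e1: "e 1 \<in> Hom C Z A" "sub_mem C S (e 1)"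
      using e[rule_format, of 0] e[rule_format, of 1] by auto
    obtain c where c: "ap (e 0) b c" "\<beta> c x" using trackerD[OF R(2) e0(1) b x e0(2)] a by blast
    obtain d where d: "ap (e 1) c d" "\<gamma> d x" using trackerD[OF S(2) e1(1) ap_Hom[OF e0(1) b c(1)] x e1(2)] c(2) by blast
    show "\<exists>v. evl (PApp (PVar 1) (PApp (PVar 0) (PVar 2))) (\<lambda>i. if i < 2 then e i else b) v \<and> \<gamma> v x"
      using c d by auto
  qed (use R S in auto)
qed

section \<open>Church encodings and the realizability connectives\<close>

definition combs where
  "combs K n t \<longleftrightarrow> K \<in> \<phi> \<and> (\<forall>Z. \<forall>r\<in>Hom C Z A. \<forall>e. (\<forall>i<n. e i \<in> Hom C Z A) \<longrightarrow> sub_mem C K r \<longrightarrow>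
    (\<exists>v. apps r e (n - 1) v) \<and> (\<forall>v. evl t e v \<longrightarrow> apps r e n v))"

definition comb where "comb n t = (SOME K. combs K n t)"

lemma comb:
  assumes "pvars t \<subseteq> {..<n}" "n \<ge> 1" shows "combs (comb n t) n t"
proof -
  have "\<exists>K. combs K n t" using combinatory[OF assms] unfolding combs_def by blast
  then show ?thesis unfolding comb_def by (rule someI_ex)
qed

text \<open>Sets of elements acting as the Church booleans \<open>\<lambda>a b. a\<close> and
  \<open>\<lambda>a b. b\<close>; \<open>Pr\<close> below acts as the pairing
  \<open>\<lambda>a b f. f a b\<close>, whose components are selected by a boolean.\<close>

definition "Kt = comb 2 (PVar 0)"
definition "Kf = comb 2 (PVar 1)"
definition "Pr = comb 3 (PApp (PApp (PVar 2) (PVar 0)) (PVar 1))"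
definition "Il = comb 3 (PApp (PVar 1) (PVar 0))"
definition "Ir = comb 3 (PApp (PVar 2) (PVar 0))"

lemma combs_inst:
  "combs Kt 2 (PVar 0)" "combs Kf 2 (PVar 1)" "combs Pr 3 (PApp (PApp (PVar 2) (PVar 0)) (PVar 1))"
  "combs Il 3 (PApp (PVar 1) (PVar 0))" "combs Ir 3 (PApp (PVar 2) (PVar 0))"
  unfolding Kt_def Kf_def Pr_def Il_def Ir_def by (rule comb; simp)+

lemma comb_filter: "Kt \<in> \<phi>" "Kf \<in> \<phi>" "Pr \<in> \<phi>" "Il \<in> \<phi>" "Ir \<in> \<phi>"
  using combs_inst by (simp_all add: combs_def)

lemma K_ap:
  assumes k: "k \<in> Hom C Z A" and a: "a \<in> Hom C Z A" and b: "b \<in> Hom C Z A"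
  shows Kt_ap: "sub_mem C Kt k \<Longrightarrow> \<exists>z. ap k a z \<and> ap z b a"
    and Kf_ap: "sub_mem C Kf k \<Longrightarrow> \<exists>z. ap k a z \<and> ap z b b"
proof -
  let ?e = "\<lambda>i::nat. if i = 0 then a else b"
  have e: "\<forall>i<2. ?e i \<in> Hom C Z A" using a b by simp
  note c = combs_inst(1,2)
  have e2: "apps k ?e 2 v \<longleftrightarrow> (\<exists>z. ap k a z \<and> ap z b v)" for v by (auto simp: numeral_2_eq_2)
  show "sub_mem C Kt k \<Longrightarrow> \<exists>z. ap k a z \<and> ap z b a"
    using c(1)[unfolded combs_def, THEN conjunct2, rule_format, OF k, of ?e] e e2 by simp
  show "sub_mem C Kf k \<Longrightarrow> \<exists>z. ap k a z \<and> ap z b b"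
    using c(2)[unfolded combs_def, THEN conjunct2, rule_format, OF k, of ?e] e e2 by simp
qed

text \<open>Two arguments already produce the values \<open>q\<close> and \<open>y\<close>, whatever
  \<open>t\<close> is; the third may come from any later stage, where uniqueness identifies the
  partial application with the restriction of \<open>y\<close>.\<close>

lemma comb3:
  assumes c: "combs T 3 t" and p: "p \<in> Hom C Z A" and a: "a \<in> Hom C Z A" and b: "b \<in> Hom C Z A" and m: "sub_mem C T p"
  shows "\<exists>q y. ap p a q \<and> ap q b y \<and> q \<in> Hom C Z A \<and> y \<in> Hom C Z A \<and>
    (\<forall>s f v. s \<in> Mor C \<longrightarrow> Cod C s = Z \<longrightarrow> f \<in> Hom C (Dom C s) A \<longrightarrow>
      evl t (\<lambda>i. if i = 0 then a \<odot> s else if i = 1 then b \<odot> s else f) v \<longrightarrow> ap (y \<odot> s) f v)"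
proof -
  have T: "T \<in> \<phi>" and act: "\<And>Z r e. r \<in> Hom C Z A \<Longrightarrow> (\<forall>i<3. e i \<in> Hom C Z A) \<Longrightarrow> sub_mem C T r \<Longrightarrow>
    (\<exists>v. apps r e 2 v) \<and> (\<forall>v. evl t e v \<longrightarrow> apps r e 3 v)"
    using c unfolding combs_def by auto
  let ?e = "\<lambda>i::nat. if i = 0 then a else b"
  have "\<exists>y. apps p ?e 2 y" using act[OF p _ m, of ?e] a b by simp
  then obtain q y where q: "ap p a q" "ap q b y" by (auto simp: numeral_2_eq_2)
  note qH = ap_Hom[OF p a q(1)] note yH = ap_Hom[OF qH b q(2)]
  have "ap (y \<odot> s) f v" if s: "s \<in> Mor C" "Cod C s = Z" and f: "f \<in> Hom C (Dom C s) A"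
    and ev: "evl t (\<lambda>i. if i = 0 then a \<odot> s else if i = 1 then b \<odot> s else f) v" for s f v
  proof -
    let ?e = "\<lambda>i::nat. if i = 0 then a \<odot> s else if i = 1 then b \<odot> s else f"
    note ps = Comp_Hom[OF p s] and as = Comp_Hom[OF a s] and bs = Comp_Hom[OF b s]
    have "apps (p \<odot> s) ?e 3 v"
      using act[OF ps _ mem_Comp_filter[OF T m p s], of ?e] as bs f ev by simp
    then obtain q' y' where q': "ap (p \<odot> s) (a \<odot> s) q'" "ap q' (b \<odot> s) y'" "ap y' f v" by (auto simp: numeral_3_eq_3)
    have "q' = q \<odot> s" using ap_fun[OF ps as q'(1) ap_comp[OF p a q(1) s]] .
    then have "y' = y \<odot> s" using ap_fun[OF Comp_Hom[OF qH s] bs _ ap_comp[OF qH b q(2) s]] q'(2) by simp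
    then show ?thesis using q'(3) by simp
  qed
  then show ?thesis using q qH yH by blast
qed

lemma pair_ex:
  assumes p: "p \<in> Hom C Z A" and a: "a \<in> Hom C Z A" and b: "b \<in> Hom C Z A" and m: "sub_mem C Pr p"
  shows "\<exists>q y. ap p a q \<and> ap q b y \<and> q \<in> Hom C Z A \<and> y \<in> Hom C Z A \<and>
    (\<forall>s k. s \<in> Mor C \<longrightarrow> Cod C s = Z \<longrightarrow> k \<in> Hom C (Dom C s) A \<longrightarrow>
      (sub_mem C Kt k \<longrightarrow> ap (y \<odot> s) k (a \<odot> s)) \<and> (sub_mem C Kf k \<longrightarrow> ap (y \<odot> s) k (b \<odot> s)))"
proof -
  let ?t = "PApp (PApp (PVar 2) (PVar 0)) (PVar 1)"
  note c = combs_inst(3)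
  obtain q y where q: "ap p a q" "ap q b y" "q \<in> Hom C Z A" "y \<in> Hom C Z A"
    and ev: "\<And>s f v. s \<in> Mor C \<Longrightarrow> Cod C s = Z \<Longrightarrow> f \<in> Hom C (Dom C s) A \<Longrightarrow>
      evl ?t (\<lambda>i. if i = 0 then a \<odot> s else if i = 1 then b \<odot> s else f) v \<Longrightarrow> ap (y \<odot> s) f v"
    using comb3[OF c p a b m] by blast
  have "(sub_mem C Kt k \<longrightarrow> ap (y \<odot> s) k (a \<odot> s)) \<and> (sub_mem C Kf k \<longrightarrow> ap (y \<odot> s) k (b \<odot> s))"
    if s: "s \<in> Mor C" "Cod C s = Z" and k: "k \<in> Hom C (Dom C s) A" for s k
  proof -
    note as = Comp_Hom[OF a s] and bs = Comp_Hom[OF b s]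
    show ?thesis using ev[OF s k] Kt_ap[OF k as bs] Kf_ap[OF k as bs] by auto
  qed
  then show ?thesis using q by blast
qed

text \<open>A pair is described by its answers to all elements of \<open>Kt\<close> and
  \<open>Kf\<close>. No projection has to be chosen globally, and representability comes from that
  of \<open>rimp\<close>.\<close>

definition rconj where
  "rconj \<alpha> \<beta> a x \<longleftrightarrow> rimp (\<lambda>a x. sub_mem C Kt a) \<alpha> a x \<and> rimp (\<lambda>a x. sub_mem C Kf a) \<beta> a x"

lemma pred_rconj: "pred X \<alpha> \<Longrightarrow> pred X \<beta> \<Longrightarrow> pred X (rconj \<alpha> \<beta>)"
  unfolding rconj_def
  by (intro pred_conj pred_rimp pred_fst filter_Sub comb_filter) (auto dest: pred_Obj)

lemma rconjI:
  assumes p: "pred X \<alpha>" "pred X \<beta>" and a: "a \<in> Hom C Z A" and b: "b \<in> Hom C Z A" and x: "x \<in> Hom C Z X"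
    and al: "\<alpha> a x" and be: "\<beta> b x"
    and y: "\<And>s k. s \<in> Mor C \<Longrightarrow> Cod C s = Z \<Longrightarrow> k \<in> Hom C (Dom C s) A \<Longrightarrow> sub_mem C Kt k \<Longrightarrow> ap (y \<odot> s) k (a \<odot> s)"
    "\<And>s k. s \<in> Mor C \<Longrightarrow> Cod C s = Z \<Longrightarrow> k \<in> Hom C (Dom C s) A \<Longrightarrow> sub_mem C Kf k \<Longrightarrow> ap (y \<odot> s) k (b \<odot> s)"
  shows "rconj \<alpha> \<beta> y x"
  unfolding rconj_def
  using y pred_comp[OF p(1) a x al] pred_comp[OF p(2) b x be] HomD(2)[OF x] by (intro conjI rimpI; metis)

lemma rconj_ex:
  assumes p: "pred X \<alpha>" "pred X \<beta>" and a: "a \<in> Hom C Z A" and b: "b \<in> Hom C Z A" and x: "x \<in> Hom C Z X"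
    and al: "\<alpha> a x" and be: "\<beta> b x" and p: "p \<in> Hom C Z A" and m: "sub_mem C Pr p"
  shows "\<exists>q y. ap p a q \<and> ap q b y \<and> y \<in> Hom C Z A \<and> rconj \<alpha> \<beta> y x"
proof -
  obtain q y where q: "ap p a q" "ap q b y" "q \<in> Hom C Z A" "y \<in> Hom C Z A"
    and y: "\<And>s k. s \<in> Mor C \<Longrightarrow> Cod C s = Z \<Longrightarrow> k \<in> Hom C (Dom C s) A \<Longrightarrow>
      (sub_mem C Kt k \<longrightarrow> ap (y \<odot> s) k (a \<odot> s)) \<and> (sub_mem C Kf k \<longrightarrow> ap (y \<odot> s) k (b \<odot> s))"
    using pair_ex[OF p a b m] by blast
  have "rconj \<alpha> \<beta> y x" by (rule rconjI[OF assms(1,2) a b x al be]) (use y in auto)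
  then show ?thesis using q by blast
qed

lemma rconj_left:
  assumes p: "pred X \<alpha>" "pred X \<beta>" shows "ent X (rconj \<alpha> \<beta>) \<alpha>"
proof (rule entI1[of 1 "\<lambda>_. Kt" "PApp (PVar 1) (PVar 0)", OF _ _ pred_rconj[OF p] p(1)])
  fix Z e b x assume e: "\<forall>i<1::nat. e i \<in> Hom C Z A \<and> sub_mem C Kt (e i)" and b: "b \<in> Hom C Z A" and x: "x \<in> Hom C Z X" and a: "rconj \<alpha> \<beta> b x"
  have "\<exists>c. ap b (e 0) c \<and> \<alpha> c x" using a rimpD0[OF _ b x, of "\<lambda>a x. sub_mem C Kt a" \<alpha> "e 0"] e unfolding rconj_def by simp
  then show "\<exists>v. evl (PApp (PVar 1) (PVar 0)) (\<lambda>i. if i < 1 then e i else b) v \<and> \<alpha> v x" by simp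
qed (auto simp: comb_filter)

lemma rconj_right:
  assumes p: "pred X \<alpha>" "pred X \<beta>" shows "ent X (rconj \<alpha> \<beta>) \<beta>"
proof (rule entI1[of 1 "\<lambda>_. Kf" "PApp (PVar 1) (PVar 0)", OF _ _ pred_rconj[OF p] p(2)])
  fix Z e b x assume e: "\<forall>i<1::nat. e i \<in> Hom C Z A \<and> sub_mem C Kf (e i)" and b: "b \<in> Hom C Z A" and x: "x \<in> Hom C Z X" and a: "rconj \<alpha> \<beta> b x"
  have "\<exists>c. ap b (e 0) c \<and> \<beta> c x" using a rimpD0[OF _ b x, of "\<lambda>a x. sub_mem C Kf a" \<beta> "e 0"] e unfolding rconj_def by simp
  then show "\<exists>v. evl (PApp (PVar 1) (PVar 0)) (\<lambda>i. if i < 1 then e i else b) v \<and> \<beta> v x" by simp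
qed (auto simp: comb_filter)

lemma rconj_intro:
  assumes "ent X \<gamma> \<alpha>" "ent X \<gamma> \<beta>" and p: "pred X \<gamma>" "pred X \<alpha>" "pred X \<beta>" shows "ent X \<gamma> (rconj \<alpha> \<beta>)"
proof -
  obtain R S where R: "R \<in> \<phi>" "tracker R X \<gamma> \<alpha>" and S: "S \<in> \<phi>" "tracker S X \<gamma> \<beta>" using assms by (auto simp: ent_def)
  let ?Rs = "\<lambda>i::nat. if i = 0 then R else S"
  \<comment> \<open>The pair is built in place as \<open>\<lambda>c k. k (r c) (s c)\<close> with
    parameters \<open>r\<close> and \<open>s\<close> from the two trackers: index 2 is the realizer
    \<open>c\<close>, index 3 the selecting boolean.\<close>
  let ?t = "PApp (PApp (PVar 3) (PApp (PVar 0) (PVar 2))) (PApp (PVar 1) (PVar 2))"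
  show ?thesis
  proof (rule entI2[of 2 ?Rs ?t, OF _ _ p(1) pred_rconj[OF p(2,3)]])
    fix Z e c x y assume e: "\<forall>i<2. e i \<in> Hom C Z A \<and> sub_mem C (?Rs i) (e i)" and c: "c \<in> Hom C Z A" and y: "y \<in> Hom C Z A"
      and x: "x \<in> Hom C Z X" and g: "\<gamma> c x"
      and act: "\<And>s b v. s \<in> Mor C \<Longrightarrow> Cod C s = Z \<Longrightarrow> b \<in> Hom C (Dom C s) A \<Longrightarrow>
        evl ?t (\<lambda>i. if i < 2 then e i \<odot> s else if i = 2 then c \<odot> s else b) v \<Longrightarrow> ap (y \<odot> s) b v"
    have e0: "e 0 \<in> Hom C Z A" "sub_mem C R (e 0)" and e1: "e 1 \<in> Hom C Z A" "sub_mem C S (e 1)"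
      using e[rule_format, of 0] e[rule_format, of 1] by auto
    obtain a where a: "ap (e 0) c a" "\<alpha> a x" using trackerD[OF R(2) e0(1) c x e0(2)] g by blast
    obtain b where b: "ap (e 1) c b" "\<beta> b x" using trackerD[OF S(2) e1(1) c x e1(2)] g by blast
    note aH = ap_Hom[OF e0(1) c a(1)] and bH = ap_Hom[OF e1(1) c b(1)]
    show "rconj \<alpha> \<beta> y x"
    proof (rule rconjI[OF p(2,3) aH bH x a(2) b(2)])
      fix s k assume s: "s \<in> Mor C" "Cod C s = Z" and k: "k \<in> Hom C (Dom C s) A" and m: "sub_mem C Kt k"
      obtain z where "ap k (a \<odot> s) z" "ap z (b \<odot> s) (a \<odot> s)" using Kt_ap[OF k Comp_Hom[OF aH s] Comp_Hom[OF bH s] m] by blast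
      then show "ap (y \<odot> s) k (a \<odot> s)"
        using ap_comp[OF e0(1) c a(1) s] ap_comp[OF e1(1) c b(1) s] by (intro act[OF s k]) auto
    next
      fix s k assume s: "s \<in> Mor C" "Cod C s = Z" and k: "k \<in> Hom C (Dom C s) A" and m: "sub_mem C Kf k"
      obtain z where "ap k (a \<odot> s) z" "ap z (b \<odot> s) (b \<odot> s)" using Kf_ap[OF k Comp_Hom[OF aH s] Comp_Hom[OF bH s] m] by blast
      then show "ap (y \<odot> s) k (b \<odot> s)"
        using ap_comp[OF e0(1) c a(1) s] ap_comp[OF e1(1) c b(1) s] by (intro act[OF s k]) auto
    qed
  qed (use R S in auto)
qed

lemma ent_reindex:
  assumes "ent Y \<alpha> \<beta>" "f \<in> Hom C X Y" shows "ent X (\<lambda>a x. \<alpha> a (f \<odot> x)) (\<lambda>a x. \<beta> a (f \<odot> x))"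
proof -
  obtain R where R: "R \<in> \<phi>" "tracker R Y \<alpha> \<beta>" using assms by (auto simp: ent_def)
  have "f \<odot> x \<in> Hom C Z Y" if "x \<in> Hom C Z X" for x Z using Comp_in_Hom[OF that assms(2)] .
  then have "tracker R X (\<lambda>a x. \<alpha> a (f \<odot> x)) (\<lambda>a x. \<beta> a (f \<odot> x))" using R(2) unfolding tracker_def by blast
  then show ?thesis using R by (auto simp: ent_def)
qed

text \<open>Currying: the realizer \<open>c\<close> of \<beta> and a realizer of \<rho> at a point
  of the fibre are paired and fed to the tracker. The polynomial need have a value only for such
  realizers of \<rho>, which \<open>entI2\<close> tolerates.\<close>

lemma rall_intro:
  assumes "ent X (rconj (\<lambda>a x. \<beta> a (f \<odot> x)) \<rho>) \<delta>" and f: "f \<in> Hom C X Y" and p: "pred Y \<beta>" "pred X \<rho>" "pred X \<delta>"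
  shows "ent Y \<beta> (rall f X (rimp \<rho> \<delta>))"
proof -
  obtain R where R: "R \<in> \<phi>" "tracker R X (rconj (\<lambda>a x. \<beta> a (f \<odot> x)) \<rho>) \<delta>" using assms by (auto simp: ent_def)
  let ?Rs = "\<lambda>i::nat. if i = 0 then R else Pr"
  \<comment> \<open>Index 0 is the tracker, 1 the pairing combinator, 2 the realizer of \<beta> and
    3 the realizer of \<rho>.\<close>
  let ?t = "PApp (PVar 0) (PApp (PApp (PVar 1) (PVar 2)) (PVar 3))"
  show ?thesis
  proof (rule entI2[of 2 ?Rs ?t, OF _ _ p(1) pred_rall[OF pred_rimp[OF p(2,3)] f]])
    fix Z e c x y assume e: "\<forall>i<2. e i \<in> Hom C Z A \<and> sub_mem C (?Rs i) (e i)" and c: "c \<in> Hom C Z A" and y: "y \<in> Hom C Z A"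
      and x: "x \<in> Hom C Z Y" and g: "\<beta> c x"
      and act: "\<And>s b v. s \<in> Mor C \<Longrightarrow> Cod C s = Z \<Longrightarrow> b \<in> Hom C (Dom C s) A \<Longrightarrow>
        evl ?t (\<lambda>i. if i < 2 then e i \<odot> s else if i = 2 then c \<odot> s else b) v \<Longrightarrow> ap (y \<odot> s) b v"
    have e0: "e 0 \<in> Hom C Z A" "sub_mem C R (e 0)" and e1: "e 1 \<in> Hom C Z A" "sub_mem C Pr (e 1)"
      using e[rule_format, of 0] e[rule_format, of 1] by auto
    note xT = HomD[OF x] and yT = HomD[OF y] and fT = HomD[OF f]
    show "rall f X (rimp \<rho> \<delta>) y x" unfolding rall_def xT(2)
    proof (intro allI impI rimpI)
      fix s x' s' b assume s: "s \<in> Mor C" "Cod C s = Z" and x': "x' \<in> Hom C (Dom C s) X" and fx: "f \<odot> x' = x \<odot> s"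
        and s': "s' \<in> Mor C" "Cod C s' = Dom C x'" and b: "b \<in> Hom C (Dom C s') A" and r: "\<rho> b (x' \<odot> s')"
      note x'T = HomD[OF x']
      let ?s = "s \<odot> s'"
      have ss: "?s \<in> Mor C" "Cod C ?s = Z" and D: "Dom C ?s = Dom C s'" using s s' x'T by simp_all
      have xs': "x' \<odot> s' \<in> Hom C (Dom C ?s) X" using Comp_Hom[OF x' s'(1)] s' x'T D by simp
      have fx': "f \<odot> (x' \<odot> s') = x \<odot> ?s"
      proof -
        have "f \<odot> (x' \<odot> s') = (f \<odot> x') \<odot> s'" using fT x'T s' by simp
        then show ?thesis unfolding fx using xT s s' x'T by simp
      qed
      note cs = Comp_Hom[OF c ss] and es = Comp_Hom[OF e0(1) ss] and ps = Comp_Hom[OF e1(1) ss]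
      have bH: "b \<in> Hom C (Dom C ?s) A" using b D by simp
      have bs: "\<beta> (c \<odot> ?s) (f \<odot> (x' \<odot> s'))" unfolding fx' using pred_comp[OF p(1) c x g ss] .
      obtain q z where q: "ap (e 1 \<odot> ?s) (c \<odot> ?s) q" "ap q b z" "z \<in> Hom C (Dom C ?s) A"
          "rconj (\<lambda>a x. \<beta> a (f \<odot> x)) \<rho> z (x' \<odot> s')"
        using rconj_ex[OF pred_reindex[OF p(1) f] p(2) cs bH xs' bs r ps mem_Comp_filter[OF comb_filter(3) e1(2,1) ss]] by blast
      obtain v where v: "ap (e 0 \<odot> ?s) z v" "\<delta> v (x' \<odot> s')"
        using trackerD[OF R(2) es q(3) xs' mem_Comp_filter[OF R(1) e0(2,1) ss] q(4)] by blast
      have "ap (y \<odot> ?s) b v" by (rule act[OF ss bH]) (use q v in auto)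
      then have "ap ((y \<odot> s) \<odot> s') b v" using yT s s' x'T by simp
      then show "\<exists>c. ap ((y \<odot> s) \<odot> s') b c \<and> \<delta> c (x' \<odot> s')" using v by blast
    qed
  qed (use R in \<open>auto simp: comb_filter\<close>)
qed

text \<open>The same tracker serves: its value at \<open>f \<odot> x\<close> is instantiated at the
  identity stage and at \<open>x\<close> itself.\<close>

lemma rall_elim:
  assumes "ent Y \<beta> (rall f X \<delta>)" and f: "f \<in> Hom C X Y"
  shows "ent X (\<lambda>a x. \<beta> a (f \<odot> x)) \<delta>"
proof -
  obtain R where R: "R \<in> \<phi>" "tracker R Y \<beta> (rall f X \<delta>)" using assms by (auto simp: ent_def)
  have "tracker R X (\<lambda>a x. \<beta> a (f \<odot> x)) \<delta>" unfolding tracker_def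
  proof (intro allI ballI impI)
    fix Z r b x assume r: "r \<in> Hom C Z A" and b: "b \<in> Hom C Z A" and x: "x \<in> Hom C Z X" and m: "sub_mem C R r" and be: "\<beta> b (f \<odot> x)"
    note fx = Comp_in_Hom[OF x f] and Z = Hom_Obj(1)[OF x]
    obtain c where c: "ap r b c" "rall f X \<delta> c (f \<odot> x)" using trackerD[OF R(2) r b fx m be] by blast
    have "\<delta> (c \<odot> Ident C Z) x"
      using c(2)[unfolded rall_def, rule_format, of "Ident C Z" x] x Z HomD[OF fx] by simp
    then show "\<exists>c. ap r b c \<and> \<delta> c x" using c(1) HomD[OF ap_Hom[OF r b c(1)]] by auto
  qed
  then show ?thesis using R by (auto simp: ent_def)
qed

text \<open>The case of \<open>rall_intro\<close> along an identity; the remaining entailments only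
  erase compositions with it.\<close>

lemma rimp_intro:
  assumes "ent X (rconj \<gamma> \<alpha>) \<beta>" and p: "pred X \<gamma>" "pred X \<alpha>" "pred X \<beta>"
  shows "ent X \<gamma> (rimp \<alpha> \<beta>)"
proof -
  have X: "X \<in> Obj C" using p(1) by (rule pred_Obj)
  have I: "Ident C X \<in> Hom C X X" using X by (rule Ident_in_Hom)
  let ?g = "\<lambda>a x. \<gamma> a (Ident C X \<odot> x)"
  have eq: "?g a x = \<gamma> a x" if "x \<in> Hom C Z X" for a x Z using HomD[OF that] by simp
  note pg = pred_reindex[OF p(1) I]
  have g\<gamma>: "ent X ?g \<gamma>" by (rule ent_mono[OF pg p(1)]) (simp add: eq)
  note pc = pred_rconj[OF pg p(2)]
  have "ent X (rconj ?g \<alpha>) (rconj \<gamma> \<alpha>)"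
    by (rule rconj_intro[OF ent_trans[OF rconj_left[OF pg p(2)] g\<gamma> pc p(1)] rconj_right[OF pg p(2)] pc p(1,2)])
  then have "ent X (rconj ?g \<alpha>) \<beta>" using ent_trans[OF _ assms(1) pc p(3)] by blast
  note r = rall_intro[OF this I p]
  have "ent X (rall (Ident C X) X (rimp \<alpha> \<beta>)) (rimp \<alpha> \<beta>)"
  proof (rule ent_mono[OF pred_rall[OF pred_rimp[OF p(2,3)] I] pred_rimp[OF p(2,3)]])
    fix Z b x assume b: "b \<in> Hom C Z A" and x: "x \<in> Hom C Z X" and a: "rall (Ident C X) X (rimp \<alpha> \<beta>) b x"
    show "rimp \<alpha> \<beta> b x"
      using a[unfolded rall_def, rule_format, of "Ident C Z" x] HomD[OF x] HomD[OF b] Hom_Obj(1)[OF x] x by simp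
  qed
  then show ?thesis using ent_trans[OF r _ p(1) pred_rimp[OF p(2,3)]] by blast
qed

lemma rimp_elim:
  assumes p: "pred X \<alpha>" "pred X \<beta>" shows "ent X (rconj (rimp \<alpha> \<beta>) \<alpha>) \<beta>"
proof -
  let ?Rs = "\<lambda>i::nat. if i = 0 then Kt else Kf"
  \<comment> \<open>The realizer of the conjunction, index 2, is split by the two booleans, and its
    first component is applied to the second.\<close>
  let ?t = "PApp (PApp (PVar 2) (PVar 0)) (PApp (PVar 2) (PVar 1))"
  show ?thesis
  proof (rule entI1[of 2 ?Rs ?t, OF _ _ pred_rconj[OF pred_rimp[OF p] p(1)] p(2)])
    fix Z e b x assume e: "\<forall>i<2. e i \<in> Hom C Z A \<and> sub_mem C (?Rs i) (e i)" and b: "b \<in> Hom C Z A" and x: "x \<in> Hom C Z X"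
      and a: "rconj (rimp \<alpha> \<beta>) \<alpha> b x"
    have e0: "e 0 \<in> Hom C Z A" "sub_mem C Kt (e 0)" and e1: "e 1 \<in> Hom C Z A" "sub_mem C Kf (e 1)"
      using e[rule_format, of 0] e[rule_format, of 1] by auto
    obtain u where u: "ap b (e 0) u" "rimp \<alpha> \<beta> u x" using a rimpD0[OF _ b x e0(1)] e0(2) unfolding rconj_def by blast
    obtain v where v: "ap b (e 1) v" "\<alpha> v x" using a rimpD0[OF _ b x e1(1)] e1(2) unfolding rconj_def by blast
    obtain c where "ap u v c" "\<beta> c x" using rimpD0[OF u(2) ap_Hom[OF b e0(1) u(1)] x ap_Hom[OF b e1(1) v(1)] v(2)] by blast
    then show "\<exists>v. evl ?t (\<lambda>i. if i < 2 then e i else b) v \<and> \<beta> v x" using u v by auto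
  qed (auto simp: comb_filter)
qed

text \<open>From right to left the same tracker serves, as \<open>rex\<close> leaves realizers
  alone; the witness exists only over a cover, which \<open>ap_pred_local\<close> removes.
  Conversely the unit of the image is composed with the reindexed entailment.\<close>

lemma rex_iff:
  assumes p: "pred X \<alpha>" "pred Y \<beta>" and f: "f \<in> Hom C X Y"
  shows "ent Y (rex f X \<alpha>) \<beta> \<longleftrightarrow> ent X \<alpha> (\<lambda>a x. \<beta> a (f \<odot> x))"
proof
  assume "ent X \<alpha> (\<lambda>a x. \<beta> a (f \<odot> x))"
  then obtain R where R: "R \<in> \<phi>" "tracker R X \<alpha> (\<lambda>a x. \<beta> a (f \<odot> x))" by (auto simp: ent_def)
  have "tracker R Y (rex f X \<alpha>) \<beta>" unfolding tracker_def
  proof (intro allI ballI impI)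
    fix Z r b y assume r: "r \<in> Hom C Z A" and b: "b \<in> Hom C Z A" and y: "y \<in> Hom C Z Y" and m: "sub_mem C R r" and be: "rex f X \<alpha> b y"
    obtain w x where w: "cover w" "Cod C w = Z" and x: "x \<in> Hom C (Dom C w) X" "f \<odot> x = y \<odot> w" "\<alpha> (b \<odot> w) x"
      using be HomD(2)[OF y] unfolding rex_def by blast
    note wM = cover_Mor[OF w(1)]
    obtain c where "ap (r \<odot> w) (b \<odot> w) c" "\<beta> c (f \<odot> x)"
      using trackerD[OF R(2) Comp_Hom[OF r wM w(2)] Comp_Hom[OF b wM w(2)] x(1) mem_Comp_filter[OF R(1) m r wM w(2)] x(3)] by blast
    then show "\<exists>c. ap r b c \<and> \<beta> c y" using ap_pred_local[OF w r b y p(2)] x(2) by simp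
  qed
  then show "ent Y (rex f X \<alpha>) \<beta>" using R by (auto simp: ent_def)
next
  assume e: "ent Y (rex f X \<alpha>) \<beta>"
  note pr = pred_rex[OF p(1) f]
  have "ent X \<alpha> (\<lambda>a x. rex f X \<alpha> a (f \<odot> x))"
  proof (rule ent_mono[OF p(1) pred_reindex[OF pr f]])
    fix Z b x assume b: "b \<in> Hom C Z A" and x: "x \<in> Hom C Z X" and a: "\<alpha> b x"
    note fx = Comp_in_Hom[OF x f] and Z = Hom_Obj(1)[OF x]
    show "rex f X \<alpha> b (f \<odot> x)" unfolding rex_def HomD(2)[OF fx]
      using cover_Ident[OF Z] Z x a HomD[OF fx] HomD[OF b] by (intro exI[of _ "Ident C Z"] exI[of _ x]) simp
  qed
  then show "ent X \<alpha> (\<lambda>a x. \<beta> a (f \<odot> x))"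
    using ent_trans[OF _ ent_reindex[OF e f] p(1) pred_reindex[OF p(2) f]] by blast
qed

section \<open>Falsity and disjunction\<close>

definition rbot where "rbot X a x \<longleftrightarrow> sub_mem C (\<bottom>\<^bsub>Sub C (prod_obj C A X)\<^esub>) (pairing C a x)"

lemma pred_rbot: assumes X: "X \<in> Obj C" shows "pred X (rbot X)"
proof -
  interpret heyting_algebra "Sub C (prod_obj C A X)" by (rule Sub_heyting) (simp add: X)
  show ?thesis unfolding rbot_def[abs_def] by (rule pred_Sub[OF X bottom_closed])
qed

text \<open>The identity realizer works, since falsity of the base yields any representable
  property.\<close>

lemma rbot_ent: assumes p: "pred X \<beta>" shows "ent X (rbot X) \<beta>"
proof (rule ent_mono[OF pred_rbot[OF pred_Obj[OF p]] p])
  fix Z b x assume b: "b \<in> Hom C Z A" and x: "x \<in> Hom C Z X" and a: "rbot X b x"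
  have "\<beta> (b \<odot> Ident C Z) (x \<odot> Ident C Z)"
    by (rule bottom_elim[OF HomD(1,3,2)[OF pairing_Hom[OF b x]] _ pred_representable[OF p b x]]) (use a in \<open>simp add: rbot_def\<close>)
  then show "\<beta> b x" using HomD[OF b] HomD[OF x] by simp
qed

text \<open>Realizers of the left and right disjunct are tagged by the images of \<open>\<lambda>b f g. f b\<close>
  and \<open>\<lambda>b f g. g b\<close>.\<close>

definition rtag where
  "rtag L X \<alpha> a x \<longleftrightarrow> (\<exists>w l b. cover w \<and> Cod C w = Dom C x \<and> l \<in> Hom C (Dom C w) A \<and> b \<in> Hom C (Dom C w) A \<and>
    sub_mem C L l \<and> \<alpha> b (x \<odot> w) \<and> ap l b (a \<odot> w))"

text \<open>The union of the tagged predicates is taken in the base. A polynomial cannot inspect on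
  which side of a union a realizer lies; the tags let one polynomial treat both.\<close>

definition ror where
  "ror X \<alpha> \<beta> a x \<longleftrightarrow> sub_mem C (
      sub_of C (prod_obj C A X) (\<lambda>p. rtag Il X \<alpha> (pr1 C A X \<odot> p) (pr2 C A X \<odot> p)) \<squnion>\<^bsub>Sub C (prod_obj C A X)\<^esub>
      sub_of C (prod_obj C A X) (\<lambda>p. rtag Ir X \<beta> (pr1 C A X \<odot> p) (pr2 C A X \<odot> p))) (pairing C a x)"

text \<open>Lets the condition that a product equals a given realizer be an instance of
  \<open>representable_ap\<close>, as \<open>rtag\<close> demands.\<close>

lemma pred_eq: "pred A (\<lambda>a x. a = x)"
proof (rule predI)
  note P = pm_total_PMor[of "pr1 C A A" "prod_obj C A A" A] pm_total_PMor[of "pr2 C A A" "prod_obj C A A" A]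
  show "representable C (prod_obj C A A) (\<lambda>p. pr1 C A A \<odot> p = pr2 C A A \<odot> p)"
  proof (rule representable_Sub[OF pm_eq_carrier[OF P]])
    fix x assume x: "x \<in> Mor C" "Cod C x = prod_obj C A A"
    show "sub_mem C (pm_eq C (pm_total C (pr1 C A A)) (pm_total C (pr2 C A A))) x \<longleftrightarrow> pr1 C A A \<odot> x = pr2 C A A \<odot> x"
      using mem_pm_eq[OF P, of x] pm_val_total[of "pr1 C A A" "prod_obj C A A" A x] pm_val_total[of "pr2 C A A" "prod_obj C A A" A x] x
      by simp
  qed simp_all
qed simp_all

lemma pred_rtag:
  assumes a: "pred X \<alpha>" and L: "L \<in> \<phi>" shows "pred X (rtag L X \<alpha>)"
proof -
  have X: "X \<in> Obj C" using a by (rule pred_Obj)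
  let ?AX = "prod_obj C A X" and ?AA = "prod_obj C A A" let ?W = "prod_obj C ?AX ?AA"
  let ?p = "pr1 C ?AX ?AA" and ?q = "pr2 C ?AX ?AA"
  let ?a = "pr1 C A X \<odot> ?p" and ?x = "pr2 C A X \<odot> ?p" and ?l = "pr1 C A A \<odot> ?q" and ?b = "pr2 C A A \<odot> ?q"
  have pT: "?p \<in> Mor C" "Dom C ?p = ?W" "Cod C ?p = ?AX" using X by simp_all
  have lH: "?l \<in> Hom C ?W A" and bH: "?b \<in> Hom C ?W A" and aH: "?a \<in> Hom C ?W A" and xH: "?x \<in> Hom C ?W X" using X by (simp_all add: Hom_def)
  note r1 = pred_representable[OF a bH xH] and r2 = representable_ap[OF lH bH aH pred_eq]
    and r3 = pred_representable[OF pred_fst[OF X filter_Sub[OF L]] lH xH]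
  note r = representable_ex[OF pT representable_conj[OF r3 representable_conj[OF r1 r2]]]
  show ?thesis
  proof (rule predI[OF X r])
    fix p assume p: "p \<in> Mor C" "Cod C p = ?AX"
    let ?P = "pr1 C A X \<odot> p" and ?X = "pr2 C A X \<odot> p"
    have D: "Dom C ?X = Dom C p" using p X by simp
    show "(\<exists>w u. cover w \<and> Cod C w = Dom C p \<and> u \<in> Mor C \<and> Dom C u = Dom C w \<and> Cod C u = ?W \<and> ?p \<odot> u = p \<odot> w \<and>
        sub_mem C L (?l \<odot> u) \<and> \<alpha> (?b \<odot> u) (?x \<odot> u) \<and> (\<exists>c. ap (?l \<odot> u) (?b \<odot> u) c \<and> c = ?a \<odot> u)) \<longleftrightarrow>
      rtag L X \<alpha> ?P ?X" (is "?L \<longleftrightarrow> ?R")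
    proof
      assume ?L
      then obtain w u where w: "cover w" "Cod C w = Dom C p" and u: "u \<in> Mor C" "Dom C u = Dom C w" "Cod C u = ?W" and e: "?p \<odot> u = p \<odot> w"
        and h: "sub_mem C L (?l \<odot> u)" "\<alpha> (?b \<odot> u) (?x \<odot> u)" "ap (?l \<odot> u) (?b \<odot> u) (?a \<odot> u)" by blast
      have "?x \<odot> u = ?X \<odot> w" "?a \<odot> u = ?P \<odot> w" using e u w p X cover_Mor[OF w(1)] by simp_all
      then show ?R unfolding rtag_def D using h w Comp_Hom[OF lH u(1,3)] Comp_Hom[OF bH u(1,3)] u(2)
        by (intro exI[of _ w] exI[of _ "?l \<odot> u"] exI[of _ "?b \<odot> u"]) simp
    next
      assume ?R
      then obtain w l b where w: "cover w" "Cod C w = Dom C p" and l: "l \<in> Hom C (Dom C w) A" "b \<in> Hom C (Dom C w) A"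
        and h: "sub_mem C L l" "\<alpha> b (?X \<odot> w)" "ap l b (?P \<odot> w)" unfolding rtag_def D by blast
      note wM = cover_Mor[OF w(1)] and lT = HomD[OF l(1)] and bT = HomD[OF l(2)]
      let ?u = "pairing C (p \<odot> w) (pairing C l b)"
      have u: "?u \<in> Mor C" "Dom C ?u = Dom C w" "Cod C ?u = ?W" "?p \<odot> ?u = p \<odot> w" using p w(2) wM lT bT X by simp_all
      have e: "?l \<odot> ?u = l" "?b \<odot> ?u = b" "?x \<odot> ?u = ?X \<odot> w" "?a \<odot> ?u = ?P \<odot> w"
        using p w(2) wM lT bT X by simp_all
      show ?L using w u h by (intro exI[of _ w] exI[of _ ?u]) (simp only: e, simp)
    qed
  qed
qed

lemma ror_carriers:
  assumes p: "pred X \<alpha>" and L: "L \<in> \<phi>"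
  shows "representable C (prod_obj C A X) (\<lambda>p. rtag L X \<alpha> (pr1 C A X \<odot> p) (pr2 C A X \<odot> p))"
  using pred_rtag[OF p L] by (simp add: pred_def)

lemma pred_ror:
  assumes p: "pred X \<alpha>" "pred X \<beta>" shows "pred X (ror X \<alpha> \<beta>)"
proof -
  have X: "X \<in> Obj C" using p(1) by (rule pred_Obj)
  interpret heyting_algebra "Sub C (prod_obj C A X)" by (rule Sub_heyting) (simp add: X)
  show ?thesis unfolding ror_def[abs_def]
    by (rule pred_Sub[OF X join_closed[OF sub_of_carrier[OF ror_carriers] sub_of_carrier[OF ror_carriers]]])
      (use p comb_filter in auto)
qed

text \<open>The injection combinator itself does the tagging: its value at one argument exists
  because two more are awaited.\<close>

lemma tracker_rtag:
  assumes p: "pred X \<alpha>" and c: "combs L 3 t"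
  shows "tracker L X \<alpha> (rtag L X \<alpha>)"
  unfolding tracker_def
proof (intro allI ballI impI)
  fix Z r b x assume r: "r \<in> Hom C Z A" and b: "b \<in> Hom C Z A" and x: "x \<in> Hom C Z X" and m: "sub_mem C L r" and a: "\<alpha> b x"
  obtain q where q: "ap r b q" "q \<in> Hom C Z A" using comb3[OF c r b b m] by blast
  have Z: "Z \<in> Obj C" using x by (rule Hom_Obj)
  have "rtag L X \<alpha> q x" unfolding rtag_def HomD(2)[OF x]
    using cover_Ident[OF Z] Z r b m a q HomD[OF x] HomD[OF q(2)]
    by (intro exI[of _ "Ident C Z"] exI[of _ r] exI[of _ b]) simp
  then show "\<exists>c. ap r b c \<and> rtag L X \<alpha> c x" using q by blast
qed

lemma ror_intro:
  assumes p: "pred X \<alpha>" "pred X \<beta>"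
  shows "ent X \<alpha> (ror X \<alpha> \<beta>)" "ent X \<beta> (ror X \<alpha> \<beta>)"
proof -
  have X: "X \<in> Obj C" using p(1) by (rule pred_Obj)
  interpret heyting_algebra "Sub C (prod_obj C A X)" by (rule Sub_heyting) (simp add: X)
  note c = combs_inst(4,5)
  note r1 = ror_carriers[OF p(1) comb_filter(4)] and r2 = ror_carriers[OF p(2) comb_filter(5)]
  note s1 = sub_of_carrier[OF r1] and s2 = sub_of_carrier[OF r2]
  have 1: "ror X \<alpha> \<beta> b x" if "b \<in> Hom C Z A" "x \<in> Hom C Z X" "rtag Il X \<alpha> b x" for Z b x
    using join_left[OF s1 s2] HomD[OF pairing_Hom[OF that(1,2)]] mem_sub_of[OF r1, of "pairing C b x"] that(3) HomD[OF that(1)] HomD[OF that(2)]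
    unfolding Sub_le_iff[OF s1 join_closed[OF s1 s2]] ror_def by simp
  have 2: "ror X \<alpha> \<beta> b x" if "b \<in> Hom C Z A" "x \<in> Hom C Z X" "rtag Ir X \<beta> b x" for Z b x
    using join_right[OF s1 s2] HomD[OF pairing_Hom[OF that(1,2)]] mem_sub_of[OF r2, of "pairing C b x"] that(3) HomD[OF that(1)] HomD[OF that(2)]
    unfolding Sub_le_iff[OF s2 join_closed[OF s1 s2]] ror_def by simp
  have "ent X \<alpha> (rtag Il X \<alpha>)" "ent X \<beta> (rtag Ir X \<beta>)"
    unfolding ent_def using tracker_rtag[OF p(1) c(1)] tracker_rtag[OF p(2) c(2)] comb_filter(4,5) by blast+
  moreover have "ent X (rtag Il X \<alpha>) (ror X \<alpha> \<beta>)" "ent X (rtag Ir X \<beta>) (ror X \<alpha> \<beta>)"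
    by (rule ent_mono[OF pred_rtag[OF p(1) comb_filter(4)] pred_ror[OF p]], rule 1, assumption+)
      (rule ent_mono[OF pred_rtag[OF p(2) comb_filter(5)] pred_ror[OF p]], rule 2, assumption+)
  ultimately show "ent X \<alpha> (ror X \<alpha> \<beta>)" "ent X \<beta> (ror X \<alpha> \<beta>)" using ent_trans p pred_ror[OF p] by blast+
qed

text \<open>The polynomial applies the tagged realizer to both trackers. A tagged realizer is
  locally \<open>l\<close> applied to \<open>b\<close> with \<open>l\<close> in \<open>Il\<close> or
  \<open>Ir\<close>, so the result is the first or the second tracker applied to \<open>b\<close>.
  The union is eliminated into the representable statement that this double application realizes
  \<gamma>.\<close>

lemma ror_elim:
  assumes "ent X \<alpha> \<gamma>" "ent X \<beta> \<gamma>" and p: "pred X \<alpha>" "pred X \<beta>" "pred X \<gamma>"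
  shows "ent X (ror X \<alpha> \<beta>) \<gamma>"
proof -
  have X: "X \<in> Obj C" using p(1) by (rule pred_Obj)
  obtain R S where R: "R \<in> \<phi>" "tracker R X \<alpha> \<gamma>" and S: "S \<in> \<phi>" "tracker S X \<beta> \<gamma>" using assms by (auto simp: ent_def)
  let ?Rs = "\<lambda>i::nat. if i = 0 then R else S"
  let ?t = "PApp (PApp (PVar 2) (PVar 0)) (PVar 1)"
  note c = combs_inst(4,5)
  note r1 = ror_carriers[OF p(1) comb_filter(4)] and r2 = ror_carriers[OF p(2) comb_filter(5)]
  note s1 = sub_of_carrier[OF r1] and s2 = sub_of_carrier[OF r2]
  show ?thesis
  proof (rule entI1[of 2 ?Rs ?t, OF _ _ pred_ror[OF p(1,2)] p(3)])
    fix Z e a x assume e: "\<forall>i<2. e i \<in> Hom C Z A \<and> sub_mem C (?Rs i) (e i)" and a: "a \<in> Hom C Z A" and x: "x \<in> Hom C Z X"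
      and o: "ror X \<alpha> \<beta> a x"
    have e0: "e 0 \<in> Hom C Z A" "sub_mem C R (e 0)" and e1: "e 1 \<in> Hom C Z A" "sub_mem C S (e 1)"
      using e[rule_format, of 0] e[rule_format, of 1] by auto
    have Z: "Z \<in> Obj C" using x by (rule Hom_Obj)
    let ?AX = "prod_obj C A X"
    \<comment> \<open>The double application is a nested use of \<open>representable_ap\<close>:
      over \<open>A \<times> X\<close> its second argument travels as a component of the
      point.\<close>
    let ?h = "\<lambda>z q. \<exists>v. ap z (pr1 C A X \<odot> q) v \<and> \<gamma> v (pr2 C A X \<odot> q)"
    have ph: "pred ?AX ?h"
    proof (rule predI)
      show "?AX \<in> Obj C" using X by simp
      let ?p = "pr1 C A ?AX" and ?q = "pr2 C A ?AX"
      show "representable C (prod_obj C A ?AX) (\<lambda>z. \<exists>c. ap (?p \<odot> z) ((pr1 C A X \<odot> ?q) \<odot> z) c \<and> \<gamma> c ((pr2 C A X \<odot> ?q) \<odot> z))"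
        by (rule representable_ap[OF _ _ _ p(3)]) (use X in \<open>simp_all add: Hom_def\<close>)
    qed (use X in simp)
    let ?Q = "\<lambda>s. \<exists>z. ap (a \<odot> s) (e 0 \<odot> s) z \<and> (\<exists>v. ap z (e 1 \<odot> s) v \<and> \<gamma> v (x \<odot> s))"
    have Q: "representable C Z ?Q"
      by (rule representable_cong[OF _ representable_ap[OF a e0(1) pairing_Hom[OF e1(1) x] ph]])
        (use HomD[OF e1(1)] HomD[OF x] in simp)
    \<comment> \<open>Both disjuncts at once: \<open>j\<close> is the index by which the injection
      selects the first or the second tracker.\<close>
    have main: "?Q s"
      if s: "s \<in> Mor C" "Cod C s = Z" and tag: "rtag L X \<delta> (a \<odot> s) (x \<odot> s)" and L: "combs L 3 (PApp (PVar j) (PVar 0))" and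
        j: "(j = 1 \<and> L = Il \<and> \<delta> = \<alpha>) \<or> (j = 2 \<and> L = Ir \<and> \<delta> = \<beta>)" for s L \<delta> j
    proof -
      note as = Comp_Hom[OF a s] and xs = Comp_Hom[OF x s]
      obtain w l b where w: "cover w" "Cod C w = Dom C s" and l: "l \<in> Hom C (Dom C w) A" "b \<in> Hom C (Dom C w) A" "sub_mem C L l"
        and d: "\<delta> b ((x \<odot> s) \<odot> w)" and al: "ap l b ((a \<odot> s) \<odot> w)"
        using tag HomD(2)[OF xs] unfolding rtag_def by auto
      note wM = cover_Mor[OF w(1)]
      let ?s = "s \<odot> w"
      have ss: "?s \<in> Mor C" "Cod C ?s = Z" and D: "Dom C ?s = Dom C w" using s w(2) wM by simp_all
      have eqs: "(x \<odot> s) \<odot> w = x \<odot> ?s" "(a \<odot> s) \<odot> w = a \<odot> ?s" using HomD[OF x] HomD[OF a] s wM w(2) by simp_all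
      have e0s: "e 0 \<odot> ?s \<in> Hom C (Dom C w) A" and e1s: "e 1 \<odot> ?s \<in> Hom C (Dom C w) A" and xss: "x \<odot> ?s \<in> Hom C (Dom C w) X"
        using Comp_Hom[OF e0(1) ss] Comp_Hom[OF e1(1) ss] Comp_Hom[OF x ss] D by simp_all
      obtain q y where q: "ap l b q" "ap q (e 0 \<odot> ?s) y" and
        ev: "\<And>s' f v. s' \<in> Mor C \<Longrightarrow> Cod C s' = Dom C w \<Longrightarrow> f \<in> Hom C (Dom C s') A \<Longrightarrow>
          evl (PApp (PVar j) (PVar 0)) (\<lambda>i. if i = 0 then b \<odot> s' else if i = 1 then (e 0 \<odot> ?s) \<odot> s' else f) v \<Longrightarrow> ap (y \<odot> s') f v"
        using comb3[OF L l(1) l(2) e0s l(3)] by blast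
      \<comment> \<open>Single-valuedness identifies the tagged realizer with the partial
        application that \<open>comb3\<close> describes.\<close>
      have qa: "q = a \<odot> ?s" using ap_fun[OF l(1,2) q(1)] al eqs by simp
      have ySame: "y \<in> Hom C (Dom C w) A" using ap_Hom[OF _ e0s q(2)] ap_Hom[OF l(1,2) q(1)] by blast
      let ?i = "Ident C (Dom C w)"
      have i: "?i \<in> Mor C" "Cod C ?i = Dom C w" "Dom C ?i = Dom C w" using wM by simp_all
      have di: "\<delta> b (x \<odot> ?s)" using d eqs by simp
      obtain v where v: "ap (if j = 1 then e 0 \<odot> ?s else e 1 \<odot> ?s) b v" "\<gamma> v (x \<odot> ?s)"
        using j trackerD[OF R(2) e0s l(2) xss mem_Comp_filter[OF R(1) e0(2,1) ss]] di
          trackerD[OF S(2) e1s l(2) xss mem_Comp_filter[OF S(1) e1(2,1) ss]] by auto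
      have "ap (y \<odot> ?i) (e 1 \<odot> ?s) v"
      proof (rule ev[OF i(1,2)])
        show "e 1 \<odot> ?s \<in> Hom C (Dom C ?i) A" using e1s i by simp
        have "b \<odot> ?i = b" "(e 0 \<odot> ?s) \<odot> ?i = e 0 \<odot> ?s" using HomD[OF l(2)] HomD[OF e0s] by simp_all
        then show "evl (PApp (PVar j) (PVar 0)) (\<lambda>i. if i = 0 then b \<odot> ?i else if i = 1 then (e 0 \<odot> ?s) \<odot> ?i else e 1 \<odot> ?s) v"
          using v(1) j by (auto simp del: Comp_assoc')
      qed
      then have "ap y (e 1 \<odot> ?s) v" using HomD[OF ySame] by simp
      then have "?Q ?s" using q(2) qa v(2) by blast
      then show "?Q s" using cover_representable[OF w(1) Q s w(2)] by blast
    qed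
    have pT: "pairing C a x \<in> Mor C" "Cod C (pairing C a x) = ?AX" "Dom C (pairing C a x) = Z"
      using HomD[OF pairing_Hom[OF a x]] by simp_all
    have "?Q (Ident C Z)"
    proof (rule join_elim[OF s1 s2 pT o[unfolded ror_def] Q])
      fix s assume s: "s \<in> Mor C" "Cod C s = Z" and m: "sub_mem C (sub_of C ?AX (\<lambda>p. rtag Il X \<alpha> (pr1 C A X \<odot> p) (pr2 C A X \<odot> p))) (pairing C a x \<odot> s)"
      have "rtag Il X \<alpha> (a \<odot> s) (x \<odot> s)"
        using m mem_sub_of[OF r1, of "pairing C a x \<odot> s"] HomD[OF a] HomD[OF x] s by simp
      then show "?Q s" by (rule main[OF s _ c(1)]) simp
    next
      fix s assume s: "s \<in> Mor C" "Cod C s = Z" and m: "sub_mem C (sub_of C ?AX (\<lambda>p. rtag Ir X \<beta> (pr1 C A X \<odot> p) (pr2 C A X \<odot> p))) (pairing C a x \<odot> s)"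
      have "rtag Ir X \<beta> (a \<odot> s) (x \<odot> s)"
        using m mem_sub_of[OF r2, of "pairing C a x \<odot> s"] HomD[OF a] HomD[OF x] s by simp
      then show "?Q s" by (rule main[OF s _ c(2)]) simp
    qed
    then have "\<exists>z. ap a (e 0) z \<and> (\<exists>v. ap z (e 1) v \<and> \<gamma> v x)"
      using HomD[OF a] HomD[OF e0(1)] HomD[OF e1(1)] HomD[OF x] by simp
    then show "\<exists>v. evl ?t (\<lambda>i. if i < 2 then e i else a) v \<and> \<gamma> v x" by auto
  qed (use R S in auto)
qed

section \<open>Predicates with local realizers everywhere\<close>

definition total where
  "total X \<alpha> \<longleftrightarrow> (\<forall>x\<in>Mor C. Cod C x = X \<longrightarrow> (\<exists>w a. cover w \<and> Cod C w = Dom C x \<and> a \<in> Hom C (Dom C w) A \<and> \<alpha> a (x \<odot> w)))"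

lemma totalD:
  "total X \<alpha> \<Longrightarrow> x \<in> Hom C Z X \<Longrightarrow> \<exists>w a. cover w \<and> Cod C w = Z \<and> a \<in> Hom C (Dom C w) A \<and> \<alpha> a (x \<odot> w)"
  unfolding total_def Hom_def by auto

text \<open>Inhabitedness of any filter set provides local elements of \<open>A\<close>.\<close>

lemma total_True: "total X (\<lambda>a x. True)"
  unfolding total_def using filter_inhabited[OF comb_filter(1)] Dom_in_Obj by blast

lemma total_reindex:
  assumes "total Y \<alpha>" and f: "f \<in> Hom C X Y" shows "total X (\<lambda>a x. \<alpha> a (f \<odot> x))"
  unfolding total_def
proof (intro ballI impI)
  fix x assume x: "x \<in> Mor C" "Cod C x = X"
  have "f \<odot> x \<in> Hom C (Dom C x) Y" using HomD[OF f] x by (simp add: Hom_def)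
  then obtain w a where w: "cover w" "Cod C w = Dom C x" "a \<in> Hom C (Dom C w) A" "\<alpha> a ((f \<odot> x) \<odot> w)" using totalD[OF assms(1)] by blast
  have "(f \<odot> x) \<odot> w = f \<odot> x \<odot> w" using HomD[OF f] x w(2) cover_Mor[OF w(1)] by simp
  then show "\<exists>w a. cover w \<and> Cod C w = Dom C x \<and> a \<in> Hom C (Dom C w) A \<and> \<alpha> a (f \<odot> x \<odot> w)" using w by auto
qed

text \<open>Three successive covers are composed: one for a realizer of \<alpha>, one for a realizer
  of \<beta>, and one for an element of \<open>Pr\<close> that pairs them.\<close>

lemma total_rconj:
  assumes t: "total X \<alpha>" "total X \<beta>" and p: "pred X \<alpha>" "pred X \<beta>"
  shows "total X (rconj \<alpha> \<beta>)"
  unfolding total_def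
proof (intro ballI impI)
  fix x assume xM: "x \<in> Mor C" "Cod C x = X"
  have x: "x \<in> Hom C (Dom C x) X" using xM by (simp add: Hom_def)
  obtain w a where w: "cover w" "Cod C w = Dom C x" and a: "a \<in> Hom C (Dom C w) A" "\<alpha> a (x \<odot> w)" using totalD[OF t(1) x] by blast
  note wM = cover_Mor[OF w(1)] note xw = Comp_Hom[OF x wM w(2)]
  obtain w' b where w': "cover w'" "Cod C w' = Dom C w" and b: "b \<in> Hom C (Dom C w') A" "\<beta> b ((x \<odot> w) \<odot> w')" using totalD[OF t(2) xw] by blast
  note w'M = cover_Mor[OF w'(1)] note xw' = Comp_Hom[OF xw w'M w'(2)]
  obtain w'' r where w'': "cover w''" "Cod C w'' = Dom C w'" and r: "r \<in> Hom C (Dom C w'') A" "sub_mem C Pr r"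
    using filter_inhabited[OF comb_filter(3), of "Dom C w'"] w'M by auto
  note w''M = cover_Mor[OF w''(1)]
  let ?w' = "w' \<odot> w''"
  have W': "?w' \<in> Mor C" "Cod C ?w' = Dom C w" "Dom C ?w' = Dom C w''" using w'M w''M w' w'' by simp_all
  note aw = Comp_Hom[OF a(1) W'(1,2)] and xw2 = Comp_Hom[OF xw W'(1,2)]
  have al: "\<alpha> (a \<odot> ?w') ((x \<odot> w) \<odot> ?w')" using pred_comp[OF p(1) a(1) xw a(2) W'(1,2)] .
  have "((x \<odot> w) \<odot> w') \<odot> w'' = (x \<odot> w) \<odot> ?w'" using HomD[OF xw] w'M w''M w' w'' by simp
  then have be: "\<beta> (b \<odot> w'') ((x \<odot> w) \<odot> ?w')" using pred_comp[OF p(2) b(1) xw' b(2) w''M w''(2)] by simp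
  have bH: "b \<odot> w'' \<in> Hom C (Dom C ?w') A" using Comp_Hom[OF b(1) w''M w''(2)] W' by simp
  have rH: "r \<in> Hom C (Dom C ?w') A" using r W' by simp
  obtain y where y: "y \<in> Hom C (Dom C ?w') A" "rconj \<alpha> \<beta> y ((x \<odot> w) \<odot> ?w')"
    using rconj_ex[OF p aw bH xw2 al be rH r(2)] by blast
  have c: "cover (w \<odot> ?w')" using cover_comp[OF cover_comp[OF w''(1) w'(1) w''(2)] w(1)] W' by simp
  have e: "(x \<odot> w) \<odot> ?w' = x \<odot> (w \<odot> ?w')" "Dom C (w \<odot> ?w') = Dom C ?w'" "Cod C (w \<odot> ?w') = Dom C x"
    using xM w(2) wM W'(1,2) by simp_all
  show "\<exists>w a. cover w \<and> Cod C w = Dom C x \<and> a \<in> Hom C (Dom C w) A \<and> rconj \<alpha> \<beta> a (x \<odot> w)"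
    by (rule exI[of _ "w \<odot> ?w'"], rule exI[of _ y]) (use c e y in simp)
qed

end

section \<open>The category of assemblies\<close>

lemma Asm_simps [simp]:
  "X \<in> Obj (Asm C A app \<phi>) \<longleftrightarrow> is_assembly C A X"
  "Dom (Asm C A app \<phi>) (X, f, Y) = X" "Cod (Asm C A app \<phi>) (X, f, Y) = Y"
  "Ident (Asm C A app \<phi>) X = (X, Ident C (fst X), X)"
  "Comp (Asm C A app \<phi>) (Y, g, Z) (X, f, Y') = (X, Comp C g f, Z)"
  by (simp_all add: Asm_def)

context pca_filter
begin

abbreviation "ASM \<equiv> Asm C A app \<phi>"

definition rl where "rl X a x \<longleftrightarrow> sub_mem C (snd X) (pairing C a x)"

definition asm_of where "asm_of X \<alpha> = (X, sub_of C (prod_obj C A X) (\<lambda>p. \<alpha> (pr1 C A X \<odot> p) (pr2 C A X \<odot> p)))"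

lemma is_assembly_iff:
  "is_assembly C A X \<longleftrightarrow> fst X \<in> Obj C \<and> snd X \<in> carrier (Sub C (prod_obj C A (fst X))) \<and> total (fst X) (rl X)"
proof (cases X)
  case (Pair Y \<rho>)
  show ?thesis unfolding Pair is_assembly_def total_def rl_def prod.case fst_conv snd_conv
    using models_assembly[OF A_Obj, of Y \<rho>] by blast
qed

lemma pred_rl: "is_assembly C A X \<Longrightarrow> pred (fst X) (rl X)"
  unfolding rl_def[abs_def] by (rule pred_Sub) (simp_all add: is_assembly_iff)

lemma total_rl: "is_assembly C A X \<Longrightarrow> total (fst X) (rl X)"
  by (simp add: is_assembly_iff)

lemma fst_asm_of [simp]: "fst (asm_of X \<alpha>) = X"
  by (simp add: asm_of_def)

lemma rl_asm_of:
  assumes "pred X \<alpha>" "a \<in> Hom C Z A" "x \<in> Hom C Z X" shows "rl (asm_of X \<alpha>) a x \<longleftrightarrow> \<alpha> a x"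
proof -
  have r: "representable C (prod_obj C A X) (\<lambda>p. \<alpha> (pr1 C A X \<odot> p) (pr2 C A X \<odot> p))" using assms by (simp add: pred_def)
  show ?thesis unfolding rl_def asm_of_def
    using mem_sub_of[OF r HomD(1,3)[OF pairing_Hom[OF assms(2,3)]]] HomD[OF assms(2)] HomD[OF assms(3)] by simp
qed

lemma total_cong:
  assumes "\<And>Z a x. a \<in> Hom C Z A \<Longrightarrow> x \<in> Hom C Z X \<Longrightarrow> \<alpha> a x \<longleftrightarrow> \<alpha>' a x" "total X \<alpha>"
  shows "total X \<alpha>'"
  unfolding total_def
proof (intro ballI impI)
  fix x assume x: "x \<in> Mor C" "Cod C x = X"
  then have xH: "x \<in> Hom C (Dom C x) X" by (simp add: Hom_def)
  obtain w a where w: "cover w" "Cod C w = Dom C x" "a \<in> Hom C (Dom C w) A" "\<alpha> a (x \<odot> w)" using totalD[OF assms(2) xH] by blast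
  then have "\<alpha>' a (x \<odot> w)" using assms(1)[OF w(3) Comp_Hom[OF xH cover_Mor[OF w(1)] w(2)]] by simp
  then show "\<exists>w a. cover w \<and> Cod C w = Dom C x \<and> a \<in> Hom C (Dom C w) A \<and> \<alpha>' a (x \<odot> w)" using w by blast
qed

lemma asm_of:
  assumes p: "pred X \<alpha>" and t: "total X \<alpha>" shows "is_assembly C A (asm_of X \<alpha>)"
proof -
  have r: "representable C (prod_obj C A X) (\<lambda>p. \<alpha> (pr1 C A X \<odot> p) (pr2 C A X \<odot> p))" using assms by (simp add: pred_def)
  have "total X (rl (asm_of X \<alpha>))" by (rule total_cong[OF _ t]) (simp add: rl_asm_of[OF p])
  then show ?thesis unfolding is_assembly_iff using sub_of_carrier[OF r] pred_Obj[OF p] by (simp add: asm_of_def)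
qed

lemma ent_cong:
  assumes "\<And>Z a x. a \<in> Hom C Z A \<Longrightarrow> x \<in> Hom C Z X \<Longrightarrow> \<alpha> a x \<longleftrightarrow> \<alpha>' a x"
    "\<And>Z a x. a \<in> Hom C Z A \<Longrightarrow> x \<in> Hom C Z X \<Longrightarrow> \<beta> a x \<longleftrightarrow> \<beta>' a x"
  shows "ent X \<alpha> \<beta> \<longleftrightarrow> ent X \<alpha>' \<beta>'"
proof -
  have "tracker R X \<alpha> \<beta> \<longleftrightarrow> tracker R X \<alpha>' \<beta>'" for R
    unfolding tracker_def
  proof (intro all_cong1 ball_cong refl imp_cong)
    fix Z r b x assume r: "r \<in> Hom C Z A" and b: "b \<in> Hom C Z A" and x: "x \<in> Hom C Z X"
    show "\<alpha> b x \<longleftrightarrow> \<alpha>' b x" using assms(1)[OF b x] .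
    show "(\<exists>c. ap r b c \<and> \<beta> c x) \<longleftrightarrow> (\<exists>c. ap r b c \<and> \<beta>' c x)" using assms(2)[OF ap_Hom[OF r b] x] by blast
  qed
  then show ?thesis by (simp add: ent_def)
qed

text \<open>With \<open>is_assembly_iff\<close> this completes the decoding of the definitions: from
  here on assemblies and their arrows are treated through \<open>total\<close> and
  \<open>ent\<close>, without the internal language.\<close>

lemma Asm_Mor_iff:
  "(X, f, Y) \<in> Mor ASM \<longleftrightarrow> is_assembly C A X \<and> is_assembly C A Y \<and> f \<in> Hom C (fst X) (fst Y) \<and>
    ent (fst X) (rl X) (\<lambda>a x. rl Y a (f \<odot> x))"
proof -
  have "tracks C A app X Y R f \<longleftrightarrow> tracker R (fst X) (rl X) (\<lambda>a x. rl Y a (f \<odot> x))"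
    if "is_assembly C A X" "is_assembly C A Y" "f \<in> Hom C (fst X) (fst Y)" "R \<in> \<phi>" for R
    using models_tracks[of A "fst X" "snd X" "snd Y" "fst Y" R app f] that app_PMor filter_Sub HomD[OF that(3)]
    by (simp add: is_assembly_iff tracker_def rl_def ap_def)
  then show ?thesis by (auto simp: Asm_def ent_def)
qed

lemma Asm_MorE:
  assumes "K \<in> Mor ASM"
  obtains X f Y where "K = (X, f, Y)" "is_assembly C A X" "is_assembly C A Y" "f \<in> Hom C (fst X) (fst Y)"
    "ent (fst X) (rl X) (\<lambda>a x. rl Y a (f \<odot> x))"
  using assms by (cases K) (auto simp: Asm_Mor_iff)

lemma Asm_HomE:
  assumes "K \<in> Hom ASM X Y"
  obtains f where "K = (X, f, Y)" "is_assembly C A X" "is_assembly C A Y" "f \<in> Hom C (fst X) (fst Y)"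
    "ent (fst X) (rl X) (\<lambda>a x. rl Y a (f \<odot> x))"
proof -
  have K: "K \<in> Mor ASM" "Dom ASM K = X" "Cod ASM K = Y" using assms by (simp_all add: Hom_def)
  obtain X' f Y' where K': "K = (X', f, Y')" "is_assembly C A X'" "is_assembly C A Y'" "f \<in> Hom C (fst X') (fst Y')"
    "ent (fst X') (rl X') (\<lambda>a x. rl Y' a (f \<odot> x))" using Asm_MorE[OF K(1)] .
  have "X' = X" "Y' = Y" using K(2,3) K'(1) by simp_all
  then show thesis using that K' by simp
qed

lemma Asm_HomI:
  "is_assembly C A X \<Longrightarrow> is_assembly C A Y \<Longrightarrow> f \<in> Hom C (fst X) (fst Y) \<Longrightarrow>
    ent (fst X) (rl X) (\<lambda>a x. rl Y a (f \<odot> x)) \<Longrightarrow> (X, f, Y) \<in> Hom ASM X Y"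
  by (simp add: Hom_def[of ASM] Asm_Mor_iff)

lemma Comp_assoc_Hom:
  "f \<in> Hom C W X \<Longrightarrow> g \<in> Hom C X Y \<Longrightarrow> z \<in> Hom C Z W \<Longrightarrow> (g \<odot> f) \<odot> z = g \<odot> f \<odot> z"
  by (simp add: Hom_def)

lemma ent_comp:
  assumes "ent X \<alpha> (\<lambda>a x. \<beta> a (f \<odot> x))" "ent Y \<beta> (\<lambda>a x. \<gamma> a (g \<odot> x))" and f: "f \<in> Hom C X Y" and g: "g \<in> Hom C Y Z"
    and p: "pred X \<alpha>" "pred Z \<gamma>"
  shows "ent X \<alpha> (\<lambda>a x. \<gamma> a ((g \<odot> f) \<odot> x))"
proof -
  have 1: "ent X (\<lambda>a x. \<beta> a (f \<odot> x)) (\<lambda>a x. \<gamma> a (g \<odot> f \<odot> x))" using ent_reindex[OF assms(2) f] .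
  have "ent X \<alpha> (\<lambda>a x. \<gamma> a (g \<odot> f \<odot> x))"
    using ent_trans[OF assms(1) 1 p(1) pred_reindex[OF pred_reindex[OF p(2) g] f]] .
  then show ?thesis by (rule iffD1[OF ent_cong, rotated -1]) (simp_all add: Comp_assoc_Hom[OF f g])
qed

lemma Asm_category: "category ASM"
proof
  fix K assume "K \<in> Mor ASM"
  then show "Dom ASM K \<in> Obj ASM" "Cod ASM K \<in> Obj ASM" by (auto elim!: Asm_MorE)
next
  fix X assume "X \<in> Obj ASM"
  then have X: "is_assembly C A X" by simp
  then have XO: "fst X \<in> Obj C" by (simp add: is_assembly_iff)
  note I = Ident_in_Hom[OF XO]
  have "ent (fst X) (rl X) (\<lambda>a x. rl X a (Ident C (fst X) \<odot> x))"
    by (rule ent_mono[OF pred_rl[OF X] pred_reindex[OF pred_rl[OF X] I]]) (use HomD in simp)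
  then show "Ident ASM X \<in> Hom ASM X X" using X I by (simp add: Hom_def[of ASM] Asm_Mor_iff)
next
  fix F X Y G Z assume FH: "F \<in> Hom ASM X Y" and GH: "G \<in> Hom ASM Y Z"
  obtain f where F: "F = (X, f, Y)" "is_assembly C A X" "is_assembly C A Y" "f \<in> Hom C (fst X) (fst Y)"
    "ent (fst X) (rl X) (\<lambda>a x. rl Y a (f \<odot> x))" using Asm_HomE[OF FH] .
  obtain g where G: "G = (Y, g, Z)" "is_assembly C A Y" "is_assembly C A Z" "g \<in> Hom C (fst Y) (fst Z)"
    "ent (fst Y) (rl Y) (\<lambda>a x. rl Z a (g \<odot> x))" using Asm_HomE[OF GH] .
  have "(X, g \<odot> f, Z) \<in> Hom ASM X Z"
    by (rule Asm_HomI[OF F(2) G(3) Comp_in_Hom[OF F(4) G(4)]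
          ent_comp[OF F(5) G(5) F(4) G(4) pred_rl[OF F(2)] pred_rl[OF G(3)]]])
  then show "Comp ASM G F \<in> Hom ASM X Z" using F(1) G(1) by simp
next
  fix F X Y assume FH: "F \<in> Hom ASM X Y"
  obtain f where "F = (X, f, Y)" "f \<in> Hom C (fst X) (fst Y)" using Asm_HomE[OF FH] .
  then show "Comp ASM (Ident ASM Y) F = F" "Comp ASM F (Ident ASM X) = F" by (simp_all add: Ident_left Ident_right)
next
  fix F W X G Y H Z assume FH: "F \<in> Hom ASM W X" and GH: "G \<in> Hom ASM X Y" and HH: "H \<in> Hom ASM Y Z"
  obtain f where F: "F = (W, f, X)" "f \<in> Hom C (fst W) (fst X)" using Asm_HomE[OF FH] .
  obtain g where G: "G = (X, g, Y)" "g \<in> Hom C (fst X) (fst Y)" using Asm_HomE[OF GH] .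
  obtain h where H: "H = (Y, h, Z)" "h \<in> Hom C (fst Y) (fst Z)" using Asm_HomE[OF HH] .
  show "Comp ASM (Comp ASM H G) F = Comp ASM H (Comp ASM G F)" using Comp_assoc[OF F(2) G(2) H(2)] F(1) G(1) H(1) by simp
qed

text \<open>Substitution commutes with the connective pointwise, not merely up to realizers, because
  \<open>rimp\<close> sees \<open>x\<close> only through its restrictions
  \<open>x \<odot> s\<close>.\<close>

lemma rimp_reindex:
  assumes f: "f \<in> Hom C X Y" and x: "x \<in> Hom C Z X"
  shows "rimp (\<lambda>a x. \<alpha> a (f \<odot> x)) (\<lambda>a x. \<beta> a (f \<odot> x)) a x \<longleftrightarrow> rimp \<alpha> \<beta> a (f \<odot> x)"
proof -
  have "(f \<odot> x) \<odot> s = f \<odot> x \<odot> s" if "s \<in> Mor C" "Cod C s = Dom C x" for s using HomD[OF f] HomD[OF x] that by simp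
  moreover have "Dom C (f \<odot> x) = Dom C x" using HomD[OF f] HomD[OF x] by simp
  ultimately show ?thesis unfolding rimp_def by (metis (no_types, lifting))
qed

lemma rconj_reindex:
  assumes f: "f \<in> Hom C X Y" and x: "x \<in> Hom C Z X"
  shows "rconj (\<lambda>a x. \<alpha> a (f \<odot> x)) (\<lambda>a x. \<beta> a (f \<odot> x)) a x \<longleftrightarrow> rconj \<alpha> \<beta> a (f \<odot> x)"
  unfolding rconj_def using rimp_reindex[OF f x, of "\<lambda>a x. sub_mem C Kt a"] rimp_reindex[OF f x, of "\<lambda>a x. sub_mem C Kf a"] by simp

lemma rconj_iff:
  assumes "pred X \<gamma>" "pred X \<alpha>" "pred X \<beta>"
  shows "ent X \<gamma> (rconj \<alpha> \<beta>) \<longleftrightarrow> ent X \<gamma> \<alpha> \<and> ent X \<gamma> \<beta>"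
  using rconj_intro[OF _ _ assms] ent_trans[OF _ rconj_left[OF assms(2,3)] assms(1,2)]
    ent_trans[OF _ rconj_right[OF assms(2,3)] assms(1,3)] by blast

lemma rconj_mono:
  assumes "ent X \<alpha> \<alpha>'" "ent X \<beta> \<beta>'" and p: "pred X \<alpha>" "pred X \<alpha>'" "pred X \<beta>" "pred X \<beta>'"
  shows "ent X (rconj \<alpha> \<beta>) (rconj \<alpha>' \<beta>')"
  using rconj_intro[OF ent_trans[OF rconj_left[OF p(1,3)] assms(1) pred_rconj[OF p(1,3)] p(2)]
    ent_trans[OF rconj_right[OF p(1,3)] assms(2) pred_rconj[OF p(1,3)] p(4)] pred_rconj[OF p(1,3)] p(2,4)] .

lemma rimp_iff:
  assumes p: "pred X \<gamma>" "pred X \<alpha>" "pred X \<beta>"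
  shows "ent X \<gamma> (rimp \<alpha> \<beta>) \<longleftrightarrow> ent X (rconj \<gamma> \<alpha>) \<beta>"
proof
  assume e: "ent X \<gamma> (rimp \<alpha> \<beta>)"
  note pi = pred_rimp[OF p(2,3)]
  have "ent X (rconj \<gamma> \<alpha>) (rconj (rimp \<alpha> \<beta>) \<alpha>)" by (rule rconj_mono[OF e ent_refl[OF p(2)] p(1) pi p(2) p(2)])
  then show "ent X (rconj \<gamma> \<alpha>) \<beta>" using ent_trans[OF _ rimp_elim[OF p(2,3)] pred_rconj[OF p(1,2)] p(3)] by blast
qed (rule rimp_intro[OF _ p])

section \<open>Finite limits of assemblies\<close>

lemma ent_rconj_reindex:
  assumes f: "f \<in> Hom C X Y" and p: "pred X \<gamma>" "pred Y \<alpha>" "pred Y \<beta>"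
  shows "ent X \<gamma> (\<lambda>a x. rconj \<alpha> \<beta> a (f \<odot> x)) \<longleftrightarrow> ent X \<gamma> (\<lambda>a x. \<alpha> a (f \<odot> x)) \<and> ent X \<gamma> (\<lambda>a x. \<beta> a (f \<odot> x))"
proof -
  have "ent X \<gamma> (\<lambda>a x. rconj \<alpha> \<beta> a (f \<odot> x)) \<longleftrightarrow> ent X \<gamma> (rconj (\<lambda>a x. \<alpha> a (f \<odot> x)) (\<lambda>a x. \<beta> a (f \<odot> x)))"
    by (rule ent_cong) (simp_all add: rconj_reindex[OF f])
  also have "\<dots> \<longleftrightarrow> ent X \<gamma> (\<lambda>a x. \<alpha> a (f \<odot> x)) \<and> ent X \<gamma> (\<lambda>a x. \<beta> a (f \<odot> x))"
    by (rule rconj_iff[OF p(1) pred_reindex[OF p(2) f] pred_reindex[OF p(3) f]])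
  finally show ?thesis .
qed

text \<open>A realizer of a point of a limit codes realizers of all its coordinates. The universal
  property is stated along arbitrary \<open>h\<close>, because mediating arrows have to be tracked.
  Finiteness enters as iterated pairing, with \<open>True\<close> for the empty family.\<close>

lemma finite_meet:
  assumes "finite I" and L: "L \<in> Obj C" and "\<And>i. i \<in> I \<Longrightarrow> pred L (\<alpha> i)" "\<And>i. i \<in> I \<Longrightarrow> total L (\<alpha> i)"
  shows "\<exists>\<delta>. pred L \<delta> \<and> total L \<delta> \<and> (\<forall>i\<in>I. ent L \<delta> (\<alpha> i)) \<and>
    (\<forall>M h \<gamma>. h \<in> Hom C M L \<longrightarrow> pred M \<gamma> \<longrightarrow> (\<forall>i\<in>I. ent M \<gamma> (\<lambda>a z. \<alpha> i a (h \<odot> z))) \<longrightarrow> ent M \<gamma> (\<lambda>a z. \<delta> a (h \<odot> z)))"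
  using assms(1,3,4)
proof (induction I)
  case empty
  have "ent M \<gamma> (\<lambda>a z. True)" if "pred M \<gamma>" for M \<gamma> by (rule ent_mono[OF that pred_True[OF pred_Obj[OF that]]]) simp
  then show ?case using pred_True[OF L] total_True by (intro exI[of _ "\<lambda>a x. True"]) simp
next
  case (insert i I)
  obtain \<delta> where d: "pred L \<delta>" "total L \<delta>" "\<forall>i\<in>I. ent L \<delta> (\<alpha> i)"
    "\<And>M h \<gamma>. h \<in> Hom C M L \<Longrightarrow> pred M \<gamma> \<Longrightarrow> (\<forall>i\<in>I. ent M \<gamma> (\<lambda>a z. \<alpha> i a (h \<odot> z))) \<Longrightarrow> ent M \<gamma> (\<lambda>a z. \<delta> a (h \<odot> z))"
    using insert.IH insert.prems by blast
  have i: "pred L (\<alpha> i)" "total L (\<alpha> i)" using insert.prems by auto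
  note c = pred_rconj[OF i(1) d(1)]
  have "ent L (rconj (\<alpha> i) \<delta>) (\<alpha> j)" if "j \<in> insert i I" for j
  proof (cases "j = i")
    case True then show ?thesis using rconj_left[OF i(1) d(1)] by simp
  next
    case False
    then have j: "j \<in> I" using that by simp
    show ?thesis by (rule ent_trans[OF rconj_right[OF i(1) d(1)] _ c]) (use d(3) j insert.prems(1) in auto)
  qed
  moreover have "ent M \<gamma> (\<lambda>a z. rconj (\<alpha> i) \<delta> a (h \<odot> z))"
    if h: "h \<in> Hom C M L" "pred M \<gamma>" "\<forall>i\<in>insert i I. ent M \<gamma> (\<lambda>a z. \<alpha> i a (h \<odot> z))" for M h \<gamma>
    unfolding ent_rconj_reindex[OF h(1,2) i(1) d(1)] using h d(4)[OF h(1,2)] by auto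
  ultimately show ?case using c total_rconj[OF i(2) d(2) i(1) d(1)] by blast
qed

text \<open>The underlying diagram has a limit in the base. The conjunction of the reindexed
  realizability relations makes its legs tracked, and the universal property of that conjunction
  tracks the mediating arrow of the base.\<close>

lemma Asm_finite_limits: "has_finite_limits ASM"
  unfolding has_finite_limits_def
proof (intro allI impI)
  fix J :: "(nat, nat) cat" and Fo Fm
  assume J: "finite_category J \<and> cat_functor J ASM Fo Fm"
  then interpret J: finite_category J by simp
  interpret F: cat_functor J ASM Fo Fm using J by simp
  let ?Fo = "\<lambda>i. fst (Fo i)" and ?Fm = "\<lambda>u. fst (snd (Fm u))"
  have Fm: "Fm u = (Fo i, ?Fm u, Fo j) \<and> ?Fm u \<in> Hom C (?Fo i) (?Fo j)" if uH: "u \<in> Hom J i j" for u i j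
  proof -
    obtain f where f: "Fm u = (Fo i, f, Fo j)" "f \<in> Hom C (?Fo i) (?Fo j)" using Asm_HomE[OF F.map_Mor[OF uH]] .
    then show ?thesis by simp
  qed
  have Fo: "is_assembly C A (Fo i)" if "i \<in> Obj J" for i using F.map_Obj[OF that] by simp
  have "cat_functor J C ?Fo ?Fm"
  proof
    fix i assume i: "i \<in> Obj J"
    show "fst (Fo i) \<in> Obj C" using Fo[OF i] by (simp add: is_assembly_iff)
    show "?Fm (Ident J i) = Ident C (?Fo i)" using F.map_Ident[OF i] by simp
  next
    fix u i j assume "u \<in> Hom J i j" then show "?Fm u \<in> Hom C (?Fo i) (?Fo j)" using Fm by blast
  next
    fix u i j v k assume u: "u \<in> Hom J i j" "v \<in> Hom J j k"
    have "Fm (v \<odot>\<^bsub>J\<^esub> u) = Comp ASM (Fo j, ?Fm v, Fo k) (Fo i, ?Fm u, Fo j)"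
      using F.map_Comp[OF u] Fm[OF u(1)] Fm[OF u(2)] by metis
    then show "?Fm (v \<odot>\<^bsub>J\<^esub> u) = ?Fm v \<odot> ?Fm u" by simp
  qed
  then obtain L l where lim: "is_limit J C ?Fo ?Fm L l"
    using finite_limits J unfolding has_finite_limits_def by blast
  then have cone: "is_cone J C ?Fo ?Fm L l"
    and univ: "\<And>M k. is_cone J C ?Fo ?Fm M k \<Longrightarrow> \<exists>!h. h \<in> Hom C M L \<and> (\<forall>i\<in>Obj J. l i \<odot> h = k i)"
    by (auto simp: is_limit_def)
  have L: "L \<in> Obj C" and l: "\<And>i. i \<in> Obj J \<Longrightarrow> l i \<in> Hom C L (?Fo i)"
    and lc: "\<And>u. u \<in> Mor J \<Longrightarrow> ?Fm u \<odot> l (Dom J u) = l (Cod J u)" using cone by (auto simp: is_cone_def)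
  let ?\<alpha> = "\<lambda>i a z. rl (Fo i) a (l i \<odot> z)"
  have p: "pred L (?\<alpha> i)" and t: "total L (?\<alpha> i)" if "i \<in> Obj J" for i
    using pred_reindex[OF pred_rl[OF Fo[OF that]] l[OF that]] total_reindex[OF total_rl[OF Fo[OF that]] l[OF that]] .
  obtain \<delta> where d: "pred L \<delta>" "total L \<delta>" "\<And>i. i \<in> Obj J \<Longrightarrow> ent L \<delta> (?\<alpha> i)"
    and du: "\<And>M h \<gamma>. h \<in> Hom C M L \<Longrightarrow> pred M \<gamma> \<Longrightarrow> (\<forall>i\<in>Obj J. ent M \<gamma> (\<lambda>a z. ?\<alpha> i a (h \<odot> z))) \<Longrightarrow> ent M \<gamma> (\<lambda>a z. \<delta> a (h \<odot> z))"
    using finite_meet[OF J.finite_Obj L, of ?\<alpha>] p t by blast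
  let ?L = "asm_of L \<delta>"
  have LA: "is_assembly C A ?L" by (rule asm_of[OF d(1,2)])
  let ?l = "\<lambda>i. (?L, l i, Fo i)"
  have lM: "?l i \<in> Hom ASM ?L (Fo i)" if "i \<in> Obj J" for i
  proof -
    have "ent L (rl ?L) (?\<alpha> i) \<longleftrightarrow> ent L \<delta> (?\<alpha> i)" by (rule ent_cong) (simp_all add: rl_asm_of[OF d(1)])
    then show ?thesis using d(3)[OF that] LA Fo[OF that] l[OF that] by (simp add: Hom_def[of ASM] Asm_Mor_iff)
  qed
  have uJ: "u \<in> Hom J (Dom J u) (Cod J u)" "Dom J u \<in> Obj J" "Cod J u \<in> Obj J" if "u \<in> Mor J" for u
    using that J.Dom_in_Obj J.Cod_in_Obj by (auto simp: Hom_def)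
  have "is_limit J ASM Fo Fm ?L ?l"
    unfolding is_limit_def
  proof (intro conjI allI impI)
    show "is_cone J ASM Fo Fm ?L ?l" unfolding is_cone_def
    proof (intro conjI ballI)
      fix u assume u: "u \<in> Mor J"
      note Fu = Fm[OF uJ(1)[OF u]]
      have "Comp ASM (Fm u) (?l (Dom J u)) = Comp ASM (Fo (Dom J u), ?Fm u, Fo (Cod J u)) (?l (Dom J u))" using Fu by metis
      then show "Comp ASM (Fm u) (?l (Dom J u)) = ?l (Cod J u)" using lc[OF u] by simp
    qed (use LA lM in simp_all)
    fix M k assume k: "is_cone J ASM Fo Fm M k"
    have M: "is_assembly C A M" using k by (simp add: is_cone_def)
    let ?k = "\<lambda>i. fst (snd (k i))"
    have kH: "k i = (M, ?k i, Fo i) \<and> ?k i \<in> Hom C (fst M) (?Fo i) \<and> ent (fst M) (rl M) (\<lambda>a x. rl (Fo i) a (?k i \<odot> x))"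
      if "i \<in> Obj J" for i
    proof -
      have "k i \<in> Hom ASM M (Fo i)" using k that by (simp add: is_cone_def)
      then obtain f where f: "k i = (M, f, Fo i)" "f \<in> Hom C (fst M) (?Fo i)"
        "ent (fst M) (rl M) (\<lambda>a x. rl (Fo i) a (f \<odot> x))" using Asm_HomE by blast
      then show ?thesis by simp
    qed
    have "is_cone J C ?Fo ?Fm (fst M) ?k" unfolding is_cone_def
    proof (intro conjI ballI)
      show "fst M \<in> Obj C" using M by (simp add: is_assembly_iff)
      show "?k i \<in> Hom C (fst M) (?Fo i)" if "i \<in> Obj J" for i using kH[OF that] by blast
      fix u assume u: "u \<in> Mor J"
      have "k (Cod J u) = Comp ASM (Fo (Dom J u), ?Fm u, Fo (Cod J u)) (M, ?k (Dom J u), Fo (Dom J u))"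
        using k u Fm[OF uJ(1)[OF u]] kH[OF uJ(2)[OF u]] unfolding is_cone_def by metis
      then show "?Fm u \<odot> ?k (Dom J u) = ?k (Cod J u)" by simp
    qed
    from univ[OF this] obtain h where h: "h \<in> Hom C (fst M) L" "\<And>i. i \<in> Obj J \<Longrightarrow> l i \<odot> h = ?k i"
      and hu: "\<And>h'. h' \<in> Hom C (fst M) L \<Longrightarrow> (\<forall>i\<in>Obj J. l i \<odot> h' = ?k i) \<Longrightarrow> h' = h" by blast
    have "ent (fst M) (rl M) (\<lambda>a z. ?\<alpha> i a (h \<odot> z))" if i: "i \<in> Obj J" for i
    proof -
      have "ent (fst M) (rl M) (\<lambda>a z. ?\<alpha> i a (h \<odot> z)) \<longleftrightarrow> ent (fst M) (rl M) (\<lambda>a x. rl (Fo i) a (?k i \<odot> x))"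
        by (rule ent_cong) (use Comp_assoc_Hom[OF h(1) l[OF i]] h(2)[OF i] in auto)
      then show ?thesis using kH[OF i] by blast
    qed
    then have "ent (fst M) (rl M) (\<lambda>a z. \<delta> a (h \<odot> z))" using du[OF h(1) pred_rl[OF M]] by blast
    moreover have "ent (fst M) (rl M) (\<lambda>a z. rl ?L a (h \<odot> z)) \<longleftrightarrow> ent (fst M) (rl M) (\<lambda>a z. \<delta> a (h \<odot> z))"
      by (rule ent_cong) (simp_all add: rl_asm_of[OF d(1) _ Comp_in_Hom[OF _ h(1)]])
    ultimately have HM: "(M, h, ?L) \<in> Hom ASM M ?L" using M LA h(1) by (simp add: Hom_def[of ASM] Asm_Mor_iff)
    show "\<exists>!h. h \<in> Hom ASM M ?L \<and> (\<forall>i\<in>Obj J. Comp ASM (?l i) h = k i)"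
    proof (rule ex1I[of _ "(M, h, ?L)"])
      have "Comp ASM (?l i) (M, h, ?L) = k i" if "i \<in> Obj J" for i
        using h(2)[OF that] kH[OF that] by simp
      then show "(M, h, ?L) \<in> Hom ASM M ?L \<and> (\<forall>i\<in>Obj J. Comp ASM (?l i) (M, h, ?L) = k i)" using HM by blast
    next
      fix H assume H: "H \<in> Hom ASM M ?L \<and> (\<forall>i\<in>Obj J. Comp ASM (?l i) H = k i)"
      then have HM: "H \<in> Hom ASM M ?L" by blast
      obtain h' where h': "H = (M, h', ?L)" "h' \<in> Hom C (fst M) L" using Asm_HomE[OF HM] by auto
      have "l i \<odot> h' = ?k i" if "i \<in> Obj J" for i
      proof -
        have "Comp ASM (?l i) H = k i" using H that by blast
        then show ?thesis using h'(1) by (metis Asm_simps(5) fst_conv snd_conv)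
      qed
      then show "H = (M, h, ?L)" using hu[OF h'(2)] h'(1) by blast
    qed
  qed
  then show "\<exists>L l. is_limit J ASM Fo Fm L l" by blast
qed

end

text \<open>Makes the calculus of generalized elements available a second time, for subobjects of
  assemblies.\<close>

sublocale pca_filter \<subseteq> ASM: finite_limit_category "Asm C A app \<phi>"
  unfolding finite_limit_category_def finite_limit_category_axioms_def
  using Asm_category Asm_finite_limits by blast

section \<open>Subobjects of assemblies\<close>

lemma sub_of_cong:
  assumes "\<And>x. x \<in> Mor C \<Longrightarrow> Cod C x = X \<Longrightarrow> Q x \<longleftrightarrow> Q' x"
  shows "sub_of C X Q = sub_of C X Q'"
  using assms unfolding sub_of_def by (intro Collect_cong) auto

context finite_limit_category
begin

lemma Sub_eq_of_le_iff:
  assumes "U \<in> carrier (Sub C X)" "V \<in> carrier (Sub C X)"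
    "\<And>W. W \<in> carrier (Sub C X) \<Longrightarrow> U \<sqsubseteq>\<^bsub>Sub C X\<^esub> W \<longleftrightarrow> V \<sqsubseteq>\<^bsub>Sub C X\<^esub> W"
  shows "U = V"
proof -
  interpret partial_order "Sub C X" by (rule Sub_partial_order)
  show ?thesis using assms le_antisym le_refl by blast
qed

lemma Sub_eq_of_ge_iff:
  assumes "U \<in> carrier (Sub C X)" "V \<in> carrier (Sub C X)"
    "\<And>W. W \<in> carrier (Sub C X) \<Longrightarrow> W \<sqsubseteq>\<^bsub>Sub C X\<^esub> U \<longleftrightarrow> W \<sqsubseteq>\<^bsub>Sub C X\<^esub> V"
  shows "U = V"
proof -
  interpret partial_order "Sub C X" by (rule Sub_partial_order)
  show ?thesis using assms le_antisym le_refl by blast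
qed

lemma is_left_adjointI:
  assumes f: "f \<in> Mor C" "Dom C f = X" "Cod C f = Y"
    and e: "\<And>U. U \<in> carrier (Sub C X) \<Longrightarrow> e U \<in> carrier (Sub C Y)"
    "\<And>U V. U \<in> carrier (Sub C X) \<Longrightarrow> V \<in> carrier (Sub C Y) \<Longrightarrow> e U \<sqsubseteq>\<^bsub>Sub C Y\<^esub> V \<longleftrightarrow> U \<sqsubseteq>\<^bsub>Sub C X\<^esub> inv_im C f V"
  shows "is_left_adjoint C f e"
  unfolding is_left_adjoint_def galois_connection_def galois_connection_axioms_def connection_def f
  using e Sub_partial_order inv_im_carrier[OF f] by simp

lemma is_right_adjointI:
  assumes f: "f \<in> Mor C" "Dom C f = X" "Cod C f = Y"
    and a: "\<And>U. U \<in> carrier (Sub C X) \<Longrightarrow> a U \<in> carrier (Sub C Y)"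
    "\<And>U V. U \<in> carrier (Sub C X) \<Longrightarrow> V \<in> carrier (Sub C Y) \<Longrightarrow> V \<sqsubseteq>\<^bsub>Sub C Y\<^esub> a U \<longleftrightarrow> inv_im C f V \<sqsubseteq>\<^bsub>Sub C X\<^esub> U"
  shows "is_right_adjoint C f a"
  unfolding is_right_adjoint_def galois_connection_def galois_connection_axioms_def connection_def f
  using a Sub_partial_order inv_im_carrier[OF f] by simp

text \<open>The Beck-Chevalley condition for universal quantification is that for existential
  quantification along the transposed square, read through the adjunctions.\<close>

lemma beck_chevalley_all_of_ex:
  assumes L: "\<And>f. f \<in> Mor C \<Longrightarrow> \<exists>e. is_left_adjoint C f e" and R: "\<And>f. f \<in> Mor C \<Longrightarrow> \<exists>a. is_right_adjoint C f a"
    and BC: "\<And>f g g' f' U. is_pullback C f g g' f' \<Longrightarrow> U \<in> carrier (Sub C (Dom C g)) \<Longrightarrow>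
      ex_along C g' (inv_im C f' U) = inv_im C f (ex_along C g U)"
    and pb: "is_pullback C f g g' f'" and U: "U \<in> carrier (Sub C (Dom C g))"
  shows "all_along C g' (inv_im C f' U) = inv_im C f (all_along C g U)"
proof -
  note pbD = pullbackD(1-8)[OF pb]
  have E: "is_left_adjoint C h (ex_along C h)" if "h \<in> Mor C" for h
    unfolding ex_along_def by (rule someI_ex[OF L[OF that]])
  have Al: "is_right_adjoint C h (all_along C h)" if "h \<in> Mor C" for h
    unfolding all_along_def by (rule someI_ex[OF R[OF that]])
  have f: "f \<in> Mor C" "Dom C f = Dom C f" "Cod C f = Cod C f" and g: "g \<in> Mor C" "Dom C g = Dom C g" "Cod C g = Cod C f"
    and g': "g' \<in> Mor C" "Dom C g' = Dom C g'" "Cod C g' = Dom C f" and f': "f' \<in> Mor C" "Dom C f' = Dom C g'" "Cod C f' = Dom C g"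
    using pbD by simp_all
  note iU = inv_im_carrier[OF f' U]
  note aU = right_adjointD(1)[OF Al[OF g(1)] g(2,3) U]
  show ?thesis
  proof (rule Sub_eq_of_ge_iff)
    show "all_along C g' (inv_im C f' U) \<in> carrier (Sub C (Dom C f))" by (rule right_adjointD(1)[OF Al[OF g'(1)] g'(2,3) iU])
    show "inv_im C f (all_along C g U) \<in> carrier (Sub C (Dom C f))" by (rule inv_im_carrier[OF f aU])
    fix W assume W: "W \<in> carrier (Sub C (Dom C f))"
    note iW = inv_im_carrier[OF g' W] and eW = left_adjointD(1)[OF E[OF f(1)] f(2,3) W]
    have "W \<sqsubseteq>\<^bsub>Sub C (Dom C f)\<^esub> all_along C g' (inv_im C f' U) \<longleftrightarrow> inv_im C g' W \<sqsubseteq>\<^bsub>Sub C (Dom C g')\<^esub> inv_im C f' U"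
      by (rule right_adjointD(2)[OF Al[OF g'(1)] g'(2,3) iU W])
    also have "\<dots> \<longleftrightarrow> ex_along C f' (inv_im C g' W) \<sqsubseteq>\<^bsub>Sub C (Dom C g)\<^esub> U"
      by (rule left_adjointD(2)[OF E[OF f'(1)] f'(2,3) iW U, symmetric])
    also have "ex_along C f' (inv_im C g' W) = inv_im C g (ex_along C f W)" by (rule BC[OF pullback_swap[OF pb] W])
    also have "inv_im C g (ex_along C f W) \<sqsubseteq>\<^bsub>Sub C (Dom C g)\<^esub> U \<longleftrightarrow> ex_along C f W \<sqsubseteq>\<^bsub>Sub C (Cod C f)\<^esub> all_along C g U"
      by (rule right_adjointD(2)[OF Al[OF g(1)] g(2,3) U eW, symmetric])
    also have "\<dots> \<longleftrightarrow> W \<sqsubseteq>\<^bsub>Sub C (Dom C f)\<^esub> inv_im C f (all_along C g U)"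
      by (rule left_adjointD(2)[OF E[OF f(1)] f(2,3) W aU])
    finally show "W \<sqsubseteq>\<^bsub>Sub C (Dom C f)\<^esub> all_along C g' (inv_im C f' U) \<longleftrightarrow> W \<sqsubseteq>\<^bsub>Sub C (Dom C f)\<^esub> inv_im C f (all_along C g U)" .
  qed
qed

end

context lattice
begin

lemma meet_eqI:
  assumes "x \<in> carrier L" "y \<in> carrier L" "z \<in> carrier L"
    "\<And>w. w \<in> carrier L \<Longrightarrow> w \<sqsubseteq> z \<longleftrightarrow> w \<sqsubseteq> x \<and> w \<sqsubseteq> y"
  shows "z = x \<sqinter> y"
  using assms le_meet_iff[OF assms(1,2)] by (meson le_antisym le_refl meet_closed)

lemma join_eqI:
  assumes "x \<in> carrier L" "y \<in> carrier L" "z \<in> carrier L"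
    "\<And>w. w \<in> carrier L \<Longrightarrow> z \<sqsubseteq> w \<longleftrightarrow> x \<sqsubseteq> w \<and> y \<sqsubseteq> w"
  shows "z = x \<squnion> y"
  using assms join_le_iff[OF assms(1,2)] by (meson le_antisym le_refl join_closed)

end

context pca_filter
begin

text \<open>The statement that some \<open>a\<close> satisfies \<open>\<gamma> a x\<close>, forced
  in the base: it cuts out the largest subobject on which \<gamma> is total.\<close>

definition supp where
  "supp \<gamma> x \<longleftrightarrow> (\<exists>w a. cover w \<and> Cod C w = Dom C x \<and> a \<in> Hom C (Dom C w) A \<and> \<gamma> a (x \<odot> w))"

lemma representable_supp:
  assumes p: "pred X \<gamma>" shows "representable C X (supp \<gamma>)"
proof -
  have X: "X \<in> Obj C" using p by (rule pred_Obj)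
  let ?q = "pr2 C A X"
  have q: "?q \<in> Mor C" "Dom C ?q = prod_obj C A X" "Cod C ?q = X" using X by simp_all
  have r: "representable C (prod_obj C A X) (\<lambda>p. \<gamma> (pr1 C A X \<odot> p) (pr2 C A X \<odot> p))" using p by (simp add: pred_def)
  show ?thesis
  proof (rule representable_cong[OF _ representable_ex[OF q r]])
    fix x assume x: "x \<in> Mor C" "Cod C x = X"
    show "(\<exists>w u. cover w \<and> Cod C w = Dom C x \<and> u \<in> Mor C \<and> Dom C u = Dom C w \<and> Cod C u = prod_obj C A X \<and>
        ?q \<odot> u = x \<odot> w \<and> \<gamma> (pr1 C A X \<odot> u) (?q \<odot> u)) \<longleftrightarrow> supp \<gamma> x" (is "?L \<longleftrightarrow> _")
    proof
      assume ?L
      then obtain w u where w: "cover w" "Cod C w = Dom C x" and u: "u \<in> Mor C" "Dom C u = Dom C w" "Cod C u = prod_obj C A X"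
        and e: "?q \<odot> u = x \<odot> w" and g: "\<gamma> (pr1 C A X \<odot> u) (?q \<odot> u)" by blast
      have "pr1 C A X \<odot> u \<in> Hom C (Dom C w) A" using u X by (simp add: Hom_def)
      then show "supp \<gamma> x" unfolding supp_def using w g unfolding e by blast
    next
      assume "supp \<gamma> x"
      then obtain w a where w: "cover w" "Cod C w = Dom C x" and a: "a \<in> Hom C (Dom C w) A" "\<gamma> a (x \<odot> w)" unfolding supp_def by blast
      note wM = cover_Mor[OF w(1)] and aT = HomD[OF a(1)]
      let ?u = "pairing C a (x \<odot> w)"
      have "?u \<in> Mor C" "Dom C ?u = Dom C w" "Cod C ?u = prod_obj C A X" "pr1 C A X \<odot> ?u = a" "?q \<odot> ?u = x \<odot> w"
        using aT wM w(2) x by simp_all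
      then show ?L using w a(2) by (intro exI[of _ w] exI[of _ ?u]) simp
    qed
  qed
qed

text \<open>Any pair of base arrows with a common domain becomes a pair of arrows of assemblies, by
  letting realizers of both values be the realizers of \<open>z\<close>. Universal properties among
  assemblies can therefore be tested on bare elements.\<close>

lemma joint_assembly:
  assumes X: "is_assembly C A X" and Y: "is_assembly C A Y" and x: "x \<in> Hom C Z (fst X)" and y: "y \<in> Hom C Z (fst Y)"
  defines "\<delta> \<equiv> rconj (\<lambda>a z. rl X a (x \<odot> z)) (\<lambda>a z. rl Y a (y \<odot> z))"
  shows "is_assembly C A (asm_of Z \<delta>)" "(asm_of Z \<delta>, x, X) \<in> Mor ASM" "(asm_of Z \<delta>, y, Y) \<in> Mor ASM"
    "\<And>a z W. a \<in> Hom C W A \<Longrightarrow> z \<in> Hom C W Z \<Longrightarrow> rl (asm_of Z \<delta>) a z \<longleftrightarrow> \<delta> a z"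
proof -
  note px = pred_reindex[OF pred_rl[OF X] x] and py = pred_reindex[OF pred_rl[OF Y] y]
  have d: "pred Z \<delta>" unfolding \<delta>_def by (rule pred_rconj[OF px py])
  have "total Z \<delta>" unfolding \<delta>_def
    by (rule total_rconj[OF total_reindex[OF total_rl[OF X] x] total_reindex[OF total_rl[OF Y] y] px py])
  then show D: "is_assembly C A (asm_of Z \<delta>)" by (rule asm_of[OF d])
  show rl: "\<And>a z W. a \<in> Hom C W A \<Longrightarrow> z \<in> Hom C W Z \<Longrightarrow> rl (asm_of Z \<delta>) a z \<longleftrightarrow> \<delta> a z" by (rule rl_asm_of[OF d])
  have "ent Z (rl (asm_of Z \<delta>)) \<beta> \<longleftrightarrow> ent Z \<delta> \<beta>" for \<beta> by (rule ent_cong) (simp_all add: rl)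
  moreover have "ent Z \<delta> (\<lambda>a z. rl X a (x \<odot> z))" "ent Z \<delta> (\<lambda>a z. rl Y a (y \<odot> z))"
    unfolding \<delta>_def by (rule rconj_left[OF px py] rconj_right[OF px py])+
  ultimately show "(asm_of Z \<delta>, x, X) \<in> Mor ASM" "(asm_of Z \<delta>, y, Y) \<in> Mor ASM"
    using D X Y x y by (simp_all add: Asm_Mor_iff)
qed

text \<open>From assemblies to the base, two arrows identified by \<open>m\<close> are given a
  common tracked domain by \<open>joint_assembly\<close>; conversely, arrows of assemblies with
  fixed ends are determined by their base arrows.\<close>

lemma Asm_mono_iff:
  assumes M: "(Y, m, X) \<in> Mor ASM" shows "mono_arr ASM (Y, m, X) \<longleftrightarrow> mono_arr C m"
proof
  have Y: "is_assembly C A Y" and m: "m \<in> Hom C (fst Y) (fst X)" using M by (simp_all add: Asm_Mor_iff)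
  note mT = HomD[OF m]
  {
    assume mono: "mono_arr ASM (Y, m, X)"
    show "mono_arr C m"
    proof (rule monoI[OF mT(1)])
      fix a b assume ab: "a \<in> Mor C" "b \<in> Mor C" "Cod C a = Dom C m" "Cod C b = Dom C m" "Dom C a = Dom C b" "m \<odot> a = m \<odot> b"
      have a: "a \<in> Hom C (Dom C a) (fst Y)" and b: "b \<in> Hom C (Dom C a) (fst Y)" using ab mT by (simp_all add: Hom_def)
      let ?d = "rconj (\<lambda>c z. rl Y c (a \<odot> z)) (\<lambda>c z. rl Y c (b \<odot> z))"
      note AB = joint_assembly(2,3)[OF Y Y a b]
      have "(asm_of (Dom C a) ?d, a, Y) = (asm_of (Dom C a) ?d, b, Y)"
        by (rule ASM.mono_cancel[OF mono AB]) (simp_all add: ab)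
      then show "a = b" by simp
    qed
  }
  assume mono: "mono_arr C m"
  show "mono_arr ASM (Y, m, X)"
  proof (rule ASM.monoI[OF M])
    fix K L assume K: "K \<in> Mor ASM" and L: "L \<in> Mor ASM" and t: "Cod ASM K = Dom ASM (Y, m, X)" "Cod ASM L = Dom ASM (Y, m, X)"
      "Dom ASM K = Dom ASM L" and e: "Comp ASM (Y, m, X) K = Comp ASM (Y, m, X) L"
    have KH: "K \<in> Hom ASM (Dom ASM L) Y" and LH: "L \<in> Hom ASM (Dom ASM L) Y" using K L t by (simp_all add: Hom_def)
    obtain k where k: "K = (Dom ASM L, k, Y)" "k \<in> Hom C (fst (Dom ASM L)) (fst Y)" using Asm_HomE[OF KH] .
    obtain l where l: "L = (Dom ASM L, l, Y)" "l \<in> Hom C (fst (Dom ASM L)) (fst Y)" using Asm_HomE[OF LH] .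
    have "m \<odot> k = m \<odot> l" using e by (subst (asm) k(1), subst (asm) (2) l(1)) simp
    then have "k = l" using mono_cancel[OF mono, of k l] HomD[OF k(2)] HomD[OF l(2)] mT by simp
    then show "K = L" using k(1) l(1) by simp
  qed
qed

lemma Asm_factors_iff:
  assumes X: "is_assembly C A X"
  shows "factors_through ASM (W, k, X) (Y, m, X) \<longleftrightarrow> (\<exists>h. (W, h, Y) \<in> Mor ASM \<and> m \<odot> h = k)"
proof
  assume "factors_through ASM (W, k, X) (Y, m, X)"
  then obtain H where H: "H \<in> Hom ASM W Y" "Comp ASM (Y, m, X) H = (W, k, X)"
    by (auto simp: factors_through_def)
  obtain h where h: "H = (W, h, Y)" using Asm_HomE[OF H(1)] .
  then show "\<exists>h. (W, h, Y) \<in> Mor ASM \<and> m \<odot> h = k" using H by (auto simp: Hom_def[of ASM])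
next
  assume "\<exists>h. (W, h, Y) \<in> Mor ASM \<and> m \<odot> h = k"
  then obtain h where h: "(W, h, Y) \<in> Mor ASM" "m \<odot> h = k" by blast
  then show "factors_through ASM (W, k, X) (Y, m, X)" by (intro ASM.factorsI[of "(W, h, Y)"]) simp_all
qed

text \<open>An arrow \<open>K = (W, k, X)\<close> belongs to it iff \<open>\<rho>\<^sub>W \<turnstile> k\<^sup>*\<alpha>\<close>.\<close>

definition asub where
  "asub X \<alpha> = sub_of ASM X (\<lambda>K. ent (fst (Dom ASM K)) (rl (Dom ASM K)) (\<lambda>a z. \<alpha> a (fst (snd K) \<odot> z)))"

text \<open>The generic point of \<open>W\<close> acquires a realizer over one cover and the tracker
  an element over a second; their product realizes \<gamma> at the restriction of
  \<open>k\<close>.\<close>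

lemma tracked_supp:
  assumes W: "is_assembly C A W" and k: "k \<in> Hom C (fst W) X" and e: "ent (fst W) (rl W) (\<lambda>a z. \<gamma> a (k \<odot> z))"
  shows "supp \<gamma> k"
proof -
  obtain R where R: "R \<in> \<phi>" "tracker R (fst W) (rl W) (\<lambda>a z. \<gamma> a (k \<odot> z))" using e by (auto simp: ent_def)
  have WO: "fst W \<in> Obj C" using k by (rule Hom_Obj)
  note I = Ident_in_Hom[OF WO]
  obtain w a where w: "cover w" "Cod C w = fst W" and a: "a \<in> Hom C (Dom C w) A" "rl W a (Ident C (fst W) \<odot> w)"
    using totalD[OF total_rl[OF W] I] by blast
  note wM = cover_Mor[OF w(1)]
  have wH: "w \<in> Hom C (Dom C w) (fst W)" using wM w by (simp add: Hom_def)
  have a2: "rl W a w" using a(2) wM w by simp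
  obtain w' r where w': "cover w'" "Cod C w' = Dom C w" and r: "r \<in> Hom C (Dom C w') A" "sub_mem C R r"
    using filter_inhabited[OF R(1), of "Dom C w"] wM by auto
  note w'M = cover_Mor[OF w'(1)]
  obtain c where c: "ap r (a \<odot> w') c" "\<gamma> c (k \<odot> w \<odot> w')"
    using trackerD[OF R(2) r(1) Comp_Hom[OF a(1) w'M w'(2)] Comp_Hom[OF wH w'M w'(2)] r(2)
        pred_comp[OF pred_rl[OF W] a(1) wH a2 w'M w'(2)]] by blast
  have cH: "c \<in> Hom C (Dom C (w \<odot> w')) A" using ap_Hom[OF r(1) Comp_Hom[OF a(1) w'M w'(2)] c(1)] wM w'M w' by simp
  show ?thesis unfolding supp_def
    using cover_comp[OF w'(1) w(1) w'(2)] cH c(2) wM w'M w' w HomD[OF k]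
    by (intro exI[of _ "w \<odot> w'"] exI[of _ c]) simp
qed

text \<open>The subobject cut out by \<alpha> is carried by the support of \<gamma>, with \<gamma>
  restricted as its relation. The conjunct \<open>rl X\<close> makes the inclusion tracked, and
  passing to the support makes the relation total.\<close>

lemma asub_canonical:
  assumes X: "is_assembly C A X" and p: "pred (fst X) \<alpha>"
  defines "\<gamma> \<equiv> rconj (rl X) \<alpha>"
  obtains D m where "m \<in> Hom C D (fst X)" "\<And>x. x \<in> Mor C \<Longrightarrow> Cod C x = fst X \<Longrightarrow> factors_through C x m \<longleftrightarrow> supp \<gamma> x"
    "(asm_of D (\<lambda>a z. \<gamma> a (m \<odot> z)), m, X) \<in> asub X \<alpha>" "(asm_of D (\<lambda>a z. \<gamma> a (m \<odot> z)), m, X) \<in> Mor ASM"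
proof -
  note r = pred_rl[OF X]
  have g: "pred (fst X) \<gamma>" unfolding \<gamma>_def by (rule pred_rconj[OF r p])
  obtain m where m: "mono_arr C m" "m \<in> Mor C" "Cod C m = fst X"
    "\<And>x. x \<in> Mor C \<Longrightarrow> Cod C x = fst X \<Longrightarrow> factors_through C x m \<longleftrightarrow> supp \<gamma> x"
    using representableE[OF representable_supp[OF g]] by blast
  let ?D = "Dom C m" and ?mg = "\<lambda>a z. \<gamma> a (m \<odot> z)"
  have mH: "m \<in> Hom C ?D (fst X)" using m by (simp add: Hom_def)
  note pm = pred_reindex[OF g mH]
  have tot: "total ?D ?mg" unfolding total_def
  proof (intro ballI impI)
    fix z assume z: "z \<in> Mor C" "Cod C z = ?D"
    have "factors_through C (m \<odot> z) m" using z m by (intro factorsI[of z]) simp_all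
    then have "supp \<gamma> (m \<odot> z)" using m(4)[of "m \<odot> z"] z m by simp
    then obtain w a where w: "cover w" "Cod C w = Dom C z" "a \<in> Hom C (Dom C w) A" "\<gamma> a ((m \<odot> z) \<odot> w)"
      unfolding supp_def using z m by auto
    then show "\<exists>w a. cover w \<and> Cod C w = Dom C z \<and> a \<in> Hom C (Dom C w) A \<and> \<gamma> a (m \<odot> z \<odot> w)"
      using z m cover_Mor[OF w(1)] by auto
  qed
  let ?Y = "asm_of ?D ?mg"
  have Y: "is_assembly C A ?Y" by (rule asm_of[OF pm tot])
  have eY: "ent ?D (rl ?Y) \<beta> \<longleftrightarrow> ent ?D ?mg \<beta>" for \<beta> by (rule ent_cong) (simp_all add: rl_asm_of[OF pm])
  have e1: "ent ?D ?mg (\<lambda>a z. rl X a (m \<odot> z))" and e2: "ent ?D ?mg (\<lambda>a z. \<alpha> a (m \<odot> z))"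
    unfolding \<gamma>_def by (rule ent_reindex[OF rconj_left[OF r p] mH] ent_reindex[OF rconj_right[OF r p] mH])+
  have MM: "(?Y, m, X) \<in> Mor ASM" using Y X mH e1 eY by (simp add: Asm_Mor_iff)
  have "factors_through ASM K (?Y, m, X) \<longleftrightarrow> ent (fst (Dom ASM K)) (rl (Dom ASM K)) (\<lambda>a z. \<alpha> a (fst (snd K) \<odot> z))"
    if K: "K \<in> Mor ASM" "Cod ASM K = X" for K
  proof -
    obtain W k X' where K': "K = (W, k, X')" "is_assembly C A W" "k \<in> Hom C (fst W) (fst X')" "ent (fst W) (rl W) (\<lambda>a x. rl X' a (k \<odot> x))"
      using Asm_MorE[OF K(1)] .
    have X': "X' = X" using K' K(2) by simp
    note rW = pred_rl[OF K'(2)] and kH = K'(3)[unfolded X'] and kE = K'(4)[unfolded X']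
    have "(\<exists>h. (W, h, ?Y) \<in> Mor ASM \<and> m \<odot> h = k) \<longleftrightarrow> ent (fst W) (rl W) (\<lambda>a z. \<alpha> a (k \<odot> z))"
    proof
      assume "\<exists>h. (W, h, ?Y) \<in> Mor ASM \<and> m \<odot> h = k"
      then obtain h where h: "h \<in> Hom C (fst W) ?D" "ent (fst W) (rl W) (\<lambda>a z. rl ?Y a (h \<odot> z))" "m \<odot> h = k"
        by (auto simp: Asm_Mor_iff)
      from ent_comp[OF h(2) _ h(1) mH rW p] show "ent (fst W) (rl W) (\<lambda>a z. \<alpha> a (k \<odot> z))"
        using e2 eY h(3) by simp
    next
      assume e: "ent (fst W) (rl W) (\<lambda>a z. \<alpha> a (k \<odot> z))"
      \<comment> \<open>An arrow into \<open>X\<close> is tracked for \<open>rl X\<close> already,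
        so realizing \<alpha> amounts to realizing \<gamma>; \<open>tracked_supp\<close> then
        supplies the factorization in the base.\<close>
      have eg: "ent (fst W) (rl W) (\<lambda>a z. \<gamma> a (k \<odot> z))"
        unfolding \<gamma>_def ent_rconj_reindex[OF kH rW r p] using e kE by blast
      have "factors_through C k m" using tracked_supp[OF K'(2) kH eg] m(4) HomD[OF kH] by simp
      then obtain h where h: "h \<in> Mor C" "Dom C h = Dom C k" "Cod C h = ?D" "m \<odot> h = k" using factorsE by blast
      have hH: "h \<in> Hom C (fst W) ?D" using h HomD[OF kH] by (simp add: Hom_def)
      have "ent (fst W) (rl W) (\<lambda>a z. rl ?Y a (h \<odot> z)) \<longleftrightarrow> ent (fst W) (rl W) (\<lambda>a z. \<gamma> a (k \<odot> z))"
        by (rule ent_cong) (use rl_asm_of[OF pm _ Comp_in_Hom[OF _ hH]] Comp_assoc_Hom[OF hH mH] h(4) in auto)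
      then have "(W, h, ?Y) \<in> Mor ASM" using eg K'(2) Y hH by (simp add: Asm_Mor_iff)
      then show "\<exists>h. (W, h, ?Y) \<in> Mor ASM \<and> m \<odot> h = k" using h(4) by blast
    qed
    then show ?thesis using Asm_factors_iff[OF X] K'(1) X' by simp
  qed
  then have "(?Y, m, X) \<in> asub X \<alpha>"
    unfolding asub_def sub_of_def using Asm_mono_iff[OF MM] m(1) by simp
  then show thesis using that[OF mH m(4) _ MM] by blast
qed

lemma representable_asub:
  assumes "is_assembly C A X" "pred (fst X) \<alpha>"
  shows "representable ASM X (\<lambda>K. ent (fst (Dom ASM K)) (rl (Dom ASM K)) (\<lambda>a z. \<alpha> a (fst (snd K) \<odot> z)))"
  using asub_canonical[OF assms] unfolding representable_def asub_def by (metis empty_iff)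

lemma asub_carrier: "is_assembly C A X \<Longrightarrow> pred (fst X) \<alpha> \<Longrightarrow> asub X \<alpha> \<in> carrier (Sub ASM X)"
  unfolding asub_def by (rule ASM.sub_of_carrier[OF representable_asub])

lemma mem_asub:
  assumes "is_assembly C A X" "pred (fst X) \<alpha>" "(W, k, X) \<in> Mor ASM"
  shows "sub_mem ASM (asub X \<alpha>) (W, k, X) \<longleftrightarrow> ent (fst W) (rl W) (\<lambda>a z. \<alpha> a (k \<odot> z))"
  unfolding asub_def using ASM.mem_sub_of[OF representable_asub[OF assms(1,2)] assms(3)] by simp

lemma asub_cong:
  assumes X: "is_assembly C A X" and "\<And>Z a x. a \<in> Hom C Z A \<Longrightarrow> x \<in> Hom C Z (fst X) \<Longrightarrow> \<alpha> a x \<longleftrightarrow> \<beta> a x"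
  shows "asub X \<alpha> = asub X \<beta>"
  unfolding asub_def
proof (rule sub_of_cong)
  fix K assume K: "K \<in> Mor ASM" "Cod ASM K = X"
  obtain W k X' where K': "K = (W, k, X')" "k \<in> Hom C (fst W) (fst X')" using Asm_MorE[OF K(1)] .
  then have "k \<in> Hom C (fst W) (fst X)" using K by simp
  then show "ent (fst (Dom ASM K)) (rl (Dom ASM K)) (\<lambda>a z. \<alpha> a (fst (snd K) \<odot> z)) \<longleftrightarrow>
    ent (fst (Dom ASM K)) (rl (Dom ASM K)) (\<lambda>a z. \<beta> a (fst (snd K) \<odot> z))"
    using K'(1) assms(2)[OF _ Comp_in_Hom] by (intro ent_cong) auto
qed

lemma ent_swap:
  assumes p: "pred X \<alpha>" "pred X \<beta>" shows "ent X (rconj \<alpha> \<beta>) (rconj \<beta> \<alpha>)"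
  using rconj_intro[OF rconj_right[OF p] rconj_left[OF p] pred_rconj[OF p] p(2,1)] .

lemma ent_swap_iff:
  assumes p: "pred X \<alpha>" "pred X \<beta>" "pred X \<gamma>" shows "ent X (rconj \<alpha> \<beta>) \<gamma> \<longleftrightarrow> ent X (rconj \<beta> \<alpha>) \<gamma>"
  using ent_trans[OF ent_swap[OF p(1,2)] _ pred_rconj[OF p(1,2)] p(3)]
    ent_trans[OF ent_swap[OF p(2,1)] _ pred_rconj[OF p(2,1)] p(3)] by blast

text \<open>Inclusion is tested on the canonical representative; outside the support the hypothesis
  has no realizers, so a tracker over the support is a tracker over all of \<open>fst X\<close>.
  Writing the extra hypothesis \<open>rl X\<close> inside \<open>rimp\<close> leaves \<alpha> alone
  on the left, where unions and images can be eliminated directly.\<close>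

lemma asub_le_iff:
  assumes X: "is_assembly C A X" and p: "pred (fst X) \<alpha>" "pred (fst X) \<beta>"
  shows "asub X \<alpha> \<sqsubseteq>\<^bsub>Sub ASM X\<^esub> asub X \<beta> \<longleftrightarrow> ent (fst X) \<alpha> (rimp (rl X) \<beta>)"
proof -
  note r = pred_rl[OF X]
  have "asub X \<alpha> \<sqsubseteq>\<^bsub>Sub ASM X\<^esub> asub X \<beta> \<longleftrightarrow> ent (fst X) (rconj (rl X) \<alpha>) \<beta>"
    unfolding ASM.Sub_le_iff[OF asub_carrier[OF X p(1)] asub_carrier[OF X p(2)]]
  proof
    assume le: "\<forall>K\<in>Mor ASM. Cod ASM K = X \<longrightarrow> sub_mem ASM (asub X \<alpha>) K \<longrightarrow> sub_mem ASM (asub X \<beta>) K"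
    let ?g = "rconj (rl X) \<alpha>"
    obtain D m where m: "m \<in> Hom C D (fst X)" "\<And>x. x \<in> Mor C \<Longrightarrow> Cod C x = fst X \<Longrightarrow> factors_through C x m \<longleftrightarrow> supp ?g x"
      and M: "(asm_of D (\<lambda>a z. ?g a (m \<odot> z)), m, X) \<in> asub X \<alpha>" "(asm_of D (\<lambda>a z. ?g a (m \<odot> z)), m, X) \<in> Mor ASM"
      using asub_canonical[OF X p(1)] by blast
    note pm = pred_reindex[OF pred_rconj[OF r p(1)] m(1)]
    have "sub_mem ASM (asub X \<alpha>) (asm_of D (\<lambda>a z. ?g a (m \<odot> z)), m, X)"
      using ASM.Sub_member(4)[OF asub_carrier[OF X p(1)] M(1)] M(2) by simp
    then have "sub_mem ASM (asub X \<beta>) (asm_of D (\<lambda>a z. ?g a (m \<odot> z)), m, X)" using le M(2) by simp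
    then have "ent D (rl (asm_of D (\<lambda>a z. ?g a (m \<odot> z)))) (\<lambda>a z. \<beta> a (m \<odot> z))" using mem_asub[OF X p(2) M(2)] by simp
    moreover have "ent D (rl (asm_of D (\<lambda>a z. ?g a (m \<odot> z)))) (\<lambda>a z. \<beta> a (m \<odot> z)) \<longleftrightarrow> ent D (\<lambda>a z. ?g a (m \<odot> z)) (\<lambda>a z. \<beta> a (m \<odot> z))"
      by (rule ent_cong) (simp_all add: rl_asm_of[OF pm])
    ultimately obtain R where R: "R \<in> \<phi>" "tracker R D (\<lambda>a z. ?g a (m \<odot> z)) (\<lambda>a z. \<beta> a (m \<odot> z))" by (auto simp: ent_def)
    have "tracker R (fst X) ?g \<beta>" unfolding tracker_def
    proof (intro allI ballI impI)
      fix Z r b x assume rb: "r \<in> Hom C Z A" "b \<in> Hom C Z A" and x: "x \<in> Hom C Z (fst X)" and mr: "sub_mem C R r" and g: "?g b x"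
      note xT = HomD[OF x] and Z = Hom_Obj(1)[OF x]
      have "supp ?g x" unfolding supp_def xT(2)
        using cover_Ident[OF Z] Z rb(2) g xT by (intro exI[of _ "Ident C Z"] exI[of _ b]) simp
      then have "factors_through C x m" using m(2)[OF xT(1,3)] by simp
      then obtain z where z: "z \<in> Mor C" "Dom C z = Dom C x" "Cod C z = Dom C m" "m \<odot> z = x" using factorsE by blast
      have zH: "z \<in> Hom C Z D" using z xT HomD[OF m(1)] by (simp add: Hom_def)
      show "\<exists>c. ap r b c \<and> \<beta> c x" using trackerD[OF R(2) rb zH mr] g z(4) by simp
    qed
    then show "ent (fst X) ?g \<beta>" using R(1) by (auto simp: ent_def)
  next
    assume e: "ent (fst X) (rconj (rl X) \<alpha>) \<beta>"
    show "\<forall>K\<in>Mor ASM. Cod ASM K = X \<longrightarrow> sub_mem ASM (asub X \<alpha>) K \<longrightarrow> sub_mem ASM (asub X \<beta>) K"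
    proof (intro ballI impI)
      fix K assume K: "K \<in> Mor ASM" "Cod ASM K = X" and m: "sub_mem ASM (asub X \<alpha>) K"
      have KH: "K \<in> Hom ASM (Dom ASM K) X" using K by (simp add: Hom_def)
      obtain k where K': "K = (Dom ASM K, k, X)" "is_assembly C A (Dom ASM K)" "k \<in> Hom C (fst (Dom ASM K)) (fst X)"
        "ent (fst (Dom ASM K)) (rl (Dom ASM K)) (\<lambda>a x. rl X a (k \<odot> x))"
        using Asm_HomE[OF KH] by blast
      define W where "W = Dom ASM K"
      note K' = K'[folded W_def]
      note rW = pred_rl[OF K'(2)]
      have KM: "(W, k, X) \<in> Mor ASM" using K(1) K'(1) by simp
      have "ent (fst W) (rl W) (\<lambda>a z. \<alpha> a (k \<odot> z))" using m K'(1) mem_asub[OF X p(1) KM] by simp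
      then have "ent (fst W) (rl W) (\<lambda>a z. rconj (rl X) \<alpha> a (k \<odot> z))"
        unfolding ent_rconj_reindex[OF K'(3) rW r p(1)] using K'(4) by blast
      then have "ent (fst W) (rl W) (\<lambda>a z. \<beta> a (k \<odot> z))"
        using ent_trans[OF _ ent_reindex[OF e K'(3)] rW pred_reindex[OF p(2) K'(3)]] by blast
      then show "sub_mem ASM (asub X \<beta>) K" using K'(1) mem_asub[OF X p(2) KM] by simp
    qed
  qed
  also have "\<dots> \<longleftrightarrow> ent (fst X) \<alpha> (rimp (rl X) \<beta>)"
    using rimp_iff[OF p(1) r p(2)] ent_swap_iff[OF r p(1,2)] by simp
  finally show ?thesis .
qed

text \<open>A mono into \<open>X\<close> is recovered from the image of its realizability relation.
  For an arrow \<open>k\<close> whose values realize the image, two things are shown: it factors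
  through \<open>m\<close>, and the factorization is tracked.\<close>

lemma asub_surj:
  assumes V: "V \<in> carrier (Sub ASM X)"
  shows "\<exists>\<alpha>. pred (fst X) \<alpha> \<and> V = asub X \<alpha>"
proof -
  obtain M where M: "mono_arr ASM M" "M \<in> Mor ASM" "Cod ASM M = X" "M \<in> V" using ASM.Sub_carrierE[OF V] by metis
  have MH: "M \<in> Hom ASM (Dom ASM M) X" using M by (simp add: Hom_def)
  obtain Y m where M': "M = (Y, m, X)" "is_assembly C A Y" "is_assembly C A X" "m \<in> Hom C (fst Y) (fst X)"
    "ent (fst Y) (rl Y) (\<lambda>a x. rl X a (m \<odot> x))"
    using Asm_HomE[OF MH] by metis
  note X = M'(3) and mH = M'(4) note mT = HomD[OF mH]
  have mono: "mono_arr C m" using M(1,2) Asm_mono_iff M'(1) by simp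
  let ?a = "rex m (fst Y) (rl Y)"
  note pY = pred_rl[OF M'(2)] note pa = pred_rex[OF pY mH]
  have rm: "representable C (fst X) (\<lambda>x. factors_through C x m)" by (rule representableI[OF mono mT(3)]) simp
  have "V = asub X ?a" unfolding asub_def
  proof (rule ASM.Sub_eq_sub_of[OF V])
    fix K assume K: "K \<in> Mor ASM" "Cod ASM K = X"
    have KH: "K \<in> Hom ASM (Dom ASM K) X" using K by (simp add: Hom_def)
    obtain W k where K': "K = (W, k, X)" "is_assembly C A W" "k \<in> Hom C (fst W) (fst X)"
      "ent (fst W) (rl W) (\<lambda>a x. rl X a (k \<odot> x))"
      using Asm_HomE[OF KH] by metis
    note pW = pred_rl[OF K'(2)] and kH = K'(3) note kT = HomD[OF kH]
    have "sub_mem ASM V K \<longleftrightarrow> (\<exists>h. (W, h, Y) \<in> Mor ASM \<and> m \<odot> h = k)"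
      using ASM.Sub_member(4)[OF V M(4)] Asm_factors_iff[OF X] K'(1) M'(1) by simp
    also have "\<dots> \<longleftrightarrow> ent (fst W) (rl W) (\<lambda>a z. ?a a (k \<odot> z))"
    proof
      assume "\<exists>h. (W, h, Y) \<in> Mor ASM \<and> m \<odot> h = k"
      then obtain h where h: "h \<in> Hom C (fst W) (fst Y)" "ent (fst W) (rl W) (\<lambda>a z. rl Y a (h \<odot> z))" "m \<odot> h = k"
        by (auto simp: Asm_Mor_iff)
      have "ent (fst Y) (rl Y) (\<lambda>a z. ?a a (m \<odot> z))" using rex_iff[OF pY pa mH] ent_refl[OF pa] by simp
      from ent_comp[OF h(2) this h(1) mH pW pa] show "ent (fst W) (rl W) (\<lambda>a z. ?a a (k \<odot> z))" using h(3) by simp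
    next
      assume e: "ent (fst W) (rl W) (\<lambda>a z. ?a a (k \<odot> z))"
      obtain w c where w: "cover w" "Cod C w = fst W" and c: "?a c (k \<odot> w)"
        using tracked_supp[OF K'(2) kH e] unfolding supp_def kT(2) by blast
      note wM = cover_Mor[OF w(1)]
      have D: "Dom C (k \<odot> w) = Dom C w" using kT w wM by simp
      obtain w2 y where w2: "cover w2" "Cod C w2 = Dom C w" and y: "y \<in> Hom C (Dom C w2) (fst Y)" "m \<odot> y = (k \<odot> w) \<odot> w2"
        using c unfolding rex_def D by blast
      note w2M = cover_Mor[OF w2(1)]
      have kw: "(k \<odot> w) \<odot> w2 = k \<odot> (w \<odot> w2)" using kT w wM w2(2) w2M by simp
      have "factors_through C (k \<odot> (w \<odot> w2)) m"
        using y HomD[OF y(1)] kT wM w2M w(2) w2(2) mT unfolding kw by (intro factorsI[of y]) simp_all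
      \<comment> \<open>Factoring through the mono \<open>m\<close> is a representable property, so
        it may be verified over the composite cover.\<close>
      then have "factors_through C k m"
        using cover_representable[OF cover_comp[OF w2(1) w(1) w2(2)] rm kT(1,3)] wM w2M w w2(2) kT by simp
      then obtain h where h: "h \<in> Mor C" "Dom C h = Dom C k" "Cod C h = Dom C m" "m \<odot> h = k" using factorsE by blast
      have hH: "h \<in> Hom C (fst W) (fst Y)" using h kT mT by (simp add: Hom_def)
      have "ent (fst W) (\<lambda>a z. ?a a (k \<odot> z)) (\<lambda>a z. rl Y a (h \<odot> z))"
      proof (rule ent_mono[OF pred_reindex[OF pa kH] pred_reindex[OF pY hH]])
        fix Z b z assume b: "b \<in> Hom C Z A" and z: "z \<in> Hom C Z (fst W)" and a: "?a b (k \<odot> z)"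
        note zT = HomD[OF z] note kz = Comp_in_Hom[OF z kH] and hz = Comp_in_Hom[OF z hH]
        obtain v y where v: "cover v" "Cod C v = Z" and y: "y \<in> Hom C (Dom C v) (fst Y)" "m \<odot> y = (k \<odot> z) \<odot> v" "rl Y (b \<odot> v) y"
          using a unfolding rex_def HomD(2)[OF kz] by blast
        note vM = cover_Mor[OF v(1)]
        have hv: "(h \<odot> z) \<odot> v \<in> Mor C" "Dom C ((h \<odot> z) \<odot> v) = Dom C v" "Cod C ((h \<odot> z) \<odot> v) = Dom C m"
          using HomD[OF hz] vM v mT by simp_all
        have "m \<odot> ((h \<odot> z) \<odot> v) = (k \<odot> z) \<odot> v" unfolding h(4)[symmetric] using h(1-3) zT vM v kT mT by simp
        then have "m \<odot> y = m \<odot> ((h \<odot> z) \<odot> v)" using y(2) by simp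
        \<comment> \<open>As \<open>m\<close> is monic, the local witness \<open>y\<close> of the
          image is the restriction of the factorization, so a realizer of the image serves for
          \<open>rl Y\<close> without change.\<close>
        then have "y = (h \<odot> z) \<odot> v" using mono_cancel[OF mono, of y "(h \<odot> z) \<odot> v"] hv HomD[OF y(1)] mT by simp
        then show "rl Y b (h \<odot> z)" using pred_local[OF pY b hz v] y(3) by simp
      qed
      then have "ent (fst W) (rl W) (\<lambda>a z. rl Y a (h \<odot> z))" using ent_trans[OF e _ pW pred_reindex[OF pY hH]] by blast
      then have "(W, h, Y) \<in> Mor ASM" using K'(2) M'(2) hH by (simp add: Asm_Mor_iff)
      then show "\<exists>h. (W, h, Y) \<in> Mor ASM \<and> m \<odot> h = k" using h(4) by blast
    qed
    finally show "sub_mem ASM V K \<longleftrightarrow> ent (fst (Dom ASM K)) (rl (Dom ASM K)) (\<lambda>a z. ?a a (fst (snd K) \<odot> z))"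
      using K'(1) by simp
  qed
  then show ?thesis using pa by blast
qed

text \<open>An arrow belongs to the inverse image when its composite with \<open>f\<close> belongs
  to the subobject, which moves \<open>f\<close> into the predicate.\<close>

lemma inv_im_asub:
  assumes F: "(X, f, Y) \<in> Mor ASM" and p: "pred (fst Y) \<beta>"
  shows "inv_im ASM (X, f, Y) (asub Y \<beta>) = asub X (\<lambda>a x. \<beta> a (f \<odot> x))"
proof -
  have X: "is_assembly C A X" and Y: "is_assembly C A Y" and f: "f \<in> Hom C (fst X) (fst Y)" using F by (simp_all add: Asm_Mor_iff)
  have FX: "Dom ASM (X, f, Y) = X" "Cod ASM (X, f, Y) = Y" by simp_all
  show ?thesis
    unfolding asub_def ASM.inv_im_sub_of[OF F FX representable_asub[OF Y p]]
  proof (rule sub_of_cong)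
    fix K assume K: "K \<in> Mor ASM" "Cod ASM K = X"
    have KH: "K \<in> Hom ASM (Dom ASM K) X" using K by (simp add: Hom_def)
    obtain W k where K': "K = (W, k, X)" "k \<in> Hom C (fst W) (fst X)"
      using Asm_HomE[OF KH] by metis
    have "ent (fst W) (rl W) (\<lambda>a z. \<beta> a ((f \<odot> k) \<odot> z)) \<longleftrightarrow> ent (fst W) (rl W) (\<lambda>a z. \<beta> a (f \<odot> k \<odot> z))"
      by (rule ent_cong) (simp_all add: Comp_assoc_Hom[OF K'(2) f])
    then show "ent (fst (Dom ASM (Comp ASM (X, f, Y) K))) (rl (Dom ASM (Comp ASM (X, f, Y) K))) (\<lambda>a z. \<beta> a (fst (snd (Comp ASM (X, f, Y) K)) \<odot> z)) \<longleftrightarrow>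
      ent (fst (Dom ASM K)) (rl (Dom ASM K)) (\<lambda>a z. \<beta> a (f \<odot> fst (snd K) \<odot> z))"
      using K'(1) by simp
  qed
qed

section \<open>The Heyting structure\<close>

text \<open>Used to drop the hypothesis \<open>rl Y\<close> at \<open>f \<odot> x\<close> in the
  presence of \<open>rl X\<close>, from which the tracker of \<open>f\<close> computes it.\<close>

lemma ent_absorb:
  assumes "ent X \<gamma> \<delta>" and p: "pred X \<gamma>" "pred X \<delta>" "pred X \<beta>"
  shows "ent X (rconj \<gamma> \<delta>) \<beta> \<longleftrightarrow> ent X \<gamma> \<beta>"
  using ent_trans[OF rconj_intro[OF ent_refl[OF p(1)] assms(1) p(1,1,2)] _ p(1,3)]
    ent_trans[OF rconj_left[OF p(1,2)] _ pred_rconj[OF p(1,2)] p(3)] by blast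

lemma ent_swap_right:
  assumes p: "pred X \<alpha>" "pred X \<beta>" "pred X \<gamma>"
  shows "ent X (rconj (rconj \<alpha> \<beta>) \<gamma>) (rconj (rconj \<alpha> \<gamma>) \<beta>)"
proof -
  note ab = pred_rconj[OF p(1,2)] note abc = pred_rconj[OF ab p(3)]
  note 1 = rconj_left[OF ab p(3)]
  have a: "ent X (rconj (rconj \<alpha> \<beta>) \<gamma>) \<alpha>" and b: "ent X (rconj (rconj \<alpha> \<beta>) \<gamma>) \<beta>"
    using ent_trans[OF 1 rconj_left[OF p(1,2)] abc p(1)] ent_trans[OF 1 rconj_right[OF p(1,2)] abc p(2)] .
  show ?thesis
    by (rule rconj_intro[OF rconj_intro[OF a rconj_right[OF ab p(3)] abc p(1,3)] b abc pred_rconj[OF p(1,3)] p(2)])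
qed

lemma ent_swap_right_iff:
  assumes p: "pred X \<alpha>" "pred X \<beta>" "pred X \<gamma>" "pred X \<delta>"
  shows "ent X (rconj (rconj \<alpha> \<beta>) \<gamma>) \<delta> \<longleftrightarrow> ent X (rconj (rconj \<alpha> \<gamma>) \<beta>) \<delta>"
  using ent_trans[OF ent_swap_right[OF p(1-3)] _ pred_rconj[OF pred_rconj[OF p(1,2)] p(3)] p(4)]
    ent_trans[OF ent_swap_right[OF p(1,3,2)] _ pred_rconj[OF pred_rconj[OF p(1,3)] p(2)] p(4)] by blast

lemma ror_iff:
  assumes p: "pred X \<alpha>" "pred X \<beta>" "pred X \<gamma>"
  shows "ent X (ror X \<alpha> \<beta>) \<gamma> \<longleftrightarrow> ent X \<alpha> \<gamma> \<and> ent X \<beta> \<gamma>"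
  using ror_elim[OF _ _ p] ent_trans[OF ror_intro(1)[OF p(1,2)] _ p(1,3)] ent_trans[OF ror_intro(2)[OF p(1,2)] _ p(2,3)] by blast

lemma rall_iff:
  assumes f: "f \<in> Hom C X Y" and p: "pred Y \<gamma>" "pred X \<rho>" "pred X \<delta>"
  shows "ent Y \<gamma> (rall f X (rimp \<rho> \<delta>)) \<longleftrightarrow> ent X (rconj (\<lambda>a x. \<gamma> a (f \<odot> x)) \<rho>) \<delta>"
  using rall_intro[OF _ f p] rall_elim[OF _ f] rimp_iff[OF pred_reindex[OF p(1) f] p(2,3)] by blast

lemma ent_rimp_weaken:
  assumes "ent X \<alpha> \<beta>" and p: "pred X \<alpha>" "pred X \<rho>" "pred X \<beta>" shows "ent X \<alpha> (rimp \<rho> \<beta>)"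
  unfolding rimp_iff[OF p] using ent_trans[OF rconj_left[OF p(1,2)] assms(1) pred_rconj[OF p(1,2)] p(3)] .

lemma rex_unit:
  assumes p: "pred X \<alpha>" and f: "f \<in> Hom C X Y" shows "ent X \<alpha> (\<lambda>a x. rex f X \<alpha> a (f \<odot> x))"
  using rex_iff[OF p pred_rex[OF p f] f] ent_refl[OF pred_rex[OF p f]] by simp

text \<open>Meets and implications are checked after moving the hypothesis \<open>rl X\<close> to
  the left, joins with it kept on the right; each clause is then the corresponding adjunction for
  \<open>ent\<close>.\<close>

lemma asub_lattice:
  assumes X: "is_assembly C A X" and p: "pred (fst X) \<alpha>" "pred (fst X) \<beta>" "pred (fst X) \<gamma>"
  shows asub_le_rconj: "asub X \<gamma> \<sqsubseteq>\<^bsub>Sub ASM X\<^esub> asub X (rconj \<alpha> \<beta>) \<longleftrightarrow>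
      asub X \<gamma> \<sqsubseteq>\<^bsub>Sub ASM X\<^esub> asub X \<alpha> \<and> asub X \<gamma> \<sqsubseteq>\<^bsub>Sub ASM X\<^esub> asub X \<beta>"
    and asub_ror_le: "asub X (ror (fst X) \<alpha> \<beta>) \<sqsubseteq>\<^bsub>Sub ASM X\<^esub> asub X \<gamma> \<longleftrightarrow>
      asub X \<alpha> \<sqsubseteq>\<^bsub>Sub ASM X\<^esub> asub X \<gamma> \<and> asub X \<beta> \<sqsubseteq>\<^bsub>Sub ASM X\<^esub> asub X \<gamma>"
    and asub_le_rimp: "asub X \<gamma> \<sqsubseteq>\<^bsub>Sub ASM X\<^esub> asub X (rimp \<alpha> \<beta>) \<longleftrightarrow> asub X (rconj \<gamma> \<alpha>) \<sqsubseteq>\<^bsub>Sub ASM X\<^esub> asub X \<beta>"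
proof -
  note r = pred_rl[OF X]
  show "asub X \<gamma> \<sqsubseteq>\<^bsub>Sub ASM X\<^esub> asub X (rconj \<alpha> \<beta>) \<longleftrightarrow>
      asub X \<gamma> \<sqsubseteq>\<^bsub>Sub ASM X\<^esub> asub X \<alpha> \<and> asub X \<gamma> \<sqsubseteq>\<^bsub>Sub ASM X\<^esub> asub X \<beta>"
    unfolding asub_le_iff[OF X p(3) pred_rconj[OF p(1,2)]] asub_le_iff[OF X p(3,1)] asub_le_iff[OF X p(3,2)]
      rimp_iff[OF p(3) r pred_rconj[OF p(1,2)]] rimp_iff[OF p(3) r p(1)] rimp_iff[OF p(3) r p(2)]
    by (rule rconj_iff[OF pred_rconj[OF p(3) r] p(1,2)])
  show "asub X (ror (fst X) \<alpha> \<beta>) \<sqsubseteq>\<^bsub>Sub ASM X\<^esub> asub X \<gamma> \<longleftrightarrow>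
      asub X \<alpha> \<sqsubseteq>\<^bsub>Sub ASM X\<^esub> asub X \<gamma> \<and> asub X \<beta> \<sqsubseteq>\<^bsub>Sub ASM X\<^esub> asub X \<gamma>"
    unfolding asub_le_iff[OF X pred_ror[OF p(1,2)] p(3)] asub_le_iff[OF X p(1,3)] asub_le_iff[OF X p(2,3)]
    by (rule ror_iff[OF p(1,2) pred_rimp[OF r p(3)]])
  show "asub X \<gamma> \<sqsubseteq>\<^bsub>Sub ASM X\<^esub> asub X (rimp \<alpha> \<beta>) \<longleftrightarrow> asub X (rconj \<gamma> \<alpha>) \<sqsubseteq>\<^bsub>Sub ASM X\<^esub> asub X \<beta>"
    unfolding asub_le_iff[OF X p(3) pred_rimp[OF p(1,2)]] asub_le_iff[OF X pred_rconj[OF p(3,1)] p(2)]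
      rimp_iff[OF p(3) r pred_rimp[OF p(1,2)]] rimp_iff[OF pred_rconj[OF p(3) r] p(1,2)] rimp_iff[OF pred_rconj[OF p(3,1)] r p(2)]
    by (rule ent_swap_right_iff[OF p(3) r p(1,2)])
qed

lemma asub_top:
  assumes X: "is_assembly C A X" and V: "V \<in> carrier (Sub ASM X)"
  shows "V \<sqsubseteq>\<^bsub>Sub ASM X\<^esub> asub X (\<lambda>a x. True)"
proof -
  note r = pred_rl[OF X] note T = pred_True[OF pred_Obj[OF r]]
  obtain \<alpha> where a: "pred (fst X) \<alpha>" "V = asub X \<alpha>" using asub_surj[OF V] by blast
  show ?thesis unfolding a(2) asub_le_iff[OF X a(1) T]
    by (rule ent_rimp_weaken[OF ent_mono[OF a(1) T] a(1) r T]) simp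
qed

lemma asub_bottom:
  assumes X: "is_assembly C A X" and V: "V \<in> carrier (Sub ASM X)"
  shows "asub X (rbot (fst X)) \<sqsubseteq>\<^bsub>Sub ASM X\<^esub> V"
proof -
  note r = pred_rl[OF X] note B = pred_rbot[OF pred_Obj[OF r]]
  obtain \<alpha> where a: "pred (fst X) \<alpha>" "V = asub X \<alpha>" using asub_surj[OF V] by blast
  show ?thesis unfolding a(2) asub_le_iff[OF X B a(1)] by (rule rbot_ent[OF pred_rimp[OF r a(1)]])
qed

lemma Asm_bounded_lattice:
  assumes X: "is_assembly C A X" shows "bounded_lattice (Sub ASM X)"
proof -
  interpret partial_order "Sub ASM X" by (rule ASM.Sub_partial_order)
  note r = pred_rl[OF X]
  show ?thesis
  proof (unfold_locales, goal_cases)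
    case (1 U V)
    obtain \<alpha> where a: "pred (fst X) \<alpha>" "U = asub X \<alpha>" using asub_surj[OF 1(1)] by blast
    obtain \<beta> where b: "pred (fst X) \<beta>" "V = asub X \<beta>" using asub_surj[OF 1(2)] by blast
    note s = asub_carrier[OF X pred_ror[OF a(1) b(1)]]
    have key: "asub X (ror (fst X) \<alpha> \<beta>) \<sqsubseteq>\<^bsub>Sub ASM X\<^esub> W \<longleftrightarrow> U \<sqsubseteq>\<^bsub>Sub ASM X\<^esub> W \<and> V \<sqsubseteq>\<^bsub>Sub ASM X\<^esub> W"
      if W: "W \<in> carrier (Sub ASM X)" for W
      using asub_surj[OF W] asub_ror_le[OF X a(1) b(1)] a(2) b(2) by auto
    have "least (Sub ASM X) (asub X (ror (fst X) \<alpha> \<beta>)) (Upper (Sub ASM X) {U, V})"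
      by (rule least_UpperI) (use 1 s key key[OF s] le_refl[OF s] in \<open>auto simp: Upper_def\<close>)
    then show ?case by blast
  next
    case (2 U V)
    obtain \<alpha> where a: "pred (fst X) \<alpha>" "U = asub X \<alpha>" using asub_surj[OF 2(1)] by blast
    obtain \<beta> where b: "pred (fst X) \<beta>" "V = asub X \<beta>" using asub_surj[OF 2(2)] by blast
    note s = asub_carrier[OF X pred_rconj[OF a(1) b(1)]]
    have key: "W \<sqsubseteq>\<^bsub>Sub ASM X\<^esub> asub X (rconj \<alpha> \<beta>) \<longleftrightarrow> W \<sqsubseteq>\<^bsub>Sub ASM X\<^esub> U \<and> W \<sqsubseteq>\<^bsub>Sub ASM X\<^esub> V"
      if W: "W \<in> carrier (Sub ASM X)" for W
      using asub_surj[OF W] asub_le_rconj[OF X a(1) b(1)] a(2) b(2) by auto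
    have "greatest (Sub ASM X) (asub X (rconj \<alpha> \<beta>)) (Lower (Sub ASM X) {U, V})"
      by (rule greatest_LowerI) (use 2 s key key[OF s] le_refl[OF s] in \<open>auto simp: Lower_def\<close>)
    then show ?case by blast
  next
    case 3
    show ?case using asub_bottom[OF X] asub_carrier[OF X pred_rbot[OF pred_Obj[OF r]]]
      by (intro exI[of _ "asub X (rbot (fst X))"]) (simp add: least_def)
  next
    case 4
    show ?case using asub_top[OF X] asub_carrier[OF X pred_True[OF pred_Obj[OF r]]]
      by (intro exI[of _ "asub X (\<lambda>a x. True)"]) (simp add: greatest_def)
  qed
qed

lemma asub_rconj_eq:
  assumes X: "is_assembly C A X" and p: "pred (fst X) \<alpha>" "pred (fst X) \<beta>"
  shows "asub X (rconj \<alpha> \<beta>) = asub X \<alpha> \<sqinter>\<^bsub>Sub ASM X\<^esub> asub X \<beta>"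
proof -
  interpret bounded_lattice "Sub ASM X" by (rule Asm_bounded_lattice[OF X])
  show ?thesis
  proof (rule meet_eqI[OF asub_carrier[OF X p(1)] asub_carrier[OF X p(2)] asub_carrier[OF X pred_rconj[OF p]]])
    fix W assume "W \<in> carrier (Sub ASM X)"
    then show "W \<sqsubseteq>\<^bsub>Sub ASM X\<^esub> asub X (rconj \<alpha> \<beta>) \<longleftrightarrow> W \<sqsubseteq>\<^bsub>Sub ASM X\<^esub> asub X \<alpha> \<and> W \<sqsubseteq>\<^bsub>Sub ASM X\<^esub> asub X \<beta>"
      using asub_surj asub_le_rconj[OF X p] by metis
  qed
qed

lemma asub_le_rimp_meet:
  assumes X: "is_assembly C A X" and p: "pred (fst X) \<alpha>" "pred (fst X) \<beta>" and W: "W \<in> carrier (Sub ASM X)"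
  shows "W \<sqsubseteq>\<^bsub>Sub ASM X\<^esub> asub X (rimp \<alpha> \<beta>) \<longleftrightarrow> W \<sqinter>\<^bsub>Sub ASM X\<^esub> asub X \<alpha> \<sqsubseteq>\<^bsub>Sub ASM X\<^esub> asub X \<beta>"
proof -
  obtain \<gamma> where g: "pred (fst X) \<gamma>" "W = asub X \<gamma>" using asub_surj[OF W] by blast
  show ?thesis unfolding g(2) asub_rconj_eq[OF X g(1) p(1), symmetric] by (rule asub_le_rimp[OF X p g(1)])
qed

lemma Asm_heyting_algebra:
  assumes X: "is_assembly C A X" shows "heyting_algebra (Sub ASM X)"
proof -
  interpret bounded_lattice "Sub ASM X" by (rule Asm_bounded_lattice[OF X])
  show ?thesis
  proof (unfold_locales, goal_cases)
    case (1 U V)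
    obtain \<alpha> where a: "pred (fst X) \<alpha>" "U = asub X \<alpha>" using asub_surj[OF 1(1)] by blast
    obtain \<beta> where b: "pred (fst X) \<beta>" "V = asub X \<beta>" using asub_surj[OF 1(2)] by blast
    note s = asub_carrier[OF X pred_rimp[OF a(1) b(1)]]
    show ?case using asub_le_rimp_meet[OF X a(1) b(1)] s le_refl[OF s] a(2) b(2)
      by (intro exI[of _ "asub X (rimp \<alpha> \<beta>)"]) (auto simp: greatest_def)
  qed
qed

lemma asub_rimp_eq:
  assumes X: "is_assembly C A X" and p: "pred (fst X) \<alpha>" "pred (fst X) \<beta>"
  shows "asub X (rimp \<alpha> \<beta>) = himp (Sub ASM X) (asub X \<alpha>) (asub X \<beta>)"
proof -
  interpret heyting_algebra "Sub ASM X" by (rule Asm_heyting_algebra[OF X])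
  show ?thesis
    by (rule himp_eqI[OF asub_carrier[OF X p(1)] asub_carrier[OF X p(2)] asub_carrier[OF X pred_rimp[OF p]] asub_le_rimp_meet[OF X p]])
qed

section \<open>Adjoints to inverse images\<close>

lemma asub_rex_le:
  assumes F: "(X, f, Y) \<in> Mor ASM" and a: "pred (fst X) \<alpha>" and V: "V \<in> carrier (Sub ASM Y)"
  shows "asub Y (rex f (fst X) (rconj \<alpha> (rl X))) \<sqsubseteq>\<^bsub>Sub ASM Y\<^esub> V \<longleftrightarrow> asub X \<alpha> \<sqsubseteq>\<^bsub>Sub ASM X\<^esub> inv_im ASM (X, f, Y) V"
proof -
  have X: "is_assembly C A X" and Y: "is_assembly C A Y" and f: "f \<in> Hom C (fst X) (fst Y)"
    and fe: "ent (fst X) (rl X) (\<lambda>a x. rl Y a (f \<odot> x))" using F by (simp_all add: Asm_Mor_iff)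
  note rX = pred_rl[OF X] and rY = pred_rl[OF Y]
  obtain \<beta> where b: "pred (fst Y) \<beta>" "V = asub Y \<beta>" using asub_surj[OF V] by blast
  note fb = pred_reindex[OF b(1) f] and fr = pred_reindex[OF rY f] and ar = pred_rconj[OF a rX]
  have "asub Y (rex f (fst X) (rconj \<alpha> (rl X))) \<sqsubseteq>\<^bsub>Sub ASM Y\<^esub> V \<longleftrightarrow>
      ent (fst X) (rconj \<alpha> (rl X)) (\<lambda>a x. rimp (rl Y) \<beta> a (f \<odot> x))"
    unfolding b(2) asub_le_iff[OF Y pred_rex[OF ar f] b(1)] rex_iff[OF ar pred_rimp[OF rY b(1)] f] ..
  also have "\<dots> \<longleftrightarrow> ent (fst X) (rconj \<alpha> (rl X)) (rimp (\<lambda>a x. rl Y a (f \<odot> x)) (\<lambda>a x. \<beta> a (f \<odot> x)))"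
    by (rule ent_cong) (simp_all add: rimp_reindex[OF f])
  also have "\<dots> \<longleftrightarrow> ent (fst X) (rconj (rconj \<alpha> (rl X)) (\<lambda>a x. rl Y a (f \<odot> x))) (\<lambda>a x. \<beta> a (f \<odot> x))"
    by (rule rimp_iff[OF ar fr fb])
  \<comment> \<open>The tracker of \<open>f\<close> computes a realizer of
    \<open>f \<odot> x\<close> from one of \<open>x\<close>. This is why \<open>rl X\<close> is
    conjoined to \<alpha> under the image: the guard \<open>rl Y\<close> is absorbed by it.\<close>
  also have "\<dots> \<longleftrightarrow> ent (fst X) (rconj \<alpha> (rl X)) (\<lambda>a x. \<beta> a (f \<odot> x))"
    by (rule ent_absorb[OF ent_trans[OF rconj_right[OF a rX] fe ar fr] ar fr fb])
  also have "\<dots> \<longleftrightarrow> asub X \<alpha> \<sqsubseteq>\<^bsub>Sub ASM X\<^esub> inv_im ASM (X, f, Y) V"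
    unfolding b(2) inv_im_asub[OF F b(1)] asub_le_iff[OF X a fb] rimp_iff[OF a rX fb] ..
  finally show ?thesis .
qed

text \<open>Dual to the image: the guard \<open>rl X\<close> inside \<open>rall\<close> reappears on
  the left as the hypothesis of the order on \<open>X\<close>, and the hypothesis
  \<open>rl Y\<close> at \<open>f \<odot> x\<close> is absorbed by means of the tracker of
  \<open>f\<close>.\<close>

lemma asub_le_rall:
  assumes F: "(X, f, Y) \<in> Mor ASM" and a: "pred (fst X) \<alpha>" and V: "V \<in> carrier (Sub ASM Y)"
  shows "V \<sqsubseteq>\<^bsub>Sub ASM Y\<^esub> asub Y (rall f (fst X) (rimp (rl X) \<alpha>)) \<longleftrightarrow> inv_im ASM (X, f, Y) V \<sqsubseteq>\<^bsub>Sub ASM X\<^esub> asub X \<alpha>"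
proof -
  have X: "is_assembly C A X" and Y: "is_assembly C A Y" and f: "f \<in> Hom C (fst X) (fst Y)"
    and fe: "ent (fst X) (rl X) (\<lambda>a x. rl Y a (f \<odot> x))" using F by (simp_all add: Asm_Mor_iff)
  note rX = pred_rl[OF X] and rY = pred_rl[OF Y]
  obtain \<beta> where b: "pred (fst Y) \<beta>" "V = asub Y \<beta>" using asub_surj[OF V] by blast
  note fb = pred_reindex[OF b(1) f] and fr = pred_reindex[OF rY f] and br = pred_rconj[OF b(1) rY]
    and fbr = pred_reindex[OF pred_rconj[OF b(1) rY] f] and ra = pred_rimp[OF rX a]
  let ?fb = "\<lambda>a x. \<beta> a (f \<odot> x)" and ?fr = "\<lambda>a x. rl Y a (f \<odot> x)"
  have "V \<sqsubseteq>\<^bsub>Sub ASM Y\<^esub> asub Y (rall f (fst X) (rimp (rl X) \<alpha>)) \<longleftrightarrow>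
      ent (fst X) (rconj (\<lambda>a x. rconj \<beta> (rl Y) a (f \<odot> x)) (rl X)) \<alpha>"
    unfolding b(2) asub_le_iff[OF Y b(1) pred_rall[OF ra f]] rimp_iff[OF b(1) rY pred_rall[OF ra f]]
    by (rule rall_iff[OF f br rX a])
  also have "\<dots> \<longleftrightarrow> ent (fst X) (\<lambda>a x. rconj \<beta> (rl Y) a (f \<odot> x)) (rimp (rl X) \<alpha>)"
    by (rule rimp_iff[OF fbr rX a, symmetric])
  also have "\<dots> \<longleftrightarrow> ent (fst X) (rconj ?fb ?fr) (rimp (rl X) \<alpha>)"
    by (rule ent_cong) (simp_all add: rconj_reindex[OF f])
  also have "\<dots> \<longleftrightarrow> ent (fst X) (rconj (rconj ?fb ?fr) (rl X)) \<alpha>"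
    by (rule rimp_iff[OF pred_rconj[OF fb fr] rX a])
  also have "\<dots> \<longleftrightarrow> ent (fst X) (rconj (rconj ?fb (rl X)) ?fr) \<alpha>" by (rule ent_swap_right_iff[OF fb fr rX a])
  also have "\<dots> \<longleftrightarrow> ent (fst X) (rconj ?fb (rl X)) \<alpha>"
    by (rule ent_absorb[OF ent_trans[OF rconj_right[OF fb rX] fe pred_rconj[OF fb rX] fr] pred_rconj[OF fb rX] fr a])
  also have "\<dots> \<longleftrightarrow> inv_im ASM (X, f, Y) V \<sqsubseteq>\<^bsub>Sub ASM X\<^esub> asub X \<alpha>"
    unfolding b(2) inv_im_asub[OF F b(1)] asub_le_iff[OF X fb a] rimp_iff[OF fb rX a] ..
  finally show ?thesis .
qed

definition asub_pred where "asub_pred X U = (SOME \<alpha>. pred (fst X) \<alpha> \<and> U = asub X \<alpha>)"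

lemma asub_pred:
  assumes "U \<in> carrier (Sub ASM X)" shows "pred (fst X) (asub_pred X U)" "asub X (asub_pred X U) = U"
  using someI_ex[OF asub_surj[OF assms]] unfolding asub_pred_def by simp_all

lemma Asm_left_adjoint:
  assumes "K \<in> Mor ASM" shows "\<exists>e. is_left_adjoint ASM K e"
proof -
  obtain X f Y where K: "K = (X, f, Y)" "is_assembly C A X" "is_assembly C A Y" "f \<in> Hom C (fst X) (fst Y)" using Asm_MorE[OF assms] .
  note F = assms[unfolded K(1)]
  let ?e = "\<lambda>U. asub Y (rex f (fst X) (rconj (asub_pred X U) (rl X)))"
  have "is_left_adjoint ASM (X, f, Y) ?e"
  proof (rule ASM.is_left_adjointI[OF F])
    fix U assume U: "U \<in> carrier (Sub ASM X)"
    note p = asub_pred[OF U]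
    show "?e U \<in> carrier (Sub ASM Y)" by (rule asub_carrier[OF K(3) pred_rex[OF pred_rconj[OF p(1) pred_rl[OF K(2)]] K(4)]])
    fix V assume "V \<in> carrier (Sub ASM Y)"
    then show "?e U \<sqsubseteq>\<^bsub>Sub ASM Y\<^esub> V \<longleftrightarrow> U \<sqsubseteq>\<^bsub>Sub ASM X\<^esub> inv_im ASM (X, f, Y) V"
      using asub_rex_le[OF F p(1)] p(2) by simp
  qed simp_all
  then show ?thesis using K(1) by blast
qed

lemma Asm_right_adjoint:
  assumes "K \<in> Mor ASM" shows "\<exists>e. is_right_adjoint ASM K e"
proof -
  obtain X f Y where K: "K = (X, f, Y)" "is_assembly C A X" "is_assembly C A Y" "f \<in> Hom C (fst X) (fst Y)" using Asm_MorE[OF assms] .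
  note F = assms[unfolded K(1)]
  let ?e = "\<lambda>U. asub Y (rall f (fst X) (rimp (rl X) (asub_pred X U)))"
  have "is_right_adjoint ASM (X, f, Y) ?e"
  proof (rule ASM.is_right_adjointI[OF F])
    fix U assume U: "U \<in> carrier (Sub ASM X)"
    note p = asub_pred[OF U]
    show "?e U \<in> carrier (Sub ASM Y)" by (rule asub_carrier[OF K(3) pred_rall[OF pred_rimp[OF pred_rl[OF K(2)] p(1)] K(4)]])
    fix V assume "V \<in> carrier (Sub ASM Y)"
    then show "V \<sqsubseteq>\<^bsub>Sub ASM Y\<^esub> ?e U \<longleftrightarrow> inv_im ASM (X, f, Y) V \<sqsubseteq>\<^bsub>Sub ASM X\<^esub> U"
      using asub_le_rall[OF F p(1)] p(2) by simp
  qed simp_all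
  then show ?thesis using K(1) by blast
qed

text \<open>\<open>ex_along\<close> is a choice among left adjoints; these agree on the carrier, so
  its values are those of the adjoint just computed.\<close>

lemma ex_along_asub:
  assumes F: "(X, f, Y) \<in> Mor ASM" and a: "pred (fst X) \<alpha>"
  shows "ex_along ASM (X, f, Y) (asub X \<alpha>) = asub Y (rex f (fst X) (rconj \<alpha> (rl X)))"
proof -
  have X: "is_assembly C A X" and Y: "is_assembly C A Y" and f: "f \<in> Hom C (fst X) (fst Y)" using F by (simp_all add: Asm_Mor_iff)
  have E: "is_left_adjoint ASM (X, f, Y) (ex_along ASM (X, f, Y))"
    unfolding ex_along_def by (rule someI_ex[OF Asm_left_adjoint[OF F]])
  note D = ASM.left_adjointD[OF E Asm_simps(2,3) asub_carrier[OF X a]]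
  show ?thesis
    by (rule ASM.Sub_eq_of_le_iff[OF D(1) asub_carrier[OF Y pred_rex[OF pred_rconj[OF a pred_rl[OF X]] f]]])
      (simp add: D(2) asub_rex_le[OF F a])
qed

text \<open>Joins and bottom are preserved because inverse image has a right adjoint; top, meets and
  implications because reindexing commutes with the predicates that present them.\<close>

lemma Asm_inv_im_hom:
  assumes K: "K \<in> Hom ASM X Y" shows "heyting_hom (Sub ASM Y) (Sub ASM X) (inv_im ASM K)"
proof -
  obtain f where f: "K = (X, f, Y)" "is_assembly C A X" "is_assembly C A Y" "f \<in> Hom C (fst X) (fst Y)" using Asm_HomE[OF K] .
  have F: "(X, f, Y) \<in> Mor ASM" using K f(1) by (simp add: Hom_def)
  note X = f(2) and Y = f(3)
  interpret X: heyting_algebra "Sub ASM X" by (rule Asm_heyting_algebra[OF X])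
  interpret Y: heyting_algebra "Sub ASM Y" by (rule Asm_heyting_algebra[OF Y])
  let ?i = "inv_im ASM (X, f, Y)"
  note ic = ASM.inv_im_carrier[OF F Asm_simps(2,3)]
  obtain a where a: "is_right_adjoint ASM (X, f, Y) a" using Asm_right_adjoint[OF F] by blast
  note aD = ASM.right_adjointD[OF a Asm_simps(2,3)]
  have top: "?i (\<top>\<^bsub>Sub ASM Y\<^esub>) = \<top>\<^bsub>Sub ASM X\<^esub>"
  proof -
    note TX = pred_True[OF pred_Obj[OF pred_rl[OF X]]] and TY = pred_True[OF pred_Obj[OF pred_rl[OF Y]]]
    have "asub Y (\<lambda>a x. True) = \<top>\<^bsub>Sub ASM Y\<^esub>" by (rule Y.top_eq[OF asub_carrier[OF Y TY] asub_top[OF Y]])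
    moreover have "asub X (\<lambda>a x. True) = \<top>\<^bsub>Sub ASM X\<^esub>" by (rule X.top_eq[OF asub_carrier[OF X TX] asub_top[OF X]])
    ultimately show ?thesis using inv_im_asub[OF F TY] by simp
  qed
  have bot: "?i (\<bottom>\<^bsub>Sub ASM Y\<^esub>) = \<bottom>\<^bsub>Sub ASM X\<^esub>"
    by (rule X.bottom_eq[OF ic[OF Y.bottom_closed]]) (simp add: aD(2)[symmetric] aD(1))
  have join: "?i (U \<squnion>\<^bsub>Sub ASM Y\<^esub> V) = ?i U \<squnion>\<^bsub>Sub ASM X\<^esub> ?i V" if U: "U \<in> carrier (Sub ASM Y)" and V: "V \<in> carrier (Sub ASM Y)" for U V
  proof (rule X.join_eqI[OF ic[OF U] ic[OF V] ic[OF Y.join_closed[OF U V]]])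
    fix W assume W: "W \<in> carrier (Sub ASM X)"
    show "?i (U \<squnion>\<^bsub>Sub ASM Y\<^esub> V) \<sqsubseteq>\<^bsub>Sub ASM X\<^esub> W \<longleftrightarrow> ?i U \<sqsubseteq>\<^bsub>Sub ASM X\<^esub> W \<and> ?i V \<sqsubseteq>\<^bsub>Sub ASM X\<^esub> W"
      unfolding aD(2)[OF W Y.join_closed[OF U V], symmetric] aD(2)[OF W U, symmetric] aD(2)[OF W V, symmetric]
      by (rule Y.join_le_iff[OF U V aD(1)[OF W]])
  qed
  have meet_imp: "?i (U \<sqinter>\<^bsub>Sub ASM Y\<^esub> V) = ?i U \<sqinter>\<^bsub>Sub ASM X\<^esub> ?i V \<and> ?i (himp (Sub ASM Y) U V) = himp (Sub ASM X) (?i U) (?i V)"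
    if U: "U \<in> carrier (Sub ASM Y)" and V: "V \<in> carrier (Sub ASM Y)" for U V
  proof -
    obtain \<alpha> where a: "pred (fst Y) \<alpha>" "U = asub Y \<alpha>" using asub_surj[OF U] by blast
    obtain \<beta> where b: "pred (fst Y) \<beta>" "V = asub Y \<beta>" using asub_surj[OF V] by blast
    note fa = pred_reindex[OF a(1) f(4)] and fb = pred_reindex[OF b(1) f(4)]
    have "?i (asub Y (rconj \<alpha> \<beta>)) = asub X (rconj (\<lambda>a x. \<alpha> a (f \<odot> x)) (\<lambda>a x. \<beta> a (f \<odot> x)))"
      unfolding inv_im_asub[OF F pred_rconj[OF a(1) b(1)]] by (rule asub_cong[OF X]) (simp add: rconj_reindex[OF f(4)])
    moreover have "?i (asub Y (rimp \<alpha> \<beta>)) = asub X (rimp (\<lambda>a x. \<alpha> a (f \<odot> x)) (\<lambda>a x. \<beta> a (f \<odot> x)))"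
      unfolding inv_im_asub[OF F pred_rimp[OF a(1) b(1)]] by (rule asub_cong[OF X]) (simp add: rimp_reindex[OF f(4)])
    ultimately show ?thesis
      unfolding a(2) b(2) inv_im_asub[OF F a(1)] inv_im_asub[OF F b(1)]
        asub_rconj_eq[OF Y a(1) b(1)] asub_rconj_eq[OF X fa fb] asub_rimp_eq[OF Y a(1) b(1)] asub_rimp_eq[OF X fa fb] by simp
  qed
  show ?thesis unfolding heyting_hom_def f(1) using top bot join meet_imp ic by simp
qed

section \<open>Pullbacks of assemblies and the Beck-Chevalley condition\<close>

lemma Asm_pullback_lift:
  assumes pb: "is_pullback ASM (X, f, Z) (Y, g, Z) (P, g', X) (P, f', Y)"
    and x: "(W, x, X) \<in> Mor ASM" and y: "(W, y, Y) \<in> Mor ASM" and e: "f \<odot> x = g \<odot> y"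
  shows "\<exists>h. (W, h, P) \<in> Mor ASM \<and> g' \<odot> h = x \<and> f' \<odot> h = y"
proof (rule ASM.pullback_lift[OF pb x y])
  fix H assume H: "H \<in> Mor ASM" "Dom ASM H = Dom ASM (W, y, Y)" "Cod ASM H = Dom ASM (P, g', X)"
    "Comp ASM (P, g', X) H = (W, x, X)" "Comp ASM (P, f', Y) H = (W, y, Y)"
  then have HH: "H \<in> Hom ASM W P" by (simp add: Hom_def)
  obtain h where h: "H = (W, h, P)" using Asm_HomE[OF HH] .
  show ?thesis using H(1,4,5) unfolding h by auto
qed (simp_all add: e)

text \<open>The pullback is arbitrary, so its elements are reached through its universal property:
  \<open>joint_assembly\<close> makes the bare pair of elements a pair of arrows of assemblies,
  which can be lifted.\<close>

lemma pullback_element: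
  assumes pb: "is_pullback ASM (X, f, Z) (Y, g, Z) (P, g', X) (P, f', Y)"
    and x: "x \<in> Hom C W (fst X)" and y: "y \<in> Hom C W (fst Y)" and e: "f \<odot> x = g \<odot> y"
  shows "\<exists>p\<in>Hom C W (fst P). g' \<odot> p = x \<and> f' \<odot> p = y"
proof -
  have X: "is_assembly C A X" and Y: "is_assembly C A Y" using ASM.pullbackD(1,2)[OF pb] by (simp_all add: Asm_Mor_iff)
  obtain p where "(asm_of W (rconj (\<lambda>a z. rl X a (x \<odot> z)) (\<lambda>a z. rl Y a (y \<odot> z))), p, P) \<in> Mor ASM" "g' \<odot> p = x" "f' \<odot> p = y"
    using Asm_pullback_lift[OF pb joint_assembly(2,3)[OF X Y x y] e] by blast
  then show ?thesis by (auto simp: Asm_Mor_iff)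
qed

text \<open>The joint relation on \<open>fst P\<close> makes both projections arrows from a second
  assembly, so there is a tracked lift \<open>h\<close> into \<open>P\<close>. Uniqueness of lifts
  forces \<open>h\<close> to be the identity, and its tracker is the required one.\<close>

lemma pullback_realizers:
  assumes pb: "is_pullback ASM (X, f, Z) (Y, g, Z) (P, g', X) (P, f', Y)"
  shows "ent (fst P) (rconj (\<lambda>a p. rl X a (g' \<odot> p)) (\<lambda>a p. rl Y a (f' \<odot> p))) (rl P)"
proof -
  have X: "is_assembly C A X" and Y: "is_assembly C A Y" using ASM.pullbackD(1,2)[OF pb] by (simp_all add: Asm_Mor_iff)
  have P: "is_assembly C A P" and g': "g' \<in> Hom C (fst P) (fst X)" "ent (fst P) (rl P) (\<lambda>a p. rl X a (g' \<odot> p))"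
    and f': "f' \<in> Hom C (fst P) (fst Y)" "ent (fst P) (rl P) (\<lambda>a p. rl Y a (f' \<odot> p))"
    using ASM.pullbackD(4,5)[OF pb] by (simp_all add: Asm_Mor_iff)
  have eq: "f \<odot> g' = g \<odot> f'" using ASM.pullbackD(9)[OF pb] by simp
  let ?d = "rconj (\<lambda>a z. rl X a (g' \<odot> z)) (\<lambda>a z. rl Y a (f' \<odot> z))"
  let ?D = "asm_of (fst P) ?d"
  note j = joint_assembly[OF X Y g'(1) f'(1)]
  note rP = pred_rl[OF P] and px = pred_reindex[OF pred_rl[OF X] g'(1)] and py = pred_reindex[OF pred_rl[OF Y] f'(1)]
  note pd = pred_rconj[OF px py]
  obtain h where h: "(?D, h, P) \<in> Mor ASM" "g' \<odot> h = g'" "f' \<odot> h = f'"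
    using Asm_pullback_lift[OF pb j(2,3) eq] by blast
  have h': "h \<in> Hom C (fst P) (fst P)" "ent (fst P) (rl ?D) (\<lambda>a x. rl P a (h \<odot> x))" using h(1) by (simp_all add: Asm_Mor_iff)
  have PO: "fst P \<in> Obj C" using P by (simp add: is_assembly_iff)
  note I = Ident_in_Hom[OF PO]
  have "ent (fst P) (rl P) (\<lambda>a x. rl ?D a (Ident C (fst P) \<odot> x)) \<longleftrightarrow> ent (fst P) (rl P) ?d"
    by (rule ent_cong) (use j(4) HomD in simp_all)
  then have IM: "(P, Ident C (fst P), ?D) \<in> Mor ASM"
    using rconj_intro[OF g'(2) f'(2) rP px py] P j(1) I by (simp add: Asm_Mor_iff)
  have hI: "h \<odot> Ident C (fst P) = h" using HomD[OF h'(1)] by simp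
  \<comment> \<open>Uniqueness of lifts is available for arrows of assemblies only; precomposition
    with the tracked identity from \<open>P\<close> makes \<open>h\<close> an endomorphism of
    \<open>P\<close>.\<close>
  have "(P, h, P) \<in> Mor ASM" "(P, Ident C (fst P), P) \<in> Mor ASM"
    using ASM.Mor_Comp[OF IM h(1)] ASM.Mor_Ident[of P] P hI by simp_all
  then have "(P, h, P) = (P, Ident C (fst P), P)"
    by (rule ASM.pullback_unique[OF pb]) (use h HomD[OF g'(1)] HomD[OF f'(1)] in simp_all)
  then have "h = Ident C (fst P)" by simp
  then have "ent (fst P) (rl ?D) (\<lambda>a x. rl P a (Ident C (fst P) \<odot> x))" using h'(2) by simp
  moreover have "ent (fst P) (rl ?D) (\<lambda>a x. rl P a (Ident C (fst P) \<odot> x)) \<longleftrightarrow> ent (fst P) ?d (rl P)"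
    by (rule ent_cong) (use j(4) HomD in simp_all)
  ultimately show ?thesis by simp
qed

text \<open>Both sides are presented by predicates on \<open>fst X\<close>, and one inclusion is
  formal. For the other, an element of the fibre of \<open>g\<close> over \<open>f \<odot> x\<close>
  gives a point of \<open>P\<close>, whose realizer is assembled from \<open>rl X\<close> and
  \<open>rl Y\<close>: the latter is conjoined under the image, the former is the guard in the order
  on \<open>X\<close>.\<close>

lemma Asm_beck_chevalley_ex:
  assumes pb0: "is_pullback ASM F G G' F'" and U: "U \<in> carrier (Sub ASM (Dom ASM G))"
  shows "ex_along ASM G' (inv_im ASM F' U) = inv_im ASM F (ex_along ASM G U)"
proof -
  note pbD = ASM.pullbackD(1-8)[OF pb0]
  obtain X f Z where F: "F = (X, f, Z)" "is_assembly C A X" "is_assembly C A Z" "f \<in> Hom C (fst X) (fst Z)" using Asm_MorE[OF pbD(1)] .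
  define Y P where "Y = Dom ASM G" and "P = Dom ASM G'"
  have GH: "G \<in> Hom ASM Y Z" and GH': "G' \<in> Hom ASM P X" and FH': "F' \<in> Hom ASM P Y"
    using pbD F(1) by (simp_all add: Hom_def Y_def P_def)
  obtain g where G: "G = (Y, g, Z)" "is_assembly C A Y" "g \<in> Hom C (fst Y) (fst Z)" using Asm_HomE[OF GH] .
  obtain g' where G': "G' = (P, g', X)" "is_assembly C A P" "g' \<in> Hom C (fst P) (fst X)"
      "ent (fst P) (rl P) (\<lambda>a p. rl X a (g' \<odot> p))" using Asm_HomE[OF GH'] .
  obtain f' where F': "F' = (P, f', Y)" "f' \<in> Hom C (fst P) (fst Y)" "ent (fst P) (rl P) (\<lambda>a p. rl Y a (f' \<odot> p))"
    using Asm_HomE[OF FH'] .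
  note pb = pb0[unfolded F(1) G(1) G'(1) F'(1)]
  have FM: "(X, f, Z) \<in> Mor ASM" "(Y, g, Z) \<in> Mor ASM" "(P, g', X) \<in> Mor ASM" "(P, f', Y) \<in> Mor ASM"
    using ASM.pullbackD(1,2,4,5)[OF pb] .
  have eq: "f \<odot> g' = g \<odot> f'" using ASM.pullbackD(9)[OF pb] by simp
  have U': "U \<in> carrier (Sub ASM Y)" using U G(1) by simp
  obtain \<alpha> where a: "pred (fst Y) \<alpha>" "U = asub Y \<alpha>" using asub_surj[OF U'] by blast
  note rX = pred_rl[OF F(2)] and rY = pred_rl[OF G(2)] and rP = pred_rl[OF G'(2)]
  let ?\<gamma> = "rconj \<alpha> (rl Y)" let ?E = "rex g (fst Y) ?\<gamma>"
  let ?fa = "\<lambda>a p. \<alpha> a (f' \<odot> p)" let ?\<delta> = "rconj ?fa (rl P)" let ?R = "rex g' (fst P) ?\<delta>"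
  let ?fE = "\<lambda>a x. ?E a (f \<odot> x)" let ?fg = "\<lambda>a p. ?\<gamma> a (f' \<odot> p)"
  note pg = pred_rconj[OF a(1) rY] note pE = pred_rex[OF pg G(3)] note pfE = pred_reindex[OF pE F(4)]
  note pfa = pred_reindex[OF a(1) F'(2)] note pd = pred_rconj[OF pfa rP] note pR = pred_rex[OF pd G'(3)]
  note pfg = pred_reindex[OF pg F'(2)] and pgR = pred_reindex[OF pR G'(3)] and pgX = pred_reindex[OF rX G'(3)]
    and pfY = pred_reindex[OF rY F'(2)]
  note pRg = pred_rex[OF pfg G'(3)]
  have l: "ex_along ASM G' (inv_im ASM F' U) = asub X ?R"
    unfolding G'(1) F'(1) a(2) inv_im_asub[OF FM(4) a(1)] by (rule ex_along_asub[OF FM(3) pfa])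
  have r: "inv_im ASM F (ex_along ASM G U) = asub X ?fE"
    unfolding F(1) G(1) a(2) ex_along_asub[OF FM(2) a(1)] by (rule inv_im_asub[OF FM(1) pE])
  interpret partial_order "Sub ASM X" by (rule ASM.Sub_partial_order)
  show ?thesis unfolding l r
  proof (rule le_antisym)
    show "asub X ?R \<in> carrier (Sub ASM X)" "asub X ?fE \<in> carrier (Sub ASM X)"
      using asub_carrier[OF F(2) pR] asub_carrier[OF F(2) pfE] .
    \<comment> \<open>The tracker of \<open>f'\<close> turns the conjunct \<open>rl P\<close> into
      \<open>rl Y\<close>.\<close>
    have "ent (fst P) ?\<delta> ?fg"
      unfolding ent_rconj_reindex[OF F'(2) pd a(1) rY]
      using rconj_left[OF pfa rP] ent_trans[OF rconj_right[OF pfa rP] F'(3) pd pfY] by blast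
    moreover have "ent (fst P) ?fg (\<lambda>a p. ?E a (g \<odot> f' \<odot> p))" by (rule ent_reindex[OF rex_unit[OF pg G(3)] F'(2)])
    ultimately have "ent (fst P) ?\<delta> (\<lambda>a p. ?E a (g \<odot> f' \<odot> p))"
      using ent_trans pd pred_reindex[OF pred_reindex[OF pE G(3)] F'(2)] by blast
    moreover have "ent (fst P) ?\<delta> (\<lambda>a p. ?E a (g \<odot> f' \<odot> p)) \<longleftrightarrow> ent (fst P) ?\<delta> (\<lambda>a p. ?fE a (g' \<odot> p))"
      by (rule ent_cong[OF HOL.refl]) (metis Comp_assoc_Hom[OF F'(2) G(3)] Comp_assoc_Hom[OF G'(3) F(4)] eq)
    ultimately have "ent (fst X) ?R ?fE" unfolding rex_iff[OF pd pfE G'(3)] by simp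
    then show "asub X ?R \<sqsubseteq>\<^bsub>Sub ASM X\<^esub> asub X ?fE"
      unfolding asub_le_iff[OF F(2) pR pfE] by (rule ent_rimp_weaken[OF _ pR rX pfE])
    \<comment> \<open>This is the Beck-Chevalley inclusion of the base, with realizers unchanged;
      \<open>fst P\<close> has enough elements by \<open>pullback_element\<close>.\<close>
    have "ent (fst X) ?fE (rex g' (fst P) ?fg)"
    proof (rule ent_mono[OF pfE pRg])
      fix W b x assume b: "b \<in> Hom C W A" and x: "x \<in> Hom C W (fst X)" and E: "?E b (f \<odot> x)"
      note fx = Comp_in_Hom[OF x F(4)] and xT = HomD[OF x]
      obtain w y where w: "cover w" "Cod C w = W" and y: "y \<in> Hom C (Dom C w) (fst Y)" "g \<odot> y = (f \<odot> x) \<odot> w" "?\<gamma> (b \<odot> w) y"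
        using E unfolding rex_def HomD(2)[OF fx] by blast
      note wM = cover_Mor[OF w(1)]
      have "f \<odot> (x \<odot> w) = g \<odot> y" using y(2) xT HomD[OF F(4)] wM w(2) by simp
      then obtain p where p: "p \<in> Hom C (Dom C w) (fst P)" "g' \<odot> p = x \<odot> w" "f' \<odot> p = y"
        using pullback_element[OF pb Comp_Hom[OF x wM w(2)] y(1)] by blast
      show "rex g' (fst P) ?fg b x" unfolding rex_def xT(2) using w p y(3) by blast
    qed
    \<comment> \<open>Here the guard \<open>rl X\<close> is spent: together with \<open>rl Y\<close>
      it yields \<open>rl P\<close>, which \<open>?\<delta>\<close> demands.\<close>
    moreover have "ent (fst X) (rex g' (fst P) ?fg) (rimp (rl X) ?R)"
    proof -
      let ?c = "rconj ?fg (\<lambda>a p. rl X a (g' \<odot> p))"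
      note pc = pred_rconj[OF pfg pgX]
      have c1: "ent (fst P) ?c ?fg" and c2: "ent (fst P) ?c (\<lambda>a p. rl X a (g' \<odot> p))"
        using rconj_left[OF pfg pgX] rconj_right[OF pfg pgX] .
      have c3: "ent (fst P) ?c ?fa" and c4: "ent (fst P) ?c (\<lambda>a p. rl Y a (f' \<odot> p))"
        using c1 unfolding ent_rconj_reindex[OF F'(2) pc a(1) rY] by simp_all
      have c5: "ent (fst P) ?c (rl P)"
        by (rule ent_trans[OF rconj_intro[OF c2 c4 pc pgX pfY] pullback_realizers[OF pb] pc rP])
      have "ent (fst P) ?c (\<lambda>a p. ?R a (g' \<odot> p))"
        by (rule ent_trans[OF rconj_intro[OF c3 c5 pc pfa rP] rex_unit[OF pd G'(3)] pc pgR])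
      then have "ent (fst P) ?fg (rimp (\<lambda>a p. rl X a (g' \<odot> p)) (\<lambda>a p. ?R a (g' \<odot> p)))"
        using rimp_iff[OF pfg pgX pgR] by simp
      moreover have "ent (fst P) ?fg (rimp (\<lambda>a p. rl X a (g' \<odot> p)) (\<lambda>a p. ?R a (g' \<odot> p))) \<longleftrightarrow>
          ent (fst P) ?fg (\<lambda>a p. rimp (rl X) ?R a (g' \<odot> p))"
        by (rule ent_cong[OF HOL.refl]) (rule rimp_reindex[OF G'(3)])
      ultimately show ?thesis using rex_iff[OF pfg pred_rimp[OF rX pR] G'(3)] by simp
    qed
    ultimately show "asub X ?fE \<sqsubseteq>\<^bsub>Sub ASM X\<^esub> asub X ?R"
      unfolding asub_le_iff[OF F(2) pfE pR] using ent_trans pfE pred_rimp[OF rX pR] by blast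
  qed
qed

theorem Asm_heyting_category: "heyting_category ASM"
proof (intro heyting_category.intro heyting_category_axioms.intro)
  show "heyting_algebra (Sub ASM X)" if "X \<in> Obj ASM" for X
    using Asm_heyting_algebra that by simp
  show "all_along ASM g' (inv_im ASM f' U) = inv_im ASM f (all_along ASM g U)"
    if "is_pullback ASM f g g' f'" "U \<in> carrier (Sub ASM (Dom ASM g))" for f g g' f' U
    by (rule ASM.beck_chevalley_all_of_ex[OF Asm_left_adjoint Asm_right_adjoint Asm_beck_chevalley_ex that])
qed (fact Asm_category Asm_finite_limits Asm_inv_im_hom Asm_left_adjoint Asm_right_adjoint Asm_beck_chevalley_ex)+

end

theorem theorem30:
  fixes B :: "('o, 'm) cat" and A :: 'o and app :: "('m \<times> 'm) set" and \<phi> :: "'m set set"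
  assumes "heyting_category B"
    and "partial_applicative_structure B A app"
    and "applicative_filter B A app \<phi>"
    and "combinatory_complete B A app \<phi>"
  shows "heyting_category (Asm B A app \<phi>)"
proof -
  interpret pca_filter B A app \<phi>
    using assms by (simp add: pca_filter_def pca_filter_axioms_def partial_applicative_def partial_applicative_axioms_def)
  show ?thesis by (rule Asm_heyting_category)
qed

end
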